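(* Let $T\subsetneqq S$ be non-empty sets of prime numbers. Then the canonical epimorphism $\mathrm{C}^*_{\mathrm{max}}(\Gamma_S)\to \mathrm{C}^*_{\mathrm{red}}(\Gamma_S)$ factors through the canonical quotient map $\mathrm{C}^*_{\mathrm{max}}(\Gamma_S)\to \mathrm{C}^*(\lambda_{\Gamma_S/\Gamma_T})$, giving epimorphisms \[ \mathrm{C}^*_{\mathrm{max}}(\Gamma_S) \longrightarrow \mathrm{C}^*(\lambda_{\Gamma_S/\Gamma_T}) \longrightarrow \mathrm{C}^*_{\mathrm{red}}(\Gamma_S), \] and neither of these two epimorphisms is an isomorphism (that is, $\mathrm{C}^*(\lambda_{\Gamma_S/\Gamma_T})$ is an exotic group C*-algebra of $\Gamma_S$). Furthermore, the unitary representation $\lambda_{\Gamma_S/\Gamma_T}$ of $\Gamma_S$ is irreducible, and the C*-algebra $\mathrm{C}^*_{\mathrm{red}}(\Gamma_S)$ is simple. Moreover, for fixed $S$, the quotients $\mathrm{C}^*_{\mathrm{max}}(\Gamma_S) \twoheadrightarrow \mathrm{C}^*(\lambda_{\Gamma_S/\Gamma_T})$ are pairwise non-isomorphic as $T$ varies over the non-empty proper subsets of $S$; that is, if $T\neq T'$ are two non-empty proper subsets of $S$, then there is no isomorphism $\mathrm{C}^*(\lambda_{\Gamma_S/\Gamma_T})\to \mathrm{C}^*(\lambda_{\Gamma_S/\Gamma_{T'}})$ commuting with the quotient maps from $\mathrm{C}^*_{\mathrm{max}}(\Gamma_S)$ (equivalently, $\lambda_{\Gamma_S/\Gamma_T}$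 and $\lambda_{\Gamma_S/\Gamma_{T'}}$ are not weakly equivalent).
   Context: For a set $S$ of prime numbers (finite or infinite), $\mathbf{Z}[1/S]\subseteq\mathbf{Q}$ denotes the ring of $S$-integers, i.e. the subring of $\mathbf{Q}$ generated by $\{1/p : p\in S\}$ (and $1$). The group $\Gamma_S$ is the group of all piecewise-$\mathbf{SL}_2(\mathbf{Z}[1/S])$ homeomorphisms of the real line $\mathbf{R}$: it consists of all homeomorphisms $g$ of $\mathbf{R}$ for which $\mathbf{R}$ can be cut into finitely many intervals such that, on each interval, $g$ coincides with a projective transformation $x\mapsto \frac{ax+b}{cx+d}$ for some $\begin{pmatrix}a&b\\c&d\end{pmatrix}\in\mathbf{SL}_2(\mathbf{Z}[1/S])$ (the matrix may depend on the interval). If $T\subseteq S$ then $\Gamma_T$ is a subgroup of $\Gamma_S$. All groups are considered as discrete groups (without topology). For a group $\Gamma$, $\mathrm{C}^*_{\mathrm{max}}(\Gamma)$ and $\mathrm{C}^*_{\mathrm{red}}(\Gamma)$ are the maximal (full) and reduced group C*-algebras. Unitary representations $\pi$ of $\Gamma$ correspond to non-degenerate representations of $\mathrm{C}^*_{\mathrm{max}}(\Gamma)$; $\mathrm{C}^*(\pi)$ denotes the C*-algebra generated by $\pi(\Gamma)$, i.e. the image of $\mathrm{C}^*_{\mathrm{max}}(\Gamma)$ under this representation, so that it comes with a canonical quotient map $\mathrm{C}^*_{\mathrm{max}}(\Gamma)\twoheadrightarrow \mathrm{C}^*(\pi)$. In particular $\mathrm{C}^*_{\mathrm{red}}(\Gamma)=\mathrm{C}^*(\lambda_\Gamma)$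 where $\lambda_\Gamma$ is the left regular representation on $\ell^2(\Gamma)$. For a subgroup $\Lambda<\Gamma$, $\lambda_{\Gamma/\Lambda}$ is the quasi-regular representation of $\Gamma$ on $\ell^2(\Gamma/\Lambda)$, i.e. the representation induced from the trivial representation of $\Lambda$. A C*-algebra $A$ is called an exotic group C*-algebra of $\Gamma$ if the canonical epimorphism $\mathrm{C}^*_{\mathrm{max}}(\Gamma)\to \mathrm{C}^*_{\mathrm{red}}(\Gamma)$ factors through two epimorphisms $\mathrm{C}^*_{\mathrm{max}}(\Gamma)\to A\to \mathrm{C}^*_{\mathrm{red}}(\Gamma)$, neither of which is an isomorphism. Two unitary representations are weakly equivalent if each is weakly contained in the other. *)

theory Defs
  imports
    "HOL-Analysis.Analysis"
    "HOL-Algebra.Module"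
    "HOL-Algebra.Ideal"
    "HOL-Algebra.Left_Coset"
    "HOL-Computational_Algebra.Primes"
begin

section \<open>Piecewise projective homeomorphisms of the line\<close>

inductive_set S_integers :: "nat set \<Rightarrow> rat set" for S :: "nat set" where
  one: "1 \<in> S_integers S"
| inverse_prime: "p \<in> S \<Longrightarrow> 1 / of_nat p \<in> S_integers S"
| diff: "x \<in> S_integers S \<Longrightarrow> y \<in> S_integers S \<Longrightarrow> x - y \<in> S_integers S"
| mult: "x \<in> S_integers S \<Longrightarrow> y \<in> S_integers S \<Longrightarrow> x * y \<in> S_integers S"

text \<open>The condition on the denominator says that the projective transformation does not
  take the value infinity on \<open>I\<close>.\<close>

definition projective_on :: "rat set \<Rightarrow> real set \<Rightarrow> (real \<Rightarrow> real) \<Rightarrow> bool" where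
  "projective_on R I g \<longleftrightarrow>
     (\<exists>a\<in>R. \<exists>b\<in>R. \<exists>c\<in>R. \<exists>d\<in>R. a * d - b * c = 1 \<and>
        (\<forall>x\<in>I. of_rat c * x + of_rat d \<noteq> 0 \<and>
               g x = (of_rat a * x + of_rat b) / (of_rat c * x + of_rat d)))"

definition piecewise_projective :: "rat set \<Rightarrow> (real \<Rightarrow> real) \<Rightarrow> bool" where
  "piecewise_projective R g \<longleftrightarrow>
     (\<exists>P. finite P \<and> partition_on UNIV P \<and> (\<forall>I\<in>P. is_interval I \<and> projective_on R I g))"

definition Gamma_group :: "nat set \<Rightarrow> (real \<Rightarrow> real) monoid" where
  "Gamma_group S = \<lparr>carrier = {g. (\<exists>h. homeomorphism UNIV UNIV g h) \<and>
                             piecewise_projective (S_integers S) g},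
              mult = (\<circ>), one = id\<rparr>"


section \<open>The Hilbert spaces of square summable families\<close>

text \<open>Up to isomorphism every complex Hilbert space is \<open>ell2 X\<close>, for \<open>X\<close> an index set of an
  orthonormal basis. Vectors are functions on the whole type that vanish outside \<open>X\<close>.\<close>

definition ell2 :: "'x set \<Rightarrow> ('x \<Rightarrow> complex) set" where
  "ell2 X = {f. (\<forall>x. x \<notin> X \<longrightarrow> f x = 0) \<and> (\<lambda>x. (cmod (f x))\<^sup>2) summable_on X}"

definition ell2_inner :: "'x set \<Rightarrow> ('x \<Rightarrow> complex) \<Rightarrow> ('x \<Rightarrow> complex) \<Rightarrow> complex" where
  "ell2_inner X f g = (\<Sum>\<^sub>\<infinity>x\<in>X. f x * cnj (g x))"

definition ell2_norm :: "'x set \<Rightarrow> ('x \<Rightarrow> complex) \<Rightarrow> real" where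
  "ell2_norm X f = sqrt (\<Sum>\<^sub>\<infinity>x\<in>X. (cmod (f x))\<^sup>2)"

definition closed_subspace :: "'x set \<Rightarrow> ('x \<Rightarrow> complex) set \<Rightarrow> bool" where
  "closed_subspace X V \<longleftrightarrow>
     V \<subseteq> ell2 X \<and> (\<lambda>x. 0) \<in> V \<and>
     (\<forall>f\<in>V. \<forall>g\<in>V. (\<lambda>x. f x + g x) \<in> V) \<and>
     (\<forall>c. \<forall>f\<in>V. (\<lambda>x. c * f x) \<in> V) \<and>
     (\<forall>f\<in>ell2 X. (\<forall>\<epsilon>>0. \<exists>g\<in>V. ell2_norm X (\<lambda>x. f x - g x) < \<epsilon>) \<longrightarrow> f \<in> V)"

type_synonym 'x operator = "('x \<Rightarrow> complex) \<Rightarrow> ('x \<Rightarrow> complex)"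

text \<open>Operators are set to \<open>0\<close> outside \<open>ell2 X\<close>, so that a bounded operator of the Hilbert space
  is represented by exactly one function.\<close>

definition bounded_ops :: "'x set \<Rightarrow> 'x operator set" where
  "bounded_ops X = {A.
     (\<forall>f\<in>ell2 X. A f \<in> ell2 X) \<and>
     (\<forall>f\<in>ell2 X. \<forall>g\<in>ell2 X. A (\<lambda>x. f x + g x) = (\<lambda>x. A f x + A g x)) \<and>
     (\<forall>c. \<forall>f\<in>ell2 X. A (\<lambda>x. c * f x) = (\<lambda>x. c * A f x)) \<and>
     (\<exists>C. \<forall>f\<in>ell2 X. ell2_norm X (A f) \<le> C * ell2_norm X f) \<and>
     (\<forall>f. f \<notin> ell2 X \<longrightarrow> A f = (\<lambda>x. 0))}"

definition op_norm :: "'x set \<Rightarrow> 'x operator \<Rightarrow> real" where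
  "op_norm X A = Sup {ell2_norm X (A f) |f. f \<in> ell2 X \<and> ell2_norm X f \<le> 1}"

definition op_adjoint :: "'x set \<Rightarrow> 'x operator \<Rightarrow> 'x operator" where
  "op_adjoint X A = (THE B. B \<in> bounded_ops X \<and>
     (\<forall>f\<in>ell2 X. \<forall>g\<in>ell2 X. ell2_inner X (A f) g = ell2_inner X f (B g)))"

definition unitary_op :: "'x set \<Rightarrow> 'x operator \<Rightarrow> bool" where
  "unitary_op X U \<longleftrightarrow>
     U \<in> bounded_ops X \<and> U ` ell2 X = ell2 X \<and>
     (\<forall>f\<in>ell2 X. \<forall>g\<in>ell2 X. ell2_inner X (U f) (U g) = ell2_inner X f g)"


section \<open>C*-algebras\<close>

record 'a star_algebra = "(complex, 'a) module" +
  star :: "'a \<Rightarrow> 'a"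
  anorm :: "'a \<Rightarrow> real"

definition norm_closed :: "'a star_algebra \<Rightarrow> 'a set \<Rightarrow> bool" where
  "norm_closed A I \<longleftrightarrow>
     (\<forall>a\<in>carrier A. (\<forall>\<epsilon>>0. \<exists>b\<in>I. anorm A (a \<ominus>\<^bsub>A\<^esub> b) < \<epsilon>) \<longrightarrow> a \<in> I)"

definition star_subalgebra :: "'a star_algebra \<Rightarrow> 'a set \<Rightarrow> bool" where
  "star_subalgebra A B \<longleftrightarrow>
     B \<subseteq> carrier A \<and> \<zero>\<^bsub>A\<^esub> \<in> B \<and>
     (\<forall>a\<in>B. \<forall>b\<in>B. a \<oplus>\<^bsub>A\<^esub> b \<in> B \<and> a \<otimes>\<^bsub>A\<^esub> b \<in> B) \<and>
     (\<forall>c. \<forall>a\<in>B. c \<odot>\<^bsub>A\<^esub> a \<in> B) \<and>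
     (\<forall>a\<in>B. star A a \<in> B)"

definition generated_cstar_algebra :: "'a star_algebra \<Rightarrow> 'a set \<Rightarrow> 'a star_algebra" where
  "generated_cstar_algebra A M =
     A\<lparr>carrier := \<Inter>{B. star_subalgebra A B \<and> norm_closed A B \<and> M \<subseteq> B}\<rparr>"

definition simple_cstar_algebra :: "'a star_algebra \<Rightarrow> bool" where
  "simple_cstar_algebra A \<longleftrightarrow>
     carrier A \<noteq> {\<zero>\<^bsub>A\<^esub>} \<and>
     (\<forall>I. ideal I A \<and> norm_closed A I \<longrightarrow> I = {\<zero>\<^bsub>A\<^esub>} \<or> I = carrier A)"

text \<open>All algebras below are unital, and \<open>ring_hom\<close> preserves the unit. This is automatic for
  the surjective homomorphisms considered here.\<close>

definition star_hom :: "'a star_algebra \<Rightarrow> 'b star_algebra \<Rightarrow> ('a \<Rightarrow> 'b) set" where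
  "star_hom A B = {\<phi> \<in> ring_hom A B.
     (\<forall>c. \<forall>a\<in>carrier A. \<phi> (c \<odot>\<^bsub>A\<^esub> a) = c \<odot>\<^bsub>B\<^esub> \<phi> a) \<and>
     (\<forall>a\<in>carrier A. \<phi> (star A a) = star B (\<phi> a))}"

definition star_epi :: "'a star_algebra \<Rightarrow> 'b star_algebra \<Rightarrow> ('a \<Rightarrow> 'b) set" where
  "star_epi A B = {\<phi> \<in> star_hom A B. \<phi> ` carrier A = carrier B}"

definition star_iso :: "'a star_algebra \<Rightarrow> 'b star_algebra \<Rightarrow> ('a \<Rightarrow> 'b) set" where
  "star_iso A B = {\<phi> \<in> star_hom A B. bij_betw \<phi> (carrier A) (carrier B)}"

definition operator_algebra :: "'x set \<Rightarrow> 'x operator star_algebra" where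
  "operator_algebra X =
     \<lparr>carrier = bounded_ops X,
      mult = (\<circ>),
      one = (\<lambda>f. if f \<in> ell2 X then f else (\<lambda>x. 0)),
      zero = (\<lambda>f x. 0),
      add = (\<lambda>A B f x. A f x + B f x),
      smult = (\<lambda>c A f x. c * A f x),
      star = op_adjoint X,
      anorm = op_norm X\<rparr>"


section \<open>Unitary representations of discrete groups\<close>

record ('g, 'x) rep =
  basis :: "'x set"
  act :: "'g \<Rightarrow> 'x operator"

definition unitary_rep :: "('g, 'm) monoid_scheme \<Rightarrow> ('g, 'x) rep \<Rightarrow> bool" where
  "unitary_rep G \<pi> \<longleftrightarrow>
     (\<forall>g\<in>carrier G. unitary_op (basis \<pi>) (act \<pi> g)) \<and>
     (\<forall>g\<in>carrier G. \<forall>h\<in>carrier G. act \<pi> (g \<otimes>\<^bsub>G\<^esub> h) = act \<pi> g \<circ> act \<pi> h)"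

definition irreducible_rep :: "('g, 'm) monoid_scheme \<Rightarrow> ('g, 'x) rep \<Rightarrow> bool" where
  "irreducible_rep G \<pi> \<longleftrightarrow>
     unitary_rep G \<pi> \<and> basis \<pi> \<noteq> {} \<and>
     (\<forall>V. closed_subspace (basis \<pi>) V \<and> (\<forall>g\<in>carrier G. act \<pi> g ` V \<subseteq> V) \<longrightarrow>
        V = {\<lambda>x. 0} \<or> V = ell2 (basis \<pi>))"

text \<open>Weak containment in the sense of Fell: every diagonal coefficient of \<open>\<pi>\<close> is a limit,
  uniformly on finite subsets of the discrete group, of finite sums of diagonal coefficients
  of \<open>\<rho>\<close>.\<close>

definition weakly_contained ::
  "('g, 'm) monoid_scheme \<Rightarrow> ('g, 'x) rep \<Rightarrow> ('g, 'y) rep \<Rightarrow> bool" where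
  "weakly_contained G \<pi> \<rho> \<longleftrightarrow>
     (\<forall>\<xi>\<in>ell2 (basis \<pi>). \<forall>F. finite F \<and> F \<subseteq> carrier G \<longrightarrow>
        (\<forall>\<epsilon>>0. \<exists>(n::nat) \<eta>. (\<forall>i<n. \<eta> i \<in> ell2 (basis \<rho>)) \<and>
           (\<forall>g\<in>F. cmod (ell2_inner (basis \<pi>) (act \<pi> g \<xi>) \<xi> -
                         (\<Sum>i<n. ell2_inner (basis \<rho>) (act \<rho> g (\<eta> i)) (\<eta> i))) < \<epsilon>)))"

definition weakly_equivalent ::
  "('g, 'm) monoid_scheme \<Rightarrow> ('g, 'x) rep \<Rightarrow> ('g, 'y) rep \<Rightarrow> bool" where
  "weakly_equivalent G \<pi> \<rho> \<longleftrightarrow> weakly_contained G \<pi> \<rho> \<and> weakly_contained G \<rho> \<pi>"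

definition regular_rep :: "('g, 'm) monoid_scheme \<Rightarrow> ('g, 'g) rep" where
  "regular_rep G =
     \<lparr>basis = carrier G,
      act = (\<lambda>g f x. if f \<in> ell2 (carrier G) \<and> x \<in> carrier G
                     then f (inv\<^bsub>G\<^esub> g \<otimes>\<^bsub>G\<^esub> x) else 0)\<rparr>"

definition quasi_regular_rep :: "('g, 'm) monoid_scheme \<Rightarrow> 'g set \<Rightarrow> ('g, 'g set) rep" where
  "quasi_regular_rep G H =
     \<lparr>basis = lcosets\<^bsub>G\<^esub> H,
      act = (\<lambda>g f C. if f \<in> ell2 (lcosets\<^bsub>G\<^esub> H) \<and> C \<in> lcosets\<^bsub>G\<^esub> H
                     then f (inv\<^bsub>G\<^esub> g <#\<^bsub>G\<^esub> C) else 0)\<rparr>"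

definition direct_sum_rep :: "('g, 'x) rep set \<Rightarrow> ('g, ('g, 'x) rep \<times> 'x) rep" where
  "direct_sum_rep R = (let X = Sigma R basis in
     \<lparr>basis = X,
      act = (\<lambda>g f (\<pi>, x). if f \<in> ell2 X \<and> (\<pi>, x) \<in> X
                          then act \<pi> g (\<lambda>y. f (\<pi>, y)) x else 0)\<rparr>)"

text \<open>Every unitary representation of \<open>G\<close> is a direct sum of cyclic ones, and the Hilbert space
  of a cyclic one is topologically spanned by an orbit of \<open>G\<close>, hence has an orthonormal basis
  of at most as many elements as \<open>G\<close>. Therefore the unitary representations on \<open>ell2 X\<close> with
  \<open>X\<close> ranging over the sets of elements of the type of \<open>G\<close> include all cyclic representations
  up to unitary equivalence.\<close>

definition universal_rep :: "('g, 'm) monoid_scheme \<Rightarrow> ('g, ('g, 'g) rep \<times> 'g) rep" where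
  "universal_rep G = direct_sum_rep {\<pi>. unitary_rep G \<pi>}"


section \<open>Maximal and reduced group C*-algebras\<close>

definition Cstar_rep ::
  "('g, 'm) monoid_scheme \<Rightarrow> ('g, 'x) rep \<Rightarrow> 'x operator star_algebra" where
  "Cstar_rep G \<pi> = generated_cstar_algebra (operator_algebra (basis \<pi>)) (act \<pi> ` carrier G)"

definition Cstar_max ::
  "('g, 'm) monoid_scheme \<Rightarrow> (('g, 'g) rep \<times> 'g) operator star_algebra" where
  "Cstar_max G = Cstar_rep G (universal_rep G)"

definition Cstar_red :: "('g, 'm) monoid_scheme \<Rightarrow> 'g operator star_algebra" where
  "Cstar_red G = Cstar_rep G (regular_rep G)"

text \<open>These conditions determine \<open>q\<close> on the carrier of the maximal C*-algebra.\<close>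

definition canonical_quotient ::
  "('g, 'm) monoid_scheme \<Rightarrow> ('g, 'x) rep \<Rightarrow>
     ((('g, 'g) rep \<times> 'g) operator \<Rightarrow> 'x operator) \<Rightarrow> bool" where
  "canonical_quotient G \<pi> q \<longleftrightarrow>
     q \<in> star_epi (Cstar_max G) (Cstar_rep G \<pi>) \<and>
     (\<forall>g\<in>carrier G. q (act (universal_rep G) g) = act \<pi> g)"

definition exotic_factorization ::
  "('g, 'm) monoid_scheme \<Rightarrow> 'a star_algebra \<Rightarrow>
     ((('g, 'g) rep \<times> 'g) operator \<Rightarrow> 'a) \<Rightarrow> ('a \<Rightarrow> 'g operator) \<Rightarrow> bool" where
  "exotic_factorization G A q r \<longleftrightarrow>
     q \<in> star_epi (Cstar_max G) A \<and> r \<in> star_epi A (Cstar_red G) \<and>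
     canonical_quotient G (regular_rep G) (r \<circ> q) \<and>
     q \<notin> star_iso (Cstar_max G) A \<and> r \<notin> star_iso A (Cstar_red G)"

abbreviation lambda_quotient ::
  "nat set \<Rightarrow> nat set \<Rightarrow> (real \<Rightarrow> real, (real \<Rightarrow> real) set) rep" where
  "lambda_quotient S T \<equiv> quasi_regular_rep (Gamma_group S) (carrier (Gamma_group T))"

end

theory Submission
  imports Defs
begin

text \<open>
  Pass from \<open>C*(\<pi>)\<close> to \<open>C*(\<rho>)\<close> whenever \<open>\<parallel>\<rho>(a)\<parallel> \<le> \<parallel>\<pi>(a)\<parallel>\<close> on the group algebra. Everything is
  decided by spectral gaps: if \<open>p \<in> S - T\<close>, then \<open>\<Gamma>\<^bsub>{p}\<^esub>\<close> contains three elements which together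
  with the identity have an average of norm less than \<open>1\<close> in \<open>\<lambda>\<^bsub>S/T\<^esub>\<close>, whereas the average of elements of
  \<open>\<Gamma>\<^sub>T\<close> fixes the vector \<open>\<delta>\<close> of the trivial coset.

  For the gap, a coset \<open>g \<Gamma>\<^sub>T\<close> attaches to almost every \<open>x = g y\<close> the class of the germ of \<open>g\<close> at \<open>y\<close> in
  \<open>SL\<^sub>2(\<rat>) / SL\<^sub>2(\<int>[1/T])\<close>, hence a vertex of the \<open>p\<close>-adic tree. The measure of the points of a short interval
  whose vertex lies in a fixed half of the tree is a function on cosets, and ping-pong between elements close to
  the identity on the interval but \<open>p\<close>-adically large moves this function too much for an almost invariant vector
  to exist.

  The regular representation is dominated by \<open>\<lambda>\<^bsub>S/T\<^esub>\<close> because a finite subset of \<open>\<Gamma>\<^sub>S\<close> can be conjugated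
  away from \<open>\<Gamma>\<^sub>T\<close> off the identity. Irreducibility holds since \<open>\<Gamma>\<^sub>T\<close> has only infinite orbits on the
  nontrivial cosets. For simplicity, conjugating \<open>g\<close> by elements supported in an interval displaced by \<open>g\<close> gives,
  by the same gap, averages whose norm decays, as in the argument of Powers.
\<close>

section \<open>Square summable families\<close>

text \<open>The gap is used algebraically. Where an average of group elements has norm below 1, the
  operator 1 minus the average is invertible in the C*-algebra; where these elements fix a vector,
  the same operator kills it. No isomorphism compatible with the quotient maps can relate the two.
  For this the elements must depend on p alone and lie in the group for the single prime p: then
  they belong to Gamma_T whenever p is in T, and they have a gap in every quotient that omits p.

  The parameter t = 1 / p^6 is small on the line, at most 1/64, so that a short interval is hardly
  moved; yet t and 2 t both have p-adic absolute value above 1, even for p = 2.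

  The gap argument sees the three elements only on the interval (0, 1/2). This locality is what
  makes it applicable to commutators in the proof of simplicity, because they agree there with the
  ping-pong elements.

  Inverses and closed images of homomorphisms come from Neumann series with explicit bounds, in
  place of functional calculus.\<close>

lemma ell2_outside: "f \<in> ell2 X \<Longrightarrow> x \<notin> X \<Longrightarrow> f x = 0"
  by (simp add: ell2_def)

lemma ell2_summable: "f \<in> ell2 X \<Longrightarrow> (\<lambda>x. (cmod (f x))\<^sup>2) summable_on X"
  by (simp add: ell2_def)

lemma ell2_norm_nonneg [simp]: "0 \<le> ell2_norm X f"
  by (simp add: ell2_norm_def infsum_nonneg)

lemma ell2_norm_sq: "(ell2_norm X f)\<^sup>2 = (\<Sum>\<^sub>\<infinity>x\<in>X. (cmod (f x))\<^sup>2)"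
  by (simp add: ell2_norm_def infsum_nonneg)

lemma ell2_finite_sum_le:
  assumes "f \<in> ell2 X" "finite F" "F \<subseteq> X"
  shows "(\<Sum>x\<in>F. (cmod (f x))\<^sup>2) \<le> (ell2_norm X f)\<^sup>2"
  unfolding ell2_norm_sq using assms
  by (intro finite_sum_le_infsum) (auto simp: ell2_summable)

lemma ell2_L2_set_le:
  assumes "f \<in> ell2 X" "finite F" "F \<subseteq> X"
  shows "L2_set (\<lambda>x. cmod (f x)) F \<le> ell2_norm X f"
  unfolding L2_set_def using ell2_finite_sum_le[OF assms]
  by (simp add: real_le_lsqrt sum_nonneg)

lemma ell2_bounded_sums:
  assumes out: "\<And>x. x \<notin> X \<Longrightarrow> f x = 0" and "0 \<le> C"
    and le: "\<And>F. finite F \<Longrightarrow> F \<subseteq> X \<Longrightarrow> (\<Sum>x\<in>F. (cmod (f x))\<^sup>2) \<le> C\<^sup>2"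
  shows "f \<in> ell2 X" "ell2_norm X f \<le> C"
proof -
  have s: "(\<lambda>x. (cmod (f x))\<^sup>2) summable_on X"
    by (rule nonneg_bdd_above_summable_on) (auto intro!: bdd_aboveI[of _ "C\<^sup>2"] le)
  then show "f \<in> ell2 X" using out by (simp add: ell2_def)
  have "(\<Sum>\<^sub>\<infinity>x\<in>X. (cmod (f x))\<^sup>2) \<le> C\<^sup>2"
    by (rule infsum_le_finite_sums[OF s]) (auto intro: le)
  then show "ell2_norm X f \<le> C"
    by (simp add: ell2_norm_def \<open>0 \<le> C\<close> real_le_lsqrt)
qed

lemma ell2_bounded_L2:
  assumes out: "\<And>x. x \<notin> X \<Longrightarrow> f x = 0" and "0 \<le> C"
    and le: "\<And>F. finite F \<Longrightarrow> F \<subseteq> X \<Longrightarrow> L2_set (\<lambda>x. cmod (f x)) F \<le> C"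
  shows "f \<in> ell2 X" "ell2_norm X f \<le> C"
proof -
  have "(\<Sum>x\<in>F. (cmod (f x))\<^sup>2) \<le> C\<^sup>2" if "finite F" "F \<subseteq> X" for F
  proof -
    have "(L2_set (\<lambda>x. cmod (f x)) F)\<^sup>2 \<le> C\<^sup>2"
      using le[OF that] by (simp add: power_mono)
    then show ?thesis by (simp add: L2_set_def sum_nonneg)
  qed
  then show "f \<in> ell2 X" "ell2_norm X f \<le> C"
    using ell2_bounded_sums[of X f, OF out \<open>0 \<le> C\<close>] by auto
qed

lemma ell2_zero [simp]: "(\<lambda>x. 0) \<in> ell2 X" "ell2_norm X (\<lambda>x. 0) = 0"
  by (simp_all add: ell2_def ell2_norm_def)

lemma
  assumes "f \<in> ell2 X" "g \<in> ell2 X"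
  shows ell2_add: "(\<lambda>x. f x + g x) \<in> ell2 X"
    and ell2_norm_triangle: "ell2_norm X (\<lambda>x. f x + g x) \<le> ell2_norm X f + ell2_norm X g"
proof -
  have "L2_set (\<lambda>x. cmod (f x + g x)) F \<le> ell2_norm X f + ell2_norm X g"
    if "finite F" "F \<subseteq> X" for F
  proof -
    have "L2_set (\<lambda>x. cmod (f x + g x)) F \<le> L2_set (\<lambda>x. cmod (f x) + cmod (g x)) F"
      by (rule L2_set_mono) (auto simp: norm_triangle_ineq)
    also have "\<dots> \<le> L2_set (\<lambda>x. cmod (f x)) F + L2_set (\<lambda>x. cmod (g x)) F"
      by (rule L2_set_triangle_ineq)
    also have "\<dots> \<le> ell2_norm X f + ell2_norm X g"
      by (intro add_mono ell2_L2_set_le assms that)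
    finally show ?thesis .
  qed
  then show "(\<lambda>x. f x + g x) \<in> ell2 X" "ell2_norm X (\<lambda>x. f x + g x) \<le> ell2_norm X f + ell2_norm X g"
    using ell2_bounded_L2[of X "\<lambda>x. f x + g x" "ell2_norm X f + ell2_norm X g"] assms
    by (auto simp: ell2_outside)
qed

lemma
  shows ell2_scale: "f \<in> ell2 X \<Longrightarrow> (\<lambda>x. c * f x) \<in> ell2 X"
    and ell2_norm_scale: "ell2_norm X (\<lambda>x. c * f x) = cmod c * ell2_norm X f"
proof -
  show "f \<in> ell2 X \<Longrightarrow> (\<lambda>x. c * f x) \<in> ell2 X"
    by (auto simp: ell2_def norm_mult power_mult_distrib intro!: summable_on_cmult_right)
  show "ell2_norm X (\<lambda>x. c * f x) = cmod c * ell2_norm X f"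
    by (simp add: ell2_norm_def norm_mult power_mult_distrib infsum_cmult_right' real_sqrt_mult)
qed

lemma ell2_uminus: "f \<in> ell2 X \<Longrightarrow> (\<lambda>x. - f x) \<in> ell2 X"
  using ell2_scale[of f X "-1"] by simp

lemma ell2_norm_uminus: "ell2_norm X (\<lambda>x. - f x) = ell2_norm X f"
  using ell2_norm_scale[of X "-1" f] by simp

lemma ell2_diff: "f \<in> ell2 X \<Longrightarrow> g \<in> ell2 X \<Longrightarrow> (\<lambda>x. f x - g x) \<in> ell2 X"
  using ell2_add[of f X "\<lambda>x. - g x"] ell2_uminus by fastforce

lemma ell2_norm_commute: "ell2_norm X (\<lambda>x. f x - g x) = ell2_norm X (\<lambda>x. g x - f x)"
  by (simp add: ell2_norm_def norm_minus_commute)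

lemma ell2_norm_le_diff:
  "f \<in> ell2 X \<Longrightarrow> g \<in> ell2 X \<Longrightarrow> ell2_norm X f \<le> ell2_norm X g + ell2_norm X (\<lambda>x. f x - g x)"
  using ell2_norm_triangle[of g X "\<lambda>x. f x - g x"] ell2_diff[of f X g] by simp

lemma ell2_norm_diff_trans:
  assumes "f \<in> ell2 X" "g \<in> ell2 X" "h \<in> ell2 X"
  shows "ell2_norm X (\<lambda>x. f x - h x) \<le> ell2_norm X (\<lambda>x. f x - g x) + ell2_norm X (\<lambda>x. g x - h x)"
  using ell2_norm_triangle[of "\<lambda>x. f x - g x" X "\<lambda>x. g x - h x"] assms by (simp add: ell2_diff)

lemma ell2_sum:
  "(\<And>i. i \<in> A \<Longrightarrow> f i \<in> ell2 X) \<Longrightarrow> (\<lambda>x. \<Sum>i\<in>A. f i x) \<in> ell2 X"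
  by (induction A rule: infinite_finite_induct) (auto intro!: ell2_add)

lemma cmod_le_ell2_norm:
  assumes "f \<in> ell2 X" shows "cmod (f x) \<le> ell2_norm X f"
proof (cases "x \<in> X")
  case True
  then show ?thesis using ell2_L2_set_le[OF assms, of "{x}"] by simp
qed (simp add: ell2_outside[OF assms])

lemma ell2_norm_eq_0: "f \<in> ell2 X \<Longrightarrow> ell2_norm X f = 0 \<Longrightarrow> f = (\<lambda>x. 0)"
  by (metis cmod_le_ell2_norm norm_le_zero_iff)

lemma ell2_abs_summable_mult:
  assumes "f \<in> ell2 X" "g \<in> ell2 X"
  shows "(\<lambda>x. norm (f x * cnj (g x))) summable_on X"
proof (rule summable_on_comparison_test)
  show "(\<lambda>x. (cmod (f x))\<^sup>2 + (cmod (g x))\<^sup>2) summable_on X"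
    using assms by (intro summable_on_add ell2_summable)
  show "norm (f x * cnj (g x)) \<le> (cmod (f x))\<^sup>2 + (cmod (g x))\<^sup>2" for x
  proof -
    have "0 \<le> cmod (f x) * cmod (g x)" by simp
    moreover have "2 * (cmod (f x) * cmod (g x)) \<le> (cmod (f x))\<^sup>2 + (cmod (g x))\<^sup>2"
      using sum_squares_bound[of "cmod (f x)" "cmod (g x)"] by (simp add: mult.assoc)
    ultimately have "cmod (f x) * cmod (g x) \<le> (cmod (f x))\<^sup>2 + (cmod (g x))\<^sup>2" by linarith
    then show ?thesis by (simp add: norm_mult)
  qed
qed auto

lemma ell2_summable_mult:
  "f \<in> ell2 X \<Longrightarrow> g \<in> ell2 X \<Longrightarrow> (\<lambda>x. f x * cnj (g x)) summable_on X"
  by (rule abs_summable_summable) (rule ell2_abs_summable_mult)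

lemma ell2_inner_cnj: "ell2_inner X g f = cnj (ell2_inner X f g)"
  unfolding ell2_inner_def by (simp flip: infsum_cnj add: mult.commute)

lemma ell2_inner_add_left:
  "f \<in> ell2 X \<Longrightarrow> g \<in> ell2 X \<Longrightarrow> h \<in> ell2 X \<Longrightarrow>
   ell2_inner X (\<lambda>x. f x + g x) h = ell2_inner X f h + ell2_inner X g h"
  unfolding ell2_inner_def by (simp add: distrib_right infsum_add ell2_summable_mult)

lemma ell2_inner_scale_left: "ell2_inner X (\<lambda>x. c * f x) h = c * ell2_inner X f h"
  unfolding ell2_inner_def by (simp add: mult.assoc infsum_cmult_right')

lemma ell2_inner_add_right:
  "f \<in> ell2 X \<Longrightarrow> g \<in> ell2 X \<Longrightarrow> h \<in> ell2 X \<Longrightarrow>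
   ell2_inner X h (\<lambda>x. f x + g x) = ell2_inner X h f + ell2_inner X h g"
  by (subst (1 2 3) ell2_inner_cnj) (simp add: ell2_inner_add_left)

lemma ell2_inner_scale_right: "ell2_inner X h (\<lambda>x. c * f x) = cnj c * ell2_inner X h f"
  by (subst (1 2) ell2_inner_cnj) (simp add: ell2_inner_scale_left)

lemma ell2_inner_diff_left:
  "f \<in> ell2 X \<Longrightarrow> g \<in> ell2 X \<Longrightarrow> h \<in> ell2 X \<Longrightarrow>
   ell2_inner X (\<lambda>x. f x - g x) h = ell2_inner X f h - ell2_inner X g h"
  using ell2_inner_add_left[of f X "\<lambda>x. - 1 * g x" h] ell2_scale[of g X "-1"]
    ell2_inner_scale_left[of X "-1" g h] by simp

lemma ell2_inner_diff_right:
  "f \<in> ell2 X \<Longrightarrow> g \<in> ell2 X \<Longrightarrow> h \<in> ell2 X \<Longrightarrow>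
   ell2_inner X h (\<lambda>x. f x - g x) = ell2_inner X h f - ell2_inner X h g"
  by (subst (1 2 3) ell2_inner_cnj) (simp add: ell2_inner_diff_left)

lemma ell2_inner_sum_left:
  "(\<And>i. i \<in> A \<Longrightarrow> f i \<in> ell2 X) \<Longrightarrow> h \<in> ell2 X \<Longrightarrow>
   ell2_inner X (\<lambda>x. \<Sum>i\<in>A. f i x) h = (\<Sum>i\<in>A. ell2_inner X (f i) h)"
proof (induction A rule: infinite_finite_induct)
  case (insert a A)
  then show ?case by (simp add: ell2_inner_add_left ell2_sum)
qed (simp_all add: ell2_inner_def)

lemma ell2_inner_self:
  assumes "f \<in> ell2 X" shows "ell2_inner X f f = of_real ((ell2_norm X f)\<^sup>2)"
  unfolding ell2_inner_def ell2_norm_sq complex_norm_square[symmetric]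
  by (rule infsumI, rule has_sum_of_real) (use ell2_summable[OF assms] in simp)

lemma ell2_Cauchy_Schwarz:
  assumes "f \<in> ell2 X" "g \<in> ell2 X"
  shows "cmod (ell2_inner X f g) \<le> ell2_norm X f * ell2_norm X g"
proof -
  have "cmod (ell2_inner X f g) \<le> (\<Sum>\<^sub>\<infinity>x\<in>X. norm (f x * cnj (g x)))"
    unfolding ell2_inner_def by (rule norm_infsum_bound) (rule ell2_abs_summable_mult[OF assms])
  also have "\<dots> \<le> ell2_norm X f * ell2_norm X g"
  proof (rule infsum_le_finite_sums[OF ell2_abs_summable_mult[OF assms]])
    fix F assume F: "finite F" "F \<subseteq> X"
    have "(\<Sum>x\<in>F. norm (f x * cnj (g x))) = (\<Sum>x\<in>F. \<bar>cmod (f x)\<bar> * \<bar>cmod (g x)\<bar>)"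
      by (simp add: norm_mult)
    also have "\<dots> \<le> L2_set (\<lambda>x. cmod (f x)) F * L2_set (\<lambda>x. cmod (g x)) F"
      by (rule L2_set_mult_ineq)
    also have "\<dots> \<le> ell2_norm X f * ell2_norm X g"
      by (intro mult_mono ell2_L2_set_le assms F) (auto simp: L2_set_nonneg)
    finally show "(\<Sum>x\<in>F. norm (f x * cnj (g x))) \<le> ell2_norm X f * ell2_norm X g" .
  qed
  finally show ?thesis .
qed

definition delta :: "'x \<Rightarrow> 'x \<Rightarrow> complex" where
  "delta a = (\<lambda>x. if x = a then 1 else 0)"

lemma delta_ell2: assumes a: "a \<in> X" shows "delta a \<in> ell2 X"
proof -
  have "(\<lambda>x. (cmod (delta a x))\<^sup>2) summable_on X \<longleftrightarrow> (\<lambda>x. (cmod (delta a x))\<^sup>2) summable_on {a}"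
    by (rule summable_on_cong_neutral) (use a in \<open>auto simp: delta_def\<close>)
  then show ?thesis using a by (auto simp: ell2_def delta_def)
qed

lemma ell2_inner_delta: assumes a: "a \<in> X" shows "ell2_inner X f (delta a) = f a"
proof -
  have "ell2_inner X f (delta a) = (\<Sum>\<^sub>\<infinity>x\<in>{a}. f x * cnj (delta a x))"
    unfolding ell2_inner_def by (rule infsum_cong_neutral) (use a in \<open>auto simp: delta_def\<close>)
  then show ?thesis by (simp add: delta_def)
qed

lemma ell2_norm_delta: assumes a: "a \<in> X" shows "ell2_norm X (delta a) = 1"
proof -
  have "of_real ((ell2_norm X (delta a))\<^sup>2) = (1 :: complex)"
    unfolding ell2_inner_self[OF delta_ell2[OF a], symmetric] ell2_inner_delta[OF a] by (simp add: delta_def)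
  then have "(ell2_norm X (delta a))\<^sup>2 = 1" using of_real_eq_1_iff by blast
  then show ?thesis using ell2_norm_nonneg[of X "delta a"] by (simp add: power2_eq_1_iff)
qed

text \<open>Fatou for square sums: a bound on the norm is a bound on all finite sums, and these pass
  to pointwise limits.\<close>

lemma ell2_limit:
  assumes lim: "\<And>x. (\<lambda>n. f n x) \<longlonglongrightarrow> g x" and f: "\<And>n. f n \<in> ell2 X"
    and "0 \<le> C" and le: "\<forall>\<^sub>F n in sequentially. ell2_norm X (f n) \<le> C"
  shows "g \<in> ell2 X" "ell2_norm X g \<le> C"
proof -
  have out: "g x = 0" if "x \<notin> X" for x
    using lim[of x] ell2_outside[OF f that] by (simp add: LIMSEQ_const_iff)
  have "(\<Sum>x\<in>F. (cmod (g x))\<^sup>2) \<le> C\<^sup>2" if F: "finite F" "F \<subseteq> X" for F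
  proof (rule tendsto_upperbound)
    show "(\<lambda>n. \<Sum>x\<in>F. (cmod (f n x))\<^sup>2) \<longlonglongrightarrow> (\<Sum>x\<in>F. (cmod (g x))\<^sup>2)"
      by (intro tendsto_intros lim)
    show "\<forall>\<^sub>F n in sequentially. (\<Sum>x\<in>F. (cmod (f n x))\<^sup>2) \<le> C\<^sup>2"
      using le
    proof eventually_elim
      case (elim n)
      have "(\<Sum>x\<in>F. (cmod (f n x))\<^sup>2) \<le> (ell2_norm X (f n))\<^sup>2"
        by (rule ell2_finite_sum_le[OF f F])
      also have "\<dots> \<le> C\<^sup>2" using elim by (simp add: power_mono)
      finally show ?case .
    qed
  qed simp
  from ell2_bounded_sums[of X g, OF out \<open>0 \<le> C\<close> this]
  show "g \<in> ell2 X" "ell2_norm X g \<le> C" by auto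
qed

text \<open>Completeness together with the rate: the \<open>e\<close> and \<open>N\<close> of a
  Cauchy estimate are inherited by the limit. This uniformity is what \<open>op_complete\<close>
  needs to bound a limit of operators in terms of the norm of the argument.\<close>

lemma ell2_complete:
  assumes f: "\<And>n. f n \<in> ell2 X"
    and cauchy: "\<And>e. 0 < e \<Longrightarrow> \<exists>N. \<forall>m\<ge>N. \<forall>n\<ge>N. ell2_norm X (\<lambda>x. f m x - f n x) \<le> e"
  shows "\<exists>g\<in>ell2 X. (\<forall>x. (\<lambda>n. f n x) \<longlonglongrightarrow> g x) \<and>
    (\<forall>e\<ge>0. \<forall>N. (\<forall>m\<ge>N. \<forall>n\<ge>N. ell2_norm X (\<lambda>x. f m x - f n x) \<le> e) \<longrightarrow>
       (\<forall>n\<ge>N. ell2_norm X (\<lambda>x. f n x - g x) \<le> e))"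
proof -
  have "Cauchy (\<lambda>n. f n x)" for x
  proof (rule CauchyI)
    fix e :: real assume "0 < e"
    then obtain N where N: "\<forall>m\<ge>N. \<forall>n\<ge>N. ell2_norm X (\<lambda>x. f m x - f n x) \<le> e/2"
      using cauchy[of "e/2"] by auto
    have "norm (f m x - f n x) < e" if "m \<ge> N" "n \<ge> N" for m n
    proof -
      have "ell2_norm X (\<lambda>x. f m x - f n x) \<le> e/2" using N that by blast
      then show ?thesis
        using cmod_le_ell2_norm[OF ell2_diff[OF f[of m] f[of n]], of x] \<open>0 < e\<close> by linarith
    qed
    then show "\<exists>M. \<forall>m\<ge>M. \<forall>n\<ge>M. norm (f m x - f n x) < e" by blast
  qed
  then have "\<forall>x. \<exists>l. (\<lambda>n. f n x) \<longlonglongrightarrow> l"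
    by (auto simp: Cauchy_convergent_iff convergent_def)
  then obtain g where g: "\<And>x. (\<lambda>n. f n x) \<longlonglongrightarrow> g x" by metis
  have *: "(\<lambda>x. f n x - g x) \<in> ell2 X \<and> ell2_norm X (\<lambda>x. f n x - g x) \<le> e"
    if e: "0 \<le> e" "\<forall>m\<ge>N. \<forall>n\<ge>N. ell2_norm X (\<lambda>x. f m x - f n x) \<le> e" and "n \<ge> N" for e N n
  proof -
    have lim: "(\<lambda>m. f n x - f m x) \<longlonglongrightarrow> f n x - g x" for x by (intro tendsto_intros g)
    have ev: "\<forall>\<^sub>F m in sequentially. ell2_norm X (\<lambda>x. f n x - f m x) \<le> e"
      using e(2) \<open>n \<ge> N\<close> by (auto simp: eventually_sequentially)
    show ?thesis
      using ell2_limit[of "\<lambda>m x. f n x - f m x" "\<lambda>x. f n x - g x" X e, OF lim ell2_diff[OF f f] e(1) ev]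
      by auto
  qed
  obtain N where "\<forall>m\<ge>N. \<forall>n\<ge>N. ell2_norm X (\<lambda>x. f m x - f n x) \<le> 1" using cauchy[of 1] by auto
  then have "(\<lambda>x. f N x - g x) \<in> ell2 X" using *[of 1 N N] by auto
  from ell2_diff[OF f[of N] this] have "g \<in> ell2 X" by simp
  with g * show ?thesis by blast
qed

lemma ell2_finite_approx:
  assumes f: "f \<in> ell2 X" and "0 < e"
  obtains F where "finite F" "F \<subseteq> X" "ell2_norm X (\<lambda>x. f x - (\<Sum>a\<in>F. f a * delta a x)) \<le> e"
proof -
  have hs: "((\<lambda>x. (cmod (f x))\<^sup>2) has_sum (ell2_norm X f)\<^sup>2) X"
    unfolding ell2_norm_sq using ell2_summable[OF f] by simp
  obtain F where F: "finite F" "F \<subseteq> X" "dist (\<Sum>x\<in>F. (cmod (f x))\<^sup>2) ((ell2_norm X f)\<^sup>2) \<le> e\<^sup>2"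
    using has_sum_finite_approximation[OF hs, of "e\<^sup>2"] \<open>0 < e\<close> by auto
  have tail: "(\<Sum>a\<in>F. f a * delta a x) = (if x \<in> F then f x else 0)" for x
    using F(1) by (simp add: delta_def if_distrib cong: if_cong)
  have "ell2_norm X (\<lambda>x. f x - (\<Sum>a\<in>F. f a * delta a x)) \<le> e"
  proof (rule ell2_bounded_sums(2))
    fix F' assume F': "finite F'" "F' \<subseteq> X"
    have "(\<Sum>x\<in>F'. (cmod (f x - (\<Sum>a\<in>F. f a * delta a x)))\<^sup>2) = (\<Sum>x\<in>F' - F. (cmod (f x))\<^sup>2)"
      unfolding tail by (rule sum.mono_neutral_cong_right) (use F' in auto)
    also have "\<dots> = (\<Sum>x\<in>F' \<union> F. (cmod (f x))\<^sup>2) - (\<Sum>x\<in>F. (cmod (f x))\<^sup>2)"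
      using sum.union_disjoint[of "F' - F" F "\<lambda>x. (cmod (f x))\<^sup>2"] F(1) F'(1)
      by (simp add: Un_commute Diff_disjoint Int_commute)
    also have "\<dots> \<le> (ell2_norm X f)\<^sup>2 - (\<Sum>x\<in>F. (cmod (f x))\<^sup>2)"
      using ell2_finite_sum_le[OF f, of "F' \<union> F"] F F' by simp
    also have "\<dots> \<le> e\<^sup>2" using F(3) by (simp add: dist_real_def)
    finally show "(\<Sum>x\<in>F'. (cmod (f x - (\<Sum>a\<in>F. f a * delta a x)))\<^sup>2) \<le> e\<^sup>2" .
  qed (use \<open>0 < e\<close> F f in \<open>auto simp: tail ell2_outside\<close>)
  with F show ?thesis using that by auto
qed

section \<open>Parallelogram law and orthogonal projection\<close>

lemma ell2_norm_sq_diff: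
  assumes "f \<in> ell2 X" "g \<in> ell2 X"
  shows "(ell2_norm X (\<lambda>x. f x - g x))\<^sup>2 =
    (ell2_norm X f)\<^sup>2 + (ell2_norm X g)\<^sup>2 - 2 * Re (ell2_inner X f g)"
proof -
  have "complex_of_real ((ell2_norm X (\<lambda>x. f x - g x))\<^sup>2) =
      of_real ((ell2_norm X f)\<^sup>2) - ell2_inner X f g - cnj (ell2_inner X f g) + of_real ((ell2_norm X g)\<^sup>2)"
    using assms ell2_inner_cnj[of X g f]
    by (simp add: ell2_inner_self[OF assms(1), symmetric] ell2_inner_self[OF assms(2), symmetric] ell2_inner_self[OF ell2_diff[OF assms], symmetric] ell2_inner_diff_left ell2_inner_diff_right ell2_diff del: of_real_power)
  from arg_cong[OF this, of Re] show ?thesis by simp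
qed

lemma ell2_parallelogram:
  assumes "f \<in> ell2 X" "g \<in> ell2 X"
  shows "(ell2_norm X (\<lambda>x. f x + g x))\<^sup>2 + (ell2_norm X (\<lambda>x. f x - g x))\<^sup>2 =
    2 * (ell2_norm X f)\<^sup>2 + 2 * (ell2_norm X g)\<^sup>2"
  using ell2_norm_sq_diff[OF assms] ell2_norm_sq_diff[OF assms(1) ell2_uminus[OF assms(2)]]
    ell2_norm_uminus[of X g] ell2_inner_scale_right[of X f "-1" g] by simp

text \<open>A sequence minimising the distance is Cauchy by the parallelogram law, since midpoints
  stay in \<open>V\<close> and cannot beat the infimum \<open>d\<close>. Varying the minimiser in a
  direction \<open>u\<close> of \<open>V\<close> then yields orthogonality.\<close>

lemma ell2_projection:
  assumes V: "closed_subspace X V" and xi: "\<xi> \<in> ell2 X"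
  obtains v where "v \<in> V" "\<And>w. w \<in> V \<Longrightarrow> ell2_inner X (\<lambda>x. \<xi> x - v x) w = 0"
proof -
  have Vsub: "V \<subseteq> ell2 X" and V0: "(\<lambda>x. 0) \<in> V"
    and Vadd: "\<And>f g. f \<in> V \<Longrightarrow> g \<in> V \<Longrightarrow> (\<lambda>x. f x + g x) \<in> V"
    and Vscale: "\<And>c f. f \<in> V \<Longrightarrow> (\<lambda>x. c * f x) \<in> V"
    and Vclosed: "\<And>f. f \<in> ell2 X \<Longrightarrow> (\<And>e. e > 0 \<Longrightarrow> \<exists>g\<in>V. ell2_norm X (\<lambda>x. f x - g x) < e) \<Longrightarrow> f \<in> V"
    using V by (auto simp: closed_subspace_def)
  define N where "N v = (ell2_norm X (\<lambda>x. \<xi> x - v x))\<^sup>2" for v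
  define d where "d = (INF v\<in>V. N v)"
  have bdd: "bdd_below (N ` V)" by (auto simp: N_def intro!: bdd_belowI[of _ 0])
  have dle: "d \<le> N v" if "v \<in> V" for v unfolding d_def by (rule cINF_lower[OF bdd that])
  have "\<exists>v\<in>V. N v < d + 1 / Suc n" for n
  proof -
    have "\<exists>y\<in>N ` V. y < d + 1 / Suc n"
      using V0 unfolding d_def by (intro cInf_lessD) auto
    then show ?thesis by auto
  qed
  then obtain v where v: "\<And>n. v n \<in> V" "\<And>n. N (v n) < d + 1 / Suc n" by metis
  have key: "(ell2_norm X (\<lambda>x. v m x - v n x))\<^sup>2 \<le> 2 / Suc m + 2 / Suc n" for m n
  proof -
    let ?a = "\<lambda>x. \<xi> x - v m x" and ?b = "\<lambda>x. \<xi> x - v n x"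
    have ab: "?a \<in> ell2 X" "?b \<in> ell2 X" using v(1) Vsub xi by (auto intro!: ell2_diff)
    have mid: "(\<lambda>x. (1/2) * (v m x + v n x)) \<in> V" by (intro Vscale Vadd v)
    have "(\<lambda>x. ?a x + ?b x) = (\<lambda>x. 2 * (\<xi> x - (1/2) * (v m x + v n x)))"
      by (auto simp: algebra_simps)
    then have "(ell2_norm X (\<lambda>x. ?a x + ?b x))\<^sup>2 = 4 * N (\<lambda>x. (1/2) * (v m x + v n x))"
      by (simp only: ell2_norm_scale N_def power_mult_distrib) simp
    then have "(ell2_norm X (\<lambda>x. ?a x + ?b x))\<^sup>2 \<ge> 4 * d" using dle[OF mid] by simp
    moreover have "(ell2_norm X (\<lambda>x. ?a x - ?b x))\<^sup>2 = (ell2_norm X (\<lambda>x. v m x - v n x))\<^sup>2"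
      by (simp add: ell2_norm_commute[of X "v m"] algebra_simps)
    ultimately show ?thesis
      using ell2_parallelogram[OF ab] v(2)[of m] v(2)[of n] by (simp add: N_def)
  qed
  have cauchy: "\<exists>N. \<forall>m\<ge>N. \<forall>n\<ge>N. ell2_norm X (\<lambda>x. v m x - v n x) \<le> e" if "0 < e" for e
  proof -
    have "0 < e\<^sup>2 / 4" using that by simp
    from reals_Archimedean[OF this] obtain K where K: "inverse (real (Suc K)) < e\<^sup>2 / 4" by blast
    have "ell2_norm X (\<lambda>x. v m x - v n x) \<le> e" if "m \<ge> K" "n \<ge> K" for m n
    proof -
      have "1 / real (Suc m) \<le> 1 / real (Suc K)" "1 / real (Suc n) \<le> 1 / real (Suc K)"
        using that by (auto simp: divide_simps)
      then have "(ell2_norm X (\<lambda>x. v m x - v n x))\<^sup>2 \<le> e\<^sup>2"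
        using key[of m n] K by (simp add: inverse_eq_divide)
      then show ?thesis by (rule power2_le_imp_le) (use \<open>0 < e\<close> in simp)
    qed
    then show ?thesis by blast
  qed
  have vX: "v n \<in> ell2 X" for n using v(1) Vsub by blast
  obtain w where w: "w \<in> ell2 X" and wlim: "\<And>e N. 0 \<le> e \<Longrightarrow>
      (\<forall>m\<ge>N. \<forall>n\<ge>N. ell2_norm X (\<lambda>x. v m x - v n x) \<le> e) \<Longrightarrow>
       \<forall>n\<ge>N. ell2_norm X (\<lambda>x. v n x - w x) \<le> e"
    using ell2_complete[of v X, OF vX cauchy] by auto
  have near: "\<exists>N. \<forall>n\<ge>N. ell2_norm X (\<lambda>x. v n x - w x) \<le> e" if "0 < e" for e
  proof -
    obtain N where "\<forall>m\<ge>N. \<forall>n\<ge>N. ell2_norm X (\<lambda>x. v m x - v n x) \<le> e" using cauchy[OF \<open>0 < e\<close>] by blast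
    from wlim[OF less_imp_le[OF that] this] show ?thesis by blast
  qed
  have wV: "w \<in> V"
  proof (rule Vclosed[OF w])
    fix e :: real assume "0 < e"
    then obtain n where "ell2_norm X (\<lambda>x. v n x - w x) \<le> e/2" using near[of "e/2"] by auto
    then show "\<exists>g\<in>V. ell2_norm X (\<lambda>x. w x - g x) < e"
      using v(1)[of n] \<open>0 < e\<close> ell2_norm_commute[of X w] by (intro bexI[of _ "v n"]) auto
  qed
  have Nw: "N w \<le> d"
  proof -
    have "sqrt (N w) \<le> sqrt d"
    proof (rule LIMSEQ_le_const)
      show "(\<lambda>n. sqrt (d + 1 / Suc n) + ell2_norm X (\<lambda>x. v n x - w x)) \<longlonglongrightarrow> sqrt d"
      proof -
        have a: "(\<lambda>n. ell2_norm X (\<lambda>x. v n x - w x)) \<longlonglongrightarrow> 0"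
          unfolding LIMSEQ_iff
        proof (intro allI impI)
          fix e :: real assume "0 < e"
          then obtain N where "\<forall>n\<ge>N. ell2_norm X (\<lambda>x. v n x - w x) \<le> e/2" using near[of "e/2"] by auto
          then show "\<exists>no. \<forall>n\<ge>no. norm (ell2_norm X (\<lambda>x. v n x - w x) - 0) < e"
            using \<open>0 < e\<close> by (intro exI[of _ N]) (fastforce)
        qed
        have b: "(\<lambda>n. sqrt (d + 1 / Suc n)) \<longlonglongrightarrow> sqrt (d + 0)"
          by (intro tendsto_intros LIMSEQ_Suc[OF lim_1_over_n])
        from tendsto_add[OF b a] show ?thesis by simp
      qed
      show "\<exists>K. \<forall>n\<ge>K. sqrt (N w) \<le> sqrt (d + 1 / Suc n) + ell2_norm X (\<lambda>x. v n x - w x)"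
      proof (intro exI allI impI)
        fix n :: nat
        have "sqrt (N w) \<le> ell2_norm X (\<lambda>x. \<xi> x - v n x) + ell2_norm X (\<lambda>x. v n x - w x)"
          unfolding N_def using ell2_norm_diff_trans[OF xi _ w, of "v n"] v(1)[of n] Vsub by auto
        also have "ell2_norm X (\<lambda>x. \<xi> x - v n x) \<le> sqrt (d + 1 / Suc n)"
          using v(2)[of n] by (simp add: N_def real_le_rsqrt)
        finally show "sqrt (N w) \<le> sqrt (d + 1 / Suc n) + ell2_norm X (\<lambda>x. v n x - w x)" by simp
      qed
    qed
    then show ?thesis by simp
  qed
  have "ell2_inner X (\<lambda>x. \<xi> x - w x) u = 0" if u: "u \<in> V" for u
  proof (rule ccontr)
    define z where "z = ell2_inner X (\<lambda>x. \<xi> x - w x) u"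
    assume "ell2_inner X (\<lambda>x. \<xi> x - w x) u \<noteq> 0"
    then have z: "0 < (cmod z)\<^sup>2" by (simp add: z_def)
    \<comment> \<open>The step length of the variation: with s |u|^2 < 1 the quadratic cost s^2
      |z|^2 |u|^2 stays below the linear gain 2 s |z|^2, so a nonzero \<open>z\<close> would improve
      on the minimum.\<close>
    define s where "s = 1 / (1 + (ell2_norm X u)\<^sup>2)"
    have s: "0 < s" "s * (ell2_norm X u)\<^sup>2 < 1"
      unfolding s_def by (auto simp: add_pos_nonneg divide_simps)
    have uX: "u \<in> ell2 X" and xw: "(\<lambda>x. \<xi> x - w x) \<in> ell2 X" using u Vsub xi w by (auto intro!: ell2_diff)
    have "(\<lambda>x. w x + of_real s * z * u x) \<in> V" by (intro Vadd Vscale wV u)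
    from dle[OF this] Nw have "N w \<le> N (\<lambda>x. w x + of_real s * z * u x)" by simp
    also have "\<dots> = (ell2_norm X (\<lambda>x. (\<xi> x - w x) - of_real s * z * u x))\<^sup>2"
      unfolding N_def by (simp add: algebra_simps)
    also have "\<dots> = N w + (s * cmod z * ell2_norm X u)\<^sup>2 - 2 * Re (cnj (of_real s * z) * z)"
      unfolding N_def
      by (subst ell2_norm_sq_diff[OF xw ell2_scale[OF uX]])
         (use s in \<open>simp add: ell2_inner_scale_right ell2_norm_scale z_def[symmetric] norm_mult\<close>)
    also have "Re (cnj (of_real s * z) * z) = s * (cmod z)\<^sup>2"
      by (simp add: cmod_power2) (simp add: power2_eq_square algebra_simps)
    finally have "2 * (s * (cmod z)\<^sup>2) \<le> (s * (cmod z)\<^sup>2) * (s * (ell2_norm X u)\<^sup>2)"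
      by (simp add: power2_eq_square algebra_simps)
    moreover have "(s * (cmod z)\<^sup>2) * (s * (ell2_norm X u)\<^sup>2) \<le> (s * (cmod z)\<^sup>2) * 1"
      using s z by (intro mult_left_mono) auto
    moreover have "0 < s * (cmod z)\<^sup>2" using s z by simp
    ultimately show False by linarith
  qed
  with wV show ?thesis using that by blast
qed

section \<open>Bounded operators\<close>

text \<open>Estimates are carried by this relation and not by \<open>op_norm\<close>: it composes
  and adds directly, without arguing about suprema. \<open>bnd_op_norm\<close> and
  \<open>op_norm_le\<close> translate between the two.\<close>

definition bnd :: "'x set \<Rightarrow> 'x operator \<Rightarrow> real \<Rightarrow> bool" where
  "bnd X A C \<longleftrightarrow> (\<forall>f\<in>ell2 X. ell2_norm X (A f) \<le> C * ell2_norm X f)"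

lemma bndD: "bnd X A C \<Longrightarrow> f \<in> ell2 X \<Longrightarrow> ell2_norm X (A f) \<le> C * ell2_norm X f"
  by (simp add: bnd_def)

lemma bnd_mono: "bnd X A C \<Longrightarrow> C \<le> D \<Longrightarrow> bnd X A D"
  unfolding bnd_def by (meson ell2_norm_nonneg mult_right_mono order_trans)

lemma
  assumes "A \<in> bounded_ops X"
  shows op_maps: "f \<in> ell2 X \<Longrightarrow> A f \<in> ell2 X"
    and op_add: "f \<in> ell2 X \<Longrightarrow> g \<in> ell2 X \<Longrightarrow> A (\<lambda>x. f x + g x) = (\<lambda>x. A f x + A g x)"
    and op_scale: "f \<in> ell2 X \<Longrightarrow> A (\<lambda>x. c * f x) = (\<lambda>x. c * A f x)"
    and op_outside: "f \<notin> ell2 X \<Longrightarrow> A f = (\<lambda>x. 0)"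
  using assms by (auto simp: bounded_ops_def)

lemma op_zero: "A \<in> bounded_ops X \<Longrightarrow> A (\<lambda>x. 0) = (\<lambda>x. 0)"
  using op_scale[of A X "\<lambda>x. 0" 0] by simp

lemma op_diff:
  "A \<in> bounded_ops X \<Longrightarrow> f \<in> ell2 X \<Longrightarrow> g \<in> ell2 X \<Longrightarrow> A (\<lambda>x. f x - g x) = (\<lambda>x. A f x - A g x)"
  using op_add[of A X f "\<lambda>x. - 1 * g x"] op_scale[of A X g "- 1"] ell2_scale[of g X "- 1"] by simp

lemma op_sum:
  assumes "A \<in> bounded_ops X" "\<And>i. i \<in> F \<Longrightarrow> u i \<in> ell2 X"
  shows "A (\<lambda>x. \<Sum>i\<in>F. c i * u i x) = (\<lambda>x. \<Sum>i\<in>F. c i * A (u i) x)"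
  using assms(2)
proof (induction F rule: infinite_finite_induct)
  case (insert a F)
  have "(\<lambda>x. \<Sum>i\<in>F. c i * u i x) \<in> ell2 X" by (intro ell2_sum ell2_scale) (use insert in auto)
  then show ?case using insert assms(1)
    by (simp add: op_add[OF assms(1)] op_scale[OF assms(1)] ell2_scale)
qed (simp_all add: op_zero[OF assms(1)])

lemma bounded_ops_bnd:
  assumes "A \<in> bounded_ops X" obtains C where "0 \<le> C" "bnd X A C"
proof -
  from assms obtain C where "bnd X A C" by (auto simp: bounded_ops_def bnd_def)
  then have "bnd X A (max 0 C)" by (rule bnd_mono) simp
  then show ?thesis using that[of "max 0 C"] by simp
qed

lemma bounded_opsI:
  assumes "\<And>f. f \<in> ell2 X \<Longrightarrow> A f \<in> ell2 X"
    and "\<And>f g. f \<in> ell2 X \<Longrightarrow> g \<in> ell2 X \<Longrightarrow> A (\<lambda>x. f x + g x) = (\<lambda>x. A f x + A g x)"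
    and "\<And>c f. f \<in> ell2 X \<Longrightarrow> A (\<lambda>x. c * f x) = (\<lambda>x. c * A f x)"
    and "bnd X A C" and "\<And>f. f \<notin> ell2 X \<Longrightarrow> A f = (\<lambda>x. 0)"
  shows "A \<in> bounded_ops X"
  using assms by (auto simp: bounded_ops_def bnd_def)

lemma op_ext:
  assumes "A \<in> bounded_ops X" "B \<in> bounded_ops X" "\<And>f. f \<in> ell2 X \<Longrightarrow> A f = B f"
  shows "A = B"
  using assms op_outside by (metis ext)

definition op_id :: "'x set \<Rightarrow> 'x operator" where
  "op_id X = (\<lambda>f. if f \<in> ell2 X then f else (\<lambda>x. 0))"

lemma op_id_apply [simp]: "f \<in> ell2 X \<Longrightarrow> op_id X f = f"
  by (simp add: op_id_def)

lemma bnd_id: "bnd X (op_id X) 1"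
  by (simp add: bnd_def)

lemma bnd_zero: "0 \<le> C \<Longrightarrow> bnd X (\<lambda>f x. 0) C"
  by (simp add: bnd_def)

lemma bnd_add:
  assumes "A \<in> bounded_ops X" "B \<in> bounded_ops X" "bnd X A C" "bnd X B D"
  shows "bnd X (\<lambda>f x. A f x + B f x) (C + D)"
  unfolding bnd_def
proof
  fix f assume f: "f \<in> ell2 X"
  have "ell2_norm X (\<lambda>x. A f x + B f x) \<le> ell2_norm X (A f) + ell2_norm X (B f)"
    using f assms op_maps by (intro ell2_norm_triangle) auto
  then show "ell2_norm X (\<lambda>x. A f x + B f x) \<le> (C + D) * ell2_norm X f"
    using bndD[OF assms(3) f] bndD[OF assms(4) f] by (simp add: algebra_simps)
qed

lemma bnd_scale: "bnd X A C \<Longrightarrow> bnd X (\<lambda>f x. c * A f x) (cmod c * C)"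
  by (auto simp: bnd_def ell2_norm_scale mult.assoc intro!: mult_left_mono)

lemma bnd_comp:
  assumes "A \<in> bounded_ops X" "B \<in> bounded_ops X" "bnd X A C" "bnd X B D" "0 \<le> C"
  shows "bnd X (A \<circ> B) (C * D)"
  unfolding bnd_def
proof
  fix f assume f: "f \<in> ell2 X"
  have "ell2_norm X (A (B f)) \<le> C * ell2_norm X (B f)"
    using f assms op_maps by (intro bndD[OF assms(3)]) auto
  also have "\<dots> \<le> C * (D * ell2_norm X f)"
    by (intro mult_left_mono bndD[OF assms(4) f] assms)
  finally show "ell2_norm X ((A \<circ> B) f) \<le> C * D * ell2_norm X f" by (simp add: mult.assoc)
qed

lemma id_bounded_op: "op_id X \<in> bounded_ops X"
  by (rule bounded_opsI[OF _ _ _ bnd_id]) (auto simp: ell2_add ell2_scale op_id_def)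

lemma zero_bounded_op: "(\<lambda>f x. 0) \<in> bounded_ops X"
  by (rule bounded_opsI[OF _ _ _ bnd_zero[of 0]]) auto

lemma add_bounded_op:
  assumes "A \<in> bounded_ops X" "B \<in> bounded_ops X"
  shows "(\<lambda>f x. A f x + B f x) \<in> bounded_ops X"
proof -
  obtain C D where "bnd X A C" "bnd X B D" using assms bounded_ops_bnd by metis
  from bnd_add[OF assms this] show ?thesis
    by (rule bounded_opsI[rotated 3])
       (use assms in \<open>auto simp: op_maps op_add op_scale op_outside ell2_add algebra_simps\<close>)
qed

lemma scale_bounded_op:
  assumes "A \<in> bounded_ops X"
  shows "(\<lambda>f x. c * A f x) \<in> bounded_ops X"
proof -
  obtain C where "bnd X A C" using assms bounded_ops_bnd by metis
  from bnd_scale[OF this] show ?thesis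
    by (rule bounded_opsI[rotated 3])
       (use assms in \<open>auto simp: op_maps op_add op_scale op_outside ell2_scale algebra_simps\<close>)
qed

lemma diff_bounded_op:
  assumes "A \<in> bounded_ops X" "B \<in> bounded_ops X"
  shows "(\<lambda>f x. A f x - B f x) \<in> bounded_ops X"
  using add_bounded_op[OF assms(1) scale_bounded_op[OF assms(2), of "-1"]] by simp

lemma comp_bounded_op:
  assumes "A \<in> bounded_ops X" "B \<in> bounded_ops X"
  shows "A \<circ> B \<in> bounded_ops X"
proof -
  obtain C D where "0 \<le> C" "bnd X A C" "bnd X B D" using assms bounded_ops_bnd by metis
  with bnd_comp[OF assms] have "bnd X (A \<circ> B) (C * D)" by blast
  then show ?thesis
    by (rule bounded_opsI[rotated 3])
       (use assms in \<open>auto simp: op_maps op_add op_scale op_outside op_zero\<close>)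
qed

lemma bnd_diff_trans:
  assumes "A \<in> bounded_ops X" "B \<in> bounded_ops X" "D \<in> bounded_ops X"
    and "bnd X (\<lambda>f x. A f x - B f x) e" "bnd X (\<lambda>f x. B f x - D f x) d"
  shows "bnd X (\<lambda>f x. A f x - D f x) (e + d)"
  using bnd_add[OF diff_bounded_op[OF assms(1,2)] diff_bounded_op[OF assms(2,3)] assms(4,5)] by simp

lemma bnd_diff_commute: "bnd X (\<lambda>f x. A f x - B f x) e \<longleftrightarrow> bnd X (\<lambda>f x. B f x - A f x) e"
  unfolding bnd_def by (subst ell2_norm_commute) (rule refl)

lemma bnd_from_diff:
  assumes "A \<in> bounded_ops X" "B \<in> bounded_ops X"
    and "bnd X (\<lambda>f x. A f x - B f x) e" "bnd X B d"
  shows "bnd X A (e + d)"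
  using bnd_add[OF diff_bounded_op[OF assms(1,2)] assms(2-)] by simp

lemma bnd_limit:
  assumes "\<And>e. 0 < e \<Longrightarrow> bnd X A (C + e)" shows "bnd X A C"
  unfolding bnd_def
proof
  fix f assume f: "f \<in> ell2 X"
  show "ell2_norm X (A f) \<le> C * ell2_norm X f"
  proof (rule field_le_epsilon)
    fix e :: real assume "0 < e"
    define d where "d = e / (1 + ell2_norm X f)"
    have n: "0 < 1 + ell2_norm X f" by (simp add: add_pos_nonneg)
    then have "0 < d" using \<open>0 < e\<close> by (simp add: d_def)
    have "ell2_norm X (A f) \<le> (C + d) * ell2_norm X f" by (rule bndD[OF assms[OF \<open>0 < d\<close>] f])
    also have "d * ell2_norm X f \<le> e"
      using n \<open>0 < e\<close> by (simp add: d_def divide_simps)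
    then have "(C + d) * ell2_norm X f \<le> C * ell2_norm X f + e" by (simp add: algebra_simps)
    finally show "ell2_norm X (A f) \<le> C * ell2_norm X f + e" .
  qed
qed

lemma bnd_0_eq:
  assumes "A \<in> bounded_ops X" "B \<in> bounded_ops X" "bnd X (\<lambda>f x. A f x - B f x) 0"
  shows "A = B"
proof (rule op_ext[OF assms(1,2)])
  fix f assume f: "f \<in> ell2 X"
  have "ell2_norm X (\<lambda>x. A f x - B f x) = 0"
    using bndD[OF assms(3) f] ell2_norm_nonneg[of X "\<lambda>x. A f x - B f x"] by simp
  then have "(\<lambda>x. A f x - B f x) = (\<lambda>x. 0)"
    by (rule ell2_norm_eq_0[rotated]) (intro ell2_diff op_maps[OF assms(1)] op_maps[OF assms(2)] f)
  then show "A f = B f" by (metis eq_iff_diff_eq_0 ext)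
qed

section \<open>Operator norm, adjoints and norm limits of operators\<close>

lemma
  assumes A: "A \<in> bounded_ops X"
  shows bnd_op_norm: "bnd X A (op_norm X A)" and op_norm_nonneg: "0 \<le> op_norm X A"
    and op_norm_le: "bnd X A C \<Longrightarrow> 0 \<le> C \<Longrightarrow> op_norm X A \<le> C"
proof -
  let ?S = "{ell2_norm X (A f) |f. f \<in> ell2 X \<and> ell2_norm X f \<le> 1}"
  have ub: "s \<le> C" if C: "bnd X A C" "0 \<le> C" and s: "s \<in> ?S" for s C
  proof -
    obtain f where f: "f \<in> ell2 X" "ell2_norm X f \<le> 1" "s = ell2_norm X (A f)" using s by auto
    have "s \<le> C * ell2_norm X f" using bndD[OF C(1) f(1)] f by simp
    also have "\<dots> \<le> C * 1" using f C by (intro mult_left_mono) auto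
    finally show ?thesis by simp
  qed
  obtain C0 where C0: "0 \<le> C0" "bnd X A C0" using bounded_ops_bnd[OF A] .
  then have bdd: "bdd_above ?S" using ub by (intro bdd_aboveI[of _ C0]) blast
  have z: "0 \<in> ?S" using op_zero[OF A] by (auto intro!: exI[of _ "\<lambda>x. 0"])
  show nn: "0 \<le> op_norm X A" unfolding op_norm_def by (rule cSup_upper[OF z bdd])
  show "op_norm X A \<le> C" if "bnd X A C" "0 \<le> C"
    unfolding op_norm_def using z ub[OF that] by (intro cSup_least) auto
  show "bnd X A (op_norm X A)"
    unfolding bnd_def
  proof
    fix f assume f: "f \<in> ell2 X"
    show "ell2_norm X (A f) \<le> op_norm X A * ell2_norm X f"
    proof (cases "ell2_norm X f = 0")
      case True
      then show ?thesis using bndD[OF C0(2) f] by simp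
    next
      case False
      then have pos: "0 < ell2_norm X f" using ell2_norm_nonneg[of X f] by linarith
      let ?c = "complex_of_real (1 / ell2_norm X f)"
      have "ell2_norm X (A (\<lambda>x. ?c * f x)) \<in> ?S"
        using ell2_scale[OF f, of ?c] pos
        by (intro CollectI exI[of _ "\<lambda>x. ?c * f x"]) (auto simp only: ell2_norm_scale, simp add: norm_divide)
      then have "ell2_norm X (A (\<lambda>x. ?c * f x)) \<le> op_norm X A"
        unfolding op_norm_def by (rule cSup_upper[OF _ bdd])
      then show ?thesis using pos
        by (simp only: op_scale[OF A f] ell2_norm_scale) (simp add: norm_divide divide_simps)
    qed
  qed
qed

text \<open>The coordinates of the adjoint are forced by pairing with basis vectors; what has to be
  shown is that they are square summable. The clause over all \<open>C\<close> records that taking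
  adjoints does not increase the norm.\<close>

lemma op_adjoint_exists:
  assumes A: "A \<in> bounded_ops X"
  shows "\<exists>B. B \<in> bounded_ops X \<and> (\<forall>C\<ge>0. bnd X A C \<longrightarrow> bnd X B C) \<and>
     (\<forall>f\<in>ell2 X. \<forall>g\<in>ell2 X. ell2_inner X (A f) g = ell2_inner X f (B g))"
proof -
  define B where "B g = (\<lambda>x. if x \<in> X \<and> g \<in> ell2 X then ell2_inner X g (A (delta x)) else 0)" for g
  have lin: "A (\<lambda>x. \<Sum>a\<in>F. c a * delta a x) = (\<lambda>x. \<Sum>a\<in>F. c a * A (delta a) x)" if "F \<subseteq> X" for F c
    using that by (intro op_sum[OF A]) (auto intro: delta_ell2)
  have dsum: "(\<lambda>x. \<Sum>a\<in>F. c a * delta a x) \<in> ell2 X" if "F \<subseteq> X" for F c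
    using that by (intro ell2_sum ell2_scale delta_ell2) auto
  have ad: "A (delta a) \<in> ell2 X" if "a \<in> X" for a using op_maps[OF A delta_ell2[OF that]] .
  have inner: "ell2_inner X (A (\<lambda>x. \<Sum>a\<in>F. c a * delta a x)) g = (\<Sum>a\<in>F. c a * cnj (B g a))"
    if "F \<subseteq> X" "g \<in> ell2 X" for F c g
  proof -
    have "ell2_inner X (A (\<lambda>x. \<Sum>a\<in>F. c a * delta a x)) g = (\<Sum>a\<in>F. ell2_inner X (\<lambda>x. c a * A (delta a) x) g)"
      unfolding lin[OF that(1)] using that
      by (intro ell2_inner_sum_left ell2_scale ad) auto
    also have "\<dots> = (\<Sum>a\<in>F. c a * cnj (B g a))"
      using that by (intro sum.cong refl)
        (auto simp: ell2_inner_scale_left B_def ell2_inner_cnj[of X g])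
    finally show ?thesis .
  qed
  have Bb: "B g \<in> ell2 X \<and> ell2_norm X (B g) \<le> C * ell2_norm X g"
    if C: "0 \<le> C" "bnd X A C" and g: "g \<in> ell2 X" for C g
  proof -
    have "L2_set (\<lambda>x. cmod (B g x)) F \<le> C * ell2_norm X g" if F: "finite F" "F \<subseteq> X" for F
    proof -
      let ?s = "L2_set (\<lambda>x. cmod (B g x)) F"
      \<comment> \<open>The test vector is \<open>B g\<close> cut down to \<open>F\<close>. Pairing
        \<open>A ?u\<close> with \<open>g\<close> returns \<open>?s\<close> squared, so
        Cauchy-Schwarz gives s^2 <= C s |g|.\<close>
      let ?u = "\<lambda>x. \<Sum>a\<in>F. B g a * delta a x"
      have s2: "?s\<^sup>2 = (\<Sum>x\<in>F. (cmod (B g x))\<^sup>2)" by (simp add: L2_set_def sum_nonneg)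
      have u: "?u x = (if x \<in> F then B g x else 0)" for x
        using F(1) by (simp add: delta_def if_distrib cong: if_cong)
      have nu: "ell2_norm X ?u \<le> ?s"
      proof (rule ell2_bounded_sums(2))
        fix F' assume F': "finite F'" "F' \<subseteq> X"
        have "(\<Sum>x\<in>F'. (cmod (?u x))\<^sup>2) = (\<Sum>x\<in>F' \<inter> F. (cmod (B g x))\<^sup>2)"
          unfolding u by (rule sum.mono_neutral_cong_right) (use F' in auto)
        also have "\<dots> \<le> ?s\<^sup>2" unfolding s2 by (rule sum_mono2) (use F in auto)
        finally show "(\<Sum>x\<in>F'. (cmod (?u x))\<^sup>2) \<le> ?s\<^sup>2" .
      qed (use F in \<open>auto simp: u L2_set_nonneg\<close>)
      have "of_real (?s\<^sup>2) = (\<Sum>a\<in>F. B g a * cnj (B g a))"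
        unfolding s2 by (simp add: complex_norm_square del: of_real_power)
      also have "\<dots> = ell2_inner X (A ?u) g" using inner[OF F(2) g] by simp
      finally have "?s\<^sup>2 = cmod (ell2_inner X (A ?u) g)"
        by (metis norm_of_real abs_of_nonneg zero_le_power2)
      also have "\<dots> \<le> ell2_norm X (A ?u) * ell2_norm X g"
        by (rule ell2_Cauchy_Schwarz[OF op_maps[OF A dsum[OF F(2)]] g])
      also have "\<dots> \<le> (C * ?s) * ell2_norm X g"
        using bndD[OF C(2) dsum[OF F(2)], of "B g"] nu C(1)
        by (intro mult_right_mono) (auto intro: order_trans[OF _ mult_left_mono])
      finally have "?s * ?s \<le> ?s * (C * ell2_norm X g)" by (simp add: power2_eq_square algebra_simps)
      then show ?thesis using C(1) L2_set_nonneg[of "\<lambda>x. cmod (B g x)" F]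
        by (cases "?s = 0") (auto simp: mult_le_cancel_left)
    qed
    then show ?thesis
      using ell2_bounded_L2[of X "B g" "C * ell2_norm X g"] C(1) by (auto simp: B_def)
  qed
  obtain C0 where C0: "0 \<le> C0" "bnd X A C0" using bounded_ops_bnd[OF A] .
  have "B \<in> bounded_ops X"
  proof (rule bounded_opsI[of X B C0])
    show "bnd X B C0" using Bb[OF C0] by (auto simp: bnd_def)
  qed (use Bb[OF C0] in \<open>auto simp: B_def ell2_inner_add_left ell2_inner_scale_left ell2_add ell2_scale ad fun_eq_iff\<close>)
  moreover have "ell2_inner X (A f) g = ell2_inner X f (B g)" if f: "f \<in> ell2 X" and g: "g \<in> ell2 X" for f g
  proof -
    have "cmod (ell2_inner X (A f) g - ell2_inner X f (B g)) \<le> 0"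
    proof (rule field_le_epsilon)
      fix e :: real assume "0 < e"
      define d where "d = e / (2 * (C0 * ell2_norm X g) + 1)"
      have pos: "0 < 2 * (C0 * ell2_norm X g) + 1" using C0 by (simp add: add_nonneg_pos)
      then have "0 < d" using \<open>0 < e\<close> by (simp add: d_def)
      then obtain F where F: "finite F" "F \<subseteq> X" and
        Fd: "ell2_norm X (\<lambda>x. f x - (\<Sum>a\<in>F. f a * delta a x)) \<le> d"
        using ell2_finite_approx[OF f] by blast
      let ?u = "\<lambda>x. \<Sum>a\<in>F. f a * delta a x" let ?w = "\<lambda>x. f x - ?u x"
      have u: "?u \<in> ell2 X" by (rule dsum[OF F(2)])
      have w: "?w \<in> ell2 X" by (rule ell2_diff[OF f u])
      have Bg: "B g \<in> ell2 X" using Bb[OF C0 g] by blast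
      have "ell2_inner X ?u (B g) = (\<Sum>a\<in>F. f a * cnj (B g a))"
        using F by (subst ell2_inner_sum_left)
          (auto simp: Bg delta_ell2 ell2_scale ell2_inner_scale_left ell2_inner_cnj[of X "delta _" "B g"] ell2_inner_delta intro!: sum.cong)
      then have eq: "ell2_inner X (A ?u) g = ell2_inner X ?u (B g)" using inner[OF F(2) g] by simp
      have "ell2_inner X (A f) g - ell2_inner X f (B g) = ell2_inner X (A ?w) g - ell2_inner X ?w (B g)"
        using eq by (simp add: op_diff[OF A f u] ell2_inner_diff_left op_maps[OF A] f u g Bg)
      then have "cmod (ell2_inner X (A f) g - ell2_inner X f (B g)) =
          cmod (ell2_inner X (A ?w) g - ell2_inner X ?w (B g))" by (rule arg_cong)
      also have "\<dots> \<le> cmod (ell2_inner X (A ?w) g) + cmod (ell2_inner X ?w (B g))"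
        by (rule norm_triangle_ineq4)
      also have "\<dots> \<le> ell2_norm X (A ?w) * ell2_norm X g + ell2_norm X ?w * ell2_norm X (B g)"
        by (rule add_mono[OF ell2_Cauchy_Schwarz[OF op_maps[OF A w] g] ell2_Cauchy_Schwarz[OF w Bg]])
      also have "\<dots> \<le> (C0 * d) * ell2_norm X g + d * (C0 * ell2_norm X g)"
      proof -
        have "ell2_norm X (A ?w) \<le> C0 * d" by (rule order_trans[OF bndD[OF C0(2) w] mult_left_mono[OF Fd C0(1)]])
        moreover have "ell2_norm X (B g) \<le> C0 * ell2_norm X g" using Bb[OF C0 g] by blast
        ultimately show ?thesis using Fd C0(1) \<open>0 < d\<close>
          by (intro add_mono mult_mono) simp_all
      qed
      also have "\<dots> = d * (2 * (C0 * ell2_norm X g))" by (simp add: algebra_simps)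
      also have "\<dots> \<le> d * (2 * (C0 * ell2_norm X g) + 1)" using \<open>0 < d\<close> by simp
      also have "\<dots> = e" using pos by (simp add: d_def)
      finally show "cmod (ell2_inner X (A f) g - ell2_inner X f (B g)) \<le> 0 + e" by simp
    qed
    then show ?thesis by simp
  qed
  ultimately show ?thesis using Bb by (auto simp: bnd_def intro!: exI[of _ B])
qed

lemma op_adjoint_unique:
  assumes "B \<in> bounded_ops X" "B' \<in> bounded_ops X"
    and "\<And>f g. f \<in> ell2 X \<Longrightarrow> g \<in> ell2 X \<Longrightarrow> ell2_inner X f (B g) = ell2_inner X f (B' g)"
  shows "B = B'"
proof (rule op_ext[OF assms(1,2)])
  fix g assume g: "g \<in> ell2 X"
  show "B g = B' g"
  proof
    fix x
    show "B g x = B' g x"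
    proof (cases "x \<in> X")
      case True
      then show ?thesis
        using assms(3)[OF delta_ell2[OF True] g]
        by (simp add: ell2_inner_cnj[of X "delta x"] ell2_inner_delta)
    next
      case False
      then show ?thesis using op_maps[OF assms(1) g] op_maps[OF assms(2) g] by (simp add: ell2_outside)
    qed
  qed
qed

lemma
  assumes A: "A \<in> bounded_ops X"
  shows adjoint_bounded_op: "op_adjoint X A \<in> bounded_ops X"
    and adjoint_inner: "f \<in> ell2 X \<Longrightarrow> g \<in> ell2 X \<Longrightarrow>
        ell2_inner X (A f) g = ell2_inner X f (op_adjoint X A g)"
    and bnd_adjoint: "0 \<le> C \<Longrightarrow> bnd X A C \<Longrightarrow> bnd X (op_adjoint X A) C"
    and adjoint_eqI: "B \<in> bounded_ops X \<Longrightarrow>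
        (\<And>f g. f \<in> ell2 X \<Longrightarrow> g \<in> ell2 X \<Longrightarrow> ell2_inner X (A f) g = ell2_inner X f (B g)) \<Longrightarrow>
        op_adjoint X A = B"
proof -
  obtain B0 where B0: "B0 \<in> bounded_ops X" "\<forall>C\<ge>0. bnd X A C \<longrightarrow> bnd X B0 C"
    "\<forall>f\<in>ell2 X. \<forall>g\<in>ell2 X. ell2_inner X (A f) g = ell2_inner X f (B0 g)"
    using op_adjoint_exists[OF A] by blast
  have *: "op_adjoint X A = B"
    if B: "B \<in> bounded_ops X" "\<forall>f\<in>ell2 X. \<forall>g\<in>ell2 X. ell2_inner X (A f) g = ell2_inner X f (B g)" for B
    unfolding op_adjoint_def
  proof (rule the_equality)
    show "B' = B" if "B' \<in> bounded_ops X \<and>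
      (\<forall>f\<in>ell2 X. \<forall>g\<in>ell2 X. ell2_inner X (A f) g = ell2_inner X f (B' g))" for B'
      using that B by (intro op_adjoint_unique) auto
  qed (use B in blast)
  have "op_adjoint X A = B0" using * B0 by blast
  then show "op_adjoint X A \<in> bounded_ops X" 
    "f \<in> ell2 X \<Longrightarrow> g \<in> ell2 X \<Longrightarrow> ell2_inner X (A f) g = ell2_inner X f (op_adjoint X A g)"
    "0 \<le> C \<Longrightarrow> bnd X A C \<Longrightarrow> bnd X (op_adjoint X A) C"
    using B0 by auto
  show "op_adjoint X A = B" if "B \<in> bounded_ops X"
    "\<And>f g. f \<in> ell2 X \<Longrightarrow> g \<in> ell2 X \<Longrightarrow> ell2_inner X (A f) g = ell2_inner X f (B g)" for B
    using * that by blast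
qed

lemma adjoint_add:
  assumes "A \<in> bounded_ops X" "B \<in> bounded_ops X"
  shows "op_adjoint X (\<lambda>f x. A f x + B f x) = (\<lambda>f x. op_adjoint X A f x + op_adjoint X B f x)"
  by (rule adjoint_eqI)
     (use assms in \<open>simp_all add: add_bounded_op adjoint_bounded_op ell2_inner_add_left ell2_inner_add_right
        op_maps adjoint_inner\<close>)

lemma adjoint_scale:
  assumes "A \<in> bounded_ops X"
  shows "op_adjoint X (\<lambda>f x. c * A f x) = (\<lambda>f x. cnj c * op_adjoint X A f x)"
  by (rule adjoint_eqI)
     (use assms in \<open>simp_all add: scale_bounded_op adjoint_bounded_op ell2_inner_scale_left ell2_inner_scale_right
        adjoint_inner\<close>)

lemma adjoint_diff:
  assumes "A \<in> bounded_ops X" "B \<in> bounded_ops X"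
  shows "op_adjoint X (\<lambda>f x. A f x - B f x) = (\<lambda>f x. op_adjoint X A f x - op_adjoint X B f x)"
  by (rule adjoint_eqI)
     (use assms in \<open>simp_all add: diff_bounded_op adjoint_bounded_op ell2_inner_diff_left ell2_inner_diff_right
        op_maps adjoint_inner\<close>)

text \<open>Limits are taken vector by vector. They are in particular coordinatewise limits, so
  linearity follows from uniqueness of limits, and the rate in \<open>ell2_complete\<close> makes
  the convergence uniform on bounded sets.\<close>

lemma op_complete:
  fixes A :: "nat \<Rightarrow> 'x operator"
  assumes A: "\<And>n. A n \<in> bounded_ops X"
    and cauchy: "\<And>e. 0 < e \<Longrightarrow> \<exists>N. \<forall>m\<ge>N. \<forall>n\<ge>N. bnd X (\<lambda>f x. A m f x - A n f x) e"
  shows "\<exists>B\<in>bounded_ops X. \<forall>e\<ge>0. \<forall>N. (\<forall>m\<ge>N. \<forall>n\<ge>N. bnd X (\<lambda>f x. A m f x - A n f x) e) \<longrightarrow>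
           (\<forall>n\<ge>N. bnd X (\<lambda>f x. A n f x - B f x) e)"
proof -
  have ex: "\<exists>g\<in>ell2 X. (\<forall>x. (\<lambda>n. A n f x) \<longlonglongrightarrow> g x) \<and>
    (\<forall>e\<ge>0. \<forall>N. (\<forall>m\<ge>N. \<forall>n\<ge>N. ell2_norm X (\<lambda>x. A m f x - A n f x) \<le> e) \<longrightarrow>
       (\<forall>n\<ge>N. ell2_norm X (\<lambda>x. A n f x - g x) \<le> e))" if f: "f \<in> ell2 X" for f
  proof (rule ell2_complete)
    show "A n f \<in> ell2 X" for n by (rule op_maps[OF A f])
    fix e :: real assume "0 < e"
    have pos: "0 < 1 + ell2_norm X f" by (simp add: add_pos_nonneg)
    then have "0 < e / (1 + ell2_norm X f)" using \<open>0 < e\<close> by simp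
    from cauchy[OF this] obtain N where
      N: "\<And>m n. m \<ge> N \<Longrightarrow> n \<ge> N \<Longrightarrow> bnd X (\<lambda>f x. A m f x - A n f x) (e / (1 + ell2_norm X f))" by blast
    have "ell2_norm X (\<lambda>x. A m f x - A n f x) \<le> e" if "m \<ge> N" "n \<ge> N" for m n
    proof -
      have "ell2_norm X (\<lambda>x. A m f x - A n f x) \<le> e / (1 + ell2_norm X f) * ell2_norm X f"
        using bndD[OF N[OF that] f] .
      also have "\<dots> \<le> e" using pos \<open>0 < e\<close> by (simp add: divide_simps)
      finally show ?thesis .
    qed
    then show "\<exists>N. \<forall>m\<ge>N. \<forall>n\<ge>N. ell2_norm X (\<lambda>x. A m f x - A n f x) \<le> e" by blast
  qed
  define G where "G f = (SOME g. g \<in> ell2 X \<and> (\<forall>x. (\<lambda>n. A n f x) \<longlonglongrightarrow> g x) \<and>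
    (\<forall>e\<ge>0. \<forall>N. (\<forall>m\<ge>N. \<forall>n\<ge>N. ell2_norm X (\<lambda>x. A m f x - A n f x) \<le> e) \<longrightarrow>
       (\<forall>n\<ge>N. ell2_norm X (\<lambda>x. A n f x - g x) \<le> e)))" for f
  have G: "G f \<in> ell2 X \<and> (\<forall>x. (\<lambda>n. A n f x) \<longlonglongrightarrow> G f x) \<and>
    (\<forall>e\<ge>0. \<forall>N. (\<forall>m\<ge>N. \<forall>n\<ge>N. ell2_norm X (\<lambda>x. A m f x - A n f x) \<le> e) \<longrightarrow>
       (\<forall>n\<ge>N. ell2_norm X (\<lambda>x. A n f x - G f x) \<le> e))" if "f \<in> ell2 X" for f
    unfolding G_def by (rule someI_ex[OF ex[OF that, unfolded Bex_def]])
  define B where "B f = (if f \<in> ell2 X then G f else (\<lambda>x. 0))" for f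
  have lim: "(\<lambda>n. A n f x) \<longlonglongrightarrow> B f x" if "f \<in> ell2 X" for f x using G[OF that] that by (simp add: B_def)
  have Bell: "B f \<in> ell2 X" if "f \<in> ell2 X" for f using G[OF that] that by (simp add: B_def)
  have Bb: "bnd X (\<lambda>f x. A n f x - B f x) e"
    if e: "0 \<le> e" "\<forall>m\<ge>N. \<forall>n\<ge>N. bnd X (\<lambda>f x. A m f x - A n f x) e" "n \<ge> N" for e N n
    unfolding bnd_def
  proof
    fix f assume f: "f \<in> ell2 X"
    have "\<forall>m\<ge>N. \<forall>n\<ge>N. ell2_norm X (\<lambda>x. A m f x - A n f x) \<le> e * ell2_norm X f"
      using e(2) f by (auto simp: bnd_def)
    then show "ell2_norm X (\<lambda>x. A n f x - B f x) \<le> e * ell2_norm X f"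
      using G[OF f] f e(1,3) by (simp add: B_def)
  qed
  obtain N where N: "\<forall>m\<ge>N. \<forall>n\<ge>N. bnd X (\<lambda>f x. A m f x - A n f x) 1" using cauchy[of 1] by auto
  obtain C where C: "bnd X (A N) C" using bounded_ops_bnd[OF A] by blast
  have "B \<in> bounded_ops X"
  proof (rule bounded_opsI[of X B "1 + C"])
    fix f g assume fg: "f \<in> ell2 X" "g \<in> ell2 X"
    show "B (\<lambda>x. f x + g x) = (\<lambda>x. B f x + B g x)"
    proof
      fix x
      have "(\<lambda>n. A n f x + A n g x) \<longlonglongrightarrow> B (\<lambda>x. f x + g x) x"
        using lim[OF ell2_add[OF fg], of x] by (simp add: op_add[OF A fg])
      moreover have "(\<lambda>n. A n f x + A n g x) \<longlonglongrightarrow> B f x + B g x" by (intro tendsto_intros lim fg)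
      ultimately show "B (\<lambda>x. f x + g x) x = B f x + B g x" by (rule LIMSEQ_unique)
    qed
  next
    fix c f assume f: "f \<in> ell2 X"
    show "B (\<lambda>x. c * f x) = (\<lambda>x. c * B f x)"
    proof
      fix x
      have "(\<lambda>n. c * A n f x) \<longlonglongrightarrow> B (\<lambda>x. c * f x) x"
        using lim[OF ell2_scale[OF f], of c x] by (simp add: op_scale[OF A f])
      moreover have "(\<lambda>n. c * A n f x) \<longlonglongrightarrow> c * B f x" by (intro tendsto_intros lim f)
      ultimately show "B (\<lambda>x. c * f x) x = c * B f x" by (rule LIMSEQ_unique)
    qed
  next
    show "bnd X B (1 + C)"
      unfolding bnd_def
    proof
      fix f assume f: "f \<in> ell2 X"
      have "ell2_norm X (B f) \<le> ell2_norm X (A N f) + ell2_norm X (\<lambda>x. B f x - A N f x)"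
        by (rule ell2_norm_le_diff[OF Bell[OF f] op_maps[OF A f]])
      also have "\<dots> \<le> C * ell2_norm X f + 1 * ell2_norm X f"
        using bndD[OF C f] bndD[OF Bb[OF _ N order_refl] f] by (simp add: ell2_norm_commute[of X "B f"])
      finally show "ell2_norm X (B f) \<le> (1 + C) * ell2_norm X f" by (simp add: algebra_simps)
    qed
  qed (auto simp: Bell, simp add: B_def)
  with Bb show ?thesis by blast
qed

section \<open>The algebra of all bounded operators as a record\<close>

lemma operator_algebra_simps [simp]:
  "carrier (operator_algebra X) = bounded_ops X"
  "mult (operator_algebra X) = (\<circ>)"
  "one (operator_algebra X) = op_id X"
  "zero (operator_algebra X) = (\<lambda>f x. 0)"
  "add (operator_algebra X) = (\<lambda>A B f x. A f x + B f x)"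
  "smult (operator_algebra X) = (\<lambda>c A f x. c * A f x)"
  "star (operator_algebra X) = op_adjoint X"
  "anorm (operator_algebra X) = op_norm X"
  by (simp_all add: operator_algebra_def op_id_def)

text \<open>Subtraction in the record unfolds to a definite description of an additive inverse; it
  has to be identified with the pointwise difference before norm closedness becomes a
  \<open>bnd\<close> estimate.\<close>

lemma operator_algebra_minus:
  assumes "A \<in> bounded_ops X" "B \<in> bounded_ops X"
  shows "A \<ominus>\<^bsub>operator_algebra X\<^esub> B = (\<lambda>f x. A f x - B f x)"
proof -
  have "(\<ominus>\<^bsub>operator_algebra X\<^esub> B) = (\<lambda>f x. - B f x)"
    unfolding a_inv_def m_inv_def
  proof (rule the_equality)
    show "(\<lambda>f x. - B f x) \<in> carrier (add_monoid (operator_algebra X)) \<and>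
      B \<otimes>\<^bsub>add_monoid (operator_algebra X)\<^esub> (\<lambda>f x. - B f x) = \<one>\<^bsub>add_monoid (operator_algebra X)\<^esub> \<and>
      (\<lambda>f x. - B f x) \<otimes>\<^bsub>add_monoid (operator_algebra X)\<^esub> B = \<one>\<^bsub>add_monoid (operator_algebra X)\<^esub>"
      using scale_bounded_op[OF assms(2), of "-1"] by simp
    fix Y assume "Y \<in> carrier (add_monoid (operator_algebra X)) \<and>
      B \<otimes>\<^bsub>add_monoid (operator_algebra X)\<^esub> Y = \<one>\<^bsub>add_monoid (operator_algebra X)\<^esub> \<and>
      Y \<otimes>\<^bsub>add_monoid (operator_algebra X)\<^esub> B = \<one>\<^bsub>add_monoid (operator_algebra X)\<^esub>"
    then have "(\<lambda>f x. Y f x + B f x) = (\<lambda>f x. 0)" by simp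
    then show "Y = (\<lambda>f x. - B f x)" by (simp add: fun_eq_iff eq_neg_iff_add_eq_0)
  qed
  then show ?thesis by (simp add: a_minus_def)
qed

lemma norm_closed_operator_algebra:
  assumes "\<A> \<subseteq> bounded_ops X"
  shows "norm_closed (operator_algebra X) \<A> \<longleftrightarrow>
    (\<forall>A\<in>bounded_ops X. (\<forall>e>0. \<exists>B\<in>\<A>. bnd X (\<lambda>f x. A f x - B f x) e) \<longrightarrow> A \<in> \<A>)"
proof -
  have "(\<forall>e>0. \<exists>B\<in>\<A>. op_norm X (A \<ominus>\<^bsub>operator_algebra X\<^esub> B) < e) \<longleftrightarrow>
        (\<forall>e>0. \<exists>B\<in>\<A>. bnd X (\<lambda>f x. A f x - B f x) e)" if A: "A \<in> bounded_ops X" for A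
  proof safe
    fix e :: real assume *: "\<forall>e>0. \<exists>B\<in>\<A>. op_norm X (A \<ominus>\<^bsub>operator_algebra X\<^esub> B) < e" "0 < e"
    then obtain B where B: "B \<in> \<A>" "op_norm X (A \<ominus>\<^bsub>operator_algebra X\<^esub> B) < e" by blast
    with assms A have "op_norm X (\<lambda>f x. A f x - B f x) < e" "B \<in> bounded_ops X"
      by (auto simp: operator_algebra_minus)
    with bnd_op_norm[OF diff_bounded_op[OF A this(2)]] B(1)
    show "\<exists>B\<in>\<A>. bnd X (\<lambda>f x. A f x - B f x) e" using bnd_mono less_imp_le by blast
  next
    fix e :: real assume *: "\<forall>e>0. \<exists>B\<in>\<A>. bnd X (\<lambda>f x. A f x - B f x) e" "0 < e"
    then obtain B where B: "B \<in> \<A>" "bnd X (\<lambda>f x. A f x - B f x) (e/2)" by (metis half_gt_zero)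
    then have "op_norm X (\<lambda>f x. A f x - B f x) \<le> e/2"
      using assms A \<open>0 < e\<close> by (intro op_norm_le diff_bounded_op) auto
    then show "\<exists>B\<in>\<A>. op_norm X (A \<ominus>\<^bsub>operator_algebra X\<^esub> B) < e"
      using B(1) assms A \<open>0 < e\<close> by (intro bexI[of _ B]) (auto simp: operator_algebra_minus subset_iff)
  qed
  then show ?thesis by (simp add: norm_closed_def)
qed

section \<open>Operators of the group algebra\<close>

text \<open>Elements of the complex group algebra as unreduced formal sums. Repeated group elements
  and zero coefficients are harmless, since only the operator attached to a list matters, and lists
  give plain induction.\<close>

definition group_lists :: "('g, 'm) monoid_scheme \<Rightarrow> (complex \<times> 'g) list set" where
  "group_lists G = {l. snd ` set l \<subseteq> carrier G}"

fun group_alg_op :: "('g, 'x) rep \<Rightarrow> (complex \<times> 'g) list \<Rightarrow> 'x operator" where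
  "group_alg_op \<pi> [] = (\<lambda>f x. 0)"
| "group_alg_op \<pi> ((c, g) # l) = (\<lambda>f x. c * act \<pi> g f x + group_alg_op \<pi> l f x)"

definition scale_list :: "complex \<Rightarrow> (complex \<times> 'g) list \<Rightarrow> (complex \<times> 'g) list" where
  "scale_list k l = map (\<lambda>(c, g). (k * c, g)) l"

definition mult_list :: "('g, 'm) monoid_scheme \<Rightarrow>
    (complex \<times> 'g) list \<Rightarrow> (complex \<times> 'g) list \<Rightarrow> (complex \<times> 'g) list" where
  "mult_list G l m = concat (map (\<lambda>(c, g). map (\<lambda>(d, h). (c * d, g \<otimes>\<^bsub>G\<^esub> h)) m) l)"

definition star_list :: "('g, 'm) monoid_scheme \<Rightarrow> (complex \<times> 'g) list \<Rightarrow> (complex \<times> 'g) list" where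
  "star_list G l = map (\<lambda>(c, g). (cnj c, inv\<^bsub>G\<^esub> g)) l"

lemma group_lists_simps [simp]:
  "[] \<in> group_lists G" "(c, g) # l \<in> group_lists G \<longleftrightarrow> g \<in> carrier G \<and> l \<in> group_lists G"
  "l @ m \<in> group_lists G \<longleftrightarrow> l \<in> group_lists G \<and> m \<in> group_lists G"
  by (auto simp: group_lists_def)

lemma scale_group_lists: "l \<in> group_lists G \<Longrightarrow> scale_list k l \<in> group_lists G"
  by (force simp: group_lists_def scale_list_def)

lemma mult_group_lists:
  "group G \<Longrightarrow> l \<in> group_lists G \<Longrightarrow> m \<in> group_lists G \<Longrightarrow> mult_list G l m \<in> group_lists G"
  by (fastforce simp: group_lists_def mult_list_def group.is_monoid intro!: monoid.m_closed)

lemma star_group_lists: "group G \<Longrightarrow> l \<in> group_lists G \<Longrightarrow> star_list G l \<in> group_lists G"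
  by (force simp: group_lists_def star_list_def group.inv_closed)

lemma group_alg_op_append: "group_alg_op \<pi> (l @ m) = (\<lambda>f x. group_alg_op \<pi> l f x + group_alg_op \<pi> m f x)"
  by (induction l) (auto simp: add.assoc)

lemma group_alg_op_scale: "group_alg_op \<pi> (scale_list k l) = (\<lambda>f x. k * group_alg_op \<pi> l f x)"
  by (induction l) (auto simp: scale_list_def algebra_simps)

lemma group_lists_induct [consumes 1, case_names Nil Cons]:
  assumes "l \<in> group_lists G" "P []"
    and "\<And>c g l. g \<in> carrier G \<Longrightarrow> l \<in> group_lists G \<Longrightarrow> P l \<Longrightarrow> P ((c, g) # l)"
  shows "P l"
  using assms(1)
proof (induction l)
  case (Cons a l)
  then show ?case using assms(3) by (cases a) auto
qed (rule assms(2))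

context
  fixes G :: "('g, 'm) monoid_scheme" and \<pi> :: "('g, 'x) rep"
  assumes G: "group G" and \<pi>: "unitary_rep G \<pi>"
begin

lemma act_bounded_op: "g \<in> carrier G \<Longrightarrow> act \<pi> g \<in> bounded_ops (basis \<pi>)"
  using \<pi> by (simp add: unitary_rep_def unitary_op_def)

lemma act_inner:
  "g \<in> carrier G \<Longrightarrow> f \<in> ell2 (basis \<pi>) \<Longrightarrow> h \<in> ell2 (basis \<pi>) \<Longrightarrow>
   ell2_inner (basis \<pi>) (act \<pi> g f) (act \<pi> g h) = ell2_inner (basis \<pi>) f h"
  using \<pi> by (simp add: unitary_rep_def unitary_op_def)

lemma act_mult:
  "g \<in> carrier G \<Longrightarrow> h \<in> carrier G \<Longrightarrow> act \<pi> (g \<otimes>\<^bsub>G\<^esub> h) = act \<pi> g \<circ> act \<pi> h"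
  using \<pi> by (simp add: unitary_rep_def)

lemma act_norm:
  assumes "g \<in> carrier G" "f \<in> ell2 (basis \<pi>)"
  shows "ell2_norm (basis \<pi>) (act \<pi> g f) = ell2_norm (basis \<pi>) f"
proof -
  have "complex_of_real ((ell2_norm (basis \<pi>) (act \<pi> g f))\<^sup>2) = of_real ((ell2_norm (basis \<pi>) f)\<^sup>2)"
    using act_inner[OF assms assms(2)] op_maps[OF act_bounded_op[OF assms(1)] assms(2)] assms(2)
    by (simp only: ell2_inner_self)
  then have "(ell2_norm (basis \<pi>) (act \<pi> g f))\<^sup>2 = (ell2_norm (basis \<pi>) f)\<^sup>2"
    by (simp only: of_real_eq_iff)
  then show ?thesis by (simp add: power2_eq_iff_nonneg)
qed

lemma bnd_act: "g \<in> carrier G \<Longrightarrow> bnd (basis \<pi>) (act \<pi> g) 1"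
  by (simp add: bnd_def act_norm)

lemma act_one: "act \<pi> \<one>\<^bsub>G\<^esub> = op_id (basis \<pi>)"
proof (rule op_ext[OF _ id_bounded_op])
  have one: "\<one>\<^bsub>G\<^esub> \<in> carrier G" using G by (simp add: group.is_monoid monoid.one_closed)
  then show "act \<pi> \<one>\<^bsub>G\<^esub> \<in> bounded_ops (basis \<pi>)" by (rule act_bounded_op)
  fix f assume f: "f \<in> ell2 (basis \<pi>)"
  moreover have "act \<pi> \<one>\<^bsub>G\<^esub> ` ell2 (basis \<pi>) = ell2 (basis \<pi>)"
    using \<pi> one by (simp add: unitary_rep_def unitary_op_def)
  ultimately obtain h where "h \<in> ell2 (basis \<pi>)" "f = act \<pi> \<one>\<^bsub>G\<^esub> h" by blast
  moreover have "act \<pi> \<one>\<^bsub>G\<^esub> (act \<pi> \<one>\<^bsub>G\<^esub> h) = act \<pi> \<one>\<^bsub>G\<^esub> h"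
    using act_mult[OF one one] G by (simp add: group.is_monoid monoid.l_one one fun_eq_iff)
  ultimately show "act \<pi> \<one>\<^bsub>G\<^esub> f = op_id (basis \<pi>) f" using f by simp
qed

lemma act_adjoint: assumes g: "g \<in> carrier G"
  shows "op_adjoint (basis \<pi>) (act \<pi> g) = act \<pi> (inv\<^bsub>G\<^esub> g)"
proof (rule adjoint_eqI[OF act_bounded_op[OF g]])
  have ig: "inv\<^bsub>G\<^esub> g \<in> carrier G" using G g by (simp add: group.inv_closed)
  then show "act \<pi> (inv\<^bsub>G\<^esub> g) \<in> bounded_ops (basis \<pi>)" by (rule act_bounded_op)
  fix f h assume f: "f \<in> ell2 (basis \<pi>)" and h: "h \<in> ell2 (basis \<pi>)"
  have "act \<pi> g (act \<pi> (inv\<^bsub>G\<^esub> g) h) = h"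
  proof -
    have "act \<pi> g (act \<pi> (inv\<^bsub>G\<^esub> g) h) = act \<pi> (g \<otimes>\<^bsub>G\<^esub> inv\<^bsub>G\<^esub> g) h"
      by (simp add: act_mult[OF g ig])
    then show ?thesis using h by (simp add: group.r_inv[OF G g] act_one)
  qed
  then show "ell2_inner (basis \<pi>) (act \<pi> g f) h = ell2_inner (basis \<pi>) f (act \<pi> (inv\<^bsub>G\<^esub> g) h)"
    using act_inner[OF g f op_maps[OF act_bounded_op[OF ig] h]] by simp
qed

lemma group_alg_bounded_op: "l \<in> group_lists G \<Longrightarrow> group_alg_op \<pi> l \<in> bounded_ops (basis \<pi>)"
  by (induction rule: group_lists_induct)
     (auto intro!: zero_bounded_op add_bounded_op scale_bounded_op act_bounded_op)

lemma group_alg_op_mult: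
  assumes "l \<in> group_lists G" and m: "m \<in> group_lists G"
  shows "group_alg_op \<pi> (mult_list G l m) = group_alg_op \<pi> l \<circ> group_alg_op \<pi> m"
  using assms(1)
proof (induction rule: group_lists_induct)
  case Nil
  then show ?case by (simp add: mult_list_def fun_eq_iff)
next
  case (Cons c g l)
  have "group_alg_op \<pi> (map (\<lambda>(d, h). (c * d, g \<otimes>\<^bsub>G\<^esub> h)) m) f = (\<lambda>x. c * act \<pi> g (group_alg_op \<pi> m f) x)"
    if f: "f \<in> ell2 (basis \<pi>)" for f
    using m
  proof (induction rule: group_lists_induct)
    case Nil
    then show ?case by (simp add: op_zero[OF act_bounded_op[OF Cons(1)]])
  next
    case (Cons d h m)
    have "act \<pi> g (\<lambda>x. d * act \<pi> h f x + group_alg_op \<pi> m f x) =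
        (\<lambda>x. d * act \<pi> g (act \<pi> h f) x + act \<pi> g (group_alg_op \<pi> m f) x)"
      using Cons \<open>g \<in> carrier G\<close> f
      by (simp add: op_add[OF act_bounded_op] op_scale[OF act_bounded_op] ell2_scale
          op_maps[OF act_bounded_op] op_maps[OF group_alg_bounded_op])
    then show ?case using Cons \<open>g \<in> carrier G\<close>
      by (simp add: act_mult fun_eq_iff algebra_simps)
  qed
  moreover have "mult_list G ((c, g) # l) m = map (\<lambda>(d, h). (c * d, g \<otimes>\<^bsub>G\<^esub> h)) m @ mult_list G l m"
    by (simp add: mult_list_def)
  ultimately have "group_alg_op \<pi> (mult_list G ((c, g) # l) m) f = (group_alg_op \<pi> ((c, g) # l) \<circ> group_alg_op \<pi> m) f"
    if "f \<in> ell2 (basis \<pi>)" for f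
    using that Cons by (simp add: group_alg_op_append fun_eq_iff)
  then show ?case
    using Cons m by (intro op_ext[of _ "basis \<pi>"] comp_bounded_op group_alg_bounded_op mult_group_lists G) auto
qed

lemma group_alg_op_star:
  "l \<in> group_lists G \<Longrightarrow> group_alg_op \<pi> (star_list G l) = op_adjoint (basis \<pi>) (group_alg_op \<pi> l)"
proof (induction rule: group_lists_induct)
  case Nil
  then show ?case using adjoint_scale[OF zero_bounded_op, of "basis \<pi>" 0] by (simp add: star_list_def)
next
  case (Cons c g l)
  then show ?case
    by (simp add: adjoint_add adjoint_scale scale_bounded_op act_bounded_op group_alg_bounded_op
        act_adjoint star_list_def)
qed

end

text \<open>Write A A' - a a' = A (A' - a') + (A - a) a', where \<open>a'\<close> is bounded by d +
  C. The assumption that \<open>d\<close> is at most 1 turns the quadratic term of the error into a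
  linear one.\<close>

lemma bnd_mult_approx:
  assumes ops: "A \<in> bounded_ops X" "A' \<in> bounded_ops X" "a \<in> bounded_ops X" "a' \<in> bounded_ops X"
    and b: "bnd X A C" "bnd X A' C" "0 \<le> C"
    and d: "bnd X (\<lambda>f x. A f x - a f x) d" "bnd X (\<lambda>f x. A' f x - a' f x) d" "0 \<le> d" "d \<le> 1"
  shows "bnd X (\<lambda>f x. (A \<circ> A') f x - (a \<circ> a') f x) (d * (2 * C + 1))"
proof -
  have a': "bnd X a' (d + C)"
    by (rule bnd_from_diff[OF ops(4,2) _ b(2)]) (use d(2) bnd_diff_commute in blast)
  have 1: "bnd X (A \<circ> (\<lambda>f x. A' f x - a' f x)) (C * d)"
    by (intro bnd_comp ops diff_bounded_op b d)
  have 2: "bnd X ((\<lambda>f x. A f x - a f x) \<circ> a') (d * (d + C))"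
    by (intro bnd_comp ops diff_bounded_op a' d)
  have "bnd X (\<lambda>f x. (A \<circ> A') f x - (a \<circ> a') f x) (C * d + d * (d + C))"
    unfolding bnd_def
  proof
    fix f assume f: "f \<in> ell2 X"
    have "(\<lambda>x. (A \<circ> A') f x - (a \<circ> a') f x) =
      (\<lambda>x. (A \<circ> (\<lambda>f x. A' f x - a' f x)) f x + ((\<lambda>f x. A f x - a f x) \<circ> a') f x)"
      using f by (simp add: op_diff[OF ops(1)] op_maps[OF ops(2)] op_maps[OF ops(4)] fun_eq_iff)
    then show "ell2_norm X (\<lambda>x. (A \<circ> A') f x - (a \<circ> a') f x) \<le> (C * d + d * (d + C)) * ell2_norm X f"
      using bndD[OF bnd_add[OF _ _ 1 2] f] ops by (simp add: comp_bounded_op diff_bounded_op)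
  qed
  then show ?thesis
    by (rule bnd_mono) (use d b mult_left_mono[of d 1 d] in \<open>simp add: algebra_simps\<close>)
qed

text \<open>Two operators approximated simultaneously by the same elements of the group algebra; such pairs form the
  graph of the quotient map from \<open>C*(\<pi>)\<close> to \<open>C*(\<rho>)\<close>.\<close>

definition approx_pair :: "('g, 'm) monoid_scheme \<Rightarrow> ('g, 'x) rep \<Rightarrow> ('g, 'y) rep \<Rightarrow>
    'x operator \<Rightarrow> 'y operator \<Rightarrow> bool" where
  "approx_pair G \<pi> \<rho> A B \<longleftrightarrow> A \<in> bounded_ops (basis \<pi>) \<and> B \<in> bounded_ops (basis \<rho>) \<and>
     (\<forall>e>0. \<exists>l\<in>group_lists G. bnd (basis \<pi>) (\<lambda>f x. A f x - group_alg_op \<pi> l f x) e \<and>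
        bnd (basis \<rho>) (\<lambda>f x. B f x - group_alg_op \<rho> l f x) e)"

lemma approx_pairD:
  assumes "approx_pair G \<pi> \<rho> A B" "0 < e"
  obtains l where "l \<in> group_lists G" "bnd (basis \<pi>) (\<lambda>f x. A f x - group_alg_op \<pi> l f x) e"
    "bnd (basis \<rho>) (\<lambda>f x. B f x - group_alg_op \<rho> l f x) e"
  using assms unfolding approx_pair_def by blast

lemma approx_pair_ops:
  "approx_pair G \<pi> \<rho> A B \<Longrightarrow> A \<in> bounded_ops (basis \<pi>)" "approx_pair G \<pi> \<rho> A B \<Longrightarrow> B \<in> bounded_ops (basis \<rho>)"
  by (auto simp: approx_pair_def)

lemma approx_pair_refl: "approx_pair G \<pi> \<rho> A B \<Longrightarrow> approx_pair G \<pi> \<pi> A A" 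
  "approx_pair G \<pi> \<rho> A B \<Longrightarrow> approx_pair G \<rho> \<rho> B B"
  by (auto simp: approx_pair_def)

lemma tendsto_0_eventually:
  fixes c :: "nat \<Rightarrow> real" assumes "c \<longlonglongrightarrow> 0" "0 < e" shows "\<exists>n. c n \<le> e"
  using order_tendstoD(2)[OF assms] by (auto simp: eventually_sequentially intro: less_imp_le)

section \<open>Closure properties of the graph of the quotient map\<close>

context
  fixes G :: "('g, 'm) monoid_scheme" and \<pi> :: "('g, 'x) rep" and \<rho> :: "('g, 'y) rep"
  assumes G: "group G" and \<pi>: "unitary_rep G \<pi>" and \<rho>: "unitary_rep G \<rho>"
begin

interpretation group G by (rule G)

lemma approx_pair_group_alg: "l \<in> group_lists G \<Longrightarrow> approx_pair G \<pi> \<rho> (group_alg_op \<pi> l) (group_alg_op \<rho> l)"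
  unfolding approx_pair_def
  by (auto intro!: group_alg_bounded_op[OF G \<pi>] group_alg_bounded_op[OF G \<rho>] bexI[of _ l] bnd_zero)

lemma approx_pair_limit:
  assumes A: "A \<in> bounded_ops (basis \<pi>)" and B: "B \<in> bounded_ops (basis \<rho>)"
    and lim: "\<And>e. 0 < e \<Longrightarrow> \<exists>A' B'. approx_pair G \<pi> \<rho> A' B' \<and> bnd (basis \<pi>) (\<lambda>f x. A f x - A' f x) e \<and>
        bnd (basis \<rho>) (\<lambda>f x. B f x - B' f x) e"
  shows "approx_pair G \<pi> \<rho> A B"
  unfolding approx_pair_def
proof (intro conjI allI impI A B)
  fix e :: real assume "0 < e"
  then have e2: "0 < e / 2" by simp
  from lim[OF e2] obtain A' B' where AB: "approx_pair G \<pi> \<rho> A' B'" "bnd (basis \<pi>) (\<lambda>f x. A f x - A' f x) (e/2)"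
     "bnd (basis \<rho>) (\<lambda>f x. B f x - B' f x) (e/2)" by blast
  from approx_pairD[OF AB(1) e2] obtain l where l: "l \<in> group_lists G"
    "bnd (basis \<pi>) (\<lambda>f x. A' f x - group_alg_op \<pi> l f x) (e/2)"
    "bnd (basis \<rho>) (\<lambda>f x. B' f x - group_alg_op \<rho> l f x) (e/2)" by blast
  have "bnd (basis \<pi>) (\<lambda>f x. A f x - group_alg_op \<pi> l f x) (e/2 + e/2)"
    by (rule bnd_diff_trans[OF A approx_pair_ops(1)[OF AB(1)] group_alg_bounded_op[OF G \<pi> l(1)] AB(2) l(2)])
  moreover have "bnd (basis \<rho>) (\<lambda>f x. B f x - group_alg_op \<rho> l f x) (e/2 + e/2)"
    by (rule bnd_diff_trans[OF B approx_pair_ops(2)[OF AB(1)] group_alg_bounded_op[OF G \<rho> l(1)] AB(3) l(3)])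
  ultimately show "\<exists>l\<in>group_lists G. bnd (basis \<pi>) (\<lambda>f x. A f x - group_alg_op \<pi> l f x) e \<and>
        bnd (basis \<rho>) (\<lambda>f x. B f x - group_alg_op \<rho> l f x) e" using l(1) by auto
qed

lemma approx_pair_add:
  assumes "approx_pair G \<pi> \<rho> A B" "approx_pair G \<pi> \<rho> A' B'"
  shows "approx_pair G \<pi> \<rho> (\<lambda>f x. A f x + A' f x) (\<lambda>f x. B f x + B' f x)"
  unfolding approx_pair_def
proof (intro conjI allI impI add_bounded_op approx_pair_ops[OF assms(1)] approx_pair_ops[OF assms(2)])
  fix e :: real assume "0 < e"
  then have e2: "0 < e / 2" by simp
  obtain l where l: "l \<in> group_lists G" "bnd (basis \<pi>) (\<lambda>f x. A f x - group_alg_op \<pi> l f x) (e/2)"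
    "bnd (basis \<rho>) (\<lambda>f x. B f x - group_alg_op \<rho> l f x) (e/2)" using approx_pairD[OF assms(1) e2] .
  obtain m where m: "m \<in> group_lists G" "bnd (basis \<pi>) (\<lambda>f x. A' f x - group_alg_op \<pi> m f x) (e/2)"
    "bnd (basis \<rho>) (\<lambda>f x. B' f x - group_alg_op \<rho> m f x) (e/2)" using approx_pairD[OF assms(2) e2] .
  have "bnd (basis \<pi>) (\<lambda>f x. (A f x - group_alg_op \<pi> l f x) + (A' f x - group_alg_op \<pi> m f x)) (e/2 + e/2)"
    by (intro bnd_add diff_bounded_op approx_pair_ops(1)[OF assms(1)] approx_pair_ops(1)[OF assms(2)]
        group_alg_bounded_op[OF G \<pi>] l m)
  moreover have "bnd (basis \<rho>) (\<lambda>f x. (B f x - group_alg_op \<rho> l f x) + (B' f x - group_alg_op \<rho> m f x)) (e/2 + e/2)"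
    by (intro bnd_add diff_bounded_op approx_pair_ops(2)[OF assms(1)] approx_pair_ops(2)[OF assms(2)]
        group_alg_bounded_op[OF G \<rho>] l m)
  ultimately show "\<exists>l\<in>group_lists G. bnd (basis \<pi>) (\<lambda>f x. A f x + A' f x - group_alg_op \<pi> l f x) e \<and>
        bnd (basis \<rho>) (\<lambda>f x. B f x + B' f x - group_alg_op \<rho> l f x) e"
    using l(1) m(1) by (intro bexI[of _ "l @ m"]) (simp_all add: group_alg_op_append algebra_simps)
qed

lemma approx_pair_scale:
  assumes "approx_pair G \<pi> \<rho> A B"
  shows "approx_pair G \<pi> \<rho> (\<lambda>f x. c * A f x) (\<lambda>f x. c * B f x)"
  unfolding approx_pair_def
proof (intro conjI allI impI scale_bounded_op approx_pair_ops[OF assms])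
  fix e :: real assume "0 < e"
  define d where "d = e / (cmod c + 1)"
  have p: "0 < cmod c + 1" by (simp add: add_nonneg_pos)
  then have d: "0 < d" "cmod c * d \<le> e" using \<open>0 < e\<close> by (auto simp: d_def divide_simps)
  obtain l where l: "l \<in> group_lists G" "bnd (basis \<pi>) (\<lambda>f x. A f x - group_alg_op \<pi> l f x) d"
    "bnd (basis \<rho>) (\<lambda>f x. B f x - group_alg_op \<rho> l f x) d" using approx_pairD[OF assms d(1)] .
  then show "\<exists>l\<in>group_lists G. bnd (basis \<pi>) (\<lambda>f x. c * A f x - group_alg_op \<pi> l f x) e \<and>
        bnd (basis \<rho>) (\<lambda>f x. c * B f x - group_alg_op \<rho> l f x) e"
    using bnd_mono[OF bnd_scale[OF l(2)] d(2)] bnd_mono[OF bnd_scale[OF l(3)] d(2)]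
    by (intro bexI[of _ "scale_list c l"])
       (simp_all add: group_alg_op_scale scale_group_lists right_diff_distrib)
qed

lemma approx_pair_diff:
  assumes "approx_pair G \<pi> \<rho> A B" "approx_pair G \<pi> \<rho> A' B'"
  shows "approx_pair G \<pi> \<rho> (\<lambda>f x. A f x - A' f x) (\<lambda>f x. B f x - B' f x)"
  using approx_pair_add[OF assms(1) approx_pair_scale[OF assms(2), of "-1"]] by simp

lemma approx_pair_comp:
  assumes "approx_pair G \<pi> \<rho> A B" "approx_pair G \<pi> \<rho> A' B'"
  shows "approx_pair G \<pi> \<rho> (A \<circ> A') (B \<circ> B')"
  unfolding approx_pair_def
proof (intro conjI allI impI comp_bounded_op approx_pair_ops[OF assms(1)] approx_pair_ops[OF assms(2)])
  fix e :: real assume "0 < e"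
  note opA = approx_pair_ops(1)[OF assms(1)] approx_pair_ops(1)[OF assms(2)]
  note opB = approx_pair_ops(2)[OF assms(1)] approx_pair_ops(2)[OF assms(2)]
  obtain C1 where C1: "0 \<le> C1" "bnd (basis \<pi>) A C1" using bounded_ops_bnd[OF opA(1)] .
  obtain C2 where C2: "0 \<le> C2" "bnd (basis \<pi>) A' C2" using bounded_ops_bnd[OF opA(2)] .
  obtain C3 where C3: "0 \<le> C3" "bnd (basis \<rho>) B C3" using bounded_ops_bnd[OF opB(1)] .
  obtain C4 where C4: "0 \<le> C4" "bnd (basis \<rho>) B' C4" using bounded_ops_bnd[OF opB(2)] .
  note C' = C1 C2 C3 C4
  define C where "C = C1 + C2 + C3 + C4"
  have C: "0 \<le> C" "bnd (basis \<pi>) A C" "bnd (basis \<pi>) A' C"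
      "bnd (basis \<rho>) B C" "bnd (basis \<rho>) B' C"
    using C' by (auto simp: C_def intro: bnd_mono)
  define d where "d = min 1 (e / (2 * C + 1))"
  have d: "0 < d" "0 \<le> d" "d \<le> 1" "d * (2 * C + 1) \<le> e"
    using \<open>0 < e\<close> C by (auto simp: d_def min_def divide_simps)
  obtain l where l: "l \<in> group_lists G" "bnd (basis \<pi>) (\<lambda>f x. A f x - group_alg_op \<pi> l f x) d"
    "bnd (basis \<rho>) (\<lambda>f x. B f x - group_alg_op \<rho> l f x) d" using approx_pairD[OF assms(1) d(1)] .
  obtain m where m: "m \<in> group_lists G" "bnd (basis \<pi>) (\<lambda>f x. A' f x - group_alg_op \<pi> m f x) d"
    "bnd (basis \<rho>) (\<lambda>f x. B' f x - group_alg_op \<rho> m f x) d" using approx_pairD[OF assms(2) d(1)] .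
  have 1: "bnd (basis \<pi>) (\<lambda>f x. (A \<circ> A') f x - group_alg_op \<pi> (mult_list G l m) f x) (d * (2 * C + 1))"
    unfolding group_alg_op_mult[OF G \<pi> l(1) m(1)]
    by (intro bnd_mult_approx opA C l m d group_alg_bounded_op[OF G \<pi>])
  have 2: "bnd (basis \<rho>) (\<lambda>f x. (B \<circ> B') f x - group_alg_op \<rho> (mult_list G l m) f x) (d * (2 * C + 1))"
    unfolding group_alg_op_mult[OF G \<rho> l(1) m(1)]
    by (intro bnd_mult_approx opB C l m d group_alg_bounded_op[OF G \<rho>])
  show "\<exists>l\<in>group_lists G. bnd (basis \<pi>) (\<lambda>f x. (A \<circ> A') f x - group_alg_op \<pi> l f x) e \<and>
        bnd (basis \<rho>) (\<lambda>f x. (B \<circ> B') f x - group_alg_op \<rho> l f x) e"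
    by (intro bexI[of _ "mult_list G l m"] conjI bnd_mono[OF 1 d(4)] bnd_mono[OF 2 d(4)]
        mult_group_lists[OF G l(1) m(1)])
qed

lemma approx_pair_adjoint:
  assumes "approx_pair G \<pi> \<rho> A B"
  shows "approx_pair G \<pi> \<rho> (op_adjoint (basis \<pi>) A) (op_adjoint (basis \<rho>) B)"
  unfolding approx_pair_def
proof (intro conjI allI impI adjoint_bounded_op approx_pair_ops[OF assms])
  fix e :: real assume "0 < e"
  obtain l where l: "l \<in> group_lists G" "bnd (basis \<pi>) (\<lambda>f x. A f x - group_alg_op \<pi> l f x) e"
    "bnd (basis \<rho>) (\<lambda>f x. B f x - group_alg_op \<rho> l f x) e" using approx_pairD[OF assms \<open>0 < e\<close>] .
  have "bnd (basis \<pi>) (\<lambda>f x. op_adjoint (basis \<pi>) A f x - group_alg_op \<pi> (star_list G l) f x) e"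
    using bnd_adjoint[OF _ _ l(2)] \<open>0 < e\<close> approx_pair_ops(1)[OF assms] group_alg_bounded_op[OF G \<pi> l(1)]
    by (simp add: group_alg_op_star[OF G \<pi> l(1)] adjoint_diff diff_bounded_op)
  moreover have "bnd (basis \<rho>) (\<lambda>f x. op_adjoint (basis \<rho>) B f x - group_alg_op \<rho> (star_list G l) f x) e"
    using bnd_adjoint[OF _ _ l(3)] \<open>0 < e\<close> approx_pair_ops(2)[OF assms] group_alg_bounded_op[OF G \<rho> l(1)]
    by (simp add: group_alg_op_star[OF G \<rho> l(1)] adjoint_diff diff_bounded_op)
  ultimately show "\<exists>l\<in>group_lists G. bnd (basis \<pi>) (\<lambda>f x. op_adjoint (basis \<pi>) A f x - group_alg_op \<pi> l f x) e \<and>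
        bnd (basis \<rho>) (\<lambda>f x. op_adjoint (basis \<rho>) B f x - group_alg_op \<rho> l f x) e"
    using star_group_lists[OF G l(1)] by blast
qed

lemma approx_pair_act: assumes "g \<in> carrier G" shows "approx_pair G \<pi> \<rho> (act \<pi> g) (act \<rho> g)"
  using approx_pair_group_alg[of "[(1, g)]"] assms by simp

lemma approx_pair_id: "approx_pair G \<pi> \<rho> (op_id (basis \<pi>)) (op_id (basis \<rho>))"
  using approx_pair_act[OF one_closed] by (simp add: act_one[OF G \<pi>] act_one[OF G \<rho>])

lemma approx_pair_zero: "approx_pair G \<pi> \<rho> (\<lambda>f x. 0) (\<lambda>f x. 0)"
  using approx_pair_group_alg[of "[]"] by simp

end

text \<open>Telescoping a geometric series of steps. The explicit rate lets several limits be
  truncated at the same index, as \<open>neumann_pair\<close> requires.\<close>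

lemma op_geometric_limit:
  fixes A :: "nat \<Rightarrow> 'x operator"
  assumes A: "\<And>n. A n \<in> bounded_ops X" and r: "0 \<le> r" "r < 1" and "0 \<le> C"
    and step: "\<And>n. bnd X (\<lambda>f x. A (Suc n) f x - A n f x) (C * r ^ n)"
  obtains B where "B \<in> bounded_ops X" "\<And>n. bnd X (\<lambda>f x. A n f x - B f x) (2 * C * r ^ n / (1 - r))"
proof -
  have fwd: "bnd X (\<lambda>f x. A (n + k) f x - A n f x) (C * r ^ n * (1 - r ^ k) / (1 - r))" for n k
  proof (induction k)
    case 0
    then show ?case by (simp add: bnd_zero)
  next
    case (Suc k)
    have "bnd X (\<lambda>f x. A (Suc (n + k)) f x - A n f x) (C * r ^ (n + k) + C * r ^ n * (1 - r ^ k) / (1 - r))"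
      by (rule bnd_diff_trans[OF A A A step Suc])
    also have "C * r ^ (n + k) + C * r ^ n * (1 - r ^ k) / (1 - r) = C * r ^ n * (1 - r ^ Suc k) / (1 - r)"
      using r by (simp add: power_add field_simps)
    finally show ?case by simp
  qed
  have fwd': "bnd X (\<lambda>f x. A m f x - A n f x) (C * r ^ n / (1 - r))" if "n \<le> m" for m n
  proof -
    have "bnd X (\<lambda>f x. A m f x - A n f x) (C * r ^ n * (1 - r ^ (m - n)) / (1 - r))"
      using fwd[of n "m - n"] that by simp
    moreover have "C * r ^ n * (1 - r ^ (m - n)) / (1 - r) \<le> C * r ^ n / (1 - r)"
      using r \<open>0 \<le> C\<close> by (intro divide_right_mono mult_right_le_one_le) (auto simp: power_le_one)
    ultimately show ?thesis by (rule bnd_mono)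
  qed
  \<comment> \<open>Both indices are compared with \<open>N\<close>, which costs the factor 2 in the
    rate.\<close>
  have all: "\<forall>m\<ge>N. \<forall>n\<ge>N. bnd X (\<lambda>f x. A m f x - A n f x) (2 * C * r ^ N / (1 - r))" for N
  proof (intro allI impI)
    fix m n assume "N \<le> m" "N \<le> n"
    have "bnd X (\<lambda>f x. A m f x - A n f x) (C * r ^ N / (1 - r) + C * r ^ N / (1 - r))"
      using fwd'[OF \<open>N \<le> m\<close>] fwd'[OF \<open>N \<le> n\<close>] bnd_diff_commute
      by (intro bnd_diff_trans[OF A A[of N] A]) blast+
    then show "bnd X (\<lambda>f x. A m f x - A n f x) (2 * C * r ^ N / (1 - r))"
      by (simp add: field_simps)
  qed
  have nn: "0 \<le> 2 * C * r ^ N / (1 - r)" for N using r \<open>0 \<le> C\<close> by simp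
  have lim: "(\<lambda>n. 2 * C * r ^ n / (1 - r)) \<longlonglongrightarrow> 2 * C * 0 / (1 - r)"
    using r by (intro tendsto_intros LIMSEQ_power_zero) auto
  have "\<exists>N. \<forall>m\<ge>N. \<forall>n\<ge>N. bnd X (\<lambda>f x. A m f x - A n f x) e" if "0 < e" for e
  proof -
    obtain N where "2 * C * r ^ N / (1 - r) \<le> e"
      using tendsto_0_eventually[of "\<lambda>n. 2 * C * r ^ n / (1 - r)" e] lim \<open>0 < e\<close> by auto
    then show ?thesis using all[of N] bnd_mono by blast
  qed
  from op_complete[OF A this] obtain B where "B \<in> bounded_ops X"
    "\<forall>e\<ge>0. \<forall>N. (\<forall>m\<ge>N. \<forall>n\<ge>N. bnd X (\<lambda>f x. A m f x - A n f x) e) \<longrightarrow>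
           (\<forall>n\<ge>N. bnd X (\<lambda>f x. A n f x - B f x) e)" by blast
  with that show ?thesis using nn all by blast
qed

lemma op_limit_apply:
  assumes "\<And>n. bnd X (\<lambda>f x. A n f x - B f x) (c n)" "c \<longlonglongrightarrow> 0" and f: "f \<in> ell2 X"
    and A: "\<And>n. A n \<in> bounded_ops X" and B: "B \<in> bounded_ops X"
  shows "(\<lambda>n. A n f x) \<longlonglongrightarrow> B f x"
proof (rule LIM_zero_cancel, rule Lim_null_comparison)
  show "\<forall>\<^sub>F n in sequentially. norm (A n f x - B f x) \<le> c n * ell2_norm X f"
    using bndD[OF assms(1) f] cmod_le_ell2_norm[OF ell2_diff[OF op_maps[OF A f] op_maps[OF B f]]]
    by (intro always_eventually allI) (rule order_trans)
  show "(\<lambda>n. c n * ell2_norm X f) \<longlonglongrightarrow> 0" using tendsto_mult_left_zero[OF assms(2)] .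
qed

section \<open>Quotients between C*-algebras of representations\<close>

lemma Cstar_rep_simps [simp]:
  "mult (Cstar_rep G \<pi>) = (\<circ>)"
  "one (Cstar_rep G \<pi>) = op_id (basis \<pi>)"
  "zero (Cstar_rep G \<pi>) = (\<lambda>f x. 0)"
  "add (Cstar_rep G \<pi>) = (\<lambda>A B f x. A f x + B f x)"
  "smult (Cstar_rep G \<pi>) = (\<lambda>c A f x. c * A f x)"
  "star (Cstar_rep G \<pi>) = op_adjoint (basis \<pi>)"
  by (simp_all add: Cstar_rep_def generated_cstar_algebra_def)

text \<open>The operators approximable by the group algebra already form a closed star-subalgebra,
  and every competitor in the intersection contains the group algebra operators together with their
  limits. Expressing membership as a diagonal \<open>approx_pair\<close> lets all closure lemmas for
  pairs apply to single elements.\<close>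

lemma carrier_Cstar_rep:
  assumes G: "group G" and \<pi>: "unitary_rep G \<pi>"
  shows "carrier (Cstar_rep G \<pi>) = {A. approx_pair G \<pi> \<pi> A A}"
proof -
  let ?X = "basis \<pi>"
  let ?K = "{A. approx_pair G \<pi> \<pi> A A}"
  let ?F = "{B. star_subalgebra (operator_algebra ?X) B \<and> norm_closed (operator_algebra ?X) B \<and>
      act \<pi> ` carrier G \<subseteq> B}"
  have K: "?K \<subseteq> bounded_ops ?X" by (auto simp: approx_pair_def)
  have "star_subalgebra (operator_algebra ?X) ?K"
    unfolding star_subalgebra_def operator_algebra_simps
    by (intro conjI ballI allI K CollectI)
       (simp_all only: mem_Collect_eq approx_pair_add[OF G \<pi> \<pi>] approx_pair_comp[OF G \<pi> \<pi>]
          approx_pair_scale[OF G \<pi> \<pi>] approx_pair_adjoint[OF G \<pi> \<pi>] approx_pair_zero[OF G \<pi> \<pi>])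
  moreover have "norm_closed (operator_algebra ?X) ?K"
    unfolding norm_closed_operator_algebra[OF K]
  proof (intro ballI impI)
    fix A assume A: "A \<in> bounded_ops ?X" "\<forall>e>0. \<exists>B\<in>?K. bnd ?X (\<lambda>f x. A f x - B f x) e"
    have "approx_pair G \<pi> \<pi> A A"
      by (rule approx_pair_limit[OF G \<pi> \<pi> A(1) A(1)]) (use A(2) in blast)
    then show "A \<in> ?K" by simp
  qed
  moreover have "act \<pi> ` carrier G \<subseteq> ?K" using approx_pair_act[OF G \<pi> \<pi>] by auto
  ultimately have "?K \<in> ?F" by blast
  then have "\<Inter>?F \<subseteq> ?K" by blast
  moreover have "?K \<subseteq> B" if "B \<in> ?F" for B
  proof
    fix A assume A: "A \<in> ?K"
    have B: "star_subalgebra (operator_algebra ?X) B" "norm_closed (operator_algebra ?X) B"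
      "act \<pi> ` carrier G \<subseteq> B" using that by auto
    have ga: "group_alg_op \<pi> l \<in> B" if "l \<in> group_lists G" for l
      using that
    proof (induction rule: group_lists_induct)
      case Nil
      then show ?case using B(1) by (simp add: star_subalgebra_def)
    next
      case (Cons c g l)
      then have "act \<pi> g \<in> B" using B(3) by auto
      then have "(\<lambda>f x. c * act \<pi> g f x) \<in> B" using B(1) by (simp add: star_subalgebra_def)
      then show ?case using B(1) Cons(3) by (simp add: star_subalgebra_def)
    qed
    have "B \<subseteq> bounded_ops ?X" using B(1) by (simp add: star_subalgebra_def)
    note nc = norm_closed_operator_algebra[OF this]
    have "\<exists>A'\<in>B. bnd ?X (\<lambda>f x. A f x - A' f x) e" if e: "0 < e" for e
    proof -
      obtain l where "l \<in> group_lists G" "bnd ?X (\<lambda>f x. A f x - group_alg_op \<pi> l f x) e"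
        using approx_pairD[OF _ e, of G \<pi> \<pi> A A] A by blast
      then show ?thesis using ga by blast
    qed
    then show "A \<in> B" using B(2) A K unfolding nc by blast
  qed
  ultimately have "\<Inter>?F = ?K" by (intro equalityI Inter_greatest)
  then show ?thesis by (simp add: Cstar_rep_def generated_cstar_algebra_def)
qed

text \<open>The partial sums 1 + K + ... + K^n in Horner form, so that membership in the graph of
  the quotient map passes along the recursion.\<close>

primrec neumann_sum :: "'x set \<Rightarrow> 'x operator \<Rightarrow> nat \<Rightarrow> 'x operator" where
  "neumann_sum X K 0 = op_id X"
| "neumann_sum X K (Suc n) = (\<lambda>f x. op_id X f x + (K \<circ> neumann_sum X K n) f x)"

declare neumann_sum.simps [simp del]

lemma neumann_sum_op: "K \<in> bounded_ops X \<Longrightarrow> neumann_sum X K n \<in> bounded_ops X"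
  by (induction n) (simp_all only: neumann_sum.simps id_bounded_op add_bounded_op comp_bounded_op)

lemma neumann_series:
  assumes Kop: "K \<in> bounded_ops X" and bK: "bnd X K r" and r: "0 \<le> r" "r < 1"
  shows "\<exists>R\<in>bounded_ops X. (\<forall>n. bnd X (\<lambda>f x. neumann_sum X K n f x - R f x) (2 * r * r ^ n / (1 - r))) \<and>
    (\<forall>f\<in>ell2 X. R (\<lambda>x. f x - K f x) = f \<and> (\<lambda>x. R f x - K (R f) x) = f)"
proof -
  note op = neumann_sum_op[OF Kop]
  have step: "bnd X (\<lambda>f x. neumann_sum X K (Suc n) f x - neumann_sum X K n f x) (r * r ^ n)" for n
  proof (induction n)
    case 0
    have "bnd X (\<lambda>f x. neumann_sum X K (Suc 0) f x - neumann_sum X K 0 f x) r"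
      unfolding bnd_def using bndD[OF bK] by (simp add: neumann_sum.simps(1) neumann_sum.simps(2))
    then show ?case by simp
  next
    case (Suc n)
    have "bnd X (K \<circ> (\<lambda>f x. neumann_sum X K (Suc n) f x - neumann_sum X K n f x)) (r * (r * r ^ n))"
      by (rule bnd_comp[OF Kop diff_bounded_op[OF op op] bK Suc r(1)])
    moreover have "(K \<circ> (\<lambda>f x. neumann_sum X K (Suc n) f x - neumann_sum X K n f x)) f =
        (\<lambda>x. neumann_sum X K (Suc (Suc n)) f x - neumann_sum X K (Suc n) f x)" if "f \<in> ell2 X" for f
      using that op_diff[OF Kop op_maps[OF op[of "Suc n"]] op_maps[OF op[of n]], of f f]
      by (simp add: neumann_sum.simps(2)[of X K "Suc n"]) (simp add: neumann_sum.simps(2)[of X K n])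
    ultimately show ?case by (simp add: bnd_def)
  qed
  obtain R where R: "R \<in> bounded_ops X" "\<And>n. bnd X (\<lambda>f x. neumann_sum X K n f x - R f x) (2 * r * r ^ n / (1 - r))"
    using op_geometric_limit[of "neumann_sum X K" X r r, OF op r r(1) step] by blast
  have c0: "(\<lambda>n. 2 * r * r ^ n / (1 - r)) \<longlonglongrightarrow> 0"
    using r by (intro tendsto_eq_intros LIMSEQ_power_zero) auto
  note lim = op_limit_apply[OF R(2) c0 _ op R(1)]
  have limK: "(\<lambda>n. K (neumann_sum X K n f) x) \<longlonglongrightarrow> K (R f) x" if f: "f \<in> ell2 X" for f x
  proof (rule LIM_zero_cancel, rule Lim_null_comparison)
    show "\<forall>\<^sub>F n in sequentially. norm (K (neumann_sum X K n f) x - K (R f) x) \<le> r * (2 * r * r ^ n / (1 - r) * ell2_norm X f)"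
    proof (intro always_eventually allI)
      fix n
      have e: "neumann_sum X K n f \<in> ell2 X" "R f \<in> ell2 X" using op_maps[OF op f] op_maps[OF R(1) f] by auto
      have "norm (K (neumann_sum X K n f) x - K (R f) x) \<le> ell2_norm X (K (\<lambda>x. neumann_sum X K n f x - R f x))"
        using cmod_le_ell2_norm[OF op_maps[OF Kop ell2_diff[OF e]], of x] by (simp add: op_diff[OF Kop e])
      also have "\<dots> \<le> r * ell2_norm X (\<lambda>x. neumann_sum X K n f x - R f x)"
        by (rule bndD[OF bK ell2_diff[OF e]])
      also have "\<dots> \<le> r * (2 * r * r ^ n / (1 - r) * ell2_norm X f)"
        by (rule mult_left_mono[OF bndD[OF R(2) f] r(1)])
      finally show "norm (K (neumann_sum X K n f) x - K (R f) x) \<le> r * (2 * r * r ^ n / (1 - r) * ell2_norm X f)" .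
    qed
    show "(\<lambda>n. r * (2 * r * r ^ n / (1 - r) * ell2_norm X f)) \<longlonglongrightarrow> 0"
      by (intro tendsto_mult_right_zero tendsto_mult_left_zero c0)
  qed
  \<comment> \<open>The partial sums commute with \<open>K\<close>; in the limit this makes the
    right inverse of 1 - K a left inverse too.\<close>
  have comm: "neumann_sum X K n (K f) = K (neumann_sum X K n f)" if f: "f \<in> ell2 X" for f n
  proof (induction n)
    case 0
    then show ?case using f op_maps[OF Kop f] by (simp add: neumann_sum.simps(1))
  next
    case (Suc n)
    have "K (\<lambda>x. f x + K (neumann_sum X K n f) x) = (\<lambda>x. K f x + K (K (neumann_sum X K n f)) x)"
      by (rule op_add[OF Kop f op_maps[OF Kop op_maps[OF op f]]])
    then show ?case using f op_maps[OF Kop f] by (simp add: neumann_sum.simps(2) Suc)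
  qed
  have right: "(\<lambda>x. R f x - K (R f) x) = f" if f: "f \<in> ell2 X" for f
  proof
    fix x
    have "(\<lambda>n. neumann_sum X K (Suc n) f x) \<longlonglongrightarrow> R f x" by (rule LIMSEQ_Suc[OF lim[OF f]])
    moreover have "(\<lambda>n. neumann_sum X K (Suc n) f x) \<longlonglongrightarrow> f x + K (R f) x"
      using f by (simp add: neumann_sum.simps(2)) (intro tendsto_intros limK f)
    ultimately have "R f x = f x + K (R f) x" by (rule LIMSEQ_unique)
    then show "R f x - K (R f) x = f x" by simp
  qed
  have left: "R (\<lambda>x. f x - K f x) = f" if f: "f \<in> ell2 X" for f
  proof -
    have "R (K f) x = K (R f) x" for x
      using LIMSEQ_unique[OF lim[OF op_maps[OF Kop f], of x]] limK[OF f, of x] by (simp add: comm[OF f])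
    then show ?thesis using right[OF f] by (simp add: op_diff[OF R(1) f op_maps[OF Kop f]] fun_eq_iff)
  qed
  show ?thesis using R left right by blast
qed

text \<open>Both inverses are limits of the same polynomials at the same geometric rate, hence again
  correspond under the quotient map. With equal representations this says that the inverse stays in
  the C*-algebra.\<close>

lemma neumann_pair:
  assumes G: "group G" and \<pi>: "unitary_rep G \<pi>" and \<rho>: "unitary_rep G \<rho>"
    and K: "approx_pair G \<pi> \<rho> K K'" and r: "0 \<le> r" "r < 1"
    and b: "bnd (basis \<pi>) K r" "bnd (basis \<rho>) K' r"
  shows "\<exists>R R'. approx_pair G \<pi> \<rho> R R' \<and>
    (\<forall>f\<in>ell2 (basis \<pi>). R (\<lambda>x. f x - K f x) = f \<and> (\<lambda>x. R f x - K (R f) x) = f) \<and>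
    (\<forall>f\<in>ell2 (basis \<rho>). (\<lambda>x. R' f x - K' (R' f) x) = f)"
proof -
  note Kop = approx_pair_ops[OF K]
  obtain R where R: "R \<in> bounded_ops (basis \<pi>)"
    "\<And>n. bnd (basis \<pi>) (\<lambda>f x. neumann_sum (basis \<pi>) K n f x - R f x) (2 * r * r ^ n / (1 - r))"
    "\<And>f. f \<in> ell2 (basis \<pi>) \<Longrightarrow> R (\<lambda>x. f x - K f x) = f"
    "\<And>f. f \<in> ell2 (basis \<pi>) \<Longrightarrow> (\<lambda>x. R f x - K (R f) x) = f"
    using neumann_series[OF Kop(1) b(1) r] by blast
  obtain R' where R': "R' \<in> bounded_ops (basis \<rho>)"
    "\<And>n. bnd (basis \<rho>) (\<lambda>f x. neumann_sum (basis \<rho>) K' n f x - R' f x) (2 * r * r ^ n / (1 - r))"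
    "\<And>f. f \<in> ell2 (basis \<rho>) \<Longrightarrow> (\<lambda>x. R' f x - K' (R' f) x) = f"
    using neumann_series[OF Kop(2) b(2) r] by blast
  have S: "approx_pair G \<pi> \<rho> (neumann_sum (basis \<pi>) K n) (neumann_sum (basis \<rho>) K' n)" for n
  proof (induction n)
    case 0
    show ?case by (simp only: neumann_sum.simps approx_pair_id[OF G \<pi> \<rho>])
  next
    case (Suc n)
    show ?case unfolding neumann_sum.simps
      by (intro approx_pair_add[OF G \<pi> \<rho>] approx_pair_comp[OF G \<pi> \<rho>] approx_pair_id[OF G \<pi> \<rho>] K Suc)
  qed
  have c0: "(\<lambda>n. 2 * r * r ^ n / (1 - r)) \<longlonglongrightarrow> 0"
    using r by (intro tendsto_eq_intros LIMSEQ_power_zero) auto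
  have "approx_pair G \<pi> \<rho> R R'"
  proof (rule approx_pair_limit[OF G \<pi> \<rho> R(1) R'(1)])
    fix e :: real assume "0 < e"
    obtain n where n: "2 * r * r ^ n / (1 - r) \<le> e" using tendsto_0_eventually[OF c0 \<open>0 < e\<close>] by blast
    have "bnd (basis \<pi>) (\<lambda>f x. R f x - neumann_sum (basis \<pi>) K n f x) e"
      using bnd_mono[OF R(2) n] by (simp only: bnd_diff_commute)
    moreover have "bnd (basis \<rho>) (\<lambda>f x. R' f x - neumann_sum (basis \<rho>) K' n f x) e"
      using bnd_mono[OF R'(2) n] by (simp only: bnd_diff_commute)
    ultimately show "\<exists>A' B'. approx_pair G \<pi> \<rho> A' B' \<and> bnd (basis \<pi>) (\<lambda>f x. R f x - A' f x) e \<and>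
        bnd (basis \<rho>) (\<lambda>f x. R' f x - B' f x) e" using S by blast
  qed
  with R(3,4) R'(3) show ?thesis by blast
qed


text \<open>Norm comparison on the group algebra. This is the operator form of weak containment of
  \<rho> in \<pi>, and the form from which homomorphisms between the C*-algebras are built.\<close>

definition dominated :: "('g, 'm) monoid_scheme \<Rightarrow> ('g, 'y) rep \<Rightarrow> ('g, 'x) rep \<Rightarrow> bool" where
  "dominated G \<rho> \<pi> \<longleftrightarrow> (\<forall>l\<in>group_lists G. \<forall>C\<ge>0.
     bnd (basis \<pi>) (group_alg_op \<pi> l) C \<longrightarrow> bnd (basis \<rho>) (group_alg_op \<rho> l) C)"

text \<open>The operator form of x / (1 + x^2) <= 1/2. With k = A* A h, expanding |f|^2 gives |h|^2
  + |k|^2 + 2 |A h|^2, while |A h|^2 = <h, k> is at most |h| |k|.\<close>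

lemma op_half_bound:
  assumes A: "A \<in> bounded_ops X" and h: "h \<in> ell2 X"
    and f: "(\<lambda>x. h x + op_adjoint X A (A h) x) = f"
  shows "ell2_norm X (A h) \<le> 1/2 * ell2_norm X f" "ell2_norm X h \<le> ell2_norm X f"
proof -
  let ?k = "op_adjoint X A (A h)"
  have Ah: "A h \<in> ell2 X" using op_maps[OF A h] .
  have k: "?k \<in> ell2 X" using op_maps[OF adjoint_bounded_op[OF A] Ah] .
  have hk: "ell2_inner X h ?k = of_real ((ell2_norm X (A h))\<^sup>2)"
    using adjoint_inner[OF A h Ah] by (simp add: ell2_inner_self[OF Ah])
  have "(\<lambda>x. h x - (- 1) * ?k x) = f" using f by simp
  then have sq: "(ell2_norm X f)\<^sup>2 = (ell2_norm X h)\<^sup>2 + (ell2_norm X ?k)\<^sup>2 + 2 * (ell2_norm X (A h))\<^sup>2"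
    using ell2_norm_sq_diff[OF h ell2_scale[OF k, of "- 1"]] ell2_inner_scale_right[of X h "- 1" ?k]
    by (simp add: ell2_norm_uminus hk)
  have "cmod (ell2_inner X h ?k) \<le> ell2_norm X h * ell2_norm X ?k" by (rule ell2_Cauchy_Schwarz[OF h k])
  then have "(ell2_norm X (A h))\<^sup>2 \<le> ell2_norm X h * ell2_norm X ?k" by (simp add: hk del: of_real_power)
  moreover have "0 \<le> (ell2_norm X h - ell2_norm X ?k)\<^sup>2" by simp
  ultimately have "(2 * ell2_norm X (A h))\<^sup>2 \<le> (ell2_norm X f)\<^sup>2"
    unfolding sq by (simp add: power2_diff)
  then have "2 * ell2_norm X (A h) \<le> ell2_norm X f" by (rule power2_le_imp_le) simp
  then show "ell2_norm X (A h) \<le> 1/2 * ell2_norm X f" by simp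
  have "(ell2_norm X h)\<^sup>2 \<le> (ell2_norm X f)\<^sup>2" unfolding sq by simp
  then show "ell2_norm X h \<le> ell2_norm X f" by (rule power2_le_imp_le) simp
qed

text \<open>An affine image K of A* A with 1 - K = (1 + A* A) / (1 + C^2). Its norm is below 1, so
  the Neumann series inverts 1 + A* A inside the C*-algebra even when \<open>A\<close> is
  large.\<close>

definition resolvent_kernel :: "'x set \<Rightarrow> real \<Rightarrow> 'x operator \<Rightarrow> 'x operator" where
  "resolvent_kernel X C A = (\<lambda>f x. of_real (C\<^sup>2 / (1 + C\<^sup>2)) *
     (op_id X f x - of_real (1 / C\<^sup>2) * (op_adjoint X A \<circ> A) f x))"

text \<open>Subtracting A* A / C^2 from the identity is a contraction: in |f - k / C^2|^2 the cross
  term is -2 |A f|^2 / C^2, and |k| <= C |A f| shows that it outweighs |k|^2 / C^4.\<close>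

lemma bnd_resolvent_kernel:
  assumes A: "A \<in> bounded_ops X" and b: "bnd X A C" and C: "1 \<le> C"
  shows "bnd X (resolvent_kernel X C A) (C\<^sup>2 / (1 + C\<^sup>2))"
proof -
  have "bnd X (\<lambda>f x. op_id X f x - of_real (1 / C\<^sup>2) * (op_adjoint X A \<circ> A) f x) 1"
    unfolding bnd_def
  proof
    fix f assume f: "f \<in> ell2 X"
    let ?k = "op_adjoint X A (A f)"
    have Af: "A f \<in> ell2 X" using op_maps[OF A f] .
    have k: "?k \<in> ell2 X" using op_maps[OF adjoint_bounded_op[OF A] Af] .
    have fk: "ell2_inner X f ?k = of_real ((ell2_norm X (A f))\<^sup>2)"
      using adjoint_inner[OF A f Af] by (simp add: ell2_inner_self[OF Af])
    have "ell2_norm X ?k \<le> C * ell2_norm X (A f)"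
      using bndD[OF bnd_adjoint[OF A _ b] Af] C by simp
    then have "(ell2_norm X ?k)\<^sup>2 \<le> (C * ell2_norm X (A f))\<^sup>2" by (simp add: power_mono)
    then have k2: "(ell2_norm X ?k)\<^sup>2 / C ^ 4 \<le> (ell2_norm X (A f))\<^sup>2 / C\<^sup>2"
      using C by (simp add: power_mult_distrib divide_simps eval_nat_numeral mult_ac)
    have "(ell2_norm X (\<lambda>x. f x - of_real (1 / C\<^sup>2) * ?k x))\<^sup>2 =
        (ell2_norm X f)\<^sup>2 + (ell2_norm X ?k)\<^sup>2 / C ^ 4 - 2 * ((ell2_norm X (A f))\<^sup>2 / C\<^sup>2)"
      using C unfolding ell2_norm_sq_diff[OF f ell2_scale[OF k]] ell2_norm_scale ell2_inner_scale_right fk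
      by (simp add: power_mult_distrib power_divide norm_divide norm_power flip: power_mult)
    also have "\<dots> \<le> (ell2_norm X f)\<^sup>2"
    proof -
      have "0 \<le> (ell2_norm X (A f))\<^sup>2 / C\<^sup>2" by simp
      with k2 show ?thesis by linarith
    qed
    finally have "ell2_norm X (\<lambda>x. f x - of_real (1 / C\<^sup>2) * ?k x) \<le> ell2_norm X f"
      by (rule power2_le_imp_le) simp
    then show "ell2_norm X (\<lambda>x. op_id X f x - of_real (1 / C\<^sup>2) * (op_adjoint X A \<circ> A) f x) \<le> 1 * ell2_norm X f"
      using f by simp
  qed
  from bnd_scale[OF this, of "of_real (C\<^sup>2 / (1 + C\<^sup>2))"]
  have "bnd X (resolvent_kernel X C A) (cmod (of_real (C\<^sup>2 / (1 + C\<^sup>2))) * 1)"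
    unfolding resolvent_kernel_def .
  moreover have "0 \<le> C\<^sup>2 / (1 + C\<^sup>2)" by (intro divide_nonneg_nonneg) auto
  then have "cmod (of_real (C\<^sup>2 / (1 + C\<^sup>2))) * 1 = C\<^sup>2 / (1 + C\<^sup>2)"
    by (simp only: norm_of_real abs_of_nonneg mult_1_right)
  ultimately show ?thesis by simp
qed

lemma resolvent_kernel_apply:
  assumes "f \<in> ell2 X" "1 \<le> C"
  shows "f x - resolvent_kernel X C A f x = of_real (1 / (1 + C\<^sup>2)) * (f x + op_adjoint X A (A f) x)"
proof -
  have C: "C\<^sup>2 \<noteq> 0" "1 + C\<^sup>2 \<noteq> 0" using assms(2) by (auto simp: add_nonneg_eq_0_iff)
  then have "C\<^sup>2 / (1 + C\<^sup>2) = 1 - 1 / (1 + C\<^sup>2)" "C\<^sup>2 / (1 + C\<^sup>2) * (1 / C\<^sup>2) = 1 / (1 + C\<^sup>2)"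
    by (simp_all add: divide_simps)
  from this[THEN arg_cong[where f = complex_of_real]]
  have *: "complex_of_real (C\<^sup>2 / (1 + C\<^sup>2)) = 1 - of_real (1 / (1 + C\<^sup>2))"
    "complex_of_real (C\<^sup>2 / (1 + C\<^sup>2)) * of_real (1 / C\<^sup>2) = of_real (1 / (1 + C\<^sup>2))"
    by (simp_all only: of_real_diff of_real_1 of_real_mult)
  have eq: "z - a * (z - b * k) = u * (z + k)" if "a = 1 - u" "a * b = u" for a b u z k :: complex
  proof -
    have "z - a * (z - b * k) = z - a * z + (a * b) * k" by (simp add: algebra_simps)
    also have "\<dots> = u * (z + k)" unfolding that(2) unfolding that(1) by (simp add: algebra_simps)
    finally show ?thesis .
  qed
  show ?thesis using assms(1) eq[OF *]
    unfolding resolvent_kernel_def by (simp only: op_id_apply comp_apply)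
qed

lemma bnd_group_alg_diff:
  assumes G: "group G" and \<pi>: "unitary_rep G \<pi>" and A: "A \<in> bounded_ops (basis \<pi>)"
    and l: "l \<in> group_lists G" "m \<in> group_lists G"
    and b: "bnd (basis \<pi>) (\<lambda>f x. A f x - group_alg_op \<pi> l f x) d"
      "bnd (basis \<pi>) (\<lambda>f x. A f x - group_alg_op \<pi> m f x) e"
  shows "bnd (basis \<pi>) (group_alg_op \<pi> (l @ scale_list (-1) m)) (d + e)"
proof -
  note ops = group_alg_bounded_op[OF G \<pi> l(1)] A group_alg_bounded_op[OF G \<pi> l(2)]
  have "bnd (basis \<pi>) (\<lambda>f x. group_alg_op \<pi> l f x - group_alg_op \<pi> m f x) (d + e)"
    by (rule bnd_diff_trans[OF ops _ b(2)]) (use b(1) in \<open>simp only: bnd_diff_commute\<close>)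
  then show ?thesis by (simp add: group_alg_op_append group_alg_op_scale)
qed

context
  fixes G :: "('g, 'm) monoid_scheme" and \<pi> :: "('g, 'x) rep" and \<rho> :: "('g, 'y) rep"
  assumes G: "group G" and \<pi>: "unitary_rep G \<pi>" and \<rho>: "unitary_rep G \<rho>"
    and dom: "dominated G \<rho> \<pi>"
begin

lemma dominated_bnd:
  assumes AB: "approx_pair G \<pi> \<rho> A B" and b: "bnd (basis \<pi>) A C" "0 \<le> C"
  shows "bnd (basis \<rho>) B C"
proof (rule bnd_limit)
  fix e :: real assume "0 < e"
  then have e2: "0 < e/2" by simp
  note ops = approx_pair_ops[OF AB]
  obtain l where l: "l \<in> group_lists G" "bnd (basis \<pi>) (\<lambda>f x. A f x - group_alg_op \<pi> l f x) (e/2)"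
    "bnd (basis \<rho>) (\<lambda>f x. B f x - group_alg_op \<rho> l f x) (e/2)" using approx_pairD[OF AB e2] .
  have "bnd (basis \<pi>) (group_alg_op \<pi> l) (e/2 + C)"
    by (rule bnd_from_diff[OF group_alg_bounded_op[OF G \<pi> l(1)] ops(1) _ b(1)])
       (use l(2) in \<open>simp only: bnd_diff_commute\<close>)
  then have "bnd (basis \<rho>) (group_alg_op \<rho> l) (e/2 + C)"
    using dom l(1) e2 b(2) by (simp add: dominated_def)
  from bnd_from_diff[OF ops(2) group_alg_bounded_op[OF G \<rho> l(1)] l(3) this]
  show "bnd (basis \<rho>) B (C + e)" by (simp add: add.commute)
qed

lemma dominated_unique:
  assumes "approx_pair G \<pi> \<rho> A B" "approx_pair G \<pi> \<rho> A B'" shows "B = B'"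
proof (rule bnd_0_eq[OF approx_pair_ops(2)[OF assms(1)] approx_pair_ops(2)[OF assms(2)]])
  show "bnd (basis \<rho>) (\<lambda>f x. B f x - B' f x) 0"
    using dominated_bnd[OF approx_pair_diff[OF G \<pi> \<rho> assms], of 0] by (simp add: bnd_zero)
qed

text \<open>Group algebra elements approximating \<open>A\<close> at a geometric rate have Cauchy
  images by domination. The constant 2 covers 1/2 + 1, the sum of two consecutive errors relative to
  (1/2)^n.\<close>

lemma dominated_exists:
  assumes A: "approx_pair G \<pi> \<pi> A A"
  shows "\<exists>B. approx_pair G \<pi> \<rho> A B"
proof -
  note Aop = approx_pair_ops(1)[OF A]
  have "\<exists>l\<in>group_lists G. bnd (basis \<pi>) (\<lambda>f x. A f x - group_alg_op \<pi> l f x) ((1/2) ^ n)" for n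
    using A by (auto simp: approx_pair_def)
  then obtain l where l: "\<And>n. l n \<in> group_lists G"
    "\<And>n. bnd (basis \<pi>) (\<lambda>f x. A f x - group_alg_op \<pi> (l n) f x) ((1/2) ^ n)" by metis
  have step: "bnd (basis \<rho>) (\<lambda>f x. group_alg_op \<rho> (l (Suc n)) f x - group_alg_op \<rho> (l n) f x) (2 * (1/2) ^ n)" for n
  proof -
    have "bnd (basis \<pi>) (group_alg_op \<pi> (l (Suc n) @ scale_list (-1) (l n))) ((1/2) ^ Suc n + (1/2) ^ n)"
      by (rule bnd_group_alg_diff[OF G \<pi> Aop l(1) l(1) l(2) l(2)])
    then have "bnd (basis \<pi>) (group_alg_op \<pi> (l (Suc n) @ scale_list (-1) (l n))) (2 * (1/2) ^ n)"
      by (rule bnd_mono) simp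
    then have "bnd (basis \<rho>) (group_alg_op \<rho> (l (Suc n) @ scale_list (-1) (l n))) (2 * (1/2) ^ n)"
      using dom l(1) by (simp add: dominated_def scale_group_lists)
    then show ?thesis by (simp add: group_alg_op_append group_alg_op_scale)
  qed
  obtain B where B: "B \<in> bounded_ops (basis \<rho>)"
    "\<And>n. bnd (basis \<rho>) (\<lambda>f x. group_alg_op \<rho> (l n) f x - B f x) (2 * 2 * (1/2) ^ n / (1 - 1/2))"
    using op_geometric_limit[of "\<lambda>n. group_alg_op \<rho> (l n)" "basis \<rho>" "1/2" 2,
        OF group_alg_bounded_op[OF G \<rho> l(1)] _ _ _ step] by auto
  have "approx_pair G \<pi> \<rho> A B"
  proof (rule approx_pair_limit[OF G \<pi> \<rho> Aop B(1)])
    fix e :: real assume "0 < e"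
    have "(\<lambda>n. 8 * (1/2) ^ n :: real) \<longlonglongrightarrow> 0" by (intro tendsto_mult_right_zero LIMSEQ_power_zero) simp
    from tendsto_0_eventually[OF this \<open>0 < e\<close>] obtain n where n: "8 * (1/2) ^ n \<le> e" by blast
    have "bnd (basis \<pi>) (\<lambda>f x. A f x - group_alg_op \<pi> (l n) f x) e"
      by (rule bnd_mono[OF l(2)[of n]]) (use n zero_le_power[of "1/2::real" n] in linarith)
    moreover have "bnd (basis \<rho>) (\<lambda>f x. B f x - group_alg_op \<rho> (l n) f x) e"
      using bnd_mono[OF B(2)[of n], of e] n by (simp add: bnd_diff_commute)
    ultimately show "\<exists>A' B'. approx_pair G \<pi> \<rho> A' B' \<and> bnd (basis \<pi>) (\<lambda>f x. A f x - A' f x) e \<and>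
        bnd (basis \<rho>) (\<lambda>f x. B f x - B' f x) e"
      using approx_pair_group_alg[OF G \<pi> \<rho> l(1)] by blast
  qed
  then show ?thesis by blast
qed

text \<open>The image of a *-homomorphism is closed because elements can be lifted with control of the norm:
  replacing \<open>a\<close> by \<open>a (1 + a* a)\<inverse>\<close> makes the norm at most \<open>1/2\<close> and changes the image
  \<open>b\<close> of \<open>a\<close> only by \<open>b b* b (1 + b* b)\<inverse>\<close>, which is of third order in \<open>b\<close>.\<close>

lemma bounded_lift:
  assumes ab: "approx_pair G \<pi> \<rho> a b" and b: "bnd (basis \<rho>) b \<beta>" "0 \<le> \<beta>"
  shows "\<exists>A B. approx_pair G \<pi> \<rho> A B \<and> bnd (basis \<pi>) A (1/2) \<and>
    bnd (basis \<rho>) (\<lambda>f x. b f x - B f x) (\<beta> ^ 3)"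
proof -
  let ?X = "basis \<pi>" and ?Y = "basis \<rho>"
  note ops = approx_pair_ops[OF ab]
  obtain C0 where C0: "0 \<le> C0" "bnd ?X a C0" using bounded_ops_bnd[OF ops(1)] .
  \<comment> \<open>The kernel divides by the square of \<open>C\<close>, hence the lower bound 1.
    Domination makes \<open>C\<close> a bound for \<open>b\<close> as well, so one kernel formula
    serves both sides of the pair.\<close>
  define C where "C = max 1 C0"
  have C: "1 \<le> C" "bnd ?X a C" using bnd_mono[OF C0(2)] by (auto simp: C_def)
  have bC: "bnd ?Y b C" using dominated_bnd[OF ab C(2)] C(1) by simp
  define r where "r = C\<^sup>2 / (1 + C\<^sup>2)"
  have pos: "0 < 1 + C\<^sup>2" by (simp add: add_pos_nonneg)
  have r: "0 \<le> r" "r < 1" using pos by (auto simp: r_def divide_simps)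
  define u where "u = complex_of_real (1 / (1 + C\<^sup>2))"
  have u: "u \<noteq> 0" using pos by (simp add: u_def del: of_real_divide)
  have K: "approx_pair G \<pi> \<rho> (resolvent_kernel ?X C a) (resolvent_kernel ?Y C b)"
    unfolding resolvent_kernel_def
    by (intro approx_pair_scale[OF G \<pi> \<rho>] approx_pair_diff[OF G \<pi> \<rho>] approx_pair_comp[OF G \<pi> \<rho>]
        approx_pair_adjoint[OF G \<pi> \<rho>] approx_pair_id[OF G \<pi> \<rho>] ab)
  have "bnd ?X (resolvent_kernel ?X C a) r" "bnd ?Y (resolvent_kernel ?Y C b) r"
    unfolding r_def
    by (rule bnd_resolvent_kernel[OF ops(1) C(2,1)], rule bnd_resolvent_kernel[OF ops(2) bC C(1)])
  from neumann_pair[OF G \<pi> \<rho> K r this] obtain R R' where R: "approx_pair G \<pi> \<rho> R R'"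
    "\<And>f. f \<in> ell2 ?X \<Longrightarrow> (\<lambda>x. R f x - resolvent_kernel ?X C a (R f) x) = f"
    "\<And>f. f \<in> ell2 ?Y \<Longrightarrow> (\<lambda>x. R' f x - resolvent_kernel ?Y C b (R' f) x) = f"
    by blast
  note Rops = approx_pair_ops[OF R(1)]
  \<comment> \<open>Since 1 minus the kernel is u (1 + a* a), the operator u R is the inverse of 1 +
    a* a; thus \<open>A\<close> is a (1 + a* a)^-1, and \<open>B\<close> is the same expression in
    \<open>b\<close>.\<close>
  define A B where "A = (\<lambda>f x. u * (a \<circ> R) f x)" and "B = (\<lambda>f x. u * (b \<circ> R') f x)"
  have "approx_pair G \<pi> \<rho> A B"
    unfolding A_def B_def by (intro approx_pair_scale[OF G \<pi> \<rho>] approx_pair_comp[OF G \<pi> \<rho>] ab R(1))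
  moreover have "bnd ?X A (1/2)"
    unfolding bnd_def
  proof
    fix f assume f: "f \<in> ell2 ?X"
    have Rf: "R f \<in> ell2 ?X" by (rule op_maps[OF Rops(1) f])
    let ?h = "\<lambda>x. u * R f x"
    have h: "?h \<in> ell2 ?X" by (rule ell2_scale[OF Rf])
    have "(\<lambda>x. ?h x + op_adjoint ?X a (a ?h) x) = f"
      using R(2)[OF f] unfolding resolvent_kernel_apply[OF Rf C(1)] u_def[symmetric]
      by (simp add: op_scale[OF ops(1) Rf] op_scale[OF adjoint_bounded_op[OF ops(1)] op_maps[OF ops(1) Rf]]
          algebra_simps)
    from op_half_bound(1)[OF ops(1) h this]
    show "ell2_norm ?X (A f) \<le> 1/2 * ell2_norm ?X f"
      by (simp add: A_def op_scale[OF ops(1) Rf])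
  qed
  moreover have "bnd ?Y (\<lambda>f x. b f x - B f x) (\<beta> ^ 3)"
    unfolding bnd_def
  proof
    fix f assume f: "f \<in> ell2 ?Y"
    have Rf: "R' f \<in> ell2 ?Y" by (rule op_maps[OF Rops(2) f])
    let ?h = "\<lambda>x. u * R' f x" let ?k = "op_adjoint ?Y b (b ?h)"
    have h: "?h \<in> ell2 ?Y" by (rule ell2_scale[OF Rf])
    have bh: "b ?h \<in> ell2 ?Y" by (rule op_maps[OF ops(2) h])
    have k: "?k \<in> ell2 ?Y" by (rule op_maps[OF adjoint_bounded_op[OF ops(2)] bh])
    have eq: "(\<lambda>x. ?h x + ?k x) = f"
      using R(3)[OF f] unfolding resolvent_kernel_apply[OF Rf C(1)] u_def[symmetric]
      by (simp add: op_scale[OF ops(2) Rf] op_scale[OF adjoint_bounded_op[OF ops(2)] op_maps[OF ops(2) Rf]]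
          algebra_simps)
    \<comment> \<open>From f = h + b* b h it follows that b f - b h = b b* b h, of third order in
      \<open>b\<close>.\<close>
    have "b f = (\<lambda>x. b ?h x + b ?k x)" using op_add[OF ops(2) h k] eq by simp
    then have "(\<lambda>x. b f x - B f x) = b ?k" by (simp add: B_def op_scale[OF ops(2) Rf])
    then have "ell2_norm ?Y (\<lambda>x. b f x - B f x) \<le> \<beta> * ell2_norm ?Y ?k" using bndD[OF b(1) k] by simp
    also have "\<dots> \<le> \<beta> * (\<beta> * ell2_norm ?Y (b ?h))"
      by (rule mult_left_mono[OF bndD[OF bnd_adjoint[OF ops(2) b(2,1)] bh] b(2)])
    also have "\<dots> \<le> \<beta> * (\<beta> * (\<beta> * ell2_norm ?Y ?h))"
      by (intro mult_left_mono b bndD[OF b(1) h])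
    also have "\<dots> \<le> \<beta> * (\<beta> * (\<beta> * ell2_norm ?Y f))"
      by (intro mult_left_mono b op_half_bound(2)[OF ops(2) h eq])
    finally show "ell2_norm ?Y (\<lambda>x. b f x - B f x) \<le> \<beta> ^ 3 * ell2_norm ?Y f"
      by (simp add: power3_eq_cube mult.assoc)
  qed
  ultimately show ?thesis by blast
qed

text \<open>One round of successive approximation: lifting with norm at most 1/2 halves an error of
  1/2. The numbers fit because 1/16 + (9/16)^3 is below 1/4, the 1/16 being the price of passing to
  the group algebra.\<close>

lemma approximate_lift:
  assumes B: "approx_pair G \<rho> \<rho> B B" and b: "bnd (basis \<rho>) B (1/2)"
  shows "\<exists>A' B'. approx_pair G \<pi> \<rho> A' B' \<and> bnd (basis \<pi>) A' (1/2) \<and>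
    bnd (basis \<rho>) (\<lambda>f x. B f x - B' f x) (1/4)"
proof -
  note Bop = approx_pair_ops(1)[OF B]
  obtain l where l: "l \<in> group_lists G" "bnd (basis \<rho>) (\<lambda>f x. B f x - group_alg_op \<rho> l f x) (1/16)"
    using approx_pairD[OF B, of "1/16"] by auto
  have "bnd (basis \<rho>) (group_alg_op \<rho> l) (1/16 + 1/2)"
    by (rule bnd_from_diff[OF group_alg_bounded_op[OF G \<rho> l(1)] Bop _ b])
       (use l(2) in \<open>simp only: bnd_diff_commute\<close>)
  then obtain A' B' where AB: "approx_pair G \<pi> \<rho> A' B'" "bnd (basis \<pi>) A' (1/2)"
    "bnd (basis \<rho>) (\<lambda>f x. group_alg_op \<rho> l f x - B' f x) ((1/16 + 1/2) ^ 3)"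
    using bounded_lift[OF approx_pair_group_alg[OF G \<pi> \<rho> l(1)], of "1/16 + 1/2"] by auto
  have "bnd (basis \<rho>) (\<lambda>f x. B f x - B' f x) (1/16 + (1/16 + 1/2) ^ 3)"
    by (rule bnd_diff_trans[OF Bop group_alg_bounded_op[OF G \<rho> l(1)] approx_pair_ops(2)[OF AB(1)] l(2) AB(3)])
  then have "bnd (basis \<rho>) (\<lambda>f x. B f x - B' f x) (1/4)"
    by (rule bnd_mono) (simp add: power3_eq_cube)
  with AB show ?thesis by blast
qed

text \<open>Successive approximation as in the open mapping theorem: each round halves the error in
  the target, and the corrections upstairs have geometrically decaying norm, so they sum to an exact
  lift.\<close>

lemma lift_exists_half:
  assumes B: "approx_pair G \<rho> \<rho> B B" and b: "bnd (basis \<rho>) B (1/2)"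
  shows "\<exists>A. approx_pair G \<pi> \<rho> A B"
proof -
  let ?X = "basis \<pi>" and ?Y = "basis \<rho>"
  note Bop = approx_pair_ops(1)[OF B]
  let ?P = "\<lambda>n p. approx_pair G \<pi> \<rho> (fst p) (snd p) \<and> bnd ?Y (\<lambda>f x. B f x - snd p f x) (1/2 * (1/2) ^ n)"
  let ?S = "\<lambda>n p q. bnd ?X (\<lambda>f x. fst q f x - fst p f x) (1/2 * (1/2) ^ n)"
  have "\<exists>F. \<forall>n. ?P n (F n) \<and> ?S n (F n) (F (Suc n))"
  proof (rule dependent_nat_choice)
    show "\<exists>p. ?P 0 p"
      using b by (intro exI[of _ "(\<lambda>f x. 0, \<lambda>f x. 0)"]) (simp add: approx_pair_zero[OF G \<pi> \<rho>])
  next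
    fix p n assume p: "?P n p"
    \<comment> \<open>The remaining error is blown up to norm 1/2, lifted approximately, and the
      correction is scaled back.\<close>
    let ?k = "complex_of_real (2 ^ n)" and ?k' = "complex_of_real ((1/2) ^ n)"
    let ?D = "\<lambda>f x. ?k * (B f x - snd p f x)"
    have D: "approx_pair G \<rho> \<rho> ?D ?D"
      using p by (intro approx_pair_scale[OF G \<rho> \<rho>] approx_pair_diff[OF G \<rho> \<rho>] B approx_pair_refl(2)) auto
    have "bnd ?Y ?D (cmod ?k * (1/2 * (1/2) ^ n))" by (rule bnd_scale) (use p in auto)
    then have "bnd ?Y ?D (1/2)" by (rule bnd_mono) (simp add: norm_power power_divide)
    from approximate_lift[OF D this] obtain A' B' where AB: "approx_pair G \<pi> \<rho> A' B'" "bnd ?X A' (1/2)"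
      "bnd ?Y (\<lambda>f x. ?D f x - B' f x) (1/4)" by blast
    let ?q = "(\<lambda>f x. fst p f x + ?k' * A' f x, \<lambda>f x. snd p f x + ?k' * B' f x)"
    have "approx_pair G \<pi> \<rho> (fst ?q) (snd ?q)"
      using p by (simp add: approx_pair_add[OF G \<pi> \<rho>] approx_pair_scale[OF G \<pi> \<rho>] AB(1) del: of_real_power)
    moreover have "bnd ?Y (\<lambda>f x. B f x - snd ?q f x) (1/2 * (1/2) ^ Suc n)"
    proof -
      have "?k' * ?k = 1" by (simp add: power_divide flip: of_real_mult del: of_real_power)
      then have kk: "?k' * (?k * z) = z" for z by (metis mult.assoc mult_1)
      have "bnd ?Y (\<lambda>f x. ?k' * (?D f x - B' f x)) (cmod ?k' * (1/4))" by (rule bnd_scale[OF AB(3)])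
      also have "(\<lambda>f x. ?k' * (?D f x - B' f x)) = (\<lambda>f x. B f x - snd ?q f x)"
        by (simp add: right_diff_distrib distrib_left kk diff_diff_eq del: of_real_power)
      finally show ?thesis by (rule bnd_mono) (simp add: norm_power norm_divide)
    qed
    moreover have "?S n p ?q"
      using bnd_mono[OF bnd_scale[OF AB(2), of ?k'], of "1/2 * (1/2) ^ n"] by (simp add: norm_power norm_divide)
    ultimately show "\<exists>q. ?P (Suc n) q \<and> ?S n p q" by blast
  qed
  then obtain F where F: "\<And>n. ?P n (F n)" "\<And>n. ?S n (F n) (F (Suc n))" by blast
  note Fops = approx_pair_ops[OF conjunct1[OF F(1)]]
  obtain A where A: "A \<in> bounded_ops ?X"
    "\<And>n. bnd ?X (\<lambda>f x. fst (F n) f x - A f x) (2 * (1/2) * (1/2) ^ n / (1 - 1/2))"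
    using op_geometric_limit[of "\<lambda>n. fst (F n)" ?X "1/2" "1/2", OF Fops(1) _ _ _ F(2)] by auto
  have "approx_pair G \<pi> \<rho> A B"
  proof (rule approx_pair_limit[OF G \<pi> \<rho> A(1) Bop])
    fix e :: real assume "0 < e"
    have "(\<lambda>n. 2 * (1/2) ^ n :: real) \<longlonglongrightarrow> 0" by (intro tendsto_mult_right_zero LIMSEQ_power_zero) simp
    from tendsto_0_eventually[OF this \<open>0 < e\<close>] obtain n where n: "2 * (1/2) ^ n \<le> e" by blast
    have "bnd ?X (\<lambda>f x. A f x - fst (F n) f x) e"
      using bnd_mono[OF A(2)[of n], of e] n by (simp add: bnd_diff_commute)
    moreover have "bnd ?Y (\<lambda>f x. B f x - snd (F n) f x) e"
      by (rule bnd_mono[OF conjunct2[OF F(1)[of n]]]) (use n zero_le_power[of "1/2::real" n] in linarith)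
    ultimately show "\<exists>A' B'. approx_pair G \<pi> \<rho> A' B' \<and> bnd ?X (\<lambda>f x. A f x - A' f x) e \<and>
        bnd ?Y (\<lambda>f x. B f x - B' f x) e"
      using conjunct1[OF F(1)[of n]] by blast
  qed
  then show ?thesis by blast
qed

lemma lift_exists:
  assumes B: "approx_pair G \<rho> \<rho> B B"
  shows "\<exists>A. approx_pair G \<pi> \<rho> A B"
proof -
  obtain C where C: "0 \<le> C" "bnd (basis \<rho>) B C" using bounded_ops_bnd[OF approx_pair_ops(1)[OF B]] .
  let ?k = "complex_of_real (1 / (2 * (C + 1)))" and ?k' = "complex_of_real (2 * (C + 1))"
  have "2 * (C + 1) * (1 / (2 * (C + 1))) = 1" using C(1) by simp
  then have "?k' * ?k = 1" by (metis of_real_mult of_real_1)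
  then have kk: "?k' * (?k * z) = z" for z by (metis mult.assoc mult_1)
  have "bnd (basis \<rho>) (\<lambda>f x. ?k * B f x) (1/2)"
    by (rule bnd_mono[OF bnd_scale[OF C(2)]]) (use C(1) in \<open>simp add: divide_simps del: of_real_divide\<close>)
  from lift_exists_half[OF approx_pair_scale[OF G \<rho> \<rho> B] this]
  obtain A where "approx_pair G \<pi> \<rho> A (\<lambda>f x. ?k * B f x)" by blast
  from approx_pair_scale[OF G \<pi> \<rho> this, of ?k'] show ?thesis unfolding kk by blast
qed

text \<open>Domination extends the identity of the group algebra continuously to the closures.
  Density alone would give only a dense image; surjectivity rests on
  \<open>lift_exists\<close>.\<close>

theorem dominated_quotient:
  "\<exists>q \<in> star_epi (Cstar_rep G \<pi>) (Cstar_rep G \<rho>). \<forall>g\<in>carrier G. q (act \<pi> g) = act \<rho> g"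
proof -
  define q where "q A = (THE B. approx_pair G \<pi> \<rho> A B)" for A
  have qI: "q A = B" if "approx_pair G \<pi> \<rho> A B" for A B
    unfolding q_def using that dominated_unique by blast
  have qQ: "approx_pair G \<pi> \<rho> A (q A)" if "approx_pair G \<pi> \<pi> A A" for A
    using dominated_exists[OF that] qI by auto
  have "q \<in> star_epi (Cstar_rep G \<pi>) (Cstar_rep G \<rho>)"
    unfolding star_epi_def star_hom_def ring_hom_def Cstar_rep_simps
      carrier_Cstar_rep[OF G \<pi>] carrier_Cstar_rep[OF G \<rho>]
  proof (intro CollectI conjI ballI allI impI Pi_I)
    show "approx_pair G \<rho> \<rho> (q A) (q A)" if "A \<in> {A. approx_pair G \<pi> \<pi> A A}" for A
      using approx_pair_refl(2)[OF qQ, of A] that by blast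
    show "q (A \<circ> B) = q A \<circ> q B" if "A \<in> {A. approx_pair G \<pi> \<pi> A A} \<and> B \<in> {A. approx_pair G \<pi> \<pi> A A}" for A B
      using that by (intro qI approx_pair_comp[OF G \<pi> \<rho>] qQ) auto
    show "q (\<lambda>f x. A f x + B f x) = (\<lambda>f x. q A f x + q B f x)"
      if "A \<in> {A. approx_pair G \<pi> \<pi> A A} \<and> B \<in> {A. approx_pair G \<pi> \<pi> A A}" for A B
      using that by (intro qI approx_pair_add[OF G \<pi> \<rho>] qQ) auto
    show "q (op_id (basis \<pi>)) = op_id (basis \<rho>)" by (rule qI[OF approx_pair_id[OF G \<pi> \<rho>]])
    show "q (\<lambda>f x. c * A f x) = (\<lambda>f x. c * q A f x)" if "A \<in> {A. approx_pair G \<pi> \<pi> A A}" for c A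
      using that by (intro qI approx_pair_scale[OF G \<pi> \<rho>] qQ) auto
    show "q (op_adjoint (basis \<pi>) A) = op_adjoint (basis \<rho>) (q A)" if "A \<in> {A. approx_pair G \<pi> \<pi> A A}" for A
      using that by (intro qI approx_pair_adjoint[OF G \<pi> \<rho>] qQ) auto
    show "q ` {A. approx_pair G \<pi> \<pi> A A} = {A. approx_pair G \<rho> \<rho> A A}"
    proof (intro equalityI subsetI)
      fix B assume "B \<in> {A. approx_pair G \<rho> \<rho> A A}"
      then obtain A where A: "approx_pair G \<pi> \<rho> A B" using lift_exists by blast
      from qI[OF A] approx_pair_refl(1)[OF A] show "B \<in> q ` {A. approx_pair G \<pi> \<pi> A A}" by blast
    qed (use approx_pair_refl(2)[OF qQ] in blast)
  qed
  moreover have "q (act \<pi> g) = act \<rho> g" if "g \<in> carrier G" for g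
    by (rule qI[OF approx_pair_act[OF G \<pi> \<rho> that]])
  ultimately show ?thesis by blast
qed

end

section \<open>Permutation representations and fixed vectors\<close>

lemma unitary_repI:
  fixes G (structure)
  assumes G: "group G"
    and maps: "\<And>g f. g \<in> carrier G \<Longrightarrow> f \<in> ell2 (basis \<pi>) \<Longrightarrow> act \<pi> g f \<in> ell2 (basis \<pi>)"
    and add: "\<And>g f h. g \<in> carrier G \<Longrightarrow> f \<in> ell2 (basis \<pi>) \<Longrightarrow> h \<in> ell2 (basis \<pi>) \<Longrightarrow>
        act \<pi> g (\<lambda>x. f x + h x) = (\<lambda>x. act \<pi> g f x + act \<pi> g h x)"
    and scale: "\<And>g c f. g \<in> carrier G \<Longrightarrow> f \<in> ell2 (basis \<pi>) \<Longrightarrow>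
        act \<pi> g (\<lambda>x. c * f x) = (\<lambda>x. c * act \<pi> g f x)"
    and outside: "\<And>g f. g \<in> carrier G \<Longrightarrow> f \<notin> ell2 (basis \<pi>) \<Longrightarrow> act \<pi> g f = (\<lambda>x. 0)"
    and inner: "\<And>g f h. g \<in> carrier G \<Longrightarrow> f \<in> ell2 (basis \<pi>) \<Longrightarrow> h \<in> ell2 (basis \<pi>) \<Longrightarrow>
        ell2_inner (basis \<pi>) (act \<pi> g f) (act \<pi> g h) = ell2_inner (basis \<pi>) f h"
    and mult: "\<And>g h f. g \<in> carrier G \<Longrightarrow> h \<in> carrier G \<Longrightarrow> f \<in> ell2 (basis \<pi>) \<Longrightarrow>
        act \<pi> (g \<otimes>\<^bsub>G\<^esub> h) f = act \<pi> g (act \<pi> h f)"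
    and one: "\<And>f. f \<in> ell2 (basis \<pi>) \<Longrightarrow> act \<pi> \<one>\<^bsub>G\<^esub> f = f"
  shows "unitary_rep G \<pi>"
proof -
  interpret group G by (rule G)
  have b: "bnd (basis \<pi>) (act \<pi> g) 1" if g: "g \<in> carrier G" for g
    unfolding bnd_def
  proof
    fix f assume f: "f \<in> ell2 (basis \<pi>)"
    have "complex_of_real ((ell2_norm (basis \<pi>) (act \<pi> g f))\<^sup>2) = of_real ((ell2_norm (basis \<pi>) f)\<^sup>2)"
      using inner[OF g f f] by (simp only: ell2_inner_self[OF maps[OF g f]] ell2_inner_self[OF f])
    then have "(ell2_norm (basis \<pi>) (act \<pi> g f))\<^sup>2 = (ell2_norm (basis \<pi>) f)\<^sup>2"
      by (simp only: of_real_eq_iff)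
    then show "ell2_norm (basis \<pi>) (act \<pi> g f) \<le> 1 * ell2_norm (basis \<pi>) f"
      by (simp add: power2_eq_iff_nonneg)
  qed
  have op: "act \<pi> g \<in> bounded_ops (basis \<pi>)" if g: "g \<in> carrier G" for g
    by (rule bounded_opsI[OF maps[OF g] add[OF g] scale[OF g] b[OF g] outside[OF g]])
  have surj: "act \<pi> g ` ell2 (basis \<pi>) = ell2 (basis \<pi>)" if g: "g \<in> carrier G" for g
  proof (intro equalityI subsetI)
    fix f assume f: "f \<in> ell2 (basis \<pi>)"
    have "f = act \<pi> g (act \<pi> (inv g) f)"
      using mult[OF g inv_closed[OF g] f] one[OF f] by (simp add: r_inv[OF g])
    then show "f \<in> act \<pi> g ` ell2 (basis \<pi>)" using maps[OF inv_closed[OF g] f] by (rule image_eqI)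
  qed (use maps[OF g] in auto)
  have "act \<pi> (g \<otimes> h) = act \<pi> g \<circ> act \<pi> h" if gh: "g \<in> carrier G" "h \<in> carrier G" for g h
    by (rule op_ext[of _ "basis \<pi>"]) (use gh in \<open>auto intro!: op comp_bounded_op simp: mult\<close>)
  then show ?thesis
    unfolding unitary_rep_def unitary_op_def
    by (intro conjI ballI op surj inner) (simp_all only:)
qed

definition group_act :: "('g, 'm) monoid_scheme \<Rightarrow> 'x set \<Rightarrow> ('g \<Rightarrow> 'x \<Rightarrow> 'x) \<Rightarrow> bool" where
  "group_act G X \<alpha> \<longleftrightarrow> (\<forall>g\<in>carrier G. \<forall>x\<in>X. \<alpha> g x \<in> X) \<and> (\<forall>x\<in>X. \<alpha> \<one>\<^bsub>G\<^esub> x = x) \<and>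
     (\<forall>g\<in>carrier G. \<forall>h\<in>carrier G. \<forall>x\<in>X. \<alpha> (g \<otimes>\<^bsub>G\<^esub> h) x = \<alpha> g (\<alpha> h x))"

text \<open>One construction for the regular, the quasi-regular and the trivial representation, so
  that unitarity and the action on basis vectors are proved once.\<close>

definition perm_rep :: "('g, 'm) monoid_scheme \<Rightarrow> 'x set \<Rightarrow> ('g \<Rightarrow> 'x \<Rightarrow> 'x) \<Rightarrow> ('g, 'x) rep" where
  "perm_rep G X \<alpha> = \<lparr>basis = X,
     act = (\<lambda>g f x. if f \<in> ell2 X \<and> x \<in> X then f (\<alpha> (inv\<^bsub>G\<^esub> g) x) else 0)\<rparr>"

lemma regular_rep_eq_perm_rep: "regular_rep G = perm_rep G (carrier G) (\<lambda>g x. g \<otimes>\<^bsub>G\<^esub> x)"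
  by (simp add: regular_rep_def perm_rep_def)

lemma quasi_regular_rep_eq_perm_rep:
  "quasi_regular_rep G H = perm_rep G (lcosets\<^bsub>G\<^esub> H) (\<lambda>g C. g <#\<^bsub>G\<^esub> C)"
  by (simp add: quasi_regular_rep_def perm_rep_def)

lemma basis_perm_rep [simp]: "basis (perm_rep G X \<alpha>) = X"
  by (simp add: perm_rep_def)

lemma act_perm_rep:
  "f \<in> ell2 X \<Longrightarrow> act (perm_rep G X \<alpha>) g f = (\<lambda>x. if x \<in> X then f (\<alpha> (inv\<^bsub>G\<^esub> g) x) else 0)"
  by (simp add: perm_rep_def)

lemma group_act_closed: "group_act G X \<alpha> \<Longrightarrow> g \<in> carrier G \<Longrightarrow> x \<in> X \<Longrightarrow> \<alpha> g x \<in> X"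
  by (simp add: group_act_def)

lemma group_act_cancel:
  fixes G (structure)
  assumes "group G" "group_act G X \<alpha>" "g \<in> carrier G" "x \<in> X"
  shows "\<alpha> (inv\<^bsub>G\<^esub> g) (\<alpha> g x) = x" "\<alpha> g (\<alpha> (inv\<^bsub>G\<^esub> g) x) = x"
proof -
  interpret group G by fact
  show "\<alpha> (inv g) (\<alpha> g x) = x" "\<alpha> g (\<alpha> (inv g) x) = x"
    using assms(2-) inv_closed[OF assms(3)] l_inv[OF assms(3)] r_inv[OF assms(3)]
    unfolding group_act_def by metis+
qed

lemma group_act_bij:
  assumes "group G" "group_act G X \<alpha>" "g \<in> carrier G"
  shows "bij_betw (\<alpha> g) X X"
  by (rule bij_betw_byWitness[where f' = "\<alpha> (inv\<^bsub>G\<^esub> g)"])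
     (use assms group_act_cancel[OF assms] group_act_closed[OF assms(2)] group.inv_closed in auto)

lemma group_act_ell2:
  assumes G: "group G" and \<alpha>: "group_act G X \<alpha>" and g: "g \<in> carrier G" and f: "f \<in> ell2 X"
  shows "(\<lambda>x. if x \<in> X then f (\<alpha> g x) else 0) \<in> ell2 X"
proof -
  have "(\<lambda>x. (cmod (f (\<alpha> g x)))\<^sup>2) summable_on X"
    using summable_on_reindex_bij_betw[OF group_act_bij[OF G \<alpha> g], of "\<lambda>x. (cmod (f x))\<^sup>2"] ell2_summable[OF f]
    by simp
  then have "(\<lambda>x. (cmod (if x \<in> X then f (\<alpha> g x) else 0))\<^sup>2) summable_on X"
    by (subst summable_on_cong[where g = "\<lambda>x. (cmod (f (\<alpha> g x)))\<^sup>2"]) auto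
  then show ?thesis by (simp add: ell2_def)
qed

lemma perm_rep_unitary:
  fixes G (structure)
  assumes G: "group G" and \<alpha>: "group_act G X \<alpha>"
  shows "unitary_rep G (perm_rep G X \<alpha>)"
proof -
  interpret group G by (rule G)
  have maps: "(\<lambda>x. if x \<in> X then f (\<alpha> (inv g) x) else 0) \<in> ell2 X" if "g \<in> carrier G" "f \<in> ell2 X" for g f
    by (rule group_act_ell2[OF G \<alpha> inv_closed]) (use that in auto)
  show ?thesis
  proof (rule unitary_repI[OF G], unfold basis_perm_rep)
    fix g f h assume *: "g \<in> carrier G" "f \<in> ell2 X" "h \<in> ell2 X"
    have "ell2_inner X (act (perm_rep G X \<alpha>) g f) (act (perm_rep G X \<alpha>) g h) =
      (\<Sum>\<^sub>\<infinity>x\<in>X. f (\<alpha> (inv g) x) * cnj (h (\<alpha> (inv g) x)))"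
      using * by (auto simp: ell2_inner_def act_perm_rep intro!: infsum_cong)
    also have "\<dots> = ell2_inner X f h"
      unfolding ell2_inner_def
      by (rule infsum_reindex_bij_betw[OF group_act_bij[OF G \<alpha> inv_closed[OF *(1)]]])
    finally show "ell2_inner X (act (perm_rep G X \<alpha>) g f) (act (perm_rep G X \<alpha>) g h) = ell2_inner X f h" .
  next
    fix g h f assume *: "g \<in> carrier G" "h \<in> carrier G" "f \<in> ell2 X"
    have "\<alpha> (inv (g \<otimes> h)) x = \<alpha> (inv h) (\<alpha> (inv g) x)" if "x \<in> X" for x
      using \<alpha> * that by (simp add: inv_mult_group group_act_def)
    then show "act (perm_rep G X \<alpha>) (g \<otimes> h) f = act (perm_rep G X \<alpha>) g (act (perm_rep G X \<alpha>) h f)"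
      using * maps group_act_closed[OF \<alpha> inv_closed] by (auto simp: act_perm_rep fun_eq_iff)
  next
    fix f assume "f \<in> ell2 X"
    then show "act (perm_rep G X \<alpha>) \<one> f = f"
      using \<alpha> by (auto simp: act_perm_rep group_act_def ell2_outside fun_eq_iff)
  qed (auto simp: act_perm_rep maps ell2_add ell2_scale fun_eq_iff, simp_all add: perm_rep_def)
qed

lemma act_perm_rep_delta:
  assumes G: "group G" and \<alpha>: "group_act G X \<alpha>" and g: "g \<in> carrier G" and x: "x \<in> X"
  shows "act (perm_rep G X \<alpha>) g (delta x) = delta (\<alpha> g x)"
proof -
  have "\<alpha> (inv\<^bsub>G\<^esub> g) y = x \<longleftrightarrow> y = \<alpha> g x" if "y \<in> X" for y
    using group_act_cancel[OF G \<alpha> g] x that by auto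
  then show ?thesis
    using group_act_closed[OF \<alpha> g x] unfolding act_perm_rep[OF delta_ell2[OF x]] by (auto simp: fun_eq_iff delta_def)
qed

lemma regular_group_act: "group G \<Longrightarrow> group_act G (carrier G) (\<lambda>g x. g \<otimes>\<^bsub>G\<^esub> x)"
  by (simp add: group_act_def group.is_monoid monoid.m_closed monoid.l_one monoid.m_assoc)

lemma regular_rep_unitary: "group G \<Longrightarrow> unitary_rep G (regular_rep G)"
  unfolding regular_rep_eq_perm_rep by (rule perm_rep_unitary[OF _ regular_group_act])

lemma lcosets_group_act:
  fixes G (structure)
  assumes G: "group G" and H: "subgroup H G"
  shows "group_act G (lcosets\<^bsub>G\<^esub> H) (\<lambda>g C. g <#\<^bsub>G\<^esub> C)"
proof -
  interpret group G by (rule G)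
  have sub: "C \<subseteq> carrier G" if "C \<in> lcosets H" for C
    using subgroup.lcosets_carrier[OF H G that] .
  have "g <# C \<in> lcosets H" if "g \<in> carrier G" "C \<in> lcosets H" for g C
    using that subgroup.subset[OF H] by (auto simp: LCOSETS_def lcos_m_assoc)
  then show ?thesis
    unfolding group_act_def using sub by (auto simp: lcos_m_assoc lcos_mult_one)
qed

lemma dominated_trans:
  "dominated G \<rho> \<pi> \<Longrightarrow> dominated G \<pi> \<sigma> \<Longrightarrow> dominated G \<rho> \<sigma>"
  by (simp add: dominated_def)

lemma group_alg_intertwine:
  assumes l: "l \<in> group_lists G" and f: "f \<in> ell2 (basis \<rho>)"
    and maps: "\<And>g. g \<in> carrier G \<Longrightarrow> act \<rho> g f \<in> ell2 (basis \<rho>)"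
    and int: "\<And>g. g \<in> carrier G \<Longrightarrow> V (act \<rho> g f) = act \<pi> g (V f)"
    and lin: "\<And>f h. f \<in> ell2 (basis \<rho>) \<Longrightarrow> h \<in> ell2 (basis \<rho>) \<Longrightarrow> V (\<lambda>x. f x + h x) = (\<lambda>x. V f x + V h x)"
      "\<And>c f. f \<in> ell2 (basis \<rho>) \<Longrightarrow> V (\<lambda>x. c * f x) = (\<lambda>x. c * V f x)"
  shows "V (group_alg_op \<rho> l f) = group_alg_op \<pi> l (V f) \<and> group_alg_op \<rho> l f \<in> ell2 (basis \<rho>)"
  using l
proof (induction rule: group_lists_induct)
  case Nil
  then show ?case using lin(2)[OF f, of 0] by simp
next
  case (Cons c g l)
  then show ?case by (simp add: lin maps int ell2_scale ell2_add)
qed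

lemma dominated_intertwiner:
  assumes G: "group G" and \<rho>: "unitary_rep G \<rho>"
    and maps: "\<And>f. f \<in> ell2 (basis \<rho>) \<Longrightarrow> V f \<in> ell2 (basis \<pi>)"
    and norm: "\<And>f. f \<in> ell2 (basis \<rho>) \<Longrightarrow> ell2_norm (basis \<pi>) (V f) = ell2_norm (basis \<rho>) f"
    and int: "\<And>g f. g \<in> carrier G \<Longrightarrow> f \<in> ell2 (basis \<rho>) \<Longrightarrow> V (act \<rho> g f) = act \<pi> g (V f)"
    and lin: "\<And>f h. f \<in> ell2 (basis \<rho>) \<Longrightarrow> h \<in> ell2 (basis \<rho>) \<Longrightarrow> V (\<lambda>x. f x + h x) = (\<lambda>x. V f x + V h x)"
      "\<And>c f. f \<in> ell2 (basis \<rho>) \<Longrightarrow> V (\<lambda>x. c * f x) = (\<lambda>x. c * V f x)"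
  shows "dominated G \<rho> \<pi>"
  unfolding dominated_def
proof (intro ballI allI impI)
  fix l C assume l: "l \<in> group_lists G" and C: "0 \<le> C" "bnd (basis \<pi>) (group_alg_op \<pi> l) C"
  show "bnd (basis \<rho>) (group_alg_op \<rho> l) C"
    unfolding bnd_def
  proof
    fix f assume f: "f \<in> ell2 (basis \<rho>)"
    have V: "V (group_alg_op \<rho> l f) = group_alg_op \<pi> l (V f)"
      and e: "group_alg_op \<rho> l f \<in> ell2 (basis \<rho>)"
      using group_alg_intertwine[OF l f, of V \<pi>] int lin op_maps[OF act_bounded_op[OF G \<rho>] f] f by blast+
    show "ell2_norm (basis \<rho>) (group_alg_op \<rho> l f) \<le> C * ell2_norm (basis \<rho>) f"
      using bndD[OF C(2) maps[OF f]] norm[OF e] norm[OF f] V by simp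
  qed
qed

text \<open>The universal representation collects representations whose basis consists of elements
  of the type of the group, whereas cosets are sets of such elements. An injective relabelling of
  the basis bridges the types.\<close>

lemma perm_rep_transport:
  fixes G (structure)
  assumes G: "group G" and \<alpha>: "group_act G X \<alpha>" and j: "inj_on j X"
  obtains \<beta> where "group_act G (j ` X) \<beta>" "dominated G (perm_rep G X \<alpha>) (perm_rep G (j ` X) \<beta>)"
proof -
  interpret group G by (rule G)
  define k where "k = inv_into X j"
  have k: "k (j x) = x" if "x \<in> X" for x using inv_into_f_f[OF j that] by (simp add: k_def)
  define \<beta> where "\<beta> g y = j (\<alpha> g (k y))" for g y
  have \<beta>: "group_act G (j ` X) \<beta>"
    using \<alpha> by (auto simp: group_act_def \<beta>_def k)
  define V where "V f y = (if y \<in> j ` X then f (k y) else 0)" for f :: "_ \<Rightarrow> complex" and y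
  have bij: "bij_betw k (j ` X) X" unfolding k_def using j by (rule bij_betw_inv_into[OF inj_on_imp_bij_betw])
  have V: "V f \<in> ell2 (j ` X) \<and> ell2_norm (j ` X) (V f) = ell2_norm X f" if f: "f \<in> ell2 X" for f
  proof -
    have "(\<lambda>y. (cmod (f (k y)))\<^sup>2) summable_on j ` X"
      using summable_on_reindex_bij_betw[OF bij, of "\<lambda>x. (cmod (f x))\<^sup>2"] ell2_summable[OF f] by simp
    then have "(\<lambda>y. (cmod (V f y))\<^sup>2) summable_on j ` X"
      by (subst summable_on_cong[where g = "\<lambda>y. (cmod (f (k y)))\<^sup>2"]) (auto simp: V_def)
    moreover have "(\<Sum>\<^sub>\<infinity>y\<in>j ` X. (cmod (V f y))\<^sup>2) = (\<Sum>\<^sub>\<infinity>y\<in>j ` X. (cmod (f (k y)))\<^sup>2)"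
      by (rule infsum_cong) (simp add: V_def)
    ultimately show ?thesis
      using infsum_reindex_bij_betw[OF bij, of "\<lambda>x. (cmod (f x))\<^sup>2"] by (auto simp: ell2_def ell2_norm_def V_def)
  qed
  have "dominated G (perm_rep G X \<alpha>) (perm_rep G (j ` X) \<beta>)"
  proof (rule dominated_intertwiner[OF G perm_rep_unitary[OF G \<alpha>], of V], unfold basis_perm_rep)
    fix g f assume "g \<in> carrier G" "f \<in> ell2 X"
    then show "V (act (perm_rep G X \<alpha>) g f) = act (perm_rep G (j ` X) \<beta>) g (V f)"
      using V group_act_closed[OF \<alpha> inv_closed]
      by (auto simp: act_perm_rep V_def k \<beta>_def fun_eq_iff)
  qed (use V in \<open>auto simp: V_def fun_eq_iff\<close>)
  with \<beta> that show ?thesis by blast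
qed

section \<open>Direct sums and the universal representation\<close>

context
  fixes G :: "('g, 'm) monoid_scheme" (structure) and R :: "('g, 'x) rep set"
  assumes G: "group G" and R: "\<And>\<pi>. \<pi> \<in> R \<Longrightarrow> unitary_rep G \<pi>"
begin

interpretation group G by (rule G)

lemma direct_sum_simps:
  "basis (direct_sum_rep R) = Sigma R basis"
  "f \<in> ell2 (Sigma R basis) \<Longrightarrow> act (direct_sum_rep R) g f =
     (\<lambda>(\<pi>, x). if (\<pi>, x) \<in> Sigma R basis then act \<pi> g (\<lambda>y. f (\<pi>, y)) x else 0)"
  "f \<notin> ell2 (Sigma R basis) \<Longrightarrow> act (direct_sum_rep R) g f = (\<lambda>x. 0)"
  by (auto simp: direct_sum_rep_def Let_def)

lemma fiber_ell2:
  assumes f: "f \<in> ell2 (Sigma R basis)" and \<pi>: "\<pi> \<in> R"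
  shows "(\<lambda>y. f (\<pi>, y)) \<in> ell2 (basis \<pi>)"
proof -
  have "(\<lambda>(\<pi>, y). (cmod (f (\<pi>, y)))\<^sup>2) summable_on Sigma R basis"
    using ell2_summable[OF f] by (simp add: case_prod_unfold)
  from summable_on_SigmaD1[OF this \<pi>] show ?thesis
    using ell2_outside[OF f] by (auto simp: ell2_def)
qed

lemma direct_sum_act_fiber:
  assumes f: "f \<in> ell2 (Sigma R basis)" and \<pi>: "\<pi> \<in> R" and g: "g \<in> carrier G"
  shows "(\<lambda>y. act (direct_sum_rep R) g f (\<pi>, y)) = act \<pi> g (\<lambda>y. f (\<pi>, y))"
  using op_maps[OF act_bounded_op[OF G R[OF \<pi>] g] fiber_ell2[OF f \<pi>]] \<pi>
  by (auto simp: direct_sum_simps(2)[OF f] ell2_outside fun_eq_iff)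

lemma direct_sum_maps:
  assumes f: "f \<in> ell2 (Sigma R basis)" and g: "g \<in> carrier G"
  shows "act (direct_sum_rep R) g f \<in> ell2 (Sigma R basis)"
proof -
  let ?n = "\<lambda>\<pi>. (ell2_norm (basis \<pi>) (\<lambda>y. f (\<pi>, y)))\<^sup>2"
  have fib: "((\<lambda>y. (cmod (h y))\<^sup>2) has_sum (ell2_norm (basis \<pi>) h)\<^sup>2) (basis \<pi>)"
    if "h \<in> ell2 (basis \<pi>)" for \<pi> and h :: "'x \<Rightarrow> complex"
    unfolding ell2_norm_sq using ell2_summable[OF that] by simp
  have "?n summable_on R"
    unfolding ell2_norm_sq
    by (rule summable_on_SigmaD[of "\<lambda>p. (cmod (f p))\<^sup>2"])
       (use ell2_summable[OF f] ell2_summable[OF fiber_ell2[OF f]] in auto)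
  then have "(\<lambda>p. (cmod (act (direct_sum_rep R) g f p))\<^sup>2) summable_on Sigma R basis"
  proof (rule summable_on_SigmaI[rotated])
    fix \<pi> assume \<pi>: "\<pi> \<in> R"
    note e = op_maps[OF act_bounded_op[OF G R[OF \<pi>] g] fiber_ell2[OF f \<pi>]]
    show "((\<lambda>y. (cmod (act (direct_sum_rep R) g f (\<pi>, y)))\<^sup>2) has_sum ?n \<pi>) (basis \<pi>)"
      using fib[OF e] fun_cong[OF direct_sum_act_fiber[OF f \<pi> g]]
      by (simp add: act_norm[OF G R[OF \<pi>] g fiber_ell2[OF f \<pi>]])
  qed simp
  then show ?thesis by (auto simp: ell2_def direct_sum_simps(2)[OF f])
qed

lemma direct_sum_inner:
  assumes "f \<in> ell2 (Sigma R basis)" "h \<in> ell2 (Sigma R basis)"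
  shows "ell2_inner (Sigma R basis) f h =
    (\<Sum>\<^sub>\<infinity>\<pi>\<in>R. ell2_inner (basis \<pi>) (\<lambda>y. f (\<pi>, y)) (\<lambda>y. h (\<pi>, y)))"
  unfolding ell2_inner_def
  using infsum_Sigma_banach[OF ell2_summable_mult[OF assms]] by simp

lemma direct_sum_unitary: "unitary_rep G (direct_sum_rep R)"
proof (rule unitary_repI[OF G], unfold direct_sum_simps(1))
  let ?X = "Sigma R basis" and ?\<Pi> = "direct_sum_rep R"
  fix g assume g: "g \<in> carrier G"
  note ops = act_bounded_op[OF G R g]
  fix f assume f: "f \<in> ell2 ?X"
  show "act ?\<Pi> g f \<in> ell2 ?X" by (rule direct_sum_maps[OF f g])
  show "act ?\<Pi> g (\<lambda>x. c * f x) = (\<lambda>x. c * act ?\<Pi> g f x)" for c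
    by (auto simp: direct_sum_simps(2) f ell2_scale fun_eq_iff op_scale[OF ops fiber_ell2[OF f]])
  fix h assume h: "h \<in> ell2 ?X"
  show "act ?\<Pi> g (\<lambda>x. f x + h x) = (\<lambda>x. act ?\<Pi> g f x + act ?\<Pi> g h x)"
    by (auto simp: direct_sum_simps(2) f h ell2_add fun_eq_iff op_add[OF ops fiber_ell2[OF f] fiber_ell2[OF h]])
  show "ell2_inner ?X (act ?\<Pi> g f) (act ?\<Pi> g h) = ell2_inner ?X f h"
    unfolding direct_sum_inner[OF f h] direct_sum_inner[OF direct_sum_maps[OF f g] direct_sum_maps[OF h g]]
    by (rule infsum_cong)
       (simp add: direct_sum_act_fiber f h g act_inner[OF G R g fiber_ell2[OF f] fiber_ell2[OF h]])
next
  let ?X = "Sigma R basis" and ?\<Pi> = "direct_sum_rep R"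
  fix g h f assume g: "g \<in> carrier G" and h: "h \<in> carrier G" and f: "f \<in> ell2 ?X"
  show "act ?\<Pi> (g \<otimes> h) f = act ?\<Pi> g (act ?\<Pi> h f)"
    by (auto simp: direct_sum_simps(2)[OF f, of "g \<otimes> h"] direct_sum_simps(2)[OF direct_sum_maps[OF f h], of g]
        direct_sum_act_fiber[OF f _ h] act_mult[OF G R g h] fun_eq_iff)
next
  let ?X = "Sigma R basis" and ?\<Pi> = "direct_sum_rep R"
  fix f assume f: "f \<in> ell2 ?X"
  show "act ?\<Pi> \<one> f = f"
    using ell2_outside[OF f]
    by (auto simp: direct_sum_simps(2)[OF f] act_one[OF G R] fiber_ell2[OF f] fun_eq_iff)
qed (simp add: direct_sum_simps)

definition summand_embedding :: "('g, 'x) rep \<Rightarrow> ('x \<Rightarrow> complex) \<Rightarrow> ('g, 'x) rep \<times> 'x \<Rightarrow> complex" where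
  "summand_embedding \<pi> f = (\<lambda>(\<pi>', x). if \<pi>' = \<pi> then f x else 0)"

lemma summand_embedding:
  assumes \<pi>: "\<pi> \<in> R" and f: "f \<in> ell2 (basis \<pi>)"
  shows "summand_embedding \<pi> f \<in> ell2 (Sigma R basis)"
    and "ell2_norm (Sigma R basis) (summand_embedding \<pi> f) = ell2_norm (basis \<pi>) f"
    and "g \<in> carrier G \<Longrightarrow> act (direct_sum_rep R) g (summand_embedding \<pi> f) = summand_embedding \<pi> (act \<pi> g f)"
proof -
  have hs: "((\<lambda>p. (cmod (summand_embedding \<pi> f p))\<^sup>2) has_sum (ell2_norm (basis \<pi>) f)\<^sup>2) (Sigma R basis)"
  proof -
    have "((\<lambda>x. (cmod (f x))\<^sup>2) has_sum (ell2_norm (basis \<pi>) f)\<^sup>2) (basis \<pi>)"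
      unfolding ell2_norm_sq using ell2_summable[OF f] by simp
    then have "((\<lambda>p. (cmod (summand_embedding \<pi> f p))\<^sup>2) has_sum (ell2_norm (basis \<pi>) f)\<^sup>2) (Pair \<pi> ` basis \<pi>)"
      by (subst has_sum_reindex) (auto simp: inj_on_def o_def summand_embedding_def)
    then show ?thesis
      by (rule has_sum_cong_neutral[THEN iffD1, rotated -1])
         (use \<pi> in \<open>auto simp: summand_embedding_def split: if_splits\<close>)
  qed
  show e: "summand_embedding \<pi> f \<in> ell2 (Sigma R basis)"
    using hs \<pi> ell2_outside[OF f] has_sum_imp_summable[OF hs] by (auto simp: ell2_def summand_embedding_def)
  show "ell2_norm (Sigma R basis) (summand_embedding \<pi> f) = ell2_norm (basis \<pi>) f"
    by (simp add: ell2_norm_def[of "Sigma R basis"] infsumI[OF hs])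
  assume g: "g \<in> carrier G"
  have z: "act \<pi>' g (\<lambda>y. 0) = (\<lambda>y. 0)" if "\<pi>' \<in> R" for \<pi>' by (rule op_zero[OF act_bounded_op[OF G R[OF that] g]])
  have out: "act \<pi> g f x = 0" if "x \<notin> basis \<pi>" for x
    using op_maps[OF act_bounded_op[OF G R[OF \<pi>] g] f] that by (rule ell2_outside)
  show "act (direct_sum_rep R) g (summand_embedding \<pi> f) = summand_embedding \<pi> (act \<pi> g f)"
    unfolding direct_sum_simps(2)[OF e] using \<pi> z out
    by (auto simp: summand_embedding_def fun_eq_iff)
qed

lemma dominated_summand:
  assumes \<pi>: "\<pi> \<in> R" shows "dominated G \<pi> (direct_sum_rep R)"
  by (rule dominated_intertwiner[OF G R[OF \<pi>], of "summand_embedding \<pi>"], unfold direct_sum_simps(1))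
     (use summand_embedding[OF \<pi>] in \<open>auto simp: summand_embedding_def fun_eq_iff\<close>)

end

lemma universal_rep_unitary: "group G \<Longrightarrow> unitary_rep G (universal_rep G)"
  unfolding universal_rep_def by (rule direct_sum_unitary) auto

lemma universal_rep_dominates:
  fixes G :: "('g, 'm) monoid_scheme" and j :: "'x \<Rightarrow> 'g"
  assumes G: "group G" and \<alpha>: "group_act G X \<alpha>" and j: "inj_on j X"
  shows "dominated G (perm_rep G X \<alpha>) (universal_rep G)"
proof -
  obtain \<beta> where \<beta>: "group_act G (j ` X) \<beta>" "dominated G (perm_rep G X \<alpha>) (perm_rep G (j ` X) \<beta>)"
    using perm_rep_transport[OF G \<alpha> j] .
  have "dominated G (perm_rep G (j ` X) \<beta>) (universal_rep G)"
    unfolding universal_rep_def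
    by (rule dominated_summand[OF G]) (use perm_rep_unitary[OF G \<beta>(1)] in auto)
  with \<beta>(2) show ?thesis by (rule dominated_trans)
qed

section \<open>Averages, fixed vectors and spectral gaps\<close>

definition fixed_vector :: "('g, 'x) rep \<Rightarrow> 'g set \<Rightarrow> ('x \<Rightarrow> complex) \<Rightarrow> bool" where
  "fixed_vector \<pi> E \<xi> \<longleftrightarrow> \<xi> \<in> ell2 (basis \<pi>) \<and> ell2_norm (basis \<pi>) \<xi> = 1 \<and> (\<forall>g\<in>E. act \<pi> g \<xi> = \<xi>)"

text \<open>The trivial representation is the permutation representation on one point, hence a
  summand of the universal one. Its fixed vector rules out gaps in the maximal C*-algebra.\<close>

lemma universal_rep_fixed_vector:
  fixes G :: "('g, 'm) monoid_scheme"
  assumes G: "group G"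
  shows "\<exists>\<xi>. fixed_vector (universal_rep G) (carrier G) \<xi>"
proof -
  let ?x = "\<one>\<^bsub>G\<^esub>"
  let ?\<pi> = "perm_rep G {?x} (\<lambda>g x. x)"
  have a: "group_act G {?x} (\<lambda>g x. x)" by (simp add: group_act_def)
  have u: "?\<pi> \<in> {\<pi>. unitary_rep G \<pi>}" using perm_rep_unitary[OF G a] by simp
  have d: "delta ?x \<in> ell2 (basis ?\<pi>)" by (simp add: delta_ell2)
  have "act ?\<pi> g (delta ?x) = delta ?x" if "g \<in> carrier G" for g
    using act_perm_rep_delta[OF G a that] by simp
  then show ?thesis
    using summand_embedding[OF G _ u d] ell2_norm_delta[of ?x "{?x}"]
    unfolding universal_rep_def fixed_vector_def
    by (intro exI[of _ "summand_embedding ?\<pi> (delta ?x)"]) (auto simp: direct_sum_rep_def Let_def)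
qed

definition average_list :: "'g list \<Rightarrow> (complex \<times> 'g) list" where
  "average_list gs = map (\<lambda>g. (of_real (1 / length gs), g)) gs"

lemma average_group_lists: "set gs \<subseteq> carrier G \<Longrightarrow> average_list gs \<in> group_lists G"
  by (auto simp: average_list_def group_lists_def)

lemma group_alg_op_sum_list:
  "group_alg_op \<pi> l f x = (\<Sum>(c, g)\<leftarrow>l. c * act \<pi> g f x)"
  by (induction l) auto

lemma average_apply:
  "group_alg_op \<pi> (average_list gs) f x = of_real (1 / length gs) * (\<Sum>g\<leftarrow>gs. act \<pi> g f x)"
  by (simp add: group_alg_op_sum_list average_list_def o_def sum_list_const_mult del: of_real_divide)

lemma average_fixed:
  assumes "fixed_vector \<pi> E \<xi>" "set gs \<subseteq> E" "gs \<noteq> []"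
  shows "group_alg_op \<pi> (average_list gs) \<xi> = \<xi>"
proof
  fix x
  have "map (\<lambda>g. act \<pi> g \<xi> x) gs = map (\<lambda>g. \<xi> x) gs"
    using assms(1,2) by (auto simp: fixed_vector_def)
  then have "(\<Sum>g\<leftarrow>gs. act \<pi> g \<xi> x) = of_nat (length gs) * \<xi> x"
    by (simp only: sum_list_triv)
  then show "group_alg_op \<pi> (average_list gs) \<xi> x = \<xi> x"
    using assms(3) by (simp add: average_apply)
qed

context
  fixes G :: "('g, 'm) monoid_scheme" and \<pi> :: "('g, 'x) rep"
  assumes G: "group G" and \<pi>: "unitary_rep G \<pi>"
begin

lemma group_alg_in_Cstar: "l \<in> group_lists G \<Longrightarrow> group_alg_op \<pi> l \<in> carrier (Cstar_rep G \<pi>)"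
  using approx_pair_group_alg[OF G \<pi> \<pi>] by (simp add: carrier_Cstar_rep[OF G \<pi>])

lemma act_in_Cstar: "g \<in> carrier G \<Longrightarrow> act \<pi> g \<in> carrier (Cstar_rep G \<pi>)"
  using approx_pair_act[OF G \<pi> \<pi>] by (simp add: carrier_Cstar_rep[OF G \<pi>])

lemma Cstar_closed:
  "A \<in> carrier (Cstar_rep G \<pi>) \<Longrightarrow> A \<in> bounded_ops (basis \<pi>)"
  "A \<in> carrier (Cstar_rep G \<pi>) \<Longrightarrow> B \<in> carrier (Cstar_rep G \<pi>) \<Longrightarrow> A \<circ> B \<in> carrier (Cstar_rep G \<pi>)"
  "A \<in> carrier (Cstar_rep G \<pi>) \<Longrightarrow> B \<in> carrier (Cstar_rep G \<pi>) \<Longrightarrow>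
     (\<lambda>f x. A f x + B f x) \<in> carrier (Cstar_rep G \<pi>)"
  "A \<in> carrier (Cstar_rep G \<pi>) \<Longrightarrow> (\<lambda>f x. c * A f x) \<in> carrier (Cstar_rep G \<pi>)"
  "op_id (basis \<pi>) \<in> carrier (Cstar_rep G \<pi>)"
  unfolding carrier_Cstar_rep[OF G \<pi>]
  by (simp_all only: mem_Collect_eq approx_pair_ops(1) approx_pair_comp[OF G \<pi> \<pi>] approx_pair_add[OF G \<pi> \<pi>]
      approx_pair_scale[OF G \<pi> \<pi>] approx_pair_id[OF G \<pi> \<pi>])

lemma group_alg_inverse:
  assumes l: "l \<in> group_lists G" and b: "bnd (basis \<pi>) (group_alg_op \<pi> l) \<kappa>" "0 \<le> \<kappa>" "\<kappa> < 1"
  shows "\<exists>R\<in>carrier (Cstar_rep G \<pi>). R \<circ> group_alg_op \<pi> ((1, \<one>\<^bsub>G\<^esub>) # scale_list (-1) l) = op_id (basis \<pi>)"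
proof -
  let ?K = "group_alg_op \<pi> l" and ?D = "group_alg_op \<pi> ((1, \<one>\<^bsub>G\<^esub>) # scale_list (-1) l)"
  have one: "\<one>\<^bsub>G\<^esub> \<in> carrier G" using G by (simp add: group.is_monoid monoid.one_closed)
  obtain R where R: "approx_pair G \<pi> \<pi> R R" "\<And>f. f \<in> ell2 (basis \<pi>) \<Longrightarrow> R (\<lambda>x. f x - ?K f x) = f"
    using neumann_pair[OF G \<pi> \<pi> approx_pair_group_alg[OF G \<pi> \<pi> l] b(2,3,1,1)] approx_pair_refl(1) by blast
  have RK: "R \<in> carrier (Cstar_rep G \<pi>)" using R(1) by (simp add: carrier_Cstar_rep[OF G \<pi>])
  have DK: "?D \<in> carrier (Cstar_rep G \<pi>)"
    by (rule group_alg_in_Cstar) (simp add: one scale_group_lists l)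
  have "?D f = (\<lambda>x. f x - ?K f x)" if "f \<in> ell2 (basis \<pi>)" for f
    using that by (simp add: act_one[OF G \<pi>] group_alg_op_scale)
  then have "R \<circ> ?D = op_id (basis \<pi>)"
    by (intro op_ext[of _ "basis \<pi>"] Cstar_closed(1)[OF Cstar_closed(2)[OF RK DK]] id_bounded_op)
       (simp add: R(2))
  with RK show ?thesis by blast
qed

lemma no_inverse_fixed:
  assumes "fixed_vector \<pi> E \<xi>" "set gs \<subseteq> E" "gs \<noteq> []" "E \<subseteq> carrier G"
    and R: "R \<in> bounded_ops (basis \<pi>)"
    and inv: "R \<circ> group_alg_op \<pi> ((1, \<one>\<^bsub>G\<^esub>) # scale_list (-1) (average_list gs)) = op_id (basis \<pi>)"
  shows False
proof -
  have xi: "\<xi> \<in> ell2 (basis \<pi>)" "ell2_norm (basis \<pi>) \<xi> = 1" using assms(1) by (auto simp: fixed_vector_def)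
  have "group_alg_op \<pi> ((1, \<one>\<^bsub>G\<^esub>) # scale_list (-1) (average_list gs)) \<xi> = (\<lambda>x. 0)"
    using xi(1) average_fixed[OF assms(1-3)] by (simp add: act_one[OF G \<pi>] group_alg_op_scale)
  then have "R (\<lambda>x. 0) = \<xi>" using fun_cong[OF inv, of \<xi>] xi(1) by simp
  then have "\<xi> = (\<lambda>x. 0)" by (simp add: op_zero[OF R])
  with xi(2) show False by simp
qed

end

lemma star_hom_group_alg:
  assumes G: "group G" and \<pi>: "unitary_rep G \<pi>" and \<rho>: "unitary_rep G \<rho>"
    and \<phi>: "\<phi> \<in> star_hom (Cstar_rep G \<pi>) (Cstar_rep G \<rho>)"
    and act: "\<And>g. g \<in> carrier G \<Longrightarrow> \<phi> (act \<pi> g) = act \<rho> g"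
    and l: "l \<in> group_lists G"
  shows "\<phi> (group_alg_op \<pi> l) = group_alg_op \<rho> l"
proof -
  have sc: "\<phi> (\<lambda>f x. c * A f x) = (\<lambda>f x. c * \<phi> A f x)" if "A \<in> carrier (Cstar_rep G \<pi>)" for c A
    using \<phi> that by (simp add: star_hom_def)
  have ad: "\<phi> (\<lambda>f x. A f x + B f x) = (\<lambda>f x. \<phi> A f x + \<phi> B f x)"
    if "A \<in> carrier (Cstar_rep G \<pi>)" "B \<in> carrier (Cstar_rep G \<pi>)" for A B
    using \<phi> that by (simp add: star_hom_def ring_hom_def)
  show ?thesis
    using l
  proof (induction rule: group_lists_induct)
    case Nil
    show ?case using sc[OF Cstar_closed(5)[OF G \<pi>], of 0] by simp
  next
    case (Cons c g l)
    then show ?case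
      by (simp add: ad[OF Cstar_closed(4)[OF G \<pi> act_in_Cstar[OF G \<pi>]] group_alg_in_Cstar[OF G \<pi>]] sc[OF act_in_Cstar[OF G \<pi>]] act)
  qed
qed

text \<open>The inverse of 1 minus the average is mapped to a left inverse of an operator that
  annihilates the fixed vector.\<close>

lemma gap_no_hom_to_fixed:
  assumes G: "group G" and \<pi>: "unitary_rep G \<pi>" and \<rho>: "unitary_rep G \<rho>"
    and \<phi>: "\<phi> \<in> star_hom (Cstar_rep G \<pi>) (Cstar_rep G \<rho>)"
    and act: "\<And>g. g \<in> carrier G \<Longrightarrow> \<phi> (act \<pi> g) = act \<rho> g"
    and fixed: "fixed_vector \<rho> E \<xi>" "set gs \<subseteq> E" "gs \<noteq> []" "E \<subseteq> carrier G"
    and gap: "bnd (basis \<pi>) (group_alg_op \<pi> (average_list gs)) \<kappa>" "0 \<le> \<kappa>" "\<kappa> < 1"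
  shows False
proof -
  have l: "average_list gs \<in> group_lists G" by (rule average_group_lists) (use fixed in blast)
  have one: "\<one>\<^bsub>G\<^esub> \<in> carrier G" using G by (simp add: group.is_monoid monoid.one_closed)
  let ?l = "(1, \<one>\<^bsub>G\<^esub>) # scale_list (-1) (average_list gs)"
  have l': "?l \<in> group_lists G" by (simp add: one scale_group_lists l)
  obtain R where R: "R \<in> carrier (Cstar_rep G \<pi>)" "R \<circ> group_alg_op \<pi> ?l = op_id (basis \<pi>)"
    using group_alg_inverse[OF G \<pi> l gap] by blast
  have "\<phi> R \<circ> \<phi> (group_alg_op \<pi> ?l) = \<phi> (R \<circ> group_alg_op \<pi> ?l)"
    using \<phi> R(1) group_alg_in_Cstar[OF G \<pi> l'] by (simp add: star_hom_def ring_hom_def)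
  also have "\<dots> = op_id (basis \<rho>)" using \<phi> R(2) by (simp add: star_hom_def ring_hom_def)
  finally have inv: "\<phi> R \<circ> group_alg_op \<rho> ?l = op_id (basis \<rho>)"
    using star_hom_group_alg[OF G \<pi> \<rho> \<phi> act l'] by simp
  have "\<phi> R \<in> bounded_ops (basis \<rho>)"
    by (rule Cstar_closed(1)[OF G \<rho>]) (use \<phi> R(1) in \<open>auto simp: star_hom_def ring_hom_def\<close>)
  from no_inverse_fixed[OF G \<rho> fixed this inv] show False .
qed

text \<open>Here the gap is on the target side, so the inverse has to be pulled back: surjectivity
  provides a preimage, and injectivity makes it a left inverse.\<close>

lemma gap_no_iso_from_fixed:
  assumes G: "group G" and \<pi>: "unitary_rep G \<pi>" and \<rho>: "unitary_rep G \<rho>"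
    and \<phi>: "\<phi> \<in> star_iso (Cstar_rep G \<rho>) (Cstar_rep G \<pi>)"
    and act: "\<And>g. g \<in> carrier G \<Longrightarrow> \<phi> (act \<rho> g) = act \<pi> g"
    and fixed: "fixed_vector \<rho> E \<xi>" "set gs \<subseteq> E" "gs \<noteq> []" "E \<subseteq> carrier G"
    and gap: "bnd (basis \<pi>) (group_alg_op \<pi> (average_list gs)) \<kappa>" "0 \<le> \<kappa>" "\<kappa> < 1"
  shows False
proof -
  have l: "average_list gs \<in> group_lists G" by (rule average_group_lists) (use fixed in blast)
  have one: "\<one>\<^bsub>G\<^esub> \<in> carrier G" using G by (simp add: group.is_monoid monoid.one_closed)
  have hom: "\<phi> \<in> star_hom (Cstar_rep G \<rho>) (Cstar_rep G \<pi>)"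
    and bij: "bij_betw \<phi> (carrier (Cstar_rep G \<rho>)) (carrier (Cstar_rep G \<pi>))"
    using \<phi> by (auto simp: star_iso_def)
  let ?l = "(1, \<one>\<^bsub>G\<^esub>) # scale_list (-1) (average_list gs)"
  have l': "?l \<in> group_lists G" by (simp add: one scale_group_lists l)
  note c = group_alg_in_Cstar[OF G \<rho> l']
  obtain R where R: "R \<in> carrier (Cstar_rep G \<pi>)" "R \<circ> group_alg_op \<pi> ?l = op_id (basis \<pi>)"
    using group_alg_inverse[OF G \<pi> l gap] by blast
  have "R \<in> \<phi> ` carrier (Cstar_rep G \<rho>)" unfolding bij_betw_imp_surj_on[OF bij] by (rule R(1))
  then obtain R' where R': "R = \<phi> R'" "R' \<in> carrier (Cstar_rep G \<rho>)" by (rule imageE)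
  have "\<phi> (R' \<circ> group_alg_op \<rho> ?l) = \<phi> R' \<circ> \<phi> (group_alg_op \<rho> ?l)"
    using hom R'(2) c by (simp add: star_hom_def ring_hom_def)
  also have "\<dots> = op_id (basis \<pi>)"
    using star_hom_group_alg[OF G \<rho> \<pi> hom act l'] R(2) R'(1) by simp
  also have "\<dots> = \<phi> (op_id (basis \<rho>))" using hom by (simp add: star_hom_def ring_hom_def)
  finally have "R' \<circ> group_alg_op \<rho> ?l = op_id (basis \<rho>)"
    by (rule inj_onD[OF bij_betw_imp_inj_on[OF bij] _ Cstar_closed(2)[OF G \<rho> R'(2) c] Cstar_closed(5)[OF G \<rho>]])
  from no_inverse_fixed[OF G \<rho> fixed Cstar_closed(1)[OF G \<rho> R'(2)] this] show False .
qed

lemma sum_list_near: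
  fixes e :: real
  assumes "\<And>g. g \<in> set gs \<Longrightarrow> cmod (1 - s g) \<le> e"
  shows "cmod (of_nat (length gs) - (\<Sum>g\<leftarrow>gs. s g)) \<le> length gs * e"
  using assms
proof (induction gs)
  case (Cons g gs)
  have "cmod (of_nat (length (g # gs)) - (\<Sum>g\<leftarrow>g # gs. s g)) =
      cmod ((1 - s g) + (of_nat (length gs) - (\<Sum>g\<leftarrow>gs. s g)))" by (simp add: algebra_simps)
  also have "\<dots> \<le> cmod (1 - s g) + cmod (of_nat (length gs) - (\<Sum>g\<leftarrow>gs. s g))" by (rule norm_triangle_ineq)
  also have "\<dots> \<le> e + length gs * e" using Cons by (intro add_mono) auto
  finally show ?case by (simp add: algebra_simps)
qed simp

text \<open>The coefficient of the fixed vector is 1 on all of \<open>E\<close>. Its approximants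
  have total mass close to 1, by evaluation at the identity, while their average over
  \<open>gs\<close> is at most \<kappa> times this mass.\<close>

lemma gap_not_weakly_contained:
  assumes G: "group G" and \<pi>: "unitary_rep G \<pi>"
    and fixed: "fixed_vector \<rho> E \<xi>" "set gs \<subseteq> E" "gs \<noteq> []" "E \<subseteq> carrier G" "\<one>\<^bsub>G\<^esub> \<in> E"
    and gap: "bnd (basis \<pi>) (group_alg_op \<pi> (average_list gs)) \<kappa>" "0 \<le> \<kappa>" "\<kappa> < 1"
  shows "\<not> weakly_contained G \<rho> \<pi>"
proof
  assume w: "weakly_contained G \<rho> \<pi>"
  let ?X = "basis \<pi>"
  \<comment> \<open>A quarter of the gap: the estimates end in 1 - \<kappa> <= \<epsilon> (1 +
    \<kappa>), whose right side is then below half of the left.\<close>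
  define \<epsilon> where "\<epsilon> = (1 - \<kappa>) / 4"
  have \<epsilon>: "0 < \<epsilon>" using gap by (simp add: \<epsilon>_def)
  \<comment> \<open>The identity is added so that the approximation also controls the sum of the
    squared norms of the \<eta> i.\<close>
  define F where "F = insert \<one>\<^bsub>G\<^esub> (set gs)"
  have F: "finite F" "F \<subseteq> E" "F \<subseteq> carrier G" using fixed by (auto simp: F_def)
  have xi: "\<xi> \<in> ell2 (basis \<rho>)" "ell2_norm (basis \<rho>) \<xi> = 1" "\<And>g. g \<in> E \<Longrightarrow> act \<rho> g \<xi> = \<xi>"
    using fixed(1) by (auto simp: fixed_vector_def)
  have one: "ell2_inner (basis \<rho>) (act \<rho> g \<xi>) \<xi> = 1" if "g \<in> F" for g
    using xi F(2) that by (auto simp: ell2_inner_self[OF xi(1)])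
  have "\<exists>(n::nat) \<eta>. (\<forall>i<n. \<eta> i \<in> ell2 ?X) \<and> (\<forall>g\<in>F. cmod (ell2_inner (basis \<rho>) (act \<rho> g \<xi>) \<xi> -
      (\<Sum>i<n. ell2_inner ?X (act \<pi> g (\<eta> i)) (\<eta> i))) < \<epsilon>)"
    using w[unfolded weakly_contained_def, rule_format, OF xi(1) conjI[OF F(1,3)] \<epsilon>] .
  then obtain n \<eta> where \<eta>: "\<And>i. i < (n::nat) \<Longrightarrow> \<eta> i \<in> ell2 ?X"
    and near: "\<And>g. g \<in> F \<Longrightarrow> cmod (ell2_inner (basis \<rho>) (act \<rho> g \<xi>) \<xi> -
      (\<Sum>i<n. ell2_inner ?X (act \<pi> g (\<eta> i)) (\<eta> i))) < \<epsilon>" by blast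
  define s where "s g = (\<Sum>i<n. ell2_inner ?X (act \<pi> g (\<eta> i)) (\<eta> i))" for g
  have near: "cmod (1 - s g) \<le> \<epsilon>" if "g \<in> F" for g
    using near[OF that] one[OF that] by (simp add: s_def)
  define N where "N = (\<Sum>i<n. (ell2_norm ?X (\<eta> i))\<^sup>2)"
  have "s \<one>\<^bsub>G\<^esub> = of_real N"
    by (simp add: s_def N_def act_one[OF G \<pi>] \<eta> ell2_inner_self)
  then have "cmod (of_real (1 - N)) \<le> \<epsilon>" using near[of "\<one>\<^bsub>G\<^esub>"] by (simp add: F_def)
  then have N: "N \<le> 1 + \<epsilon>" unfolding norm_of_real by linarith
  let ?A = "group_alg_op \<pi> (average_list gs)" and ?n = "length gs"
  have n0: "0 < ?n" using fixed(3) by simp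
  have gsC: "set gs \<subseteq> carrier G" using fixed by blast
  have A: "?A \<in> bounded_ops ?X" by (rule group_alg_bounded_op[OF G \<pi> average_group_lists[OF gsC]])
  have inner: "ell2_inner ?X (group_alg_op \<pi> l f) f = (\<Sum>(c, g)\<leftarrow>l. c * ell2_inner ?X (act \<pi> g f) f)"
    if "l \<in> group_lists G" "f \<in> ell2 ?X" for l f
    using that(1)
  proof (induction rule: group_lists_induct)
    case (Cons c g l)
    then show ?case
      using that(2) op_maps[OF act_bounded_op[OF G \<pi>]] op_maps[OF group_alg_bounded_op[OF G \<pi>]]
      by (simp add: ell2_inner_add_left ell2_inner_scale_left ell2_scale)
  qed (simp add: ell2_inner_def)
  have avg: "ell2_inner ?X (?A (\<eta> i)) (\<eta> i) = of_real (1 / ?n) * (\<Sum>g\<leftarrow>gs. ell2_inner ?X (act \<pi> g (\<eta> i)) (\<eta> i))"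
    if "i < n" for i
    unfolding inner[OF average_group_lists[OF gsC] \<eta>[OF that]]
    by (simp add: average_list_def o_def sum_list_const_mult del: of_real_divide)
  have swap: "(\<Sum>i<n. \<Sum>g\<leftarrow>gs. h i g) = (\<Sum>g\<leftarrow>gs. \<Sum>i<n. h i g)" for h :: "nat \<Rightarrow> _ \<Rightarrow> complex"
    by (induction gs) (simp_all add: sum.distrib)
  have tot: "(\<Sum>i<n. ell2_inner ?X (?A (\<eta> i)) (\<eta> i)) = of_real (1 / ?n) * (\<Sum>g\<leftarrow>gs. s g)"
    by (simp add: avg s_def swap[symmetric] sum_distrib_left del: of_real_divide)
  have "cmod (of_nat ?n - (\<Sum>g\<leftarrow>gs. s g)) \<le> ?n * \<epsilon>"
    by (rule sum_list_near[OF near]) (simp add: F_def)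
  then have "real ?n - cmod (\<Sum>g\<leftarrow>gs. s g) \<le> ?n * \<epsilon>"
    using norm_triangle_ineq2[of "of_nat ?n" "\<Sum>g\<leftarrow>gs. s g"] by simp
  then have "?n * (1 - \<epsilon>) \<le> cmod (\<Sum>g\<leftarrow>gs. s g)" by (simp add: algebra_simps)
  also have "\<dots> = ?n * cmod (\<Sum>i<n. ell2_inner ?X (?A (\<eta> i)) (\<eta> i))"
    unfolding tot using n0 by (simp add: norm_mult norm_divide)
  finally have "1 - \<epsilon> \<le> cmod (\<Sum>i<n. ell2_inner ?X (?A (\<eta> i)) (\<eta> i))" using n0 by simp
  also have "\<dots> \<le> (\<Sum>i<n. \<kappa> * (ell2_norm ?X (\<eta> i))\<^sup>2)"
  proof (rule sum_norm_le)
    fix i assume "i \<in> {..<n}"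
    then have e: "\<eta> i \<in> ell2 ?X" using \<eta> by simp
    have "cmod (ell2_inner ?X (?A (\<eta> i)) (\<eta> i)) \<le> ell2_norm ?X (?A (\<eta> i)) * ell2_norm ?X (\<eta> i)"
      by (rule ell2_Cauchy_Schwarz[OF op_maps[OF A e] e])
    also have "\<dots> \<le> \<kappa> * ell2_norm ?X (\<eta> i) * ell2_norm ?X (\<eta> i)"
      by (intro mult_right_mono bndD[OF gap(1) e]) simp
    finally show "cmod (ell2_inner ?X (?A (\<eta> i)) (\<eta> i)) \<le> \<kappa> * (ell2_norm ?X (\<eta> i))\<^sup>2"
      by (simp add: power2_eq_square mult.assoc)
  qed
  also have "\<dots> = \<kappa> * N" by (simp add: N_def sum_distrib_left)
  also have "\<dots> \<le> \<kappa> * (1 + \<epsilon>)" by (rule mult_left_mono[OF N gap(2)])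
  finally have "1 - \<kappa> \<le> \<epsilon> * (1 + \<kappa>)" by (simp add: algebra_simps)
  also have "\<dots> \<le> \<epsilon> * 2" using \<epsilon> gap by (intro mult_left_mono) auto
  finally show False using gap(3) by (simp add: \<epsilon>_def)
qed

section \<open>The p-adic absolute value and projective germs\<close>

definition padic_abs :: "nat \<Rightarrow> rat \<Rightarrow> real" where
  "padic_abs p x = (if x = 0 then 0 else
     real p powi (int (multiplicity (int p) (snd (quotient_of x))) - int (multiplicity (int p) (fst (quotient_of x)))))"

context
  fixes p :: nat assumes p: "prime p"
begin

lemma padic_abs_zero_iff [simp]: "padic_abs p x = 0 \<longleftrightarrow> x = 0"
  using prime_gt_0_nat[OF p] by (simp add: padic_abs_def)

lemma padic_abs_nonneg [simp]: "0 \<le> padic_abs p x"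
  by (simp add: padic_abs_def)

lemma padic_abs_fraction:
  assumes "a \<noteq> 0" "b \<noteq> 0"
  shows "padic_abs p (of_int a / of_int b) = real p powi (int (multiplicity (int p) b) - int (multiplicity (int p) a))"
proof -
  let ?x = "of_int a / of_int b :: rat"
  obtain n d where nd: "quotient_of ?x = (n, d)" by (cases "quotient_of ?x")
  have d: "0 < d" using quotient_of_denom_pos[OF nd] .
  have x: "?x = of_int n / of_int d" using quotient_of_div[OF nd] .
  then have n: "n \<noteq> 0" using assms d by auto
  have "(of_int (a * d) :: rat) = of_int (n * b)" using x assms d by (simp add: field_simps)
  then have eq: "a * d = n * b" by (simp only: of_int_eq_iff)
  have pe: "prime_elem (int p)" using p by auto
  have "multiplicity (int p) a + multiplicity (int p) d = multiplicity (int p) n + multiplicity (int p) b"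
    using arg_cong[OF eq, of "multiplicity (int p)"] assms d n
    by (simp add: prime_elem_multiplicity_mult_distrib[OF pe])
  then have "int (multiplicity (int p) d) - int (multiplicity (int p) n) =
      int (multiplicity (int p) b) - int (multiplicity (int p) a)" by linarith
  moreover have "?x \<noteq> 0" using assms by simp
  ultimately show ?thesis by (simp only: padic_abs_def nd if_False fst_conv snd_conv)
qed

lemma rat_fraction: "\<exists>a b. (x :: rat) = of_int a / of_int b \<and> b \<noteq> 0 \<and> coprime a b"
proof -
  obtain n d where nd: "quotient_of x = (n, d)" by (cases "quotient_of x")
  show ?thesis using quotient_of_div[OF nd] quotient_of_denom_pos[OF nd] quotient_of_coprime[OF nd]
    by (intro exI[of _ n] exI[of _ d]) auto
qed

lemma padic_abs_mult: "padic_abs p (x * y) = padic_abs p x * padic_abs p y"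
proof (cases "x = 0 \<or> y = 0")
  case False
  obtain a b where x: "x = of_int a / of_int b" "b \<noteq> 0" using rat_fraction by blast
  obtain c d where y: "y = of_int c / of_int d" "d \<noteq> 0" using rat_fraction by blast
  have ac: "a \<noteq> 0" "c \<noteq> 0" using False x y by auto
  have pe: "prime_elem (int p)" using p by auto
  have xy: "x * y = of_int (a * c) / of_int (b * d)" using x y by simp
  show ?thesis
    unfolding xy unfolding x(1) y(1)
    using ac x(2) y(2) prime_gt_0_nat[OF p]
    by (simp add: padic_abs_fraction prime_elem_multiplicity_mult_distrib[OF pe] power_int_add[symmetric]
        del: of_int_mult) (simp add: algebra_simps)
qed (auto simp: padic_abs_def)

text \<open>The unit ball is the localisation of the integers at p. Its closure under addition is
  visible from fractions, and \<open>padic_abs_add\<close> follows from it by scaling.\<close>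

lemma padic_abs_le_1_iff: "padic_abs p x \<le> 1 \<longleftrightarrow> (\<exists>a b. x = of_int a / of_int b \<and> \<not> int p dvd b)"
proof
  assume le: "padic_abs p x \<le> 1"
  obtain a b where x: "x = of_int a / of_int b" "b \<noteq> 0" "coprime a b" using rat_fraction by blast
  have "\<not> int p dvd b"
  proof
    assume b: "int p dvd b"
    then have a: "\<not> int p dvd a" using x(3) p by (meson coprime_common_divisor not_prime_unit prime_nat_int_transfer)
    then have "a \<noteq> 0" by auto
    have "multiplicity (int p) a = 0" by (rule not_dvd_imp_multiplicity_0[OF a])
    moreover have "0 < multiplicity (int p) b"
      using b x(2) p by (subst multiplicity_gt_zero_iff) (auto dest: prime_gt_1_nat)
    ultimately have "padic_abs p x = real p ^ multiplicity (int p) b"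
      unfolding x(1) by (simp add: padic_abs_fraction[OF \<open>a \<noteq> 0\<close> x(2)])
    moreover have "1 < real p ^ multiplicity (int p) b"
      using \<open>0 < multiplicity (int p) b\<close> prime_gt_1_nat[OF p] by (intro one_less_power) auto
    ultimately show False using le by simp
  qed
  with x show "\<exists>a b. x = of_int a / of_int b \<and> \<not> int p dvd b" by blast
next
  assume "\<exists>a b. x = of_int a / of_int b \<and> \<not> int p dvd b"
  then obtain a b where x: "x = of_int a / of_int b" "\<not> int p dvd b" by blast
  then have "b \<noteq> 0" by auto
  show "padic_abs p x \<le> 1"
  proof (cases "a = 0")
    case False
    then show ?thesis
      using x \<open>b \<noteq> 0\<close> not_dvd_imp_multiplicity_0[OF x(2)] prime_gt_0_nat[OF p]
      by (simp add: padic_abs_fraction power_int_minus power_int_of_nat inverse_le_1_iff)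
  qed (simp add: x(1) padic_abs_def)
qed

lemma padic_abs_one [simp]: "padic_abs p 1 = 1"
  using padic_abs_mult[of 1 1] padic_abs_zero_iff[of 1] by (metis mult_1 mult_cancel_left2 zero_neq_one)

lemma padic_abs_minus [simp]: "padic_abs p (- x) = padic_abs p x"
proof -
  have "(padic_abs p (-1))\<^sup>2 = 1" using padic_abs_mult[of "-1" "-1"] by (simp add: power2_eq_square)
  then have "padic_abs p (-1) = 1" using padic_abs_nonneg[of "-1"] by (simp add: power2_eq_1_iff)
  then show ?thesis using padic_abs_mult[of "-1" x] by simp
qed

lemma padic_abs_inverse: "x \<noteq> 0 \<Longrightarrow> padic_abs p (1 / x) = 1 / padic_abs p x"
  using padic_abs_mult[of x "1 / x"] by (simp add: field_simps)

lemma padic_abs_prime: "padic_abs p (of_nat p) = 1 / p"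
proof -
  have "multiplicity (int p) (int p) = 1"
    using p by (intro multiplicity_self) (auto simp: prime_gt_0_nat)
  moreover have "multiplicity (int p) 1 = 0" by simp
  ultimately show ?thesis
    using padic_abs_fraction[of "int p" 1] prime_gt_0_nat[OF p] by (simp add: power_int_minus field_simps)
qed

lemma padic_abs_prime_power: "padic_abs p (of_nat p ^ n) = (1 / p) ^ n"
  by (induction n) (simp_all add: padic_abs_mult padic_abs_prime)

lemma padic_abs_add: "padic_abs p (x + y) \<le> max (padic_abs p x) (padic_abs p y)"
proof -
  have 1: "padic_abs p (u + v) \<le> 1" if uv: "padic_abs p u \<le> 1" "padic_abs p v \<le> 1" for u v
  proof -
    obtain a b where u: "u = of_int a / of_int b" "\<not> int p dvd b" using uv padic_abs_le_1_iff by blast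
    obtain c d where v: "v = of_int c / of_int d" "\<not> int p dvd d" using uv padic_abs_le_1_iff by blast
    have "\<not> int p dvd b * d" using u v p by (simp add: prime_dvd_mult_iff)
    moreover have "b \<noteq> 0" "d \<noteq> 0" using u v by auto
    then have "u + v = of_int (a * d + c * b) / of_int (b * d)" by (simp add: u v field_simps)
    ultimately show ?thesis using padic_abs_le_1_iff by blast
  qed
  have le: "padic_abs p (x + y) \<le> padic_abs p y" if "padic_abs p x \<le> padic_abs p y" for x y
  proof (cases "y = 0")
    case True
    then have "x = 0" using that padic_abs_nonneg[of x] by (simp add: padic_abs_def[of p 0]) 
    with True show ?thesis by simp
  next
    case False
    then have y: "0 < padic_abs p y" using padic_abs_nonneg[of y] padic_abs_zero_iff[of y] by linarith
    have "padic_abs p (x / y) = padic_abs p x / padic_abs p y"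
      using padic_abs_mult[of x "1 / y"] padic_abs_inverse[OF False] by simp
    then have "padic_abs p (x / y) \<le> 1" using that y by simp
    then have "padic_abs p (x / y + 1) \<le> 1" by (rule 1) simp
    moreover have "x + y = (x / y + 1) * y" using False by (simp add: field_simps)
    ultimately show ?thesis using padic_abs_mult[of "x / y + 1" y] y by simp
  qed
  show ?thesis using le[of x y] le[of y x] by (cases "padic_abs p x \<le> padic_abs p y") (auto simp: add.commute)
qed

lemma padic_abs_add_eq: 
  assumes "padic_abs p x < padic_abs p y" shows "padic_abs p (x + y) = padic_abs p y"
proof (rule antisym)
  show "padic_abs p (x + y) \<le> padic_abs p y" using padic_abs_add[of x y] assms by simp
  have "padic_abs p y \<le> max (padic_abs p (x + y)) (padic_abs p x)"
    using padic_abs_add[of "x + y" "- x"] by simp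
  then show "padic_abs p y \<le> padic_abs p (x + y)" using assms by simp
qed

lemma padic_abs_diff: "padic_abs p (x - y) \<le> max (padic_abs p x) (padic_abs p y)"
  using padic_abs_add[of x "- y"] by simp

lemma padic_abs_other_prime: "prime q \<Longrightarrow> q \<noteq> p \<Longrightarrow> padic_abs p (1 / of_nat q) \<le> 1"
  unfolding padic_abs_le_1_iff
  using primes_dvd_imp_eq[of p q] p by (intro exI[of _ 1] exI[of _ "int q"]) auto

lemma S_integers_padic_abs:
  assumes "x \<in> S_integers T" "\<forall>q\<in>T. prime q" "p \<notin> T"
  shows "padic_abs p x \<le> 1"
  using assms(1)
proof induction
  case (inverse_prime q)
  then show ?case using assms by (intro padic_abs_other_prime) auto
next
  case (diff x y)
  then show ?case using padic_abs_diff[of x y] by simp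
next
  case (mult x y)
  then show ?case by (simp add: padic_abs_mult mult_le_one)
qed simp

end

section \<open>Arithmetic of the ring of S-integers\<close>

lemma S_integers_zero: "0 \<in> S_integers T"
  using S_integers.diff[OF S_integers.one S_integers.one] by simp

lemma S_integers_uminus: "x \<in> S_integers T \<Longrightarrow> - x \<in> S_integers T"
  using S_integers.diff[OF S_integers_zero] by fastforce

lemma S_integers_add: "x \<in> S_integers T \<Longrightarrow> y \<in> S_integers T \<Longrightarrow> x + y \<in> S_integers T"
  using S_integers.diff[OF _ S_integers_uminus] by fastforce

lemma S_integers_of_nat: "of_nat n \<in> S_integers T"
  by (induction n) (auto intro: S_integers_zero S_integers_add S_integers.one)

lemma S_integers_of_int: "of_int a \<in> S_integers T"
  by (cases a rule: int_cases2) (auto intro: S_integers_of_nat S_integers_uminus)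

lemma S_integers_power: "x \<in> S_integers T \<Longrightarrow> x ^ n \<in> S_integers T"
  by (induction n) (auto intro: S_integers.one S_integers.mult)

lemma S_integers_mono: "x \<in> S_integers T \<Longrightarrow> T \<subseteq> S \<Longrightarrow> x \<in> S_integers S"
  by (induction rule: S_integers.induct) (auto intro: S_integers.intros)

lemma S_integers_inverse_nat:
  "0 < n \<Longrightarrow> (\<And>q. prime q \<Longrightarrow> q dvd n \<Longrightarrow> q \<in> T) \<Longrightarrow> 1 / of_nat n \<in> S_integers T"
proof (induction n rule: less_induct)
  case (less n)
  show ?case
  proof (cases "n = 1")
    case False
    then obtain q where q: "prime q" "q dvd n" using prime_factor_nat by blast
    then obtain m where m: "n = q * m" by blast
    have "m < n" "0 < m" using less(2) prime_gt_1_nat[OF q(1)] by (auto simp: m)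
    then have "1 / of_nat m \<in> S_integers T" using less by (auto simp: m)
    with S_integers.mult[OF S_integers.inverse_prime[of q T] this] less(3)[OF q]
    show ?thesis by (simp add: m)
  qed (simp add: S_integers.one)
qed

text \<open>The local description of the ring: if x is p-integral at all primes outside
  \<open>T\<close>, only primes of \<open>T\<close> divide its reduced denominator. It later turns
  failure of integrality into growth at one prime.\<close>

lemma not_S_integer_padic:
  assumes x: "x \<notin> S_integers T"
  shows "\<exists>p. prime p \<and> p \<notin> T \<and> 1 < padic_abs p x"
proof (rule ccontr)
  assume *: "\<not> ?thesis"
  obtain a b where ab: "x = of_int a / of_int b" "b \<noteq> 0" "coprime a b" using rat_fraction by blast
  have "q \<in> T" if q: "prime q" "q dvd nat \<bar>b\<bar>" for q
  proof (rule ccontr)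
    assume "q \<notin> T"
    then have "\<not> 1 < padic_abs q x" using * q(1) by blast
    then have "padic_abs q x \<le> 1" by simp
    then obtain c d where cd: "x = of_int c / of_int d" "\<not> int q dvd d"
      using padic_abs_le_1_iff[OF q(1)] by blast
    then have "d \<noteq> 0" by auto
    then have "(of_int (a * d) :: rat) = of_int (c * b)" using ab cd by (simp add: field_simps)
    then have "a * d = c * b" by (simp only: of_int_eq_iff)
    moreover have qb: "int q dvd b" using q(2) by (simp add: int_dvd_int_iff[symmetric])
    ultimately have "int q dvd a * d" by simp
    then have "int q dvd a" using cd(2) q(1) by (simp add: prime_dvd_mult_iff)
    then show False using qb ab(3) q(1) by (meson coprime_common_divisor not_prime_unit prime_nat_int_transfer)
  qed
  then have "1 / of_nat (nat \<bar>b\<bar>) \<in> S_integers T" using ab(2) by (intro S_integers_inverse_nat) auto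
  then have "of_int (a * sgn b) * (1 / of_nat (nat \<bar>b\<bar>)) \<in> S_integers T"
    by (intro S_integers.mult S_integers_of_int)
  moreover have "of_int (a * sgn b) * (1 / of_nat (nat \<bar>b\<bar>)) = x"
    using ab(1,2) by (cases "0 < b") (auto simp: field_simps)
  ultimately show False using x by simp
qed

section \<open>Matrices, fractional linear maps and germs\<close>

type_synonym mat2 = "rat \<times> rat \<times> rat \<times> rat"

definition SL2 :: "rat set \<Rightarrow> mat2 set" where
  "SL2 R = {(a, b, c, d). a \<in> R \<and> b \<in> R \<and> c \<in> R \<and> d \<in> R \<and> a * d - b * c = 1}"

fun denom :: "mat2 \<Rightarrow> real \<Rightarrow> real" where
  "denom (a, b, c, d) x = of_rat c * x + of_rat d"

fun mob :: "mat2 \<Rightarrow> real \<Rightarrow> real" where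
  "mob (a, b, c, d) x = (of_rat a * x + of_rat b) / (of_rat c * x + of_rat d)"

fun mat_mult :: "mat2 \<Rightarrow> mat2 \<Rightarrow> mat2" where
  "mat_mult (a, b, c, d) (a', b', c', d') = (a * a' + b * c', a * b' + b * d', c * a' + d * c', c * b' + d * d')"

fun mat_inv :: "mat2 \<Rightarrow> mat2" where
  "mat_inv (a, b, c, d) = (d, - b, - c, a)"

fun mat_neg :: "mat2 \<Rightarrow> mat2" where
  "mat_neg (a, b, c, d) = (- a, - b, - c, - d)"

lemma SL2_UNIV: "M \<in> SL2 R \<Longrightarrow> M \<in> SL2 UNIV"
  by (auto simp: SL2_def)

lemma SL2_mono: "T \<subseteq> S \<Longrightarrow> M \<in> SL2 (S_integers T) \<Longrightarrow> M \<in> SL2 (S_integers S)"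
  by (auto simp: SL2_def intro: S_integers_mono)

lemma det_mult:
  fixes a :: rat
  assumes "a * d - b * c = 1" "a' * d' - b' * c' = 1"
  shows "(a * a' + b * c') * (c * b' + d * d') - (a * b' + b * d') * (c * a' + d * c') = 1"
proof -
  have "(a * a' + b * c') * (c * b' + d * d') - (a * b' + b * d') * (c * a' + d * c') =
      (a * d - b * c) * (a' * d' - b' * c')"
    by (simp add: algebra_simps)
  then show ?thesis using assms by simp
qed

lemma SL2_mult_UNIV: "M \<in> SL2 UNIV \<Longrightarrow> N \<in> SL2 UNIV \<Longrightarrow> mat_mult M N \<in> SL2 UNIV"
  by (cases M; cases N) (simp add: SL2_def det_mult)

lemma SL2_mult: "M \<in> SL2 (S_integers T) \<Longrightarrow> N \<in> SL2 (S_integers T) \<Longrightarrow> mat_mult M N \<in> SL2 (S_integers T)"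
  by (cases M; cases N) (simp add: SL2_def det_mult S_integers_add S_integers.mult)

lemma SL2_inv_UNIV: "M \<in> SL2 UNIV \<Longrightarrow> mat_inv M \<in> SL2 UNIV"
  by (cases M) (simp add: SL2_def algebra_simps)

lemma SL2_inv: "M \<in> SL2 (S_integers T) \<Longrightarrow> mat_inv M \<in> SL2 (S_integers T)"
  by (cases M) (simp add: SL2_def algebra_simps S_integers_uminus)

lemma SL2_neg: "M \<in> SL2 (S_integers T) \<Longrightarrow> mat_neg M \<in> SL2 (S_integers T)"
  by (cases M) (simp add: SL2_def S_integers_uminus)

lemma SL2_one: "(1, 0, 0, 1) \<in> SL2 (S_integers T)"
  by (simp add: SL2_def S_integers_zero S_integers.one)

lemma mat_mult_assoc: "mat_mult (mat_mult M N) L = mat_mult M (mat_mult N L)"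
  by (cases M; cases N; cases L) (simp add: algebra_simps)

lemma mat_mult_one [simp]: "mat_mult (1, 0, 0, 1) M = M" "mat_mult M (1, 0, 0, 1) = M"
  by (cases M; simp)+

lemma mat_mult_inv:
  "M \<in> SL2 UNIV \<Longrightarrow> mat_mult (mat_inv M) M = (1, 0, 0, 1)"
  "M \<in> SL2 UNIV \<Longrightarrow> mat_mult M (mat_inv M) = (1, 0, 0, 1)"
  by (cases M; simp add: SL2_def algebra_simps)+

lemma
  assumes "denom M x \<noteq> 0"
  shows denom_mult: "denom (mat_mult N M) x = denom N (mob M x) * denom M x"
    and mob_mult: "denom N (mob M x) \<noteq> 0 \<Longrightarrow> mob (mat_mult N M) x = mob N (mob M x)"
proof -
  obtain a b c d where M: "M = (a, b, c, d)" by (cases M)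
  obtain a' b' c' d' where N: "N = (a', b', c', d')" by (cases N)
  let ?D = "of_rat c * x + of_rat d"
  have D: "?D \<noteq> 0" using assms by (simp add: M)
  show *: "denom (mat_mult N M) x = denom N (mob M x) * denom M x"
    using D by (simp add: M N of_rat_add of_rat_mult field_simps)
  have num: "of_rat (a' * a + b' * c) * x + of_rat (a' * b + b' * d) =
      (of_rat a' * mob M x + of_rat b') * ?D"
    using D by (simp add: M of_rat_add of_rat_mult field_simps)
  assume n: "denom N (mob M x) \<noteq> 0"
  have "mob (mat_mult N M) x = ((of_rat a' * mob M x + of_rat b') * ?D) / (denom N (mob M x) * ?D)"
    unfolding num[symmetric] using * by (simp add: M N)
  also have "\<dots> = mob N (mob M x)" using D n by (simp add: N)
  finally show "mob (mat_mult N M) x = mob N (mob M x)" .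
qed

lemma
  assumes M: "M \<in> SL2 UNIV" and D: "denom M x \<noteq> 0"
  shows denom_inv: "denom (mat_inv M) (mob M x) \<noteq> 0"
    and mob_inv: "mob (mat_inv M) (mob M x) = x"
proof -
  have "denom (mat_mult (mat_inv M) M) x = 1" by (simp add: mat_mult_inv[OF M])
  then show n: "denom (mat_inv M) (mob M x) \<noteq> 0" using denom_mult[OF D, of "mat_inv M"] by auto
  have "mob (mat_mult (mat_inv M) M) x = x" by (simp add: mat_mult_inv[OF M])
  then show "mob (mat_inv M) (mob M x) = x" using mob_mult[OF D n] by simp
qed

lemma projective_on_iff:
  "projective_on R I g \<longleftrightarrow> (\<exists>M\<in>SL2 R. \<forall>x\<in>I. denom M x \<noteq> 0 \<and> g x = mob M x)"
  unfolding projective_on_def SL2_def by fastforce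

text \<open>Agreement on a two-sided neighbourhood, with the pole excluded. The matrix is determined
  by the map only up to sign, as \<open>germ_unique\<close> shows for group elements.\<close>

definition germ :: "(real \<Rightarrow> real) \<Rightarrow> real \<Rightarrow> mat2 \<Rightarrow> bool" where
  "germ g x M \<longleftrightarrow> (\<forall>\<^sub>F z in nhds x. denom M z \<noteq> 0 \<and> g z = mob M z)"

lemma germ_at: "germ g x M \<Longrightarrow> denom M x \<noteq> 0 \<and> g x = mob M x"
  unfolding germ_def by (rule eventually_nhds_x_imp_x)

lemma germI_open:
  "open U \<Longrightarrow> x \<in> U \<Longrightarrow> (\<And>z. z \<in> U \<Longrightarrow> denom M z \<noteq> 0 \<and> g z = mob M z) \<Longrightarrow> germ g x M"
  unfolding germ_def eventually_nhds by blast

lemma germ_eventually: "germ g x M \<Longrightarrow> \<forall>\<^sub>F y in nhds x. germ g y M"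
  unfolding germ_def by (simp add: eventually_eventually)

lemma open_germ: "open {y. germ g y M}"
proof (subst open_subopen, intro ballI)
  fix y assume "y \<in> {y. germ g y M}"
  then have "\<forall>\<^sub>F y in nhds y. germ g y M" by (simp add: germ_eventually)
  then obtain U where "open U" "y \<in> U" "\<forall>z\<in>U. germ g z M" unfolding eventually_nhds by blast
  then show "\<exists>U. open U \<and> y \<in> U \<and> U \<subseteq> {y. germ g y M}" by blast
qed

lemma germ_comp:
  assumes "germ g x M" "germ h (g x) N" "isCont g x"
  shows "germ (h \<circ> g) x (mat_mult N M)"
proof -
  have "filterlim g (nhds (g x)) (nhds x)"
    using assms(3) by (simp add: isCont_def tendsto_at_iff_tendsto_nhds)
  then have "\<forall>\<^sub>F z in nhds x. denom N (g z) \<noteq> 0 \<and> h (g z) = mob N (g z)"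
    using assms(2) unfolding germ_def filterlim_iff by blast
  with assms(1)[unfolded germ_def] show ?thesis
    unfolding germ_def by eventually_elim (auto simp: denom_mult mob_mult)
qed

lemma germ_inverse:
  assumes "germ g x M" "M \<in> SL2 UNIV" "\<And>y. g (h y) = y" "h (g x) = x" "isCont h (g x)"
  shows "germ h (g x) (mat_inv M)"
proof -
  have "filterlim h (nhds x) (nhds (g x))"
    using assms(4,5) tendsto_at_iff_tendsto_nhds[of h "g x"] by (simp add: isCont_def)
  then have "\<forall>\<^sub>F w in nhds (g x). denom M (h w) \<noteq> 0 \<and> g (h w) = mob M (h w)"
    using assms(1) unfolding germ_def filterlim_iff by blast
  then show ?thesis
    unfolding germ_def
  proof eventually_elim
    case (elim w)
    then have "w = mob M (h w)" using assms(3) by simp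
    with denom_inv[OF assms(2), of "h w"] mob_inv[OF assms(2), of "h w"] elim show ?case by metis
  qed
qed

text \<open>Clearing denominators gives a quadratic polynomial that vanishes near x. Its second
  difference at x - h, x, x + h kills the leading coefficient, a first difference the next one, and
  the determinant leaves only the sign.\<close>

lemma germ_id_unique:
  assumes "germ g x M" "\<And>y. g y = y" "M \<in> SL2 UNIV"
  shows "M = (1, 0, 0, 1) \<or> M = (-1, 0, 0, -1)"
proof -
  obtain a b c d where M: "M = (a, b, c, d)" by (cases M)
  let ?q = "\<lambda>z::real. of_rat c * z\<^sup>2 + (of_rat d - of_rat a) * z - of_rat b"
  have "\<forall>\<^sub>F z in nhds x. ?q z = 0"
    using assms(1) unfolding germ_def
  proof eventually_elim
    case (elim z)
    then have "of_rat c * z + of_rat d \<noteq> 0" "z = (of_rat a * z + of_rat b) / (of_rat c * z + of_rat d)"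
      using assms(2)[of z] by (simp_all add: M)
    then have "z * (of_rat c * z + of_rat d) = of_rat a * z + of_rat b" by (metis nonzero_eq_divide_eq)
    then show ?case by (simp add: algebra_simps power2_eq_square)
  qed
  then obtain e where e: "0 < e" "\<And>z. dist z x < e \<Longrightarrow> ?q z = 0"
    unfolding eventually_nhds_metric by blast
  define h where "h = e / 2"
  have h: "0 < h" "?q x = 0" "?q (x + h) = 0" "?q (x - h) = 0"
    using e by (auto simp: h_def dist_real_def)
  have "2 * of_rat c * h\<^sup>2 = ?q (x + h) + ?q (x - h) - 2 * ?q x" by (simp add: power2_eq_square algebra_simps)
  then have c: "c = 0" using h by simp
  have "(of_rat d - of_rat a) * h = ?q (x + h) - ?q x" by (simp add: c algebra_simps)
  then have "(of_rat d - of_rat a :: real) = 0" using h by simp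
  then have d: "d = a" by simp
  have b: "b = 0" using h(2) c d by simp
  have "a * a = 1" using assms(3) by (simp add: M SL2_def b d)
  then have "a = 1 \<or> a = -1" using square_eq_1_iff[of a] by simp
  then show ?thesis by (auto simp: M b c d)
qed

section \<open>The groups of piecewise projective homeomorphisms\<close>

abbreviation inv_map :: "(real \<Rightarrow> real) \<Rightarrow> real \<Rightarrow> real" where
  "inv_map g \<equiv> inv_into UNIV g"

lemma Gamma_carrier:
  "g \<in> carrier (Gamma_group S) \<longleftrightarrow>
    (\<exists>h. homeomorphism UNIV UNIV g h) \<and> piecewise_projective (S_integers S) g"
  by (simp add: Gamma_group_def)

lemma Gamma_simps [simp]: "mult (Gamma_group S) = (\<circ>)" "one (Gamma_group S) = id"
  by (simp_all add: Gamma_group_def)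

lemma homeomorphism_inv:
  fixes g :: "real \<Rightarrow> real"
  assumes "homeomorphism UNIV UNIV g h"
  shows "bij g" "inv_map g = h" "continuous_on UNIV g" "continuous_on UNIV (inv_map g)"
proof -
  have gh: "g (h y) = y" "h (g x) = x" for x y using assms by (auto simp: homeomorphism_def)
  show "bij g" by (rule bijI') (metis gh)+
  show i: "inv_map g = h" by (rule inv_equality) (simp_all add: gh)
  show "continuous_on UNIV g" "continuous_on UNIV (inv_map g)" using assms i by (auto simp: homeomorphism_def)
qed

lemma Gamma_bij: "g \<in> carrier (Gamma_group S) \<Longrightarrow> bij g"
  using homeomorphism_inv(1) by (auto simp: Gamma_carrier)

lemma Gamma_inv [simp]:
  assumes "g \<in> carrier (Gamma_group S)"
  shows "g (inv_map g x) = x" "inv_map g (g x) = x"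
  using Gamma_bij[OF assms] by (simp_all add: bij_is_surj surj_f_inv_f bij_is_inj)

lemma Gamma_isCont:
  assumes "g \<in> carrier (Gamma_group S)"
  shows "isCont g x" "isCont (inv_map g) x"
  using assms homeomorphism_inv(3,4) by (auto simp: Gamma_carrier continuous_on_eq_continuous_at)

lemma Gamma_open_image:
  assumes "g \<in> carrier (Gamma_group S)" "open U" shows "open (g ` U)"
proof -
  have "g ` U = inv_map g -` U" using bij_image_Collect_eq[OF Gamma_bij[OF assms(1)], of "\<lambda>x. x \<in> U"]
    by (auto simp: vimage_def)
  moreover have "continuous_on UNIV (inv_map g)"
    using assms(1) homeomorphism_inv(4) by (auto simp: Gamma_carrier)
  ultimately show ?thesis using assms(2) by (simp add: open_vimage)
qed

lemma piecewise_projective_comp: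
  assumes g: "bij g" "continuous_on UNIV (inv_map g)" "piecewise_projective (S_integers S) g"
    and f: "piecewise_projective (S_integers S) f"
  shows "piecewise_projective (S_integers S) (f \<circ> g)"
proof -
  obtain P where P: "finite P" "partition_on UNIV P" "\<And>I. I \<in> P \<Longrightarrow> is_interval I"
    "\<And>I. I \<in> P \<Longrightarrow> projective_on (S_integers S) I g"
    using g(3) unfolding piecewise_projective_def by blast
  obtain Q where Q: "finite Q" "partition_on UNIV Q" "\<And>I. I \<in> Q \<Longrightarrow> is_interval I"
    "\<And>I. I \<in> Q \<Longrightarrow> projective_on (S_integers S) I f"
    using f unfolding piecewise_projective_def by blast
  define D where "D = (\<lambda>(I, J). I \<inter> g -` J) ` (P \<times> Q) - {{}}"
  have "finite D" using P(1) Q(1) by (simp add: D_def)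
  moreover have "partition_on UNIV D"
    unfolding partition_on_def
  proof (intro conjI)
    show "\<Union>D = UNIV"
    proof (intro equalityI subsetI UNIV_I)
      fix x
      obtain I where I: "I \<in> P" "x \<in> I" using P(2) by (auto simp: partition_on_def)
      obtain J where J: "J \<in> Q" "g x \<in> J" using Q(2) by (auto simp: partition_on_def)
      have "I \<inter> g -` J \<in> D" using I J by (auto simp: D_def)
      then show "x \<in> \<Union>D" using I J by blast
    qed
    show "disjoint D"
      unfolding disjoint_def
    proof (intro ballI impI)
      fix A B assume "A \<in> D" "B \<in> D" "A \<noteq> B"
      then obtain I J I' J' where IJ: "I \<in> P" "J \<in> Q" "A = I \<inter> g -` J" "I' \<in> P" "J' \<in> Q" "B = I' \<inter> g -` J'"
        by (auto simp: D_def)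
      then have "I \<noteq> I' \<or> J \<noteq> J'" using \<open>A \<noteq> B\<close> by blast
      then have "I \<inter> I' = {} \<or> J \<inter> J' = {}"
        using P(2) Q(2) IJ unfolding partition_on_def disjoint_def by blast
      then show "A \<inter> B = {}" using IJ by blast
    qed
    show "{} \<notin> D" by (simp add: D_def)
  qed
  moreover have "is_interval K \<and> projective_on (S_integers S) K (f \<circ> g)" if K: "K \<in> D" for K
  proof -
    obtain I J where IJ: "I \<in> P" "J \<in> Q" "K = I \<inter> g -` J" using K by (auto simp: D_def)
    have "g -` J = inv_map g ` J" using bij_vimage_eq_inv_image[OF g(1)] by simp
    moreover have "connected (inv_map g ` J)"
      using Q(3)[OF IJ(2)] by (intro connected_continuous_image continuous_on_subset[OF g(2)])
        (auto simp: is_interval_connected_1)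
    ultimately have "is_interval (g -` J)" by (simp add: is_interval_connected_1)
    then have "is_interval K" unfolding IJ(3) by (rule is_interval_Int[OF P(3)[OF IJ(1)]])
    moreover obtain M where M: "M \<in> SL2 (S_integers S)" "\<And>x. x \<in> I \<Longrightarrow> denom M x \<noteq> 0 \<and> g x = mob M x"
      using P(4)[OF IJ(1)] unfolding projective_on_iff by blast
    obtain N where N: "N \<in> SL2 (S_integers S)" "\<And>x. x \<in> J \<Longrightarrow> denom N x \<noteq> 0 \<and> f x = mob N x"
      using Q(4)[OF IJ(2)] unfolding projective_on_iff by blast
    have "denom (mat_mult N M) x \<noteq> 0 \<and> (f \<circ> g) x = mob (mat_mult N M) x" if x: "x \<in> K" for x
    proof -
      have m: "denom M x \<noteq> 0" "g x = mob M x" using M(2) x IJ(3) by auto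
      have n: "denom N (mob M x) \<noteq> 0" "f (mob M x) = mob N (mob M x)" using N(2)[of "g x"] x IJ(3) m by auto
      show ?thesis using denom_mult[OF m(1), of N] mob_mult[OF m(1) n(1)] m n by simp
    qed
    then have "projective_on (S_integers S) K (f \<circ> g)"
      unfolding projective_on_iff using SL2_mult[OF N(1) M(1)] by blast
    ultimately show ?thesis by blast
  qed
  ultimately show ?thesis unfolding piecewise_projective_def by blast
qed

lemma piecewise_projective_inv:
  assumes g: "bij g" "continuous_on UNIV g" "piecewise_projective (S_integers S) g"
  shows "piecewise_projective (S_integers S) (inv_map g)"
proof -
  obtain P where P: "finite P" "partition_on UNIV P" "\<And>I. I \<in> P \<Longrightarrow> is_interval I"
    "\<And>I. I \<in> P \<Longrightarrow> projective_on (S_integers S) I g"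
    using g(3) unfolding piecewise_projective_def by blast
  have inj: "inj g" and surj: "surj g" using g(1) by (auto simp: bij_def)
  have "partition_on UNIV ((`) g ` P)"
    unfolding partition_on_def
  proof (intro conjI)
    show "\<Union> ((`) g ` P) = UNIV" using P(2) surj unfolding partition_on_def by (metis image_Union)
    show "disjoint ((`) g ` P)"
      unfolding disjoint_def
    proof (intro ballI impI)
      fix A B assume "A \<in> (`) g ` P" "B \<in> (`) g ` P" "A \<noteq> B"
      then obtain I J where IJ: "I \<in> P" "J \<in> P" "A = g ` I" "B = g ` J" "I \<noteq> J" by blast
      then have "I \<inter> J = {}" using P(2) unfolding partition_on_def disjoint_def by blast
      then show "A \<inter> B = {}" using image_Int[OF inj, of I J] IJ by simp
    qed
    show "{} \<notin> (`) g ` P" using P(2) by (auto simp: partition_on_def)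
  qed
  moreover have "is_interval (g ` I) \<and> projective_on (S_integers S) (g ` I) (inv_map g)" if I: "I \<in> P" for I
  proof -
    have "connected (g ` I)"
      using P(3)[OF I] by (intro connected_continuous_image continuous_on_subset[OF g(2)])
        (auto simp: is_interval_connected_1)
    then have "is_interval (g ` I)" by (simp add: is_interval_connected_1)
    moreover obtain M where M: "M \<in> SL2 (S_integers S)" "\<And>x. x \<in> I \<Longrightarrow> denom M x \<noteq> 0 \<and> g x = mob M x"
      using P(4)[OF I] unfolding projective_on_iff by blast
    have "denom (mat_inv M) y \<noteq> 0 \<and> inv_map g y = mob (mat_inv M) y" if y: "y \<in> g ` I" for y
    proof -
      obtain x where x: "x \<in> I" "y = g x" using y by blast
      have "inv_map g y = x" using inj x(2) by simp
      moreover have "denom M x \<noteq> 0" "y = mob M x" using M(2)[OF x(1)] x(2) by auto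
      ultimately show ?thesis
        using denom_inv[OF SL2_UNIV[OF M(1)]] mob_inv[OF SL2_UNIV[OF M(1)]] by metis
    qed
    then have "projective_on (S_integers S) (g ` I) (inv_map g)"
      unfolding projective_on_iff using SL2_inv[OF M(1)] by blast
    ultimately show ?thesis by blast
  qed
  ultimately show ?thesis unfolding piecewise_projective_def using P(1) by (intro exI[of _ "(`) g ` P"]) auto
qed

lemma Gamma_comp_closed:
  assumes "f \<in> carrier (Gamma_group S)" "g \<in> carrier (Gamma_group S)"
  shows "f \<circ> g \<in> carrier (Gamma_group S)"
proof -
  obtain h k where hk: "homeomorphism UNIV UNIV f h" "homeomorphism UNIV UNIV g k"
    using assms by (auto simp: Gamma_carrier)
  have "homeomorphism UNIV UNIV (f \<circ> g) (k \<circ> h)" by (rule homeomorphism_compose[OF hk(2,1)])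
  moreover have "piecewise_projective (S_integers S) (f \<circ> g)"
    using assms homeomorphism_inv[OF hk(2)] by (intro piecewise_projective_comp) (auto simp: Gamma_carrier)
  ultimately show ?thesis by (auto simp: Gamma_carrier)
qed

lemma Gamma_inv_closed:
  assumes "g \<in> carrier (Gamma_group S)"
  shows "inv_map g \<in> carrier (Gamma_group S)"
proof -
  obtain k where k: "homeomorphism UNIV UNIV g k" using assms by (auto simp: Gamma_carrier)
  have "homeomorphism UNIV UNIV (inv_map g) g" using homeomorphism_inv(2)[OF k] homeomorphism_symD[OF k] by simp
  moreover have "piecewise_projective (S_integers S) (inv_map g)"
    using assms homeomorphism_inv[OF k] by (intro piecewise_projective_inv) (auto simp: Gamma_carrier)
  ultimately show ?thesis by (auto simp: Gamma_carrier)
qed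

lemma homeomorphism_id: "homeomorphism UNIV UNIV (id :: real \<Rightarrow> real) id"
  by (simp add: homeomorphism_def continuous_on_id)

lemma Gamma_id: "id \<in> carrier (Gamma_group S)"
proof -
  have "projective_on (S_integers S) UNIV id"
    unfolding projective_on_iff by (rule bexI[OF _ SL2_one]) simp
  then have "piecewise_projective (S_integers S) id"
    unfolding piecewise_projective_def by (intro exI[of _ "{UNIV}"]) (simp add: partition_on_def disjoint_def)
  then show ?thesis using homeomorphism_id by (auto simp: Gamma_carrier)
qed

lemma Gamma_group: "group (Gamma_group S)"
proof (rule groupI)
  fix x assume x: "x \<in> carrier (Gamma_group S)"
  show "\<exists>y\<in>carrier (Gamma_group S). y \<otimes>\<^bsub>Gamma_group S\<^esub> x = \<one>\<^bsub>Gamma_group S\<^esub>"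
    using x by (intro bexI[OF _ Gamma_inv_closed[OF x]]) (auto simp: fun_eq_iff)
qed (auto simp: Gamma_comp_closed Gamma_id comp_assoc)

lemma Gamma_m_inv: "g \<in> carrier (Gamma_group S) \<Longrightarrow> inv\<^bsub>Gamma_group S\<^esub> g = inv_map g"
  by (rule group.inv_equality[OF Gamma_group]) (auto simp: fun_eq_iff Gamma_inv_closed)

lemma Gamma_mono: "T \<subseteq> S \<Longrightarrow> carrier (Gamma_group T) \<subseteq> carrier (Gamma_group S)"
proof
  fix g assume "T \<subseteq> S" and g: "g \<in> carrier (Gamma_group T)"
  then have "projective_on (S_integers S) I g" if "projective_on (S_integers T) I g" for I
    using that SL2_mono unfolding projective_on_iff by blast
  with g show "g \<in> carrier (Gamma_group S)" unfolding Gamma_carrier piecewise_projective_def by blast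
qed

lemma Gamma_subgroup: "T \<subseteq> S \<Longrightarrow> subgroup (carrier (Gamma_group T)) (Gamma_group S)"
proof
  assume T: "T \<subseteq> S"
  show "carrier (Gamma_group T) \<subseteq> carrier (Gamma_group S)" by (rule Gamma_mono[OF T])
  show "inv\<^bsub>Gamma_group S\<^esub> g \<in> carrier (Gamma_group T)" if g: "g \<in> carrier (Gamma_group T)" for g
    using Gamma_m_inv[of g S] Gamma_mono[OF T] Gamma_inv_closed[OF g] g by auto
qed (auto simp: Gamma_comp_closed Gamma_id)

text \<open>Of three distinct points of an interval the middle one is interior, so at most two
  points are not.\<close>

lemma finite_interval_boundary:
  fixes I :: "real set" assumes "is_interval I" shows "finite (I - interior I)"
proof (rule ccontr)
  assume "infinite (I - interior I)"
  then obtain F where F: "finite F" "card F = 3" "F \<subseteq> I - interior I"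
    using infinite_arbitrarily_large by blast
  have ne: "F \<noteq> {}" using F by auto
  have "card (F - {Min F, Max F}) \<noteq> 0"
    using F card_mono[of "F \<union> {Min F, Max F}" F] card_Diff_subset[of "{Min F, Max F}" F] ne
    by (cases "Min F = Max F") auto
  then obtain y where y: "y \<in> F" "y \<noteq> Min F" "y \<noteq> Max F" by (auto simp: card_eq_0_iff)
  then have lt: "Min F < y" "y < Max F" using F(1) by (simp_all add: order_less_le)
  have mm: "Min F \<in> I" "Max F \<in> I" using F ne Min_in Max_in by blast+
  have "{Min F<..<Max F} \<subseteq> I"
  proof
    fix z assume "z \<in> {Min F<..<Max F}"
    then have "Min F \<le> z" "z \<le> Max F" by auto
    then show "z \<in> I" by (rule mem_is_interval_1_I[OF assms mm])
  qed
  then have "y \<in> interior I" using lt by (intro interiorI[of "{Min F<..<Max F}"]) auto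
  then show False using y(1) F(3) by blast
qed

lemma finite_no_germ:
  assumes "piecewise_projective (S_integers S) g"
  shows "finite {x. \<not> (\<exists>M\<in>SL2 (S_integers S). germ g x M)}"
proof -
  obtain P where P: "finite P" "partition_on UNIV P" "\<And>I. I \<in> P \<Longrightarrow> is_interval I"
    "\<And>I. I \<in> P \<Longrightarrow> projective_on (S_integers S) I g"
    using assms unfolding piecewise_projective_def by blast
  have "{x. \<not> (\<exists>M\<in>SL2 (S_integers S). germ g x M)} \<subseteq> (\<Union>I\<in>P. I - interior I)"
  proof
    fix x assume x: "x \<in> {x. \<not> (\<exists>M\<in>SL2 (S_integers S). germ g x M)}"
    obtain I where I: "I \<in> P" "x \<in> I" using P(2) by (auto simp: partition_on_def)
    obtain M where M: "M \<in> SL2 (S_integers S)" "\<And>x. x \<in> I \<Longrightarrow> denom M x \<noteq> 0 \<and> g x = mob M x"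
      using P(4)[OF I(1)] unfolding projective_on_iff by blast
    have "x \<notin> interior I"
    proof
      assume "x \<in> interior I"
      then have "germ g x M" by (rule germI_open[OF open_interior]) (use M(2) interior_subset in blast)
      with x M(1) show False by blast
    qed
    with I show "x \<in> (\<Union>I\<in>P. I - interior I)" by blast
  qed
  moreover have "finite (\<Union>I\<in>P. I - interior I)" using P(1,3) finite_interval_boundary by blast
  ultimately show ?thesis by (rule finite_subset)
qed

lemma Gamma_germ_in_open:
  assumes g: "g \<in> carrier (Gamma_group S)" and U: "open U" "U \<noteq> {}"
  obtains y M where "y \<in> U" "M \<in> SL2 (S_integers S)" "germ g y M"
proof -
  have "infinite U" using U finite_imp_not_open by blast
  moreover have "finite {x. \<not> (\<exists>M\<in>SL2 (S_integers S). germ g x M)}"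
    using finite_no_germ g by (simp add: Gamma_carrier)
  ultimately have "\<not> U \<subseteq> {x. \<not> (\<exists>M\<in>SL2 (S_integers S). germ g x M)}" using finite_subset by blast
  then show ?thesis using that by blast
qed

lemma Gamma_germ_comp:
  assumes "g \<in> carrier (Gamma_group S)" "germ g x M" "germ h (g x) N"
  shows "germ (h \<circ> g) x (mat_mult N M)"
  by (rule germ_comp[OF assms(2,3) Gamma_isCont(1)[OF assms(1)]])

lemma Gamma_germ_inv:
  assumes "g \<in> carrier (Gamma_group S)" "germ g x M" "M \<in> SL2 UNIV"
  shows "germ (inv_map g) (g x) (mat_inv M)"
  by (rule germ_inverse[OF assms(2,3)]) (use Gamma_inv[OF assms(1)] Gamma_isCont[OF assms(1)] in auto)

lemma germ_unique:
  assumes g: "g \<in> carrier (Gamma_group S)" and M: "germ g x M" "M \<in> SL2 UNIV" and N: "germ g x N" "N \<in> SL2 UNIV"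
  shows "N = M \<or> N = mat_neg M"
proof -
  have "germ (inv_map g \<circ> g) x (mat_mult (mat_inv M) N)"
    by (rule Gamma_germ_comp[OF g N(1) Gamma_germ_inv[OF g M]])
  then have "mat_mult (mat_inv M) N = (1, 0, 0, 1) \<or> mat_mult (mat_inv M) N = (-1, 0, 0, -1)"
    by (rule germ_id_unique) (auto simp: Gamma_inv[OF g] SL2_mult_UNIV SL2_inv_UNIV M N)
  moreover have "N = mat_mult M (mat_mult (mat_inv M) N)"
    by (simp add: mat_mult_assoc[symmetric] mat_mult_inv[OF M(2)])
  moreover have "mat_mult M (-1, 0, 0, -1) = mat_neg M" by (cases M) simp
  ultimately show ?thesis by auto
qed

text \<open>A germ of an element of Gamma_T may be presented by any rational matrix. It persists
  near x, where some point carries a T-integral matrix, and the two agree up to sign.\<close>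

lemma Gamma_germ_integral:
  assumes g: "g \<in> carrier (Gamma_group T)" and M: "germ g x M" "M \<in> SL2 UNIV"
  shows "M \<in> SL2 (S_integers T)"
proof -
  have "x \<in> {y. germ g y M}" using M by simp
  then obtain y N where y: "germ g y M" "N \<in> SL2 (S_integers T)" "germ g y N"
    using Gamma_germ_in_open[OF g open_germ, of g M] by blast
  have "M = N \<or> M = mat_neg N" by (rule germ_unique[OF g y(3) SL2_UNIV[OF y(2)] y(1) M(2)])
  then show ?thesis using y(2) SL2_neg[OF y(2)] by blast
qed

text \<open>Pieces with interior carry a germ and are settled by the hypothesis. A piece reduced to
  a single point carries none of its own, so its matrix is borrowed by continuity from a
  neighbouring piece.\<close>

lemma Gamma_membership_by_germs:
  assumes g: "g \<in> carrier (Gamma_group S)"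
    and germs: "\<And>x M. M \<in> SL2 (S_integers S) \<Longrightarrow> germ g x M \<Longrightarrow> M \<in> SL2 (S_integers T)"
  shows "g \<in> carrier (Gamma_group T)"
proof -
  obtain P where P: "finite P" "partition_on UNIV P" "\<And>I. I \<in> P \<Longrightarrow> is_interval I"
    "\<And>I. I \<in> P \<Longrightarrow> projective_on (S_integers S) I g"
    using g unfolding Gamma_carrier piecewise_projective_def by blast
  have cont: "continuous_on UNIV g" using g homeomorphism_inv(3) by (auto simp: Gamma_carrier)
  have piece: "\<exists>M\<in>SL2 (S_integers T). \<forall>z\<in>I. denom M z \<noteq> 0 \<and> g z = mob M z"
    if I: "I \<in> P" "interior I \<noteq> {}" for I
  proof -
    obtain M where M: "M \<in> SL2 (S_integers S)" "\<And>x. x \<in> I \<Longrightarrow> denom M x \<noteq> 0 \<and> g x = mob M x"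
      using P(4)[OF I(1)] unfolding projective_on_iff by blast
    obtain x where "x \<in> interior I" using I(2) by blast
    then have "germ g x M" by (rule germI_open[OF open_interior]) (use M(2) interior_subset in blast)
    then show ?thesis using germs[OF M(1)] M(2) by blast
  qed
  \<comment> \<open>Only finitely many points lie outside the interiors of the pieces, so their
    complement is dense.\<close>
  have dense: "closure (\<Union>I\<in>P. interior I) = UNIV"
  proof -
    have "finite (\<Union>I\<in>P. I - interior I)" using P(1,3) finite_interval_boundary by blast
    then have "interior (\<Union>I\<in>P. I - interior I) = {}" using finite_imp_not_open interior_subset
      by (metis finite_subset open_interior)
    moreover have "- (\<Union>I\<in>P. interior I) \<subseteq> (\<Union>I\<in>P. I - interior I)"
    proof
      fix x assume x: "x \<in> - (\<Union>I\<in>P. interior I)"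
      have "x \<in> \<Union>P" using P(2) by (simp add: partition_on_def)
      with x show "x \<in> (\<Union>I\<in>P. I - interior I)" by blast
    qed
    ultimately have "interior (- (\<Union>I\<in>P. interior I)) = {}" using interior_mono by blast
    then show ?thesis by (simp only: closure_interior Compl_empty_eq)
  qed
  have proj: "projective_on (S_integers T) K g" if K: "K \<in> P" for K
  proof (cases "interior K = {}")
    case False
    then show ?thesis using piece[OF K] unfolding projective_on_iff by blast
  next
    case True
    have "K \<noteq> {}" using P(2) K by (auto simp: partition_on_def)
    then obtain x where x: "x \<in> K" by blast
    have single: "K = {x}"
    proof (rule ccontr)
      assume "K \<noteq> {x}"
      then obtain y where y: "y \<in> K" "y \<noteq> x" using x by blast
      have mm: "min x y \<in> K" "max x y \<in> K" using x y(1) by (auto simp: min_def max_def)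
      have "{min x y<..<max x y} \<subseteq> K"
      proof
        fix z assume "z \<in> {min x y<..<max x y}"
        then have "min x y \<le> z" "z \<le> max x y" by auto
        then show "z \<in> K" by (rule mem_is_interval_1_I[OF P(3)[OF K] mm])
      qed
      moreover have "(x + y) / 2 \<in> {min x y<..<max x y}" using y(2) by (auto simp: min_def max_def)
      ultimately have "(x + y) / 2 \<in> interior K" by (intro interiorI[of "{min x y<..<max x y}"]) auto
      with True show False by blast
    qed
    have "closure (\<Union>I\<in>P. interior I) \<subseteq> (\<Union>I\<in>P. closure (interior I))"
    proof (rule closure_minimal)
      show "closed (\<Union>I\<in>P. closure (interior I))" using P(1) by (intro closed_UN) auto
      show "(\<Union>I\<in>P. interior I) \<subseteq> (\<Union>I\<in>P. closure (interior I))" using closure_subset by blast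
    qed
    then have "x \<in> (\<Union>I\<in>P. closure (interior I))" using dense by auto
    then obtain I where I: "I \<in> P" "x \<in> closure (interior I)" by blast
    then have "interior I \<noteq> {}" by auto
    then obtain M where M: "M \<in> SL2 (S_integers T)" "\<And>z. z \<in> I \<Longrightarrow> denom M z \<noteq> 0 \<and> g z = mob M z"
      using piece[OF I(1)] by blast
    obtain a b c d where Me: "M = (a, b, c, d)" by (cases M)
    \<comment> \<open>The identity g = mob M is cleared of denominators, so that it defines a closed
      set and passes to the limit even if the denominator were to vanish there.\<close>
    let ?Z = "{z. g z * (of_rat c * z + of_rat d) - (of_rat a * z + of_rat b) = 0}"
    have "closed ?Z"
      by (rule closed_Collect_eq) (intro continuous_intros continuous_on_subset[OF cont] subset_UNIV)+
    moreover have "interior I \<subseteq> ?Z"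
    proof
      fix z assume "z \<in> interior I"
      then have "z \<in> I" using interior_subset by blast
      then show "z \<in> ?Z" using M(2)[of z] by (simp add: Me)
    qed
    ultimately have "closure (interior I) \<subseteq> ?Z" by (rule closure_minimal[rotated])
    then have eq: "g x * (of_rat c * x + of_rat d) = of_rat a * x + of_rat b" using I(2) by auto
    have "a * d - b * c = 1" using M(1) by (simp add: Me SL2_def)
    then have det: "of_rat a * of_rat d - of_rat b * of_rat c = (1::real)"
      by (metis of_rat_1 of_rat_diff of_rat_mult)
    \<comment> \<open>A zero of the denominator would be a zero of the numerator, against
      determinant 1.\<close>
    have "of_rat c * x + of_rat d \<noteq> 0"
    proof
      assume 0: "of_rat c * x + of_rat d = 0"
      then have "of_rat a * x + of_rat b = 0" using eq by simp
      then have "of_rat a * (of_rat c * x + of_rat d) - of_rat c * (of_rat a * x + of_rat b) = (0::real)"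
        using 0 by simp
      then show False using det by (simp add: algebra_simps)
    qed
    then have "denom M x \<noteq> 0 \<and> g x = mob M x" using eq by (simp add: Me nonzero_eq_divide_eq)
    then show ?thesis unfolding projective_on_iff single using M(1) by blast
  qed
  then have "piecewise_projective (S_integers T) g"
    unfolding piecewise_projective_def using P(1-3) by blast
  then show ?thesis using g by (simp add: Gamma_carrier)
qed

section \<open>Affine elements of the groups\<close>

lemma affine_homeomorphism:
  fixes a b :: real assumes "a \<noteq> 0"
  shows "homeomorphism UNIV UNIV (\<lambda>x. a * x + b) (\<lambda>y. (y - b) / a)"
  by (rule homeomorphismI) (use assms in \<open>auto intro!: continuous_intros\<close>)

lemma mob_affine:
  assumes "(a, b, 0, d) \<in> SL2 R"
  shows "mob (a, b, 0, d) x = of_rat (a * a) * x + of_rat (a * b)" "denom (a, b, 0, d) x \<noteq> 0" "a \<noteq> 0"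
proof -
  have ad: "a * d = 1" using assms by (simp add: SL2_def)
  then show "a \<noteq> 0" "denom (a, b, 0, d) x \<noteq> 0" by auto
  then have d: "d = 1 / a" using ad by (simp add: field_simps)
  show "mob (a, b, 0, d) x = of_rat (a * a) * x + of_rat (a * b)"
    using \<open>a \<noteq> 0\<close> by (simp add: d of_rat_divide of_rat_mult field_simps)
qed

lemma affine_in_Gamma:
  assumes M: "(a, b, 0, d) \<in> SL2 (S_integers S)"
  shows "mob (a, b, 0, d) \<in> carrier (Gamma_group S)" "germ (mob (a, b, 0, d)) x (a, b, 0, d)"
proof -
  show "germ (mob (a, b, 0, d)) x (a, b, 0, d)"
    by (rule germI_open[OF open_UNIV UNIV_I]) (use mob_affine(2)[OF M] in auto)
  have "projective_on (S_integers S) UNIV (mob (a, b, 0, d))"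
    unfolding projective_on_iff using M mob_affine(2)[OF M] by blast
  then have "piecewise_projective (S_integers S) (mob (a, b, 0, d))"
    unfolding piecewise_projective_def by (intro exI[of _ "{UNIV}"]) (simp add: partition_on_def disjoint_def)
  moreover have "mob (a, b, 0, d) = (\<lambda>x. of_rat (a * a) * x + of_rat (a * b))"
    using mob_affine(1)[OF M] by blast
  moreover have "real_of_rat (a * a) \<noteq> 0" using mob_affine(3)[OF M] by simp
  ultimately show "mob (a, b, 0, d) \<in> carrier (Gamma_group S)"
    unfolding Gamma_carrier using affine_homeomorphism by metis
qed

lemma translation_in_Gamma:
  assumes "t \<in> S_integers S" shows "(\<lambda>x. x + of_rat t) \<in> carrier (Gamma_group S)"
proof -
  have "(1, t, 0, 1) \<in> SL2 (S_integers S)" using assms by (simp add: SL2_def S_integers.one S_integers_zero)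
  from affine_in_Gamma(1)[OF this] show ?thesis by (simp add: mob.simps[abs_def] cong: if_cong)
qed

section \<open>Ping-pong elements\<close>

text \<open>Identity, a parabolic map fixing x, and a translation are glued. With v = z - x the
  parabolic map displaces z by s v^2 / (1 - s v), which increases from 0 and reaches t exactly when
  s v (v + t) = t. The break point x + u may be irrational; only the matrices have to be
  S-integral.\<close>

lemma bump_exists:
  fixes s t x :: rat
  assumes pos: "0 < s" "0 < t"
    and mem: "s \<in> S_integers S" "s * x \<in> S_integers S" "s * x * x \<in> S_integers S" "t \<in> S_integers S"
  shows "\<exists>g\<in>carrier (Gamma_group S). \<exists>u>0. of_rat s * u * (u + of_rat t) = of_rat t \<and>
    (\<forall>z\<le>of_rat x. g z = z) \<and>
    (\<forall>z. of_rat x \<le> z \<and> z \<le> of_rat x + u \<longrightarrow> denom (1 - s * x, s * x * x, - s, 1 + s * x) z > 0 \<and>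
       g z = mob (1 - s * x, s * x * x, - s, 1 + s * x) z) \<and>
    (\<forall>z\<ge>of_rat x + u. g z = z + of_rat t)"
proof -
  define s' t' x' :: real where "s' = of_rat s" and "t' = of_rat t" and "x' = of_rat x"
  have s: "0 < s'" and t: "0 < t'" using pos by (simp_all add: s'_def t'_def)
  let ?q = "\<lambda>u. s' * u * (u + t') - t'"
  have "\<exists>u. 0 \<le> u \<and> u \<le> 1 + 1 / s' \<and> ?q u = 0"
  proof (rule IVT')
    show "?q 0 \<le> 0" using t by simp
    have "t' \<le> (s' + 1) * t'" using s t by (simp add: algebra_simps)
    also have "\<dots> \<le> (s' + 1) * (1 + 1 / s' + t')" using s by (intro mult_left_mono) auto
    also have "s' + 1 = s' * (1 + 1 / s')" using s by (simp add: field_simps)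
    finally show "0 \<le> ?q (1 + 1 / s')" by simp
  qed (use s in \<open>auto intro!: continuous_intros\<close>)
  then obtain u where u: "0 \<le> u" "s' * u * (u + t') = t'" by auto
  have u0: "0 < u" using u t by (cases "u = 0") auto
  \<comment> \<open>The inequality s u < 1 keeps the pole of the parabolic map beyond the break
    point.\<close>
  have "s' * u * (u + t') < 1 * (u + t')" using u u0 t by simp
  then have su: "s' * u < 1" using u0 t by (simp only: mult_less_cancel_right)
  define k where "k v = s' * v * v / (1 - s' * v)" for v
  define cl where "cl z = min (max (z - x') 0) u" for z
  define g where "g z = z + k (cl z)" for z
  have cl: "0 \<le> cl z" "cl z \<le> u" for z using u0 by (auto simp: cl_def)
  have den: "0 < 1 - s' * v" if "v \<le> u" for v
  proof -
    have "s' * v \<le> s' * u" using that s by simp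
    then show ?thesis using su by linarith
  qed
  have kmono: "k v \<le> k w" if "0 \<le> v" "v \<le> w" "w \<le> u" for v w
  proof -
    have "s' * v * v \<le> s' * w * w" using that s by (simp add: mult.assoc mult_mono)
    moreover have "1 - s' * w \<le> 1 - s' * v" using that s by simp
    ultimately show ?thesis unfolding k_def using den[of w] den[of v] that s by (intro frac_le) auto
  qed
  have ku: "k u = t'"
  proof -
    have "s' * u * u = t' * (1 - s' * u)" using u(2) by (simp add: algebra_simps)
    then show ?thesis using den[of u] by (simp add: k_def)
  qed
  have k0: "k 0 = 0" by (simp add: k_def)
  have kb: "0 \<le> k (cl z)" "k (cl z) \<le> t'" for z
    using kmono[of 0 "cl z"] kmono[of "cl z" u] cl k0 ku by auto
  have clm: "cl z \<le> cl w" if "z \<le> w" for z w using that by (auto simp: cl_def)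
  have mono: "g z < g w" if "z < w" for z w
    using kmono[OF cl(1) clm[of z w] cl(2)] that by (simp add: g_def)
  have inj: "inj g" by (rule linorder_injI) (metis mono less_irrefl)
  have "continuous_on UNIV cl" unfolding cl_def by (intro continuous_intros)
  moreover have "1 - s' * cl z \<noteq> 0" for z using den[OF cl(2)[of z]] by linarith
  ultimately have cont: "continuous_on UNIV g"
    unfolding g_def k_def by (intro continuous_intros) auto
  have surj: "surj g"
  proof (unfold surj_def, intro allI)
    fix y
    \<comment> \<open>The displacement lies between 0 and t', so a preimage of y is found between y
      - t' and y.\<close>
    have "\<exists>z. y - t' \<le> z \<and> z \<le> y \<and> g z = y"
      using kb[of y] kb[of "y - t'"] t continuous_on_subset[OF cont]
      by (intro IVT') (auto simp: g_def)
    then show "\<exists>z. y = g z" by blast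
  qed
  obtain h where "homeomorphism UNIV (g ` UNIV) g h"
    using invariance_of_domain_homeomorphism[OF open_UNIV cont _ inj] by auto
  then have hom: "homeomorphism UNIV UNIV g h" using surj by simp
  let ?N = "(1 - s * x, s * x * x, - s, 1 + s * x)"
  have N: "?N \<in> SL2 (S_integers S)"
    using mem by (simp add: SL2_def S_integers.diff S_integers_uminus S_integers_add S_integers.one algebra_simps)
  have left: "g z = z" if "z \<le> x'" for z using that u0 by (simp add: g_def cl_def k0)
  have right: "g z = z + t'" if "x' + u \<le> z" for z
  proof -
    have "cl z = u" using that u0 by (auto simp: cl_def)
    then show ?thesis by (simp add: g_def ku)
  qed
  have mid: "denom ?N z > 0 \<and> g z = mob ?N z" if z: "x' \<le> z" "z \<le> x' + u" for z
  proof -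
    have clz: "cl z = z - x'" using z by (auto simp: cl_def)
    have d: "denom ?N z = 1 - s' * (z - x')"
      by (simp add: s'_def x'_def of_rat_add of_rat_mult of_rat_minus algebra_simps)
    have pos: "0 < 1 - s' * (z - x')" using den[of "z - x'"] z by simp
    have "g z * (1 - s' * (z - x')) = (1 - s' * x') * z + s' * x' * x'"
      using pos unfolding g_def k_def clz by (simp add: field_simps)
    then have "g z = ((1 - s' * x') * z + s' * x' * x') / (1 - s' * (z - x'))"
      using pos by (simp add: nonzero_eq_divide_eq)
    also have "\<dots> = mob ?N z"
      by (simp add: s'_def x'_def of_rat_add of_rat_mult of_rat_minus of_rat_diff algebra_simps)
    finally show ?thesis using d pos by simp
  qed
  let ?P = "{{..x'}, {x'<..x' + u}, {x' + u<..}}"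
  have "piecewise_projective (S_integers S) g"
    unfolding piecewise_projective_def
  proof (intro exI[of _ ?P] conjI ballI)
    show "partition_on UNIV ?P"
    proof -
      have "x' + u + 1 \<in> {x' + u<..}" by simp
      then have "{} \<noteq> {x' + u<..}" by blast
      then show ?thesis using u0 by (auto simp: partition_on_def disjoint_def)
    qed
    fix I assume "I \<in> ?P"
    then consider "I = {..x'}" | "I = {x'<..x' + u}" | "I = {x' + u<..}" by blast
    then have "is_interval I \<and> projective_on (S_integers S) I g"
    proof cases
      case 1
      then show ?thesis unfolding projective_on_iff
        by (auto intro!: bexI[OF _ SL2_one] simp: left is_interval_1)
    next
      case 2
      have "\<forall>z\<in>I. denom ?N z \<noteq> 0 \<and> g z = mob ?N z"
      proof
        fix z assume "z \<in> I"
        then show "denom ?N z \<noteq> 0 \<and> g z = mob ?N z" using mid[of z] 2 by (auto simp del: denom.simps mob.simps)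
      qed
      then have "projective_on (S_integers S) I g" unfolding projective_on_iff using N by blast
      then show ?thesis using 2 by (simp add: is_interval_1)
    next
      case 3
      have "(1, t, 0, 1) \<in> SL2 (S_integers S)" using mem by (simp add: SL2_def S_integers.one S_integers_zero)
      then show ?thesis unfolding projective_on_iff using 3
        by (auto intro!: bexI[of _ "(1, t, 0, 1)"] simp: right is_interval_1 t'_def)
    qed
    then show "is_interval I" "projective_on (S_integers S) I g" by auto
  qed simp
  then have "g \<in> carrier (Gamma_group S)" using hom by (auto simp: Gamma_carrier)
  then show ?thesis
    using u0 u(2) left mid right unfolding s'_def t'_def x'_def
    by (intro bexI[of _ g] exI[of _ u]) (auto simp del: denom.simps mob.simps)
qed

text \<open>A bump at 0 followed by the inverse of a bump at 5 would not commute with the ends of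
  the line; composing them so that both eventual translations by t cancel gives \<open>b\<close>
  with support inside (0, 7). It is a lower shear just right of 0 and a translation by t on [1, 5];
  conjugation by a translation by 2 brings the latter stretch over the base interval and gives
  \<open>c\<close>.\<close>

lemma ping_pong_elements:
  fixes t :: rat
  assumes t: "t \<in> S_integers S" "0 < t" "t \<le> 1/64"
  obtains b c where "b \<in> carrier (Gamma_group S)" "c \<in> carrier (Gamma_group S)"
    "\<And>z. z \<le> -2 \<or> 7 \<le> z \<Longrightarrow> b z = z \<and> c z = z"
    "\<And>z. 0 \<le> z \<Longrightarrow> z \<le> 1/2 \<Longrightarrow> denom (1, 0, - t, 1) z \<noteq> 0 \<and> b z = mob (1, 0, - t, 1) z"
    "\<And>z. -1 \<le> z \<Longrightarrow> z \<le> 3 \<Longrightarrow> c z = z + of_rat t"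
proof -
  define t' where "t' = real_of_rat t"
  have t': "0 < t'" "t' \<le> 1/64"
    using t of_rat_less_eq[of t "1/64"] by (auto simp: t'_def of_rat_divide simp del: of_rat_less_eq)
  have five: "t * 5 \<in> S_integers S" "t * 5 * 5 \<in> S_integers S"
    using S_integers.mult[OF t(1) S_integers_of_nat[of 5]] S_integers.mult[OF t(1) S_integers_of_nat[of 25]]
    by (simp_all add: algebra_simps)
  have "\<exists>\<sigma>\<in>carrier (Gamma_group S). \<exists>u>0. t' * u * (u + t') = t' \<and> (\<forall>z\<le>0. \<sigma> z = z) \<and>
    (\<forall>z. 0 \<le> z \<and> z \<le> u \<longrightarrow> denom (1, 0, - t, 1) z > 0 \<and> \<sigma> z = mob (1, 0, - t, 1) z) \<and>
    (\<forall>z\<ge>u. \<sigma> z = z + t')"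
    using bump_exists[of t t S 0] t S_integers_zero unfolding t'_def by (simp del: denom.simps mob.simps)
  then obtain \<sigma> u where \<sigma>: "\<sigma> \<in> carrier (Gamma_group S)" "0 < u" "t' * u * (u + t') = t'"
    "\<And>z. z \<le> 0 \<Longrightarrow> \<sigma> z = z"
    "\<And>z. 0 \<le> z \<Longrightarrow> z \<le> u \<Longrightarrow> denom (1, 0, - t, 1) z > 0 \<and> \<sigma> z = mob (1, 0, - t, 1) z"
    "\<And>z. u \<le> z \<Longrightarrow> \<sigma> z = z + t'" by blast
  have five': "real_of_rat 5 = 5" by simp
  obtain \<tau> v where \<tau>: "\<tau> \<in> carrier (Gamma_group S)" "0 < v" "t' * v * (v + t') = t'"
    "\<And>z. z \<le> 5 \<Longrightarrow> \<tau> z = z" "\<And>z. 5 + v \<le> z \<Longrightarrow> \<tau> z = z + t'"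
    using bump_exists[of t t S 5, OF t(2) t(2) t(1) five t(1), unfolded five'] unfolding t'_def by blast
  \<comment> \<open>The break point lies beyond 1/2, so the shear covers the whole base interval,
    and before 1, so the translation has begun on [1, 5].\<close>
  have root: "w < 1 \<and> 1/2 < w" if w: "0 < w" "t' * w * (w + t') = t'" for w
  proof -
    have e: "w * (w + t') = 1" using w(2) t' by simp
    have "w < 1"
    proof (rule ccontr)
      assume "\<not> w < 1"
      then have "1 * (1 + t') \<le> w * (w + t')" using t' by (intro mult_mono) auto
      then show False using e t' by simp
    qed
    moreover have "1/2 < w"
    proof (rule ccontr)
      assume "\<not> 1/2 < w"
      then have "w * (w + t') \<le> (1/2) * (1/2 + 1/64)" using w t' by (intro mult_mono) auto
      then show False using e by simp
    qed
    ultimately show ?thesis by blast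
  qed
  note u = root[OF \<sigma>(2,3)] and v = root[OF \<tau>(2,3)]
  define b where "b = \<sigma> \<circ> inv_map \<tau>"
  have b: "b \<in> carrier (Gamma_group S)" unfolding b_def by (intro Gamma_comp_closed Gamma_inv_closed \<sigma> \<tau>)
  have b5: "b z = \<sigma> z" if "z \<le> 5" for z
    using Gamma_inv(2)[OF \<tau>(1), of z] \<tau>(4)[OF that] by (simp add: b_def)
  have b7: "b z = z" if "7 \<le> z" for z
  proof -
    have "\<tau> (z - t') = z" using \<tau>(5)[of "z - t'"] that v t' by simp
    then have "inv_map \<tau> z = z - t'" using Gamma_inv(2)[OF \<tau>(1), of "z - t'"] by simp
    then show ?thesis using \<sigma>(6)[of "z - t'"] that u t' by (simp add: b_def)
  qed
  define T where "T = (\<lambda>z. z + real_of_rat 2)"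
  define T' where "T' = (\<lambda>z. z + real_of_rat (-2))"
  have two: "2 \<in> S_integers S" using S_integers_of_nat[of 2 S] by simp
  have TT: "T \<in> carrier (Gamma_group S)" "T' \<in> carrier (Gamma_group S)"
    unfolding T_def T'_def
    by (rule translation_in_Gamma[OF two], rule translation_in_Gamma[OF S_integers_uminus[OF two]])
  define c where "c = T' \<circ> (b \<circ> T)"
  have cz: "c z = b (z + 2) - 2" for z by (simp add: c_def T_def T'_def of_rat_minus)
  have c: "c \<in> carrier (Gamma_group S)" unfolding c_def by (intro Gamma_comp_closed b TT)
  show ?thesis
  proof (rule that[OF b c])
    show "b z = z \<and> c z = z" if "z \<le> -2 \<or> 7 \<le> z" for z
      using that b7[of z] b7[of "z + 2"] b5[of z] b5[of "z + 2"] \<sigma>(4)[of z] \<sigma>(4)[of "z + 2"] by (auto simp: cz)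
    show "denom (1, 0, - t, 1) z \<noteq> 0 \<and> b z = mob (1, 0, - t, 1) z" if "0 \<le> z" "z \<le> 1/2" for z
      using \<sigma>(5)[of z] b5[of z] that u by (auto simp del: denom.simps mob.simps)
    show "c z = z + of_rat t" if "-1 \<le> z" "z \<le> 3" for z
      using \<sigma>(6)[of "z + 2"] b5[of "z + 2"] that u by (simp add: cz t'_def)
  qed
qed

section \<open>Germs of cosets and the half-tree\<close>

text \<open>The shear used for ping-pong does not preserve length. A derivative of at least 1
  suffices for the one-sided comparison of weights, through the change of variables formula.\<close>

lemma expanding_map_measure:
  fixes g :: "real \<Rightarrow> real"
  assumes U: "open U" "bounded U" and gU: "open (g ` U)" "bounded (g ` U)"
    and der: "\<And>x. x \<in> U \<Longrightarrow> (g has_field_derivative g' x) (at x)" and ge: "\<And>x. x \<in> U \<Longrightarrow> 1 \<le> g' x"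
    and inj: "inj_on g U"
  shows "measure lborel U \<le> measure lborel (g ` U)"
proof -
  have lm: "U \<in> lmeasurable" "g ` U \<in> lmeasurable"
    using U gU by (auto intro: lmeasurable_open)
  have "(\<lambda>x. 1 :: real) absolutely_integrable_on (g ` U)"
    using lm(2) by (simp add: absolutely_integrable_on_const)
  then have *: "(\<lambda>x. \<bar>g' x\<bar> * 1) absolutely_integrable_on U \<and>
      integral U (\<lambda>x. \<bar>g' x\<bar> * 1) = integral (g ` U) (\<lambda>x. 1 :: real)"
    using has_absolute_integral_change_of_variables_1'[of U g g' "\<lambda>x. 1" "integral (g ` U) (\<lambda>x. 1)"]
      lm(1) der inj by (auto simp: fmeasurableD intro: has_field_derivative_at_within)
  have "measure lebesgue U = integral U (\<lambda>x. 1 :: real)" using lmeasure_integral[OF lm(1)] by simp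
  also have "\<dots> \<le> integral U (\<lambda>x. \<bar>g' x\<bar> * 1)"
  proof (rule integral_le)
    show "(\<lambda>x. 1 :: real) integrable_on U" using lm(1) by (simp add: lmeasurable_iff_integrable_on)
    show "(\<lambda>x. \<bar>g' x\<bar> * 1) integrable_on U" using * set_lebesgue_integral_eq_integral(1) by blast
  qed (use ge in fastforce)
  also have "\<dots> = measure lebesgue (g ` U)" using * lmeasure_integral[OF lm(2)] by simp
  finally show ?thesis using U(1) gU(1) by (simp add: measure_completion)
qed

abbreviation base_interval :: "real set" where "base_interval \<equiv> {0<..<1/2}"

lemma bounded_fmeasurable: "U \<in> sets borel \<Longrightarrow> bounded U \<Longrightarrow> U \<in> fmeasurable lborel" for U :: "real set"
  using emeasure_bounded_finite[of U] by (simp add: fmeasurable_def)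

lemma open_lmeasurable: "open U \<Longrightarrow> bounded U \<Longrightarrow> U \<in> fmeasurable lborel" for U :: "real set"
  by (simp add: bounded_fmeasurable)

text \<open>The maximum norm is preserved when rows are multiplied from the right by determinant-1
  matrices with p-integral entries, so comparing the two rows is a condition on right cosets of
  germs.\<close>

definition row_norm :: "nat \<Rightarrow> rat \<Rightarrow> rat \<Rightarrow> real" where
  "row_norm p a b = max (padic_abs p a) (padic_abs p b)"

fun small_top_row :: "nat \<Rightarrow> mat2 \<Rightarrow> bool" where
  "small_top_row p (a, b, c, d) \<longleftrightarrow> row_norm p a b \<le> row_norm p c d"

text \<open>The condition depends only on the vertex \<open>M SL\<^sub>2(\<int>\<^bsub>(p)\<^esub>)\<close> of the \<open>p\<close>-adic tree.\<close>

definition half_tree :: "nat \<Rightarrow> mat2 set" where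
  "half_tree p = {M \<in> SL2 UNIV. small_top_row p M}"

context
  fixes p :: nat assumes p: "prime p"
begin

text \<open>Ultrametric dominance: where the second row attains its norm, adding \<tau> times this
  row swamps the first one. This is the ping-pong move; exchanging the rows gives the move in the
  other direction.\<close>

lemma row_norm_shear:
  assumes "row_norm p a b \<le> row_norm p c d" "0 < row_norm p c d" "1 < padic_abs p \<tau>"
  shows "row_norm p c d < row_norm p (a + \<tau> * c) (b + \<tau> * d)"
proof -
  have main: "padic_abs p z < padic_abs p (y + \<tau> * z)"
    if "padic_abs p y \<le> padic_abs p z" "0 < padic_abs p z" for y z
  proof -
    have l: "padic_abs p z < padic_abs p (\<tau> * z)" using that assms(3) by (simp add: padic_abs_mult[OF p])
    then have "padic_abs p (y + \<tau> * z) = padic_abs p (\<tau> * z)"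
      using that by (intro padic_abs_add_eq[OF p]) simp
    with l show ?thesis by simp
  qed
  show ?thesis
  proof (cases "padic_abs p c \<le> padic_abs p d")
    case True
    then show ?thesis using main[of b d] assms by (auto simp: row_norm_def max_def split: if_splits)
  next
    case False
    then show ?thesis using main[of a c] assms by (auto simp: row_norm_def max_def split: if_splits)
  qed
qed

lemma row_norm_pos:
  assumes "a * d - b * c = 1" shows "0 < row_norm p a b" "0 < row_norm p c d"
proof -
  have pos: "0 < padic_abs p x" if "x \<noteq> 0" for x
    using padic_abs_nonneg[OF p, of x] padic_abs_zero_iff[OF p, of x] that by linarith
  have "a \<noteq> 0 \<or> b \<noteq> 0" "c \<noteq> 0 \<or> d \<noteq> 0" using assms by auto
  then show "0 < row_norm p a b" "0 < row_norm p c d"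
    using pos by (auto simp: row_norm_def less_max_iff_disj)
qed

lemma row_norm_mult_le:
  assumes "padic_abs p a' \<le> 1" "padic_abs p b' \<le> 1" "padic_abs p c' \<le> 1" "padic_abs p d' \<le> 1"
  shows "row_norm p (a * a' + b * c') (a * b' + b * d') \<le> row_norm p a b"
proof -
  have "padic_abs p (a * x + b * y) \<le> row_norm p a b" if "padic_abs p x \<le> 1" "padic_abs p y \<le> 1" for x y
  proof -
    have "padic_abs p (a * x) \<le> padic_abs p a" "padic_abs p (b * y) \<le> padic_abs p b"
      using that by (auto simp: padic_abs_mult[OF p] mult_left_le padic_abs_nonneg[OF p])
    then show ?thesis using padic_abs_add[OF p, of "a * x" "b * y"] by (auto simp: row_norm_def)
  qed
  then show ?thesis using assms by (simp add: row_norm_def[of p "_ + _"])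
qed

text \<open>Since p is outside \<open>T\<close>, both \<open>N\<close> and its inverse have
  p-integral entries, and neither can lengthen a row; hence row norms do not change.\<close>

lemma half_tree_right_invariant:
  assumes M: "M \<in> SL2 UNIV" and N: "N \<in> SL2 (S_integers T)" and T: "\<forall>q\<in>T. prime q" "p \<notin> T"
  shows "mat_mult M N \<in> half_tree p \<longleftrightarrow> M \<in> half_tree p"
proof -
  have le: "small_top_row p M \<longleftrightarrow> small_top_row p (mat_mult M N)"
  proof -
    obtain a b c d where M': "M = (a, b, c, d)" by (cases M)
    obtain a' b' c' d' where N': "N = (a', b', c', d')" by (cases N)
    have n: "padic_abs p a' \<le> 1" "padic_abs p b' \<le> 1" "padic_abs p c' \<le> 1" "padic_abs p d' \<le> 1"
      using N S_integers_padic_abs[OF p _ T] by (auto simp: N' SL2_def)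
    have det: "a' * d' - b' * c' = 1" using N by (simp add: N' SL2_def)
    have inv: "(x * a' + y * c') * d' + (x * b' + y * d') * (- c') = x"
      "(x * a' + y * c') * (- b') + (x * b' + y * d') * a' = y" for x y
    proof -
      have "(x * a' + y * c') * d' + (x * b' + y * d') * (- c') = x * (a' * d' - b' * c')" by (simp add: algebra_simps)
      then show "(x * a' + y * c') * d' + (x * b' + y * d') * (- c') = x" using det by simp
      have "(x * a' + y * c') * (- b') + (x * b' + y * d') * a' = y * (a' * d' - b' * c')" by (simp add: algebra_simps)
      then show "(x * a' + y * c') * (- b') + (x * b' + y * d') * a' = y" using det by simp
    qed
    have eq: "row_norm p (x * a' + y * c') (x * b' + y * d') = row_norm p x y" for x y
    proof (rule antisym)
      show "row_norm p (x * a' + y * c') (x * b' + y * d') \<le> row_norm p x y" by (rule row_norm_mult_le[OF n])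
      show "row_norm p x y \<le> row_norm p (x * a' + y * c') (x * b' + y * d')"
        using row_norm_mult_le[of d' "- b'" "- c'" a' "x * a' + y * c'" "x * b' + y * d'"] n
        unfolding inv by (simp add: padic_abs_minus[OF p])
    qed
    show ?thesis by (simp add: M' N' eq)
  qed
  show ?thesis using le M SL2_mult_UNIV[OF M SL2_UNIV[OF N]] by (simp add: half_tree_def)
qed

lemma half_tree_upper:
  assumes "M \<in> half_tree p" "1 < padic_abs p \<tau>"
  shows "mat_mult (1, \<tau>, 0, 1) M \<notin> half_tree p"
proof -
  obtain a b c d where M: "M = (a, b, c, d)" by (cases M)
  have det: "a * d - b * c = 1" using assms(1) by (simp add: half_tree_def SL2_def M)
  have "row_norm p a b \<le> row_norm p c d" using assms(1) by (simp add: half_tree_def M)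
  from row_norm_shear[OF this row_norm_pos(2)[OF det] assms(2)]
  show ?thesis by (simp add: half_tree_def M)
qed

lemma half_tree_lower:
  assumes "M \<in> SL2 UNIV" "M \<notin> half_tree p" "1 < padic_abs p \<tau>"
  shows "mat_mult (1, 0, \<tau>, 1) M \<in> half_tree p"
proof -
  obtain a b c d where M: "M = (a, b, c, d)" by (cases M)
  have det: "a * d - b * c = 1" using assms(1) by (simp add: SL2_def M)
  have "(1, 0, \<tau>, 1) \<in> SL2 UNIV" by (simp add: SL2_def)
  then have "mat_mult (1, 0, \<tau>, 1) M \<in> SL2 UNIV" using assms(1) by (rule SL2_mult_UNIV)
  moreover have "row_norm p c d \<le> row_norm p a b" using assms(1,2) by (simp add: half_tree_def M)
  from row_norm_shear[OF this row_norm_pos(1)[OF det] assms(3)]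
  have "small_top_row p (mat_mult (1, 0, \<tau>, 1) M)" by (simp add: M add.commute)
  ultimately show ?thesis by (simp add: half_tree_def)
qed

end

text \<open>For a coset \<open>C\<close> of \<open>\<Gamma>\<^sub>T\<close>, the germs over a point \<open>x = g y\<close> form a single coset of
  \<open>SL\<^sub>2(\<int>[1/T])\<close>, so sets \<open>A\<close> invariant under this group decompose the line.\<close>

definition germ_set :: "(real \<Rightarrow> real) set \<Rightarrow> mat2 set \<Rightarrow> real set" where
  "germ_set C A = {g y |g y M. g \<in> C \<and> germ g y M \<and> M \<in> A}"

lemma open_germ_set:
  assumes "C \<subseteq> carrier (Gamma_group S)" shows "open (germ_set C A)"
proof -
  have "germ_set C A = (\<Union>g\<in>C. \<Union>M\<in>A. g ` {y. germ g y M})"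
    unfolding germ_set_def by blast
  also have "open \<dots>" using assms by (intro open_UN ballI Gamma_open_image[OF _ open_germ]) auto
  finally show ?thesis .
qed

lemma germ_set_equivariant:
  assumes C: "C \<subseteq> carrier (Gamma_group S)" and K: "germ h x K" and x: "x \<in> germ_set C A"
  shows "h x \<in> germ_set (h <#\<^bsub>Gamma_group S\<^esub> C) (mat_mult K ` A)"
proof -
  obtain g y M where g: "g \<in> C" "germ g y M" "M \<in> A" "x = g y" using x by (auto simp: germ_set_def)
  have "germ (h \<circ> g) y (mat_mult K M)"
    by (rule Gamma_germ_comp[OF _ g(2)]) (use g C K in auto)
  moreover have "h \<circ> g \<in> h <#\<^bsub>Gamma_group S\<^esub> C" using g(1) by (auto simp: l_coset_def)
  ultimately show ?thesis unfolding germ_set_def using g(3,4)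
    by (intro CollectI exI[of _ "h \<circ> g"] exI[of _ y] exI[of _ "mat_mult K M"]) simp
qed

section \<open>Germs over cosets and the weight of a coset\<close>

context
  fixes S T :: "nat set" assumes TS: "T \<subseteq> S"
begin

interpretation group "Gamma_group S" by (rule Gamma_group)

lemma lcoset_quotient_in:
  assumes C: "C \<in> lcosets\<^bsub>Gamma_group S\<^esub> (carrier (Gamma_group T))" and g: "g \<in> C" "g' \<in> C"
  shows "inv_map g \<circ> g' \<in> carrier (Gamma_group T)"
proof -
  note sub = Gamma_mono[OF TS]
  obtain a where a: "a \<in> carrier (Gamma_group S)" "C = a <#\<^bsub>Gamma_group S\<^esub> carrier (Gamma_group T)"
    using C by (auto simp: LCOSETS_def)
  obtain \<gamma> \<gamma>' where \<gamma>: "\<gamma> \<in> carrier (Gamma_group T)" "g = a \<circ> \<gamma>" "\<gamma>' \<in> carrier (Gamma_group T)" "g' = a \<circ> \<gamma>'"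
    using g a(2) by (auto simp: l_coset_def)
  have "inv_map (a \<circ> \<gamma>) = inv_map \<gamma> \<circ> inv_map a"
    using Gamma_bij[OF a(1)] Gamma_bij[OF \<gamma>(1)] by (rule o_inv_distrib)
  then have "inv_map g \<circ> g' = inv_map \<gamma> \<circ> \<gamma>'" using Gamma_inv[OF a(1)] by (auto simp: \<gamma> fun_eq_iff)
  then show ?thesis using Gamma_comp_closed[OF Gamma_inv_closed[OF \<gamma>(1)] \<gamma>(3)] by simp
qed

lemma lcoset_subset:
  "C \<in> lcosets\<^bsub>Gamma_group S\<^esub> (carrier (Gamma_group T)) \<Longrightarrow> C \<subseteq> carrier (Gamma_group S)"
  by (rule subgroup.lcosets_carrier[OF Gamma_subgroup[OF TS] Gamma_group])

lemma lcoset_nonempty: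
  assumes "C \<in> lcosets\<^bsub>Gamma_group S\<^esub> (carrier (Gamma_group T))" shows "C \<noteq> {}"
  using assms Gamma_id[of T] by (auto simp: LCOSETS_def l_coset_def)

lemma germ_set_disjoint:
  assumes C: "C \<in> lcosets\<^bsub>Gamma_group S\<^esub> (carrier (Gamma_group T))"
    and A: "A \<subseteq> SL2 UNIV" "A' \<subseteq> SL2 UNIV" "A \<inter> A' = {}"
    and inv: "\<And>M N. M \<in> A \<Longrightarrow> N \<in> SL2 (S_integers T) \<Longrightarrow> mat_mult M N \<in> A"
  shows "germ_set C A \<inter> germ_set C A' = {}"
proof (rule ccontr)
  assume "germ_set C A \<inter> germ_set C A' \<noteq> {}"
  then obtain x where x: "x \<in> germ_set C A" "x \<in> germ_set C A'" by blast
  obtain g y M where g: "g \<in> C" "germ g y M" "M \<in> A" "x = g y" using x(1) by (auto simp: germ_set_def)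
  obtain g' y' M' where g': "g' \<in> C" "germ g' y' M'" "M' \<in> A'" "x = g' y'" using x(2) by (auto simp: germ_set_def)
  have gS: "g \<in> carrier (Gamma_group S)" "g' \<in> carrier (Gamma_group S)" using lcoset_subset[OF C] g g' by auto
  have M: "M \<in> SL2 UNIV" "M' \<in> SL2 UNIV" using A g g' by auto
  have "germ (inv_map g) (g' y') (mat_inv M)" using Gamma_germ_inv[OF gS(1) g(2) M(1)] g g' by simp
  from Gamma_germ_comp[OF gS(2) g'(2) this]
  have "germ (inv_map g \<circ> g') y' (mat_mult (mat_inv M) M')" .
  then have "mat_mult (mat_inv M) M' \<in> SL2 (S_integers T)"
    by (rule Gamma_germ_integral[OF lcoset_quotient_in[OF C g(1) g'(1)]])
       (intro SL2_mult_UNIV SL2_inv_UNIV M)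
  from inv[OF g(3) this] have "M' \<in> A" by (simp add: mat_mult_assoc[symmetric] mat_mult_inv[OF M(1)])
  with g'(3) A(3) show False by blast
qed

text \<open>One representative decides: away from the image of its finitely many break points, every
  point has a germ over the coset, and its matrix is in \<open>A\<close> or not.\<close>

lemma germ_set_cover:
  assumes C: "C \<in> lcosets\<^bsub>Gamma_group S\<^esub> (carrier (Gamma_group T))"
  shows "finite (- (germ_set C A \<union> germ_set C (SL2 UNIV - A)))"
proof -
  obtain g where g: "g \<in> C" using lcoset_nonempty[OF C] by blast
  have gS: "g \<in> carrier (Gamma_group S)" using lcoset_subset[OF C] g by auto
  let ?B = "{x. \<not> (\<exists>M\<in>SL2 (S_integers S). germ g x M)}"
  have "- (germ_set C A \<union> germ_set C (SL2 UNIV - A)) \<subseteq> g ` ?B"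
  proof
    fix x assume x: "x \<in> - (germ_set C A \<union> germ_set C (SL2 UNIV - A))"
    have xg: "x = g (inv_map g x)" using Gamma_inv[OF gS] by simp
    have "\<not> germ g (inv_map g x) M" if "M \<in> SL2 (S_integers S)" for M
    proof
      assume "germ g (inv_map g x) M"
      then have "x \<in> germ_set C A \<or> x \<in> germ_set C (SL2 UNIV - A)"
        using g SL2_UNIV[OF that] xg unfolding germ_set_def by blast
      with x show False by blast
    qed
    then show "x \<in> g ` ?B" using xg by blast
  qed
  moreover have "finite ?B" using finite_no_germ gS by (simp add: Gamma_carrier)
  ultimately show ?thesis by (meson finite_imageI finite_subset)
qed

definition germ_measure :: "mat2 set \<Rightarrow> (real \<Rightarrow> real) set \<Rightarrow> real" where
  "germ_measure A C = measure lborel (base_interval \<inter> germ_set C A)"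

lemma base_interval_germ_set:
  assumes C: "C \<in> lcosets\<^bsub>Gamma_group S\<^esub> (carrier (Gamma_group T))"
  shows "open (base_interval \<inter> germ_set C A)" "bounded (base_interval \<inter> germ_set C A)" "base_interval \<inter> germ_set C A \<in> fmeasurable lborel"
proof -
  show o: "open (base_interval \<inter> germ_set C A)" by (intro open_Int open_germ_set[OF lcoset_subset[OF C]]) simp
  show b: "bounded (base_interval \<inter> germ_set C A)" by (rule bounded_subset[of base_interval]) auto
  show "base_interval \<inter> germ_set C A \<in> fmeasurable lborel" by (rule open_lmeasurable[OF o b])
qed

lemma germ_measure_total:
  assumes C: "C \<in> lcosets\<^bsub>Gamma_group S\<^esub> (carrier (Gamma_group T))"
  shows "1/2 \<le> germ_measure A C + germ_measure (SL2 UNIV - A) C"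
proof -
  let ?F = "- (germ_set C A \<union> germ_set C (SL2 UNIV - A))"
  have F: "finite ?F" by (rule germ_set_cover[OF C])
  then have "?F \<in> fmeasurable lborel"
    by (intro bounded_fmeasurable borel_closed finite_imp_closed finite_imp_bounded)
  moreover have "measure lborel ?F = 0"
    using F by (simp only: measure_def emeasure_lborel_countable countable_finite) simp
  ultimately have F0: "?F \<in> fmeasurable lborel" "measure lborel ?F = 0" by blast+
  have "measure lborel base_interval \<le> measure lborel (((base_interval \<inter> germ_set C A) \<union> (base_interval \<inter> germ_set C (SL2 UNIV - A))) \<union> ?F)"
    by (rule measure_mono_fmeasurable)
       (blast, simp, intro fmeasurable.Un base_interval_germ_set(3)[OF C] F0(1))
  also have "\<dots> \<le> measure lborel ((base_interval \<inter> germ_set C A) \<union> (base_interval \<inter> germ_set C (SL2 UNIV - A))) + measure lborel ?F"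
    using base_interval_germ_set(3)[OF C] F0(1) by (intro measure_Un_le fmeasurableD fmeasurable.Un)
  also have "\<dots> \<le> germ_measure A C + germ_measure (SL2 UNIV - A) C"
    unfolding germ_measure_def F0(2) using base_interval_germ_set(3)[OF C]
    by (simp, intro measure_Un_le fmeasurableD)
  finally show ?thesis by simp
qed

lemma germ_measure_le: 
  assumes C: "C \<in> lcosets\<^bsub>Gamma_group S\<^esub> (carrier (Gamma_group T))"
  shows "germ_measure A C \<le> 1/2"
proof -
  have "germ_measure A C \<le> measure lborel base_interval"
    unfolding germ_measure_def
    by (rule measure_mono_fmeasurable[OF _ fmeasurableD[OF base_interval_germ_set(3)[OF C]] open_lmeasurable]) auto
  then show ?thesis by simp
qed

lemma germ_measure_mono:
  assumes C: "C \<in> lcosets\<^bsub>Gamma_group S\<^esub> (carrier (Gamma_group T))" and "A \<subseteq> B"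
  shows "germ_measure A C \<le> germ_measure B C"
  unfolding germ_measure_def
proof (rule measure_mono_fmeasurable[OF _ fmeasurableD[OF base_interval_germ_set(3)[OF C]] base_interval_germ_set(3)[OF C]])
  show "base_interval \<inter> germ_set C A \<subseteq> base_interval \<inter> germ_set C B" using assms(2) unfolding germ_set_def by blast
qed

text \<open>The map carries points with germ in \<open>A\<close> to points with germ in K A without
  shrinking their measure. Those pushed past 1/2 leave the base interval, but they lie in an
  interval of length \<delta>.\<close>

lemma germ_measure_expand:
  assumes C: "C \<in> lcosets\<^bsub>Gamma_group S\<^esub> (carrier (Gamma_group T))"
    and h: "h \<in> carrier (Gamma_group S)" and \<delta>: "0 \<le> \<delta>"
    and K: "\<And>x. x \<in> base_interval \<Longrightarrow> germ h x K" and range: "\<And>x. x \<in> base_interval \<Longrightarrow> 0 < h x \<and> h x < 1/2 + \<delta>"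
    and der: "\<And>x. x \<in> base_interval \<Longrightarrow> (h has_field_derivative h' x) (at x)" "\<And>x. x \<in> base_interval \<Longrightarrow> 1 \<le> h' x"
  shows "germ_measure A C \<le> germ_measure (mat_mult K ` A) (h <#\<^bsub>Gamma_group S\<^esub> C) + \<delta>"
proof -
  let ?U = "base_interval \<inter> germ_set C A" and ?C = "h <#\<^bsub>Gamma_group S\<^esub> C"
  let ?V = "base_interval \<inter> germ_set ?C (mat_mult K ` A)"
  have hC: "?C \<in> lcosets\<^bsub>Gamma_group S\<^esub> (carrier (Gamma_group T))"
    using group_act_closed[OF lcosets_group_act[OF Gamma_group Gamma_subgroup[OF TS]] h C] .
  have hU: "open (h ` ?U)" by (rule Gamma_open_image[OF h base_interval_germ_set(1)[OF C]])
  have sub: "h ` ?U \<subseteq> ?V \<union> {1/2..1/2 + \<delta>}"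
  proof
    fix y assume "y \<in> h ` ?U"
    then obtain x where x: "x \<in> base_interval" "x \<in> germ_set C A" "y = h x" by blast
    have "y \<in> germ_set ?C (mat_mult K ` A)"
      unfolding x(3) by (rule germ_set_equivariant[OF lcoset_subset[OF C] K[OF x(1)] x(2)])
    then show "y \<in> ?V \<union> {1/2..1/2 + \<delta>}" using range[OF x(1)] x(3) by (cases "y < 1/2") auto
  qed
  have bdd: "bounded (h ` ?U)"
    by (rule bounded_subset[OF _ sub]) (use base_interval_germ_set(2)[OF hC] in auto)
  have Icc: "{1/2..1/2 + \<delta>} \<in> fmeasurable lborel" by (rule bounded_fmeasurable) auto
  have "measure lborel ?U \<le> measure lborel (h ` ?U)"
    by (rule expanding_map_measure[OF base_interval_germ_set(1,2)[OF C] hU bdd])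
       (use der Gamma_bij[OF h] in \<open>auto simp: bij_def intro: inj_on_subset\<close>)
  also have "\<dots> \<le> measure lborel (?V \<union> {1/2..1/2 + \<delta>})"
    by (rule measure_mono_fmeasurable[OF sub fmeasurableD[OF open_lmeasurable[OF hU bdd]]
          fmeasurable.Un[OF base_interval_germ_set(3)[OF hC] Icc]])
  also have "\<dots> \<le> measure lborel ?V + measure lborel {1/2..1/2 + \<delta>}"
    by (intro measure_Un_le fmeasurableD base_interval_germ_set(3)[OF hC] Icc)
  also have "measure lborel {1/2..1/2 + \<delta>} = \<delta>" using \<delta> by simp
  finally show ?thesis unfolding germ_measure_def by simp
qed

end

section \<open>The spectral gap\<close>

text \<open>If \<open>\<xi>\<close> were almost invariant, the mean of \<open>a\<close> against \<open>\<bar>\<xi>\<bar>\<^sup>2\<close> would be at least about \<open>15/64\<close> by \<open>lower\<close>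
  and at most about \<open>12/64\<close> by \<open>upper\<close>.\<close>

lemma displacement_from_weight:
  fixes G (structure) and a :: "_ \<Rightarrow> real"
  assumes G: "group G" and \<alpha>: "group_act G X \<alpha>"
    and e: "e1 \<in> carrier G" "e2 \<in> carrier G" "e3 \<in> carrier G"
    and a: "\<And>x. x \<in> X \<Longrightarrow> 0 \<le> a x" "\<And>x. x \<in> X \<Longrightarrow> a x \<le> 1"
    and lower: "\<And>x. x \<in> X \<Longrightarrow> 15/32 \<le> a (\<alpha> e1 x) + a x"
    and upper: "\<And>x. x \<in> X \<Longrightarrow> a x + a (\<alpha> (inv e2) x) + a (\<alpha> (inv e3) x) \<le> 9/16"
    and xi: "\<xi> \<in> ell2 X" "ell2_norm X \<xi> = 1"
  shows "\<exists>g\<in>{e1, e2, e3}. 1/64 \<le> ell2_norm X (\<lambda>x. act (perm_rep G X \<alpha>) g \<xi> x - \<xi> x)"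
proof (rule ccontr)
  assume *: "\<not> ?thesis"
  interpret group G by (rule G)
  let ?L = "act (perm_rep G X \<alpha>)"
  note U = perm_rep_unitary[OF G \<alpha>]
  have near: "ell2_norm X (\<lambda>x. ?L g \<xi> x - \<xi> x) \<le> 1/64" if "g \<in> {e1, e2, e3}" for g
    using * that by (meson linear)
  have Lell: "?L g \<xi> \<in> ell2 X" if "g \<in> carrier G" for g
    using op_maps[OF act_bounded_op[OF G U that]] xi(1) by simp
  have near': "ell2_norm X (\<lambda>x. \<xi> x - ?L (inv g) \<xi> x) \<le> 1/64" if g: "g \<in> {e1, e2, e3}" for g
  proof -
    have gc: "g \<in> carrier G" using g e by auto
    have "?L (inv g) (\<lambda>x. ?L g \<xi> x - \<xi> x) = (\<lambda>x. ?L (inv g) (?L g \<xi>) x - ?L (inv g) \<xi> x)"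
      using op_diff[OF act_bounded_op[OF G U inv_closed[OF gc]]] Lell[OF gc] xi(1) by simp
    also have "?L (inv g) (?L g \<xi>) = \<xi>"
      using act_mult[OF G U inv_closed[OF gc] gc] act_one[OF G U] xi(1) l_inv[OF gc]
      by (metis basis_perm_rep comp_apply op_id_apply)
    finally have "?L (inv g) (\<lambda>x. ?L g \<xi> x - \<xi> x) = (\<lambda>x. \<xi> x - ?L (inv g) \<xi> x)" .
    then show ?thesis
      using act_norm[OF G U inv_closed[OF gc], of "\<lambda>x. ?L g \<xi> x - \<xi> x"] near[OF g] ell2_diff[OF Lell[OF gc] xi(1)]
      by simp
  qed
  \<comment> \<open>Multiplication by the square root of the weight: the squared norm of
    \<open>M \<xi>\<close> is the mean of \<open>a\<close> against |\<xi>|^2, and \<open>M\<close>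
    is a contraction, so small displacements of \<xi> change this mean little.\<close>
  define M where "M f x = complex_of_real (if x \<in> X then sqrt (a x) else 0) * f x" for f x
  have Msq: "(cmod (M f x))\<^sup>2 = a x * (cmod (f x))\<^sup>2" if "x \<in> X" for f x
    using that a(1)[OF that] by (simp add: M_def norm_mult power_mult_distrib)
  have M: "M f \<in> ell2 X \<and> ell2_norm X (M f) \<le> ell2_norm X f" if f: "f \<in> ell2 X" for f
  proof -
    have "(\<Sum>x\<in>F. (cmod (M f x))\<^sup>2) \<le> (ell2_norm X f)\<^sup>2" if F: "finite F" "F \<subseteq> X" for F
    proof -
      have "(\<Sum>x\<in>F. (cmod (M f x))\<^sup>2) \<le> (\<Sum>x\<in>F. (cmod (f x))\<^sup>2)"
      proof (rule sum_mono)
        fix x assume "x \<in> F"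
        then have x: "x \<in> X" using F(2) by blast
        have "a x * (cmod (f x))\<^sup>2 \<le> 1 * (cmod (f x))\<^sup>2" by (rule mult_right_mono[OF a(2)[OF x]]) simp
        then show "(cmod (M f x))\<^sup>2 \<le> (cmod (f x))\<^sup>2" by (simp add: Msq[OF x])
      qed
      also have "\<dots> \<le> (ell2_norm X f)\<^sup>2" by (rule ell2_finite_sum_le[OF f F])
      finally show ?thesis .
    qed
    then show ?thesis using ell2_bounded_sums[of X "M f" "ell2_norm X f"] by (auto simp: M_def)
  qed
  have Mdiff: "ell2_norm X (M f) \<le> ell2_norm X (M h) + ell2_norm X (\<lambda>x. f x - h x)"
    if "f \<in> ell2 X" "h \<in> ell2 X" for f h
  proof -
    have "M (\<lambda>x. f x - h x) = (\<lambda>x. M f x - M h x)" by (auto simp: M_def algebra_simps)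
    then have "ell2_norm X (\<lambda>x. M f x - M h x) \<le> ell2_norm X (\<lambda>x. f x - h x)"
      using M[OF ell2_diff[OF that]] by simp
    then show ?thesis using ell2_norm_le_diff[of "M f" X "M h"] M that by fastforce
  qed
  have hs: "((\<lambda>x. a (\<alpha> g x) * (cmod (\<xi> x))\<^sup>2) has_sum (ell2_norm X (M (?L g \<xi>)))\<^sup>2) X"
    if g: "g \<in> carrier G" for g
  proof -
    have e: "M (?L g \<xi>) \<in> ell2 X" using M[OF Lell[OF g]] by blast
    have "((\<lambda>x. (cmod (M (?L g \<xi>) x))\<^sup>2) has_sum (ell2_norm X (M (?L g \<xi>)))\<^sup>2) X"
      unfolding ell2_norm_sq using ell2_summable[OF e] by simp
    then have sum: "((\<lambda>x. (cmod (M (?L g \<xi>) (\<alpha> g x)))\<^sup>2) has_sum (ell2_norm X (M (?L g \<xi>)))\<^sup>2) X"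
      using has_sum_reindex_bij_betw[OF group_act_bij[OF G \<alpha> g],
          of "\<lambda>x. (cmod (M (?L g \<xi>) x))\<^sup>2"] by simp
    have eq: "(cmod (M (?L g \<xi>) (\<alpha> g x)))\<^sup>2 = a (\<alpha> g x) * (cmod (\<xi> x))\<^sup>2" if x: "x \<in> X" for x
      using Msq[OF group_act_closed[OF \<alpha> g x]] group_act_closed[OF \<alpha> g x] group_act_cancel(1)[OF G \<alpha> g x]
      by (simp add: act_perm_rep[OF xi(1)])
    show ?thesis by (rule iffD1[OF has_sum_cong[OF eq] sum])
  qed
  have Lone: "?L \<one> \<xi> = \<xi>" using act_one[OF G U] xi(1) by simp
  define s where "s = ell2_norm X (M \<xi>)"
  have hs1: "((\<lambda>x. a x * (cmod (\<xi> x))\<^sup>2) has_sum s\<^sup>2) X"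
  proof -
    have "((\<lambda>x. a (\<alpha> \<one> x) * (cmod (\<xi> x))\<^sup>2) has_sum s\<^sup>2) X"
      using hs[OF one_closed] by (simp add: Lone s_def)
    then show ?thesis using \<alpha> by (subst has_sum_cong[of X _ "\<lambda>x. a (\<alpha> \<one> x) * (cmod (\<xi> x))\<^sup>2"]) (auto simp: group_act_def)
  qed
  have hs0: "((\<lambda>x. c * (cmod (\<xi> x))\<^sup>2) has_sum c * 1) X" for c
    by (rule has_sum_cmult_right)
      (use ell2_summable[OF xi(1)] ell2_norm_sq[of X \<xi>] xi(2) in \<open>simp add: has_sum_iff\<close>)
  have s: "0 \<le> s" "s \<le> 1" using M[OF xi(1)] xi(2) by (auto simp: s_def)
  have "15/32 * 1 \<le> (ell2_norm X (M (?L e1 \<xi>)))\<^sup>2 + s\<^sup>2"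
  proof (rule has_sum_mono[OF hs0 has_sum_add[OF hs[OF e(1)] hs1]])
    fix x assume "x \<in> X"
    from mult_right_mono[OF lower[OF this], of "(cmod (\<xi> x))\<^sup>2"]
    show "15/32 * (cmod (\<xi> x))\<^sup>2 \<le> a (\<alpha> e1 x) * (cmod (\<xi> x))\<^sup>2 + a x * (cmod (\<xi> x))\<^sup>2"
      by (simp add: algebra_simps)
  qed
  moreover have "(ell2_norm X (M (?L e1 \<xi>)))\<^sup>2 \<le> (s + 1/64)\<^sup>2"
    using Mdiff[OF Lell[OF e(1)] xi(1)] near[of e1] by (intro power_mono) (auto simp: s_def)
  ultimately have low: "15/32 \<le> (s + 1/64)\<^sup>2 + s\<^sup>2" by simp
  have up: "s\<^sup>2 + (ell2_norm X (M (?L (inv e2) \<xi>)))\<^sup>2 + (ell2_norm X (M (?L (inv e3) \<xi>)))\<^sup>2 \<le> 9/16 * 1"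
  proof (rule has_sum_mono[OF has_sum_add[OF has_sum_add[OF hs1 hs[OF inv_closed[OF e(2)]]] hs[OF inv_closed[OF e(3)]]] hs0])
    fix x assume "x \<in> X"
    from mult_right_mono[OF upper[OF this], of "(cmod (\<xi> x))\<^sup>2"]
    show "a x * (cmod (\<xi> x))\<^sup>2 + a (\<alpha> (inv e2) x) * (cmod (\<xi> x))\<^sup>2 + a (\<alpha> (inv e3) x) * (cmod (\<xi> x))\<^sup>2
        \<le> 9/16 * (cmod (\<xi> x))\<^sup>2"
      by (simp add: algebra_simps)
  qed
  have rg: "s - 1/64 \<le> ell2_norm X (M (?L (inv g) \<xi>))" if g: "g \<in> {e1, e2, e3}" for g
  proof -
    have "g \<in> carrier G" using g e by auto
    from Mdiff[OF xi(1) Lell[OF inv_closed[OF this]]] near'[OF g] show ?thesis by (simp add: s_def)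
  qed
  \<comment> \<open>For s at least 1/64 this is the square of the hypothesis; for smaller s the left
    side is not positive.\<close>
  have sq: "s\<^sup>2 - s / 32 \<le> r\<^sup>2" if "s - 1/64 \<le> r" "0 \<le> r" for r
  proof (cases "1/64 \<le> s")
    case True
    then have "(s - 1/64)\<^sup>2 \<le> r\<^sup>2" using that by (intro power_mono) auto
    then show ?thesis by (simp add: power2_eq_square algebra_simps)
  next
    case False
    then have "s * s \<le> s * (1/32)" using s by (intro mult_left_mono) auto
    then have "s\<^sup>2 - s / 32 \<le> 0" by (simp add: power2_eq_square)
    then show ?thesis using zero_le_power2[of r] by linarith
  qed
  have "s\<^sup>2 - s / 32 \<le> (ell2_norm X (M (?L (inv e2) \<xi>)))\<^sup>2" "s\<^sup>2 - s / 32 \<le> (ell2_norm X (M (?L (inv e3) \<xi>)))\<^sup>2"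
    by (rule sq[OF rg]; simp)+
  with up have "s\<^sup>2 + (s\<^sup>2 - s / 32) + (s\<^sup>2 - s / 32) \<le> 9/16" by linarith
  \<comment> \<open>The upper estimate leaves s^2 <= 5/24, about 0.208, while the lower one forces
    s^2 to be about 0.218 at least.\<close>
  then have "3 * s\<^sup>2 \<le> 5/8" using s by linarith
  moreover have "15/32 \<le> 2 * s\<^sup>2 + 1/32 + 1/4096"
    using low s by (simp add: power2_eq_square algebra_simps)
  ultimately show False by linarith
qed

text \<open>The average runs over the identity and three elements. Some image of a unit vector \<xi>
  is displaced by at least 1/64; paired with \<xi>, the contribution of the identity, it sums to
  norm at most sqrt (4 - (1/64)^2) by the parallelogram law. The other two vectors add at most
  2.\<close>

definition gap_constant :: real where
  "gap_constant = (sqrt (4 - 1/4096) + 2) / 4"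

lemma gap_constant: "0 \<le> gap_constant" "gap_constant < 1"
proof -
  have "sqrt (4 - 1/4096) < sqrt 4" by (rule real_sqrt_less_mono) simp
  moreover have "0 \<le> sqrt (4 - 1/4096 :: real)" by simp
  ultimately show "0 \<le> gap_constant" "gap_constant < 1" by (simp_all add: gap_constant_def)
qed

lemma average_norm_gap:
  assumes G: "group G" and \<pi>: "unitary_rep G \<pi>" and e: "e1 \<in> carrier G" "e2 \<in> carrier G" "e3 \<in> carrier G"
    and disp: "\<And>\<xi>. \<xi> \<in> ell2 (basis \<pi>) \<Longrightarrow> ell2_norm (basis \<pi>) \<xi> = 1 \<Longrightarrow>
        \<exists>g\<in>{e1, e2, e3}. 1/64 \<le> ell2_norm (basis \<pi>) (\<lambda>x. act \<pi> g \<xi> x - \<xi> x)"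
  shows "bnd (basis \<pi>) (group_alg_op \<pi> (average_list [\<one>\<^bsub>G\<^esub>, e1, e2, e3])) gap_constant"
proof -
  let ?X = "basis \<pi>"
  let ?A = "group_alg_op \<pi> (average_list [\<one>\<^bsub>G\<^esub>, e1, e2, e3])"
  have one: "\<one>\<^bsub>G\<^esub> \<in> carrier G" using G by (simp add: group.is_monoid monoid.one_closed)
  have A: "?A \<in> bounded_ops ?X"
    by (rule group_alg_bounded_op[OF G \<pi> average_group_lists]) (use e one in auto)
  have unit: "ell2_norm ?X (?A \<xi>) \<le> gap_constant" if xi: "\<xi> \<in> ell2 ?X" "ell2_norm ?X \<xi> = 1" for \<xi>
  proof -
    have ell: "act \<pi> g \<xi> \<in> ell2 ?X" "ell2_norm ?X (act \<pi> g \<xi>) = 1" if "g \<in> carrier G" for g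
      using op_maps[OF act_bounded_op[OF G \<pi> that] xi(1)] act_norm[OF G \<pi> that xi(1)] xi(2) by auto
    have main: "ell2_norm ?X (\<lambda>x. (1/4) * ((act \<pi> g \<xi> x + \<xi> x) + (act \<pi> h \<xi> x + act \<pi> k \<xi> x))) \<le> gap_constant"
      if g: "g \<in> carrier G" "h \<in> carrier G" "k \<in> carrier G"
        and d: "1/64 \<le> ell2_norm ?X (\<lambda>x. act \<pi> g \<xi> x - \<xi> x)" for g h k
    proof -
      have "(1/64)\<^sup>2 \<le> (ell2_norm ?X (\<lambda>x. act \<pi> g \<xi> x - \<xi> x))\<^sup>2" using d by (intro power_mono) auto
      then have "(ell2_norm ?X (\<lambda>x. act \<pi> g \<xi> x + \<xi> x))\<^sup>2 \<le> 4 - 1/4096"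
        using ell2_parallelogram[OF ell(1)[OF g(1)] xi(1)] ell(2)[OF g(1)] xi(2) by (simp add: power2_eq_square)
      then have 1: "ell2_norm ?X (\<lambda>x. act \<pi> g \<xi> x + \<xi> x) \<le> sqrt (4 - 1/4096)" by (rule real_le_rsqrt)
      have 2: "ell2_norm ?X (\<lambda>x. act \<pi> h \<xi> x + act \<pi> k \<xi> x) \<le> 2"
        using ell2_norm_triangle[OF ell(1)[OF g(2)] ell(1)[OF g(3)]] ell(2) g by simp
      have "ell2_norm ?X (\<lambda>x. (act \<pi> g \<xi> x + \<xi> x) + (act \<pi> h \<xi> x + act \<pi> k \<xi> x)) \<le> sqrt (4 - 1/4096) + 2"
        using ell2_norm_triangle[OF ell2_add[OF ell(1)[OF g(1)] xi(1)] ell2_add[OF ell(1)[OF g(2)] ell(1)[OF g(3)]]]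
          1 2 by linarith
      then show ?thesis
        unfolding ell2_norm_scale gap_constant_def by (simp add: norm_divide)
    qed
    obtain g where g: "g \<in> {e1, e2, e3}" "1/64 \<le> ell2_norm ?X (\<lambda>x. act \<pi> g \<xi> x - \<xi> x)"
      using disp[OF xi] by blast
    have A\<xi>: "?A \<xi> = (\<lambda>x. (1/4) * (\<xi> x + (act \<pi> e1 \<xi> x + (act \<pi> e2 \<xi> x + act \<pi> e3 \<xi> x))))"
      using xi(1) by (simp add: fun_eq_iff average_apply act_one[OF G \<pi>])
    consider "g = e1" | "g = e2" | "g = e3" using g(1) by blast
    then show ?thesis
    proof cases
      case 1
      then show ?thesis using main[of e1 e2 e3] e g(2) A\<xi> by (simp add: add_ac)
    next
      case 2
      then show ?thesis using main[of e2 e1 e3] e g(2) A\<xi> by (simp add: add_ac)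
    next
      case 3
      then show ?thesis using main[of e3 e1 e2] e g(2) A\<xi> by (simp add: add_ac)
    qed
  qed
  show ?thesis
    unfolding bnd_def
  proof
    fix f assume f: "f \<in> ell2 ?X"
    show "ell2_norm ?X (?A f) \<le> gap_constant * ell2_norm ?X f"
    proof (cases "ell2_norm ?X f = 0")
      case True
      then have "f = (\<lambda>x. 0)" by (rule ell2_norm_eq_0[OF f])
      then show ?thesis using op_zero[OF A] by simp
    next
      case False
      then have pos: "0 < ell2_norm ?X f" using ell2_norm_nonneg[of ?X f] by linarith
      let ?c = "complex_of_real (1 / ell2_norm ?X f)"
      have c: "cmod ?c = 1 / ell2_norm ?X f" using pos by (simp add: norm_divide)
      have "ell2_norm ?X (?A (\<lambda>x. ?c * f x)) \<le> gap_constant"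
        by (rule unit[OF ell2_scale[OF f]]) (use pos in \<open>simp only: ell2_norm_scale c, simp\<close>)
      then show ?thesis using pos
        unfolding op_scale[OF A f] ell2_norm_scale c by (simp add: divide_simps)
    qed
  qed
qed

text \<open>The conditions on the three elements concern \<open>base_interval\<close> alone, so any
  elements with these germs there qualify. On it they are expanding in the weak sense and overshoot
  1/2 by less than 1/32; the bounds 15/32 and 9/16 of \<open>displacement_from_weight\<close> are
  1/2 corrected by one or two such overshoots.\<close>

theorem quasi_regular_gap:
  assumes TS: "T \<subseteq> S" and primes: "\<forall>q\<in>S. prime q" and p: "p \<in> S" "p \<notin> T"
    and t: "t = 1 / of_nat p ^ 6"
    and e: "e1 \<in> carrier (Gamma_group S)" "e2 \<in> carrier (Gamma_group S)" "e3 \<in> carrier (Gamma_group S)"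
    and e1: "\<And>z. z \<in> base_interval \<Longrightarrow> denom (1, 0, - t, 1) z \<noteq> 0 \<and> e1 z = mob (1, 0, - t, 1) z"
    and e2: "\<And>z. z \<in> base_interval \<Longrightarrow> e2 z = z + of_rat t"
    and e3: "\<And>z. z \<in> base_interval \<Longrightarrow> e3 z = z + 2 * of_rat t"
  shows "bnd (lcosets\<^bsub>Gamma_group S\<^esub> (carrier (Gamma_group T)))
    (group_alg_op (lambda_quotient S T) (average_list [id, e1, e2, e3])) gap_constant"
proof -
  let ?G = "Gamma_group S" and ?H = "carrier (Gamma_group T)"
  let ?X = "lcosets\<^bsub>?G\<^esub> ?H" and ?\<alpha> = "\<lambda>g C. g <#\<^bsub>?G\<^esub> C"
  let ?D = "half_tree p" and ?a = "germ_measure (half_tree p)"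
  have pp: "prime p" using primes p by blast
  have Tp: "\<forall>q\<in>T. prime q" using primes TS by blast
  have \<alpha>: "group_act ?G ?X ?\<alpha>" by (rule lcosets_group_act[OF Gamma_group Gamma_subgroup[OF TS]])
  define t' where "t' = real_of_rat t"
  have p2: "2 \<le> p" using prime_ge_2_nat[OF pp] .
  have "(2::rat) ^ 6 \<le> of_nat p ^ 6" by (rule power_mono) (use p2 in auto)
  then have trat: "0 < t" "t \<le> 1/64" using p2 by (auto simp: t divide_simps)
  have t': "0 < t'" "t' \<le> 1/64"
    using trat of_rat_less_eq[of t "1/64"] by (auto simp: t'_def of_rat_divide simp del: of_rat_less_eq)
  have pt: "padic_abs p t = real p ^ 6"
    using padic_abs_inverse[OF pp, of "of_nat p ^ 6"] padic_abs_prime_power[OF pp, of 6] p2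
    by (simp add: t power_divide)
  have "(1::real) < real p ^ 5" using p2 by (intro one_less_power) auto
  moreover have "real p ^ 6 = real p ^ 5 * p" by (simp add: eval_nat_numeral)
  moreover have "real p ^ 5 * 1 \<le> real p ^ 5 * p" using p2 by (intro mult_left_mono) auto
  ultimately have tau1: "1 < padic_abs p t" "1 < padic_abs p (- t)"
    by (simp_all add: pt padic_abs_minus[OF pp])
  \<comment> \<open>The factor 2 is a p-adic unit except for p = 2, where it costs one factor p; the
    exponent 6 of p in t absorbs this.\<close>
  have two: "1 / p \<le> padic_abs p 2"
  proof (cases "p = 2")
    case True
    then show ?thesis using padic_abs_prime[OF pp] by simp
  next
    case False
    then have "padic_abs p (1 / of_nat 2) \<le> 1" by (intro padic_abs_other_prime[OF pp]) auto
    then have "1 / padic_abs p 2 \<le> 1" using padic_abs_inverse[OF pp, of 2] by simp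
    moreover have "0 < padic_abs p 2" using padic_abs_nonneg[OF pp, of 2] padic_abs_zero_iff[OF pp, of 2] by linarith
    ultimately have "1 \<le> padic_abs p 2" by simp
    moreover have "1 / real p \<le> 1" using p2 by simp
    ultimately show ?thesis by linarith
  qed
  have tau2: "1 < padic_abs p (2 * t)"
  proof -
    have "1 < real p ^ 5" using p2 by (intro one_less_power) auto
    also have "real p ^ 5 = 1 / p * real p ^ 6" using p2 by (simp add: eval_nat_numeral)
    also have "\<dots> \<le> padic_abs p 2 * real p ^ 6" using two by (intro mult_right_mono) auto
    finally show ?thesis by (simp add: padic_abs_mult[OF pp] pt)
  qed
  have DU: "?D \<subseteq> SL2 UNIV" by (auto simp: half_tree_def)
  have up: "(1, \<tau>, 0, 1) \<in> SL2 UNIV" for \<tau> by (simp add: SL2_def)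
  have germ1: "germ e1 x (1, 0, - t, 1)" if "x \<in> base_interval" for x
    by (rule germI_open[of base_interval]) (use that e1 in auto)
  have germ2: "germ e2 x (1, t, 0, 1)" if "x \<in> base_interval" for x
    by (rule germI_open[of base_interval]) (use that e2 in auto)
  have germ3: "germ e3 x (1, 2 * t, 0, 1)" if "x \<in> base_interval" for x
    by (rule germI_open[of base_interval]) (use that e3 in \<open>auto simp: of_rat_mult\<close>)
  have den1: "31/32 \<le> 1 - t' * z" "1 - t' * z < 1" if "z \<in> base_interval" for z
  proof -
    have "t' * z \<le> 1/64 * (1/2)" using that t' by (intro mult_mono) auto
    then show "31/32 \<le> 1 - t' * z" by simp
    show "1 - t' * z < 1" using that t' by simp
  qed
  have e1': "e1 z = z / (1 - t' * z)" if "z \<in> base_interval" for z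
    using e1[OF that] by (simp add: t'_def of_rat_minus)
  have expand1: "germ_measure A C \<le> germ_measure (mat_mult (1, 0, - t, 1) ` A) (?\<alpha> e1 C) + 1/32" if C: "C \<in> ?X" for A C
  proof (rule germ_measure_expand[OF TS C e(1) _ germ1])
    fix x :: real assume x: "x \<in> base_interval"
    have "x / (1 - t' * x) < 1/2 + 1/32"
    proof -
      have "x < 1/2" using x by simp
      also have "1/2 \<le> (1/2 + 1/32) * (31/32 :: real)" by simp
      also have "\<dots> \<le> (1/2 + 1/32) * (1 - t' * x)" using den1[OF x] by (intro mult_left_mono) auto
      finally show ?thesis using den1[OF x] by (simp add: divide_less_eq)
    qed
    then show "0 < e1 x \<and> e1 x < 1/2 + 1/32" using x den1[OF x] e1'[OF x] by simp
    have "((\<lambda>z. z / (1 - t' * z)) has_field_derivative 1 / (1 - t' * x)\<^sup>2) (at x)"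
      using den1[OF x] by (auto intro!: derivative_eq_intros simp: divide_simps power2_eq_square)
    then show "(e1 has_field_derivative 1 / (1 - t' * x)\<^sup>2) (at x)"
      by (rule has_field_derivative_transform_within_open[of _ _ _ base_interval]) (use x e1' in auto)
    have "(1 - t' * x)\<^sup>2 \<le> 1" using den1[OF x] by (intro power_le_one) auto
    then show "1 \<le> 1 / (1 - t' * x)\<^sup>2" using den1[OF x] by (simp add: divide_simps)
  qed simp
  have transl: "germ_measure A C \<le> germ_measure (mat_mult K ` A) (?\<alpha> h C) + 1/32"
    if C: "C \<in> ?X" and h: "h \<in> carrier ?G" "\<And>x. x \<in> base_interval \<Longrightarrow> germ h x K" "\<And>z. z \<in> base_interval \<Longrightarrow> h z = z + r" "0 < r" "r \<le> 1/32"
    for A C h K r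
  proof (rule germ_measure_expand[OF TS C h(1) _ h(2)])
    fix x :: real assume x: "x \<in> base_interval"
    then show "0 < h x \<and> h x < 1/2 + 1/32" using h by simp
    have "((\<lambda>z. z + r) has_field_derivative 1) (at x)" by (auto intro!: derivative_eq_intros)
    then show "(h has_field_derivative 1) (at x)"
      by (rule has_field_derivative_transform_within_open[of _ _ _ base_interval]) (use x h in auto)
  qed simp_all
  have disp: "\<exists>g\<in>{e1, e2, e3}. 1/64 \<le> ell2_norm ?X (\<lambda>x. act (perm_rep ?G ?X ?\<alpha>) g \<xi> x - \<xi> x)"
    if xi: "\<xi> \<in> ell2 ?X" "ell2_norm ?X \<xi> = 1" for \<xi>
  proof (rule displacement_from_weight[where a = ?a, OF Gamma_group \<alpha> e _ _ _ _ xi])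
    fix C assume C: "C \<in> ?X"
    show "0 \<le> ?a C" by (simp add: germ_measure_def[OF TS])
    show "?a C \<le> 1" using germ_measure_le[OF TS C, of ?D] by simp
    have e1C: "?\<alpha> e1 C \<in> ?X" by (rule group_act_closed[OF \<alpha> e(1) C])
    \<comment> \<open>The lower shear moves the complement of the half-tree into the half-tree. The
      weights of C and of its translate therefore cover the interval up to one overshoot: 1/2 - 1/32
      = 15/32.\<close>
    have "mat_mult (1, 0, - t, 1) ` (SL2 UNIV - ?D) \<subseteq> ?D"
      using half_tree_lower[OF pp _ _ tau1(2)] by blast
    from germ_measure_mono[OF TS e1C this] expand1[OF C, of "SL2 UNIV - ?D"] germ_measure_total[OF TS C, of ?D]
    show "15/32 \<le> ?a (?\<alpha> e1 C) + ?a C" by linarith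
    interpret group ?G by (rule Gamma_group)
    \<comment> \<open>The expansion estimate is applied to the coset h^-1 C, which h carries back to
      C.\<close>
    have shift: "?a (?\<alpha> (inv\<^bsub>?G\<^esub> h) C) \<le> germ_measure (mat_mult (1, \<tau>, 0, 1) ` ?D) C + 1/32"
      if h: "h \<in> carrier ?G" "\<And>x. x \<in> base_interval \<Longrightarrow> germ h x (1, \<tau>, 0, 1)" "\<And>z. z \<in> base_interval \<Longrightarrow> h z = z + r" "0 < r" "r \<le> 1/32" for h r \<tau>
      using transl[OF group_act_closed[OF \<alpha> inv_closed[OF h(1)] C] h, of ?D] group_act_cancel(2)[OF Gamma_group \<alpha> h(1) C]
      by simp
    have s2: "?a (?\<alpha> (inv\<^bsub>?G\<^esub> e2) C) \<le> germ_measure (mat_mult (1, t, 0, 1) ` ?D) C + 1/32"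
      by (rule shift[OF e(2) germ2, of t']) (use e2 t' in \<open>auto simp: t'_def\<close>)
    have s3: "?a (?\<alpha> (inv\<^bsub>?G\<^esub> e3) C) \<le> germ_measure (mat_mult (1, 2 * t, 0, 1) ` ?D) C + 1/32"
      by (rule shift[OF e(3) germ3, of "2 * t'"]) (use e3 t' in \<open>auto simp: t'_def\<close>)
    let ?D2 = "mat_mult (1, t, 0, 1) ` ?D" and ?D3 = "mat_mult (1, 2 * t, 0, 1) ` ?D"
    have sub: "?D2 \<subseteq> SL2 UNIV" "?D3 \<subseteq> SL2 UNIV" using DU SL2_mult_UNIV[OF up] by blast+
    have invD: "mat_mult M N \<in> ?D" if "M \<in> ?D" "N \<in> SL2 (S_integers T)" for M N
      using half_tree_right_invariant[OF pp _ that(2) Tp p(2), of M] that(1) DU by blast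
    have inv2: "mat_mult M N \<in> ?D2" if M2: "M \<in> ?D2" and N: "N \<in> SL2 (S_integers T)" for M N
    proof -
      obtain L where L: "L \<in> ?D" "M = mat_mult (1, t, 0, 1) L" using M2 by blast
      have "mat_mult M N = mat_mult (1, t, 0, 1) (mat_mult L N)" unfolding L(2) by (rule mat_mult_assoc)
      then show ?thesis using invD[OF L(1) N] by (rule image_eqI)
    qed
    have d12: "?D \<inter> ?D2 = {}" using half_tree_upper[OF pp _ tau1(1)] by blast
    have d13: "?D \<inter> ?D3 = {}" using half_tree_upper[OF pp _ tau2] by blast
    \<comment> \<open>Undoing the shear by t on both sides reduces this to the fact that this shear
      moves the half-tree off itself.\<close>
    have d23: "?D2 \<inter> ?D3 = {}"
    proof (rule ccontr)
      assume "?D2 \<inter> ?D3 \<noteq> {}"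
      then obtain M N where MN: "M \<in> ?D" "N \<in> ?D" "mat_mult (1, t, 0, 1) M = mat_mult (1, 2 * t, 0, 1) N" by blast
      have "mat_mult (1, - t, 0, 1) (mat_mult (1, t, 0, 1) M) = M"
        by (simp add: mat_mult_assoc[symmetric] del: mat_mult.simps(1)) simp
      moreover have "mat_mult (1, - t, 0, 1) (mat_mult (1, 2 * t, 0, 1) N) = mat_mult (1, t, 0, 1) N"
        by (cases N) (simp add: algebra_simps)
      ultimately have "M = mat_mult (1, t, 0, 1) N" using MN(3) by simp
      then show False using half_tree_upper[OF pp MN(2) tau1(1)] MN(1) by simp
    qed
    note dis = germ_set_disjoint[OF TS C DU sub(1) d12 invD] germ_set_disjoint[OF TS C DU sub(2) d13 invD]
      germ_set_disjoint[OF TS C sub(1) sub(2) d23 inv2]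
    note fm = base_interval_germ_set(3)[OF TS C]
    let ?B = "\<lambda>A. base_interval \<inter> germ_set C A"
    have "measure lborel (?B ?D \<union> ?B ?D2 \<union> ?B ?D3) = measure lborel (?B ?D \<union> ?B ?D2) + measure lborel (?B ?D3)"
      by (rule measure_Un_AE[OF _ fmeasurable.Un[OF fm fm] fm]) (use dis in auto)
    also have "measure lborel (?B ?D \<union> ?B ?D2) = measure lborel (?B ?D) + measure lborel (?B ?D2)"
      by (rule measure_Un_AE[OF _ fm fm]) (use dis in auto)
    finally have "?a C + germ_measure ?D2 C + germ_measure ?D3 C = measure lborel (?B ?D \<union> ?B ?D2 \<union> ?B ?D3)"
      by (simp add: germ_measure_def[OF TS])
    also have "\<dots> \<le> measure lborel base_interval"
      by (rule measure_mono_fmeasurable[OF _ fmeasurableD[OF fmeasurable.Un[OF fmeasurable.Un[OF fm fm] fm]]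
            open_lmeasurable]) auto
    also have "\<dots> = 1/2" by simp
    \<comment> \<open>Three disjoint parts of an interval of length 1/2, with an overshoot for each
      of the two translates.\<close>
    finally show "?a C + ?a (?\<alpha> (inv\<^bsub>?G\<^esub> e2) C) + ?a (?\<alpha> (inv\<^bsub>?G\<^esub> e3) C) \<le> 9/16"
      using s2 s3 by linarith
  qed
  have "bnd (basis (lambda_quotient S T))
    (group_alg_op (lambda_quotient S T) (average_list [\<one>\<^bsub>?G\<^esub>, e1, e2, e3])) gap_constant"
    unfolding quasi_regular_rep_eq_perm_rep
    by (rule average_norm_gap[OF Gamma_group perm_rep_unitary[OF Gamma_group \<alpha>] e])
       (use disp in \<open>simp add: basis_perm_rep\<close>)
  then show ?thesis by (simp add: quasi_regular_rep_eq_perm_rep)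
qed

section \<open>Domination of the regular representation\<close>

lemma nontrivial_germ:
  assumes g: "g \<in> carrier (Gamma_group S)" "g \<noteq> id"
  shows "\<exists>x. \<exists>M\<in>SL2 (S_integers S). germ g x M \<and> M \<noteq> (1, 0, 0, 1) \<and> M \<noteq> (-1, 0, 0, -1)"
proof -
  have cont: "continuous_on UNIV g" using g(1) homeomorphism_inv(3) by (auto simp: Gamma_carrier)
  have "closed {x. g x = x}" by (rule closed_Collect_eq[OF cont continuous_on_id])
  then have "open (- {x. g x = x})" by (simp add: open_closed)
  moreover have "- {x. g x = x} \<noteq> {}" using g(2) by (auto simp: fun_eq_iff)
  ultimately obtain y M where y: "y \<in> - {x. g x = x}" "M \<in> SL2 (S_integers S)" "germ g y M"
    by (rule Gamma_germ_in_open[OF g(1)])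
  have "g y = mob M y" using germ_at[OF y(3)] by simp
  then have "M \<noteq> (1, 0, 0, 1)" "M \<noteq> (-1, 0, 0, -1)" using y(1) by auto
  with y show ?thesis by blast
qed

lemma finite_quadratic_roots:
  fixes a b c :: rat
  assumes "a \<noteq> 0 \<or> b \<noteq> 0 \<or> c \<noteq> 0"
  shows "finite {n::nat. a + b * of_nat n + c * (of_nat n)\<^sup>2 = 0}"
proof -
  have "[:a, b, c:] \<noteq> 0" using assms by auto
  then have "finite {x. poly [:a, b, c:] x = 0}" by (rule poly_roots_finite)
  then have "finite (of_nat -` {x. poly [:a, b, c:] x = 0} :: nat set)"
    by (rule finite_vimageI) (simp add: inj_on_def)
  then show ?thesis by (rule finite_subset[rotated]) (auto simp: power2_eq_square algebra_simps)
qed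

text \<open>The conjugator is z -> r^2 z + n. Conjugating a germ (a, b, c, d) by it yields the upper
  right entry (b + (a - d) n - c n^2) / r^2. The quadratic vanishes only if n is a fixed point, so
  one n works for all of \<open>F\<close>; a large power r of p then makes all these entries fail to
  be p-integral.\<close>

lemma conjugate_off_Gamma:
  assumes primes: "\<forall>q\<in>S. prime q" and TS: "T \<subseteq> S" and p: "p \<in> S" "p \<notin> T"
    and F: "finite F" "F \<subseteq> carrier (Gamma_group S) - {id}"
  shows "\<exists>\<theta>\<in>carrier (Gamma_group S). \<forall>g\<in>F. inv_map \<theta> \<circ> (g \<circ> \<theta>) \<notin> carrier (Gamma_group T)"
proof -
  have pp: "prime p" using primes p by blast
  have Tp: "\<forall>q\<in>T. prime q" using primes TS by blast
  have "\<forall>g\<in>F. \<exists>x M. M \<in> SL2 (S_integers S) \<and> germ g x M \<and> M \<noteq> (1, 0, 0, 1) \<and> M \<noteq> (-1, 0, 0, -1)"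
    using nontrivial_germ F(2) by blast
  then obtain X M where M: "\<And>g. g \<in> F \<Longrightarrow> M g \<in> SL2 (S_integers S)" "\<And>g. g \<in> F \<Longrightarrow> germ g (X g) (M g)"
    "\<And>g. g \<in> F \<Longrightarrow> M g \<noteq> (1, 0, 0, 1) \<and> M g \<noteq> (-1, 0, 0, -1)"
    by metis
  define \<beta> where "\<beta> N t = (case N of (a, b, c, d) \<Rightarrow> b + (a - d) * t + (- c) * t\<^sup>2)" for N :: mat2 and t :: rat
  have "finite {n::nat. \<beta> (M g) (of_nat n) = 0}" if g: "g \<in> F" for g
  proof -
    obtain a b c d where Mg: "M g = (a, b, c, d)" by (cases "M g")
    have "b \<noteq> 0 \<or> a - d \<noteq> 0 \<or> - c \<noteq> 0"
    proof (rule ccontr)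
      assume "\<not> ?thesis"
      then have 0: "b = 0" "c = 0" "d = a" by auto
      then have "a * a = 1" using M(1)[OF g] by (simp add: Mg SL2_def)
      then have "a = 1 \<or> a = -1" using square_eq_1_iff[of a] by simp
      then show False using M(3)[OF g] 0 by (auto simp: Mg)
    qed
    then show ?thesis unfolding \<beta>_def Mg prod.case by (rule finite_quadratic_roots)
  qed
  then have "finite (\<Union>g\<in>F. {n::nat. \<beta> (M g) (of_nat n) = 0})" using F(1) by blast
  then obtain n :: nat where "n \<notin> (\<Union>g\<in>F. {n::nat. \<beta> (M g) (of_nat n) = 0})"
    using ex_new_if_finite infinite_UNIV_nat by blast
  then have \<beta>n: "\<beta> (M g) (of_nat n) \<noteq> 0" if "g \<in> F" for g using that by blast
  let ?t = "of_nat n :: rat"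
  have "\<forall>\<^sub>F k in sequentially. 1 < padic_abs p (\<beta> (M g) ?t) * (real p ^ k)" if g: "g \<in> F" for g
  proof -
    have pos: "0 < padic_abs p (\<beta> (M g) ?t)"
      using padic_abs_nonneg[OF pp] padic_abs_zero_iff[OF pp] \<beta>n[OF g] by (simp add: order_less_le)
    have p1: "1 < real p" using prime_gt_1_nat[OF pp] by simp
    obtain m where m: "1 / padic_abs p (\<beta> (M g) ?t) < real p ^ m" using real_arch_pow[OF p1] by blast
    have "1 < padic_abs p (\<beta> (M g) ?t) * real p ^ k" if "m \<le> k" for k
    proof -
      have "real p ^ m \<le> real p ^ k" using that p1 by (intro power_increasing) auto
      then have "1 / padic_abs p (\<beta> (M g) ?t) < real p ^ k" using m by linarith
      then show ?thesis using pos by (simp add: divide_less_eq mult.commute)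
    qed
    then show ?thesis unfolding eventually_sequentially by blast
  qed
  then have "\<forall>\<^sub>F k in sequentially. \<forall>g\<in>F. 1 < padic_abs p (\<beta> (M g) ?t) * (real p ^ k)"
    by (intro eventually_ball_finite F(1)) blast
  then obtain k0 where k0: "\<And>g k. k \<ge> k0 \<Longrightarrow> g \<in> F \<Longrightarrow> 1 < padic_abs p (\<beta> (M g) ?t) * (real p ^ k)"
    unfolding eventually_sequentially by blast
  define r :: rat where "r = of_nat p ^ k0"
  have r: "r \<noteq> 0" using prime_gt_0_nat[OF pp] by (simp add: r_def)
  have pr: "1 / r = (1 / of_nat p) ^ k0" by (simp add: r_def power_divide)
  have rS: "r \<in> S_integers S" "1 / r \<in> S_integers S" "?t / r \<in> S_integers S"
    unfolding r_def using S_integers_power[OF S_integers_of_nat] S_integers_power[OF S_integers.inverse_prime[OF p(1)]]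
      S_integers.mult[OF S_integers_of_nat, of _ S n] pr[unfolded r_def] by (force simp: divide_inverse)+
  let ?N = "(r, ?t / r, 0, 1 / r)"
  have N: "?N \<in> SL2 (S_integers S)" using rS r by (simp add: SL2_def S_integers_zero)
  define \<theta> where "\<theta> = mob ?N"
  have \<theta>: "\<theta> \<in> carrier (Gamma_group S)" "\<And>x. germ \<theta> x ?N"
    unfolding \<theta>_def by (rule affine_in_Gamma[OF N])+
  have "inv_map \<theta> \<circ> (g \<circ> \<theta>) \<notin> carrier (Gamma_group T)" if g: "g \<in> F" for g
  proof
    assume in_T: "inv_map \<theta> \<circ> (g \<circ> \<theta>) \<in> carrier (Gamma_group T)"
    have gS: "g \<in> carrier (Gamma_group S)" using g F(2) by blast
    let ?y = "inv_map \<theta> (X g)"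
    have \<theta>y: "\<theta> ?y = X g" by (rule Gamma_inv(1)[OF \<theta>(1)])
    have g1: "germ (g \<circ> \<theta>) ?y (mat_mult (M g) ?N)"
      by (rule Gamma_germ_comp[OF \<theta>(1,2)]) (simp only: \<theta>y M(2)[OF g])
    have "germ (inv_map \<theta>) (\<theta> (inv_map \<theta> ((g \<circ> \<theta>) ?y))) (mat_inv ?N)"
      by (rule Gamma_germ_inv[OF \<theta>(1,2) SL2_UNIV[OF N]])
    then have "germ (inv_map \<theta>) ((g \<circ> \<theta>) ?y) (mat_inv ?N)" by (simp only: Gamma_inv(1)[OF \<theta>(1)])
    from Gamma_germ_comp[OF Gamma_comp_closed[OF gS \<theta>(1)] g1 this]
    have gc: "germ (inv_map \<theta> \<circ> (g \<circ> \<theta>)) ?y (mat_mult (mat_inv ?N) (mat_mult (M g) ?N))" .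
    have "mat_mult (mat_inv ?N) (mat_mult (M g) ?N) \<in> SL2 UNIV"
      by (intro SL2_mult_UNIV SL2_inv_UNIV SL2_UNIV[OF N] SL2_UNIV[OF M(1)[OF g]])
    from Gamma_germ_integral[OF in_T gc this]
    have inT: "mat_mult (mat_inv ?N) (mat_mult (M g) ?N) \<in> SL2 (S_integers T)" .
    obtain a b c d where Mg: "M g = (a, b, c, d)" by (cases "M g")
    have entry: "y \<in> R" if "(x, y, z, w) \<in> SL2 R" for x y z w R using that by (simp add: SL2_def)
    have "1 / r * (a * (?t / r) + b * (1 / r)) + - (?t / r) * (c * (?t / r) + d * (1 / r)) = \<beta> (M g) ?t / (r * r)"
      using r by (simp add: Mg \<beta>_def power2_eq_square field_simps)
    with entry[OF inT[unfolded Mg mat_inv.simps mat_mult.simps]]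
    have "\<beta> (M g) ?t / (r * r) \<in> S_integers T" by simp
    then have "padic_abs p (\<beta> (M g) ?t / (r * r)) \<le> 1"
      by (rule S_integers_padic_abs[OF pp _ Tp p(2)])
    moreover have pr: "padic_abs p (1 / r) = real p ^ k0"
      using padic_abs_inverse[OF pp r] by (simp add: r_def padic_abs_prime_power[OF pp] power_divide)
    have "\<beta> (M g) ?t / (r * r) = \<beta> (M g) ?t * ((1 / r) * (1 / r))" by simp
    then have "padic_abs p (\<beta> (M g) ?t / (r * r)) = padic_abs p (\<beta> (M g) ?t) * (real p ^ k0 * real p ^ k0)"
      by (simp only: padic_abs_mult[OF pp] pr)
    ultimately have "padic_abs p (\<beta> (M g) ?t) * real p ^ (k0 + k0) \<le> 1"
      by (simp add: power_add)
    with k0[of "k0 + k0", OF _ g] show False by simp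
  qed
  with \<theta>(1) show ?thesis by blast
qed

section \<open>Copying finite windows of the group into the coset space\<close>

lemma bnd_by_approximation:
  assumes A: "A \<in> bounded_ops X" and "0 \<le> C"
    and fin: "\<And>F f. finite F \<Longrightarrow> F \<subseteq> X \<Longrightarrow> f \<in> ell2 X \<Longrightarrow> (\<And>x. x \<notin> F \<Longrightarrow> f x = 0) \<Longrightarrow>
        ell2_norm X (A f) \<le> C * ell2_norm X f"
  shows "bnd X A C"
  unfolding bnd_def
proof
  fix f assume f: "f \<in> ell2 X"
  obtain D where D: "0 \<le> D" "bnd X A D" using bounded_ops_bnd[OF A] .
  show "ell2_norm X (A f) \<le> C * ell2_norm X f"
  proof (rule field_le_epsilon)
    fix e :: real assume "0 < e"
    define d where "d = e / (C + D + 1)"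
    have p: "0 < C + D + 1" using D \<open>0 \<le> C\<close> by linarith
    then have d: "0 < d" using \<open>0 < e\<close> by (simp add: d_def)
    obtain F where F: "finite F" "F \<subseteq> X" "ell2_norm X (\<lambda>x. f x - (\<Sum>a\<in>F. f a * delta a x)) \<le> d"
      using ell2_finite_approx[OF f d] .
    let ?u = "\<lambda>x. \<Sum>a\<in>F. f a * delta a x"
    have u: "?u \<in> ell2 X" using F(2) by (intro ell2_sum ell2_scale delta_ell2) auto
    have w: "(\<lambda>x. f x - ?u x) \<in> ell2 X" by (rule ell2_diff[OF f u])
    have u0: "?u x = 0" if "x \<notin> F" for x
      by (rule sum.neutral) (use that in \<open>auto simp: delta_def\<close>)
    have nu: "ell2_norm X ?u \<le> ell2_norm X f + d"
      using ell2_norm_le_diff[OF u f] F(3) by (simp add: ell2_norm_commute[of X f])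
    have "ell2_norm X (A f) \<le> ell2_norm X (A ?u) + ell2_norm X (\<lambda>x. A f x - A ?u x)"
      by (rule ell2_norm_le_diff[OF op_maps[OF A f] op_maps[OF A u]])
    also have "(\<lambda>x. A f x - A ?u x) = A (\<lambda>x. f x - ?u x)" by (simp add: op_diff[OF A f u])
    also have "ell2_norm X (A ?u) + ell2_norm X (A (\<lambda>x. f x - ?u x)) \<le> C * ell2_norm X ?u + D * d"
      by (intro add_mono fin[OF F(1,2) u u0] order_trans[OF bndD[OF D(2) w] mult_left_mono[OF F(3) D(1)]])
    also have "\<dots> \<le> C * (ell2_norm X f + d) + D * d"
      by (intro add_right_mono mult_left_mono nu \<open>0 \<le> C\<close>)
    also have "\<dots> = C * ell2_norm X f + (C + D) * d" by (simp add: algebra_simps)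
    also have "\<dots> \<le> C * ell2_norm X f + e"
    proof -
      have "(C + D + 1) * d = e" using p by (simp add: d_def)
      then have "(C + D) * d \<le> e" using d by (simp add: distrib_right)
      then show ?thesis by simp
    qed
    finally show "ell2_norm X (A f) \<le> C * ell2_norm X f + e" .
  qed
qed

lemma group_alg_support:
  assumes l: "l \<in> group_lists G" "snd ` set l \<subseteq> E"
    and W: "\<And>g a. g \<in> E \<Longrightarrow> a \<in> F0 \<Longrightarrow> g \<otimes>\<^bsub>G\<^esub> a \<in> W"
    and G: "group G" and F0: "F0 \<subseteq> carrier G" and f: "f \<in> ell2 (carrier G)" "\<And>x. x \<notin> F0 \<Longrightarrow> f x = 0"
    and w: "x \<notin> W"
  shows "group_alg_op (regular_rep G) l f x = 0"
  using l
proof (induction rule: group_lists_induct)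
  case (Cons c g l)
  have "act (regular_rep G) g f x = 0"
  proof (cases "x \<in> carrier G \<and> inv\<^bsub>G\<^esub> g \<otimes>\<^bsub>G\<^esub> x \<in> F0")
    case True
    interpret group G by (rule G)
    have "g \<otimes>\<^bsub>G\<^esub> (inv\<^bsub>G\<^esub> g \<otimes>\<^bsub>G\<^esub> x) = x" using True Cons(1) by (simp add: m_assoc[symmetric])
    moreover have "g \<in> E" using Cons(4) by simp
    ultimately show ?thesis using W[of g "inv\<^bsub>G\<^esub> g \<otimes>\<^bsub>G\<^esub> x"] True w by simp
  next
    case False
    then show ?thesis using f by (auto simp: regular_rep_def)
  qed
  then show ?case using Cons by simp
qed simp

text \<open>For finitely supported \<open>f\<close> only a finite window of the group is visible.
  After right translation by a suitable \<theta> the window injects into the cosets, which gives an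
  isometric copy. Right translation commutes with the left action, so the copy intertwines the
  elements that occur in \<open>l\<close>.\<close>

theorem regular_dominated_by_quasi_regular:
  assumes primes: "\<forall>q\<in>S. prime q" and TS: "T \<subseteq> S" and p: "p \<in> S" "p \<notin> T"
  shows "dominated (Gamma_group S) (regular_rep (Gamma_group S)) (lambda_quotient S T)"
  unfolding dominated_def
proof (intro ballI allI impI)
  let ?G = "Gamma_group S" and ?H = "carrier (Gamma_group T)"
  let ?X = "lcosets\<^bsub>?G\<^esub> ?H" and ?\<alpha> = "\<lambda>g C. g <#\<^bsub>?G\<^esub> C"
  let ?R = "regular_rep ?G" and ?\<pi> = "lambda_quotient S T"
  interpret group ?G by (rule Gamma_group)
  have H: "subgroup ?H ?G" by (rule Gamma_subgroup[OF TS])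
  have \<alpha>: "group_act ?G ?X ?\<alpha>" by (rule lcosets_group_act[OF Gamma_group H])
  have UR: "unitary_rep ?G ?R"
    unfolding regular_rep_eq_perm_rep by (rule perm_rep_unitary[OF Gamma_group regular_group_act[OF Gamma_group]])
  have U\<pi>: "unitary_rep ?G ?\<pi>"
    unfolding quasi_regular_rep_eq_perm_rep by (rule perm_rep_unitary[OF Gamma_group \<alpha>])
  have bR: "basis ?R = carrier ?G" and b\<pi>: "basis ?\<pi> = ?X"
    by (simp_all add: regular_rep_eq_perm_rep quasi_regular_rep_eq_perm_rep)
  fix l C assume l: "l \<in> group_lists ?G" and C: "0 \<le> C" "bnd (basis ?\<pi>) (group_alg_op ?\<pi> l) C"
  show "bnd (basis ?R) (group_alg_op ?R l) C"
  proof (rule bnd_by_approximation[OF group_alg_bounded_op[OF Gamma_group UR l] C(1)], unfold bR)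
    fix F0 f assume F0: "finite F0" "F0 \<subseteq> carrier ?G" and f: "f \<in> ell2 (carrier ?G)" "\<And>x. x \<notin> F0 \<Longrightarrow> f x = 0"
    define E where "E = snd ` set l"
    have E: "finite E" "E \<subseteq> carrier ?G" using l by (auto simp: E_def group_lists_def)
    \<comment> \<open>The window holds the support of the vector and its translates by the elements
      of \<open>l\<close>.\<close>
    define W where "W = F0 \<union> (\<lambda>(g, a). g \<circ> a) ` (E \<times> F0)"
    have W: "finite W" "W \<subseteq> carrier ?G" "F0 \<subseteq> W" "\<And>g a. g \<in> E \<Longrightarrow> a \<in> F0 \<Longrightarrow> g \<circ> a \<in> W"
      using F0 E by (auto simp: W_def intro!: Gamma_comp_closed)
    \<comment> \<open>Two points of the window fall into one coset after translation by \<theta>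
      only if \<theta> conjugates their quotient into Gamma_T; hence the nontrivial quotients have
      to be conjugated off Gamma_T.\<close>
    let ?F = "(\<lambda>(x, y). inv_map x \<circ> y) ` (W \<times> W) - {id}"
    have "?F \<subseteq> carrier ?G - {id}" using W(2) by (auto intro!: Gamma_comp_closed Gamma_inv_closed)
    then obtain \<theta> where \<theta>: "\<theta> \<in> carrier ?G"
      "\<And>g. g \<in> ?F \<Longrightarrow> inv_map \<theta> \<circ> (g \<circ> \<theta>) \<notin> carrier (Gamma_group T)"
      using conjugate_off_Gamma[OF primes TS p, of ?F] W(1) by blast
    define j where "j x = (x \<circ> \<theta>) <#\<^bsub>?G\<^esub> ?H" for x
    have jX: "j x \<in> ?X" if "x \<in> carrier ?G" for x
      using Gamma_comp_closed[OF that \<theta>(1)] by (auto simp: j_def LCOSETS_def)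
    have j\<alpha>: "?\<alpha> g (j x) = j (g \<circ> x)" if "g \<in> carrier ?G" "x \<in> carrier ?G" for g x
      using lcos_m_assoc[OF subgroup.subset[OF H] that(1) Gamma_comp_closed[OF that(2) \<theta>(1)]]
      by (simp add: j_def comp_assoc)
    have jinj: "inj_on j W"
    proof (rule inj_onI, rule ccontr)
      fix x y assume xy: "x \<in> W" "y \<in> W" "j x = j y" "x \<noteq> y"
      have c: "x \<in> carrier ?G" "y \<in> carrier ?G" using xy W(2) by auto
      have "x \<circ> \<theta> \<in> j x" "y \<circ> \<theta> \<in> j x"
        using lcos_self[OF Gamma_comp_closed[OF c(1) \<theta>(1)] H] lcos_self[OF Gamma_comp_closed[OF c(2) \<theta>(1)] H] xy(3)
        by (auto simp: j_def)
      from lcoset_quotient_in[OF TS jX[OF c(1)] this]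
      have "inv_map (x \<circ> \<theta>) \<circ> (y \<circ> \<theta>) \<in> ?H" .
      moreover have "inv_map (x \<circ> \<theta>) = inv_map \<theta> \<circ> inv_map x"
        using Gamma_bij[OF c(1)] Gamma_bij[OF \<theta>(1)] by (rule o_inv_distrib)
      ultimately have in_H: "inv_map \<theta> \<circ> ((inv_map x \<circ> y) \<circ> \<theta>) \<in> ?H" by (simp add: comp_assoc)
      have "inv_map x \<circ> y \<noteq> id"
      proof
        assume "inv_map x \<circ> y = id"
        then have "x \<circ> (inv_map x \<circ> y) = x" by simp
        then have "y = x" using Gamma_inv(1)[OF c(1)] by (auto simp: fun_eq_iff)
        with xy(4) show False by simp
      qed
      then have "inv_map x \<circ> y \<in> ?F" using xy by auto
      from \<theta>(2)[OF this] in_H show False by blast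
    qed
    define V where "V h D = (\<Sum>w\<in>W. h w * delta (j w) D)" for h :: "(real \<Rightarrow> real) \<Rightarrow> complex" and D
    have Vj: "V h (j w) = h w" if "w \<in> W" for h w
    proof -
      have "V h (j w) = (\<Sum>v\<in>W. if v = w then h v else 0)"
        unfolding V_def by (rule sum.cong) (use inj_onD[OF jinj] that in \<open>auto simp: delta_def\<close>)
      then show ?thesis using that W(1) by simp
    qed
    have Vout: "V h D = 0" if "D \<notin> j ` W" for h D
      unfolding V_def by (rule sum.neutral) (use that in \<open>auto simp: delta_def\<close>)
    have Vell: "V h \<in> ell2 ?X" for h
      unfolding V_def[abs_def] using W(2) jX by (intro ell2_sum ell2_scale delta_ell2) auto
    have Vnorm: "ell2_norm ?X (V h) = ell2_norm (carrier ?G) h" if h: "\<And>x. x \<notin> W \<Longrightarrow> h x = 0" for h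
    proof -
      have "(\<Sum>\<^sub>\<infinity>D\<in>?X. (cmod (V h D))\<^sup>2) = (\<Sum>\<^sub>\<infinity>D\<in>j ` W. (cmod (V h D))\<^sup>2)"
        by (rule infsum_cong_neutral) (use Vout W(2) jX in auto)
      also have "\<dots> = (\<Sum>w\<in>W. (cmod (h w))\<^sup>2)" using W(1) by (simp add: sum.reindex[OF jinj] Vj)
      also have "\<dots> = (\<Sum>\<^sub>\<infinity>w\<in>W. (cmod (h w))\<^sup>2)" using W(1) by simp
      also have "\<dots> = (\<Sum>\<^sub>\<infinity>x\<in>carrier ?G. (cmod (h x))\<^sup>2)"
        by (rule infsum_cong_neutral) (use h W(2) in auto)
      finally show ?thesis by (simp add: ell2_norm_def)
    qed
    have Vact: "V (act ?R g f) = act ?\<pi> g (V f)" if g: "g \<in> E" for g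
    proof
      fix D
      have gc: "g \<in> carrier ?G" using g E by blast
      have lam: "act ?R g f w = f (inv\<^bsub>?G\<^esub> g \<otimes>\<^bsub>?G\<^esub> w)" if "w \<in> carrier ?G" for w
        using f(1) that by (simp add: regular_rep_def)
      have Vf: "V f = (\<lambda>D. \<Sum>a\<in>F0. f a * delta (j a) D)"
        unfolding V_def[abs_def] using W(1,3) f(2) by (intro ext sum.mono_neutral_right) auto
      have e0: "act ?\<pi> g (V f) = (\<lambda>D. \<Sum>a\<in>F0. f a * act ?\<pi> g (delta (j a)) D)"
        unfolding Vf by (rule op_sum[of _ ?X]) (use act_bounded_op[OF Gamma_group U\<pi> gc] F0 jX b\<pi> in \<open>auto intro: delta_ell2\<close>)
      have "act ?\<pi> g (V f) D = (\<Sum>a\<in>F0. f a * delta (j (g \<circ> a)) D)"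
        unfolding e0 using F0(2) act_perm_rep_delta[OF Gamma_group \<alpha> gc jX] j\<alpha>[OF gc]
        by (intro sum.cong) (auto simp: quasi_regular_rep_eq_perm_rep)
      also have "\<dots> = (\<Sum>w\<in>(\<lambda>a. g \<circ> a) ` F0. f (inv\<^bsub>?G\<^esub> g \<otimes>\<^bsub>?G\<^esub> w) * delta (j w) D)"
      proof (subst sum.reindex)
        show "inj_on (\<lambda>a. g \<circ> a) F0"
        proof (rule inj_onI)
          fix a b assume "g \<circ> a = g \<circ> b"
          then have "inv_map g \<circ> (g \<circ> a) = inv_map g \<circ> (g \<circ> b)" by simp
          then show "a = b" using Gamma_inv(2)[OF gc] by (auto simp: fun_eq_iff)
        qed
        have "inv\<^bsub>?G\<^esub> g \<otimes>\<^bsub>?G\<^esub> (g \<circ> a) = a" if "a \<in> F0" for a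
          using l_inv[OF gc] m_assoc[OF inv_closed[OF gc] gc, of a] that F0(2) by auto
        then show "(\<Sum>a\<in>F0. f a * delta (j (g \<circ> a)) D) =
          sum ((\<lambda>w. f (inv\<^bsub>?G\<^esub> g \<otimes>\<^bsub>?G\<^esub> w) * delta (j w) D) \<circ> (\<circ>) g) F0"
          by (intro sum.cong) auto
      qed
      also have "\<dots> = (\<Sum>w\<in>W. act ?R g f w * delta (j w) D)"
      proof (rule sum.mono_neutral_cong_left)
        show "(\<lambda>a. g \<circ> a) ` F0 \<subseteq> W" using W(4)[OF g] by auto
        show "\<forall>w\<in>W - (\<lambda>a. g \<circ> a) ` F0. act ?R g f w * delta (j w) D = 0"
        proof
          fix w assume w: "w \<in> W - (\<lambda>a. g \<circ> a) ` F0"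
          have wc: "w \<in> carrier ?G" using w W(2) by blast
          have "g \<otimes>\<^bsub>?G\<^esub> (inv\<^bsub>?G\<^esub> g \<otimes>\<^bsub>?G\<^esub> w) = w" using r_inv[OF gc] m_assoc[OF gc inv_closed[OF gc] wc] wc by simp
          then have "inv\<^bsub>?G\<^esub> g \<otimes>\<^bsub>?G\<^esub> w \<notin> F0"
            using w image_eqI[of w "(\<circ>) g" "inv\<^bsub>?G\<^esub> g \<otimes>\<^bsub>?G\<^esub> w" F0] by auto
          then show "act ?R g f w * delta (j w) D = 0" using lam[OF wc] f(2) by simp
        qed
        show "f (inv\<^bsub>?G\<^esub> g \<otimes>\<^bsub>?G\<^esub> w) * delta (j w) D = act ?R g f w * delta (j w) D" if "w \<in> (\<lambda>a. g \<circ> a) ` F0" for w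
        proof -
          have "w \<in> carrier ?G" using that W(4)[OF g] W(2) by auto
          then show ?thesis by (simp only: lam)
        qed
      qed (rule W(1))
      finally show "V (act ?R g f) D = act ?\<pi> g (V f) D" by (simp add: V_def)
    qed
    have Vga: "V (group_alg_op ?R m f) = group_alg_op ?\<pi> m (V f)" if "m \<in> group_lists ?G" "snd ` set m \<subseteq> E" for m
      using that
    proof (induction rule: group_lists_induct)
      case Nil
      then show ?case by (simp add: V_def)
    next
      case (Cons c g m)
      have "V (\<lambda>x. c * act ?R g f x + group_alg_op ?R m f x) =
          (\<lambda>D. c * V (act ?R g f) D + V (group_alg_op ?R m f) D)"
        by (simp add: V_def[abs_def] distrib_right sum.distrib sum_distrib_left mult.assoc)
      then show ?case using Cons Vact by simp
    qed
    have supp: "group_alg_op ?R l f x = 0" if "x \<notin> W" for x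
      by (rule group_alg_support[OF l _ _ Gamma_group F0(2) f that, of E]) (use W(4) in \<open>auto simp: E_def\<close>)
    have "ell2_norm (carrier ?G) (group_alg_op ?R l f) = ell2_norm ?X (V (group_alg_op ?R l f))"
      by (rule Vnorm[symmetric, OF supp])
    also have "V (group_alg_op ?R l f) = group_alg_op ?\<pi> l (V f)" by (rule Vga[OF l]) (simp add: E_def)
    also have "ell2_norm ?X \<dots> \<le> C * ell2_norm ?X (V f)" using bndD[OF C(2)] Vell by (simp add: b\<pi>)
    also have "ell2_norm ?X (V f) = ell2_norm (carrier ?G) f" using f(2) W(3) by (intro Vnorm) auto
    finally show "ell2_norm (carrier ?G) (group_alg_op ?R l f) \<le> C * ell2_norm (carrier ?G) f" .
  qed
qed

section \<open>Irreducibility\<close>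

text \<open>The integer vectors (\<alpha>, \<kappa>), (\<alpha> + 1, \<kappa>) and (\<alpha>,
  \<kappa> + 1) differ by the standard basis. If the matrix sent all three to r-integral vectors,
  its columns would be r-integral. For a large denominator all three slopes lie in the given
  interval.\<close>

lemma rational_direction:
  assumes r: "prime r" and bad: "\<not> (padic_abs r A \<le> 1 \<and> padic_abs r B \<le> 1 \<and> padic_abs r C \<le> 1 \<and> padic_abs r D \<le> 1)"
    and uv: "u < (v :: real)"
  shows "\<exists>\<alpha> \<kappa>::int. 0 < \<kappa> \<and> u < of_int \<alpha> / of_int \<kappa> \<and> of_int \<alpha> / of_int \<kappa> < v \<and>
    \<not> (padic_abs r (A * of_int \<alpha> + B * of_int \<kappa>) \<le> 1 \<and> padic_abs r (C * of_int \<alpha> + D * of_int \<kappa>) \<le> 1)"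
proof -
  define m h where "m = (u + v) / 2" and "h = (v - u) / 2"
  have h: "0 < h" "u = m - h" "v = m + h" using uv by (auto simp: m_def h_def field_simps)
  \<comment> \<open>Beyond (|m| + 2) / h, changing numerator or denominator by 1 keeps the slope
    within h of the midpoint m.\<close>
  obtain k :: nat where k: "(\<bar>m\<bar> + 2) / h < real k" using reals_Archimedean2 by blast
  define \<kappa> where "\<kappa> = int k"
  have "0 < (\<bar>m\<bar> + 2) / h" using h by (simp add: add_nonneg_pos)
  then have kpos: "0 < real k" using k by linarith
  then have \<kappa>: "0 < \<kappa>" "real_of_int \<kappa> = real k" by (auto simp: \<kappa>_def)
  have small: "(\<bar>m\<bar> + 2) / real k < h" using k h kpos by (simp add: field_simps)
  define \<alpha> where "\<alpha> = \<lfloor>m * real k\<rfloor>"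
  have a: "real_of_int \<alpha> \<le> m * real k" "m * real k < real_of_int \<alpha> + 1" unfolding \<alpha>_def by linarith+
  have a1: "real_of_int \<alpha> / real k \<le> m" using a kpos by (simp add: divide_le_eq)
  have a2: "m < real_of_int \<alpha> / real k + 1 / real k" using a kpos by (simp add: add_divide_distrib[symmetric] less_divide_eq)
  have one: "1 / real k \<le> (\<bar>m\<bar> + 2) / real k" using kpos by (intro divide_right_mono) auto
  let ?in = "\<lambda>x. u < x \<and> x < v"
  have i1: "?in (real_of_int \<alpha> / real_of_int \<kappa>)" unfolding \<kappa>(2) using a1 a2 one small h by linarith
  have i2: "?in (real_of_int (\<alpha> + 1) / real_of_int \<kappa>)"
    unfolding \<kappa>(2) of_int_add add_divide_distrib of_int_1 using a1 a2 one small h by linarith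
  have i3: "?in (real_of_int \<alpha> / real_of_int (\<kappa> + 1))"
  proof -
    let ?q = "real_of_int \<alpha> / real k"
    have le1: "1 / real k \<le> 1" using kpos by simp
    have q: "\<bar>?q\<bar> \<le> \<bar>m\<bar> + 1" using a1 a2 le1 by linarith
    have eq: "real_of_int \<alpha> / real_of_int (\<kappa> + 1) = ?q - ?q / (real k + 1)"
    proof -
      have "real_of_int \<alpha> + ?q = ?q * (real k + 1)" using kpos by (simp add: distrib_left)
      then have "(real_of_int \<alpha> + ?q) / (real k + 1) = ?q" using kpos by simp
      then show ?thesis by (simp add: \<kappa>(2) add_divide_distrib)
    qed
    have "\<bar>?q / (real k + 1)\<bar> = \<bar>?q\<bar> / (real k + 1)" using kpos by simp
    also have "\<dots> \<le> (\<bar>m\<bar> + 1) / real k" using q kpos by (intro frac_le) auto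
    finally have d: "\<bar>?q / (real k + 1)\<bar> \<le> (\<bar>m\<bar> + 1) / real k" .
    have "(\<bar>m\<bar> + 1) / real k + 1 / real k = (\<bar>m\<bar> + 2) / real k" by (simp add: add_divide_distrib[symmetric])
    then show ?thesis unfolding eq using a1 a2 d small h by linarith
  qed
  let ?ok = "\<lambda>\<alpha> \<kappa>. padic_abs r (A * of_int \<alpha> + B * of_int \<kappa>) \<le> 1 \<and> padic_abs r (C * of_int \<alpha> + D * of_int \<kappa>) \<le> 1"
  have diff: "padic_abs r (x - y) \<le> 1" if "padic_abs r x \<le> 1" "padic_abs r y \<le> 1" for x y
    using padic_abs_diff[OF r, of x y] that by simp
  have "\<not> (?ok \<alpha> \<kappa> \<and> ?ok (\<alpha> + 1) \<kappa> \<and> ?ok \<alpha> (\<kappa> + 1))"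
  proof
    assume ok: "?ok \<alpha> \<kappa> \<and> ?ok (\<alpha> + 1) \<kappa> \<and> ?ok \<alpha> (\<kappa> + 1)"
    have "padic_abs r ((A * of_int (\<alpha> + 1) + B * of_int \<kappa>) - (A * of_int \<alpha> + B * of_int \<kappa>)) \<le> 1"
      "padic_abs r ((C * of_int (\<alpha> + 1) + D * of_int \<kappa>) - (C * of_int \<alpha> + D * of_int \<kappa>)) \<le> 1"
      "padic_abs r ((A * of_int \<alpha> + B * of_int (\<kappa> + 1)) - (A * of_int \<alpha> + B * of_int \<kappa>)) \<le> 1"
      "padic_abs r ((C * of_int \<alpha> + D * of_int (\<kappa> + 1)) - (C * of_int \<alpha> + D * of_int \<kappa>)) \<le> 1"
      by (rule diff; (use ok in blast))+
    then have "padic_abs r A \<le> 1 \<and> padic_abs r B \<le> 1 \<and> padic_abs r C \<le> 1 \<and> padic_abs r D \<le> 1"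
      by (simp add: algebra_simps)
    with bad show False by blast
  qed
  then consider "\<not> ?ok \<alpha> \<kappa>" | "\<not> ?ok (\<alpha> + 1) \<kappa>" | "\<not> ?ok \<alpha> (\<kappa> + 1)" by blast
  then show ?thesis
  proof cases
    case 1
    then show ?thesis using i1 \<kappa>(1) by blast
  next
    case 2
    then show ?thesis using i2 \<kappa>(1) by blast
  next
    case 3
    then show ?thesis using i3 \<kappa>(1) by (intro exI[of _ \<alpha>] exI[of _ "\<kappa> + 1"]) auto
  qed
qed

text \<open>With \<open>v = (\<alpha>, \<kappa>)\<close>, the parabolic matrix fixing \<open>\<alpha> / \<kappa>\<close> is \<open>1 + v v\<^sup>\<bottom>\<close>, and its conjugate by
  \<open>M\<close> is \<open>1 + w w\<^sup>\<bottom>\<close> with \<open>w = M\<inverse> v\<close>.\<close>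

lemma parabolic_conjugate_not_integral:
  assumes r: "prime r" "r \<notin> T" and T: "\<forall>q\<in>T. prime q" and M: "M \<in> SL2 UNIV"
    and Mi: "mat_inv M = (A, B, C, D)"
    and bad: "\<not> (padic_abs r (A * \<alpha> + B * \<kappa>) \<le> 1 \<and> padic_abs r (C * \<alpha> + D * \<kappa>) \<le> 1)"
  shows "mat_mult (mat_inv M) (mat_mult (1 - \<alpha> * \<kappa>, \<alpha> * \<alpha>, - (\<kappa> * \<kappa>), 1 + \<alpha> * \<kappa>) M) \<notin> SL2 (S_integers T)"
proof
  let ?w = "A * \<alpha> + B * \<kappa>" and ?z = "C * \<alpha> + D * \<kappa>"
  assume "mat_mult (mat_inv M) (mat_mult (1 - \<alpha> * \<kappa>, \<alpha> * \<alpha>, - (\<kappa> * \<kappa>), 1 + \<alpha> * \<kappa>) M) \<in> SL2 (S_integers T)"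
  moreover have M': "M = (D, - B, - C, A)" using Mi by (cases M) auto
  moreover have det: "A * D - B * C = 1" using M by (simp add: M' SL2_def algebra_simps)
  \<comment> \<open>The off-diagonal entries of the conjugate are the square of one coordinate of w
    and minus the square of the other, and a rational with r-integral square is r-integral.\<close>
  have "A * ((1 - \<alpha> * \<kappa>) * (- B) + \<alpha> * \<alpha> * A) + B * (- (\<kappa> * \<kappa>) * (- B) + (1 + \<alpha> * \<kappa>) * A) = ?w * ?w"
    by (simp add: algebra_simps)
  moreover have "C * ((1 - \<alpha> * \<kappa>) * D + \<alpha> * \<alpha> * (- C)) + D * (- (\<kappa> * \<kappa>) * D + (1 + \<alpha> * \<kappa>) * (- C)) = - (?z * ?z)"
    by (simp add: algebra_simps)
  ultimately have mem: "?w * ?w \<in> S_integers T" "- (?z * ?z) \<in> S_integers T"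
    unfolding Mi by (auto simp: SL2_def simp del: distrib_left distrib_right)
  have "padic_abs r x \<le> 1" if "padic_abs r (x * x) \<le> 1" for x
  proof (rule ccontr)
    assume "\<not> padic_abs r x \<le> 1"
    then have "1 * 1 < padic_abs r x * padic_abs r x" by (intro mult_strict_mono) auto
    then show False using that by (simp add: padic_abs_mult[OF r(1)])
  qed
  moreover have "padic_abs r (?w * ?w) \<le> 1" "padic_abs r (?z * ?z) \<le> 1"
    using S_integers_padic_abs[OF r(1) mem(1) T r(2)] S_integers_padic_abs[OF r(1) mem(2) T r(2)]
    by (simp_all add: padic_abs_minus[OF r(1)])
  ultimately show False using bad by blast
qed

text \<open>An element outside Gamma_T has a germ M that is not T-integral, valid on an interval.
  Inside its image there are infinitely many rational x n and elements \<gamma> n of Gamma_T,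
  trivial to the left of x n and parabolic just to the right. For i < j the quotient of \<gamma> j g
  and \<gamma> i g has, near x i, a germ equal to the conjugate by M of the parabolic matrix at x i,
  and the directions are chosen so that this is not integral.\<close>

lemma infinite_double_coset:
  assumes primes: "\<forall>q\<in>S. prime q" and TS: "T \<subseteq> S"
    and g: "g \<in> carrier (Gamma_group S)" "g \<notin> carrier (Gamma_group T)"
  shows "infinite ((\<lambda>\<gamma>. \<gamma> <#\<^bsub>Gamma_group S\<^esub> (g <#\<^bsub>Gamma_group S\<^esub> carrier (Gamma_group T))) ` carrier (Gamma_group T))"
proof -
  let ?G = "Gamma_group S" and ?H = "carrier (Gamma_group T)"
  interpret group ?G by (rule Gamma_group)
  have Tp: "\<forall>q\<in>T. prime q" using primes TS by blast
  obtain x0 M where M: "M \<in> SL2 (S_integers S)" "germ g x0 M" "M \<notin> SL2 (S_integers T)"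
    using Gamma_membership_by_germs[OF g(1), of T] g(2) by blast
  have MU: "M \<in> SL2 UNIV" by (rule SL2_UNIV[OF M(1)])
  obtain A B C D where Mi: "mat_inv M = (A, B, C, D)" by (cases "mat_inv M")
  then have M': "M = (D, - B, - C, A)" by (cases M) auto
  obtain e where "e \<in> {A, B, C, D}" "e \<notin> S_integers T"
    using M(3) MU S_integers_uminus by (auto simp: M' SL2_def)
  then obtain r where r: "prime r" "r \<notin> T"
    and bad: "\<not> (padic_abs r A \<le> 1 \<and> padic_abs r B \<le> 1 \<and> padic_abs r C \<le> 1 \<and> padic_abs r D \<le> 1)"
    using not_S_integer_padic[of e T] by force
  have "open (g ` {y. germ g y M})" by (rule Gamma_open_image[OF g(1) open_germ])
  moreover have "g x0 \<in> g ` {y. germ g y M}" using M(2) by blast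
  ultimately obtain d where d: "0 < d" "\<And>w. dist w (g x0) < d \<Longrightarrow> w \<in> g ` {y. germ g y M}"
    unfolding open_dist by blast
  define u0 v0 where "u0 = g x0" and "v0 = g x0 + d"
  have gM: "germ g (inv_map g w) M" if "u0 < w" "w < v0" for w
  proof -
    have "w \<in> g ` {y. germ g y M}" using d(2)[of w] that by (auto simp: u0_def v0_def dist_real_def)
    then show ?thesis using Gamma_inv(2)[OF g(1)] by auto
  qed
  \<comment> \<open>An increasing sequence inside the image interval; choosing x n between
    consecutive terms makes the x n increase strictly.\<close>
  define u where "u n = v0 - (v0 - u0) / (real n + 1)" for n :: nat
  have uv: "u0 < v0" using d by (simp add: u0_def v0_def)
  have umono: "u n < u (Suc n)" for n
    using uv by (auto simp: u_def intro!: divide_strict_left_mono)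
  have u_strict: "strict_mono u" by (simp add: strict_mono_Suc_iff umono)
  have ub: "u0 \<le> u n" "u n < v0" for n
  proof -
    have "(v0 - u0) / (real n + 1) \<le> (v0 - u0) / 1" using uv by (intro divide_left_mono) auto
    then show "u0 \<le> u n" by (simp add: u_def)
    show "u n < v0" using uv by (simp add: u_def)
  qed
  have "\<exists>\<alpha> \<kappa>::int. 0 < \<kappa> \<and> u n < of_int \<alpha> / of_int \<kappa> \<and> of_int \<alpha> / of_int \<kappa> < u (Suc n) \<and>
    \<not> (padic_abs r (A * of_int \<alpha> + B * of_int \<kappa>) \<le> 1 \<and> padic_abs r (C * of_int \<alpha> + D * of_int \<kappa>) \<le> 1)" for n
    by (rule rational_direction[OF r(1) bad umono])
  then obtain \<alpha> \<kappa> :: "nat \<Rightarrow> int" where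
    \<kappa>: "\<And>n. 0 < \<kappa> n" and x_in: "\<And>n. u n < of_int (\<alpha> n) / of_int (\<kappa> n)" "\<And>n. of_int (\<alpha> n) / of_int (\<kappa> n) < u (Suc n)"
    and bad': "\<And>n. \<not> (padic_abs r (A * of_int (\<alpha> n) + B * of_int (\<kappa> n)) \<le> 1 \<and> padic_abs r (C * of_int (\<alpha> n) + D * of_int (\<kappa> n)) \<le> 1)"
    by metis
  define x where "x n = (of_int (\<alpha> n) / of_int (\<kappa> n) :: real)" for n
  let ?a = "\<lambda>n. of_int (\<alpha> n) :: rat" and ?k = "\<lambda>n. of_int (\<kappa> n) :: rat"
  let ?N = "\<lambda>n. (1 - ?a n * ?k n, ?a n * ?a n, - (?k n * ?k n), 1 + ?a n * ?k n)"
  have N_ok: "mat_mult (mat_inv M) (mat_mult (?N n) M) \<notin> SL2 (S_integers T)" for n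
    by (rule parabolic_conjugate_not_integral[OF r Tp MU Mi bad'])
  have "\<exists>\<gamma>\<in>?H. \<exists>w>0. (\<forall>z\<le>x n. \<gamma> z = z) \<and> (\<forall>z. x n \<le> z \<and> z \<le> x n + w \<longrightarrow> denom (?N n) z > 0 \<and> \<gamma> z = mob (?N n) z)" for n
  proof -
    have k0: "?k n \<noteq> 0" using \<kappa>[of n] by simp
    have s1: "?k n * ?k n * (?a n / ?k n) = ?a n * ?k n" "?a n * ?k n * (?a n / ?k n) = ?a n * ?a n"
      using k0 by (simp_all add: field_simps)
    have rx: "of_rat (?a n / ?k n) = x n" by (simp add: x_def of_rat_divide)
    have int: "?k n * ?k n \<in> S_integers T" "?a n * ?k n \<in> S_integers T" "?a n * ?a n \<in> S_integers T"
      by (intro S_integers.mult S_integers_of_int)+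
    have "0 < ?k n * ?k n" using \<kappa>[of n] by simp
    from bump_exists[of "?k n * ?k n" 1 T "?a n / ?k n", unfolded s1 rx, OF this _ int S_integers.one]
    show ?thesis by simp blast
  qed
  then obtain \<gamma> w where \<gamma>: "\<And>n. \<gamma> n \<in> ?H" "\<And>n. 0 < w n" "\<And>n z. z \<le> x n \<Longrightarrow> \<gamma> n z = z"
    "\<And>n z. x n \<le> z \<Longrightarrow> z \<le> x n + w n \<Longrightarrow> denom (?N n) z > 0 \<and> \<gamma> n z = mob (?N n) z"
    by metis
  have \<gamma>S: "\<gamma> n \<in> carrier ?G" for n using \<gamma>(1) Gamma_mono[OF TS] by blast
  have x_less: "x i < x j" if "i < j" for i j
  proof -
    have "u (Suc i) \<le> u j" using u_strict that by (simp add: strict_mono_less_eq)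
    then show ?thesis using x_in[of i] x_in[of j] by (simp add: x_def)
  qed
  define c where "c n = \<gamma> n <#\<^bsub>?G\<^esub> (g <#\<^bsub>?G\<^esub> ?H)" for n
  have H: "subgroup ?H ?G" by (rule Gamma_subgroup[OF TS])
  have c_eq: "c n = (\<gamma> n \<circ> g) <#\<^bsub>?G\<^esub> ?H" for n
    using lcos_m_assoc[OF subgroup.subset[OF H] \<gamma>S g(1)] by (simp add: c_def)
  have ne: "c i \<noteq> c j" if ij: "i < j" for i j
  proof
    assume eq: "c i = c j"
    have m: "\<gamma> i \<circ> g \<in> c i" "\<gamma> j \<circ> g \<in> c i"
      using lcos_self[OF Gamma_comp_closed[OF \<gamma>S g(1)] H] eq by (auto simp: c_eq)
    have "c i \<in> lcosets\<^bsub>?G\<^esub> ?H" using Gamma_comp_closed[OF \<gamma>S g(1)] by (auto simp: c_eq LCOSETS_def)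
    from lcoset_quotient_in[OF TS this m(2,1)]
    have "inv_map (\<gamma> j \<circ> g) \<circ> (\<gamma> i \<circ> g) \<in> ?H" .
    moreover have "inv_map (\<gamma> j \<circ> g) = inv_map g \<circ> inv_map (\<gamma> j)"
      using Gamma_bij[OF \<gamma>S] Gamma_bij[OF g(1)] by (rule o_inv_distrib)
    ultimately have in_H: "inv_map g \<circ> (inv_map (\<gamma> j) \<circ> (\<gamma> i \<circ> g)) \<in> ?H" by (simp add: comp_assoc)
    \<comment> \<open>A point z slightly to the right of x i is wanted: there \<gamma> i is
      parabolic, while \<gamma> i z is still to the left of x j, where \<gamma> j is the
      identity.\<close>
    have xi: "u0 < x i" "x i < min (x j) v0"
      using ub(1)[of i] ub(2)[of "Suc i"] x_in[of i] x_less[OF ij] by (auto simp: x_def)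
    have "\<forall>\<^sub>F z in nhds (x i). \<gamma> i z \<in> {u0<..<min (x j) v0}"
    proof -
      have "(\<gamma> i \<longlongrightarrow> \<gamma> i (x i)) (nhds (x i))"
        using Gamma_isCont(1)[OF \<gamma>S] tendsto_at_iff_tendsto_nhds isCont_def by blast
      then show ?thesis
        by (rule topological_tendstoD) (use xi \<gamma>(3)[of "x i" i] in auto)
    qed
    moreover have "\<forall>\<^sub>F z in nhds (x i). z \<in> {u0<..<v0}"
      by (rule eventually_nhds_in_open) (use xi in auto)
    moreover have "\<forall>\<^sub>F z in nhds (x i). z \<in> {..<x i + w i}"
      by (rule eventually_nhds_in_open) (use \<gamma>(2) in auto)
    ultimately have "\<forall>\<^sub>F z in nhds (x i). \<gamma> i z \<in> {u0<..<min (x j) v0} \<and> z \<in> {u0<..<v0} \<and> z \<in> {..<x i + w i}"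
      by eventually_elim blast
    then obtain \<epsilon> where \<epsilon>: "0 < \<epsilon>" "\<And>z. dist z (x i) < \<epsilon> \<Longrightarrow>
        \<gamma> i z \<in> {u0<..<min (x j) v0} \<and> z \<in> {u0<..<v0} \<and> z \<in> {..<x i + w i}"
      unfolding eventually_nhds_metric by blast
    define z where "z = x i + \<epsilon> / 2"
    have z: "x i < z" "z < x i + w i" "u0 < z" "z < v0" "u0 < \<gamma> i z" "\<gamma> i z < x j" "\<gamma> i z < v0"
      using \<epsilon>(2)[of z] \<epsilon>(1) by (auto simp: z_def dist_real_def)
    let ?y = "inv_map g z"
    have gy: "g ?y = z" by (rule Gamma_inv(1)[OF g(1)])
    have 1: "germ g ?y M" by (rule gM[OF z(3,4)])
    have "germ (\<gamma> i) z (?N i)"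
    proof (rule germI_open[of "{x i<..<x i + w i}"])
      fix y assume "y \<in> {x i<..<x i + w i}"
      then show "denom (?N i) y \<noteq> 0 \<and> \<gamma> i y = mob (?N i) y"
        using \<gamma>(4)[of i y] by (simp del: denom.simps mob.simps)
    qed (use z in auto)
    then have 2: "germ (\<gamma> i \<circ> g) ?y (mat_mult (?N i) M)"
      by (intro Gamma_germ_comp[OF g(1) 1]) (simp only: gy)
    have yz: "(\<gamma> i \<circ> g) ?y = \<gamma> i z" by (simp add: gy)
    have "germ (\<gamma> j) (\<gamma> i z) (1, 0, 0, 1)"
      by (rule germI_open[of "{..<x j}"]) (use z \<gamma>(3)[of _ j] in auto)
    from Gamma_germ_inv[OF \<gamma>S this] \<gamma>(3)[of "\<gamma> i z" j] z(6)
    have "germ (inv_map (\<gamma> j)) (\<gamma> i z) (1, 0, 0, 1)" by (simp add: SL2_def)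
    from Gamma_germ_comp[OF Gamma_comp_closed[OF \<gamma>S g(1)] 2, of "inv_map (\<gamma> j)" "(1, 0, 0, 1)"] this
    have 3: "germ (inv_map (\<gamma> j) \<circ> (\<gamma> i \<circ> g)) ?y (mat_mult (?N i) M)" by (simp only: yz mat_mult_one)
    have yz': "(inv_map (\<gamma> j) \<circ> (\<gamma> i \<circ> g)) ?y = \<gamma> i z"
      using Gamma_inv(2)[OF \<gamma>S, of j "\<gamma> i z"] \<gamma>(3)[of "\<gamma> i z" j] z(6) by (simp add: gy)
    have "germ (inv_map g) (\<gamma> i z) (mat_inv M)"
      using Gamma_germ_inv[OF g(1) gM[OF z(5,7)] MU] by (simp only: Gamma_inv(1)[OF g(1)])
    then have "germ (inv_map g \<circ> (inv_map (\<gamma> j) \<circ> (\<gamma> i \<circ> g))) ?y (mat_mult (mat_inv M) (mat_mult (?N i) M))"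
      by (intro Gamma_germ_comp[OF Gamma_comp_closed[OF Gamma_inv_closed[OF \<gamma>S] Gamma_comp_closed[OF \<gamma>S g(1)]] 3])
        (simp only: yz')
    moreover have "?N i \<in> SL2 UNIV" by (simp add: SL2_def algebra_simps)
    ultimately have "mat_mult (mat_inv M) (mat_mult (?N i) M) \<in> SL2 (S_integers T)"
      by (intro Gamma_germ_integral[OF in_H] SL2_mult_UNIV SL2_inv_UNIV MU)
    with N_ok show False by blast
  qed
  have "inj c" by (rule linorder_injI) (use ne in blast)
  then have "infinite (range c)" by (rule range_inj_infinite)
  moreover have "range c \<subseteq> (\<lambda>\<gamma>. \<gamma> <#\<^bsub>?G\<^esub> (g <#\<^bsub>?G\<^esub> ?H)) ` ?H" using \<gamma>(1) by (auto simp: c_def)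
  ultimately show ?thesis using finite_subset by blast
qed

section \<open>Irreducibility from infinite orbits\<close>

lemma ell2_constant_on_infinite:
  assumes f: "f \<in> ell2 X" and Y: "infinite Y" "Y \<subseteq> X" "\<And>x. x \<in> Y \<Longrightarrow> f x = c"
  shows "c = 0"
proof (rule ccontr)
  assume "c \<noteq> 0"
  then have c: "0 < (cmod c)\<^sup>2" by simp
  obtain n :: nat where n: "(ell2_norm X f)\<^sup>2 / (cmod c)\<^sup>2 < real n" using reals_Archimedean2 by blast
  obtain F where F: "finite F" "card F = n" "F \<subseteq> Y" using infinite_arbitrarily_large[OF Y(1)] by blast
  have "(\<Sum>x\<in>F. (cmod (f x))\<^sup>2) \<le> (ell2_norm X f)\<^sup>2" using F Y(2) by (intro ell2_finite_sum_le[OF f]) auto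
  moreover have "(\<Sum>x\<in>F. (cmod (f x))\<^sup>2) = (\<Sum>x\<in>F. (cmod c)\<^sup>2)" using F Y(3) by (intro sum.cong) auto
  ultimately have "real n * (cmod c)\<^sup>2 \<le> (ell2_norm X f)\<^sup>2" using F(2) by simp
  with n c show False by (simp add: divide_less_eq)
qed

text \<open>The projection v of the basis vector at the trivial coset to an invariant subspace is
  fixed by \<open>H\<close>. It is constant on the infinite orbits of the other cosets, hence a
  multiple of that basis vector. If the multiple is zero, the translates of the basis vector are
  orthogonal to \<open>V\<close>; otherwise they lie in \<open>V\<close>. They span a dense
  subspace.\<close>

theorem quasi_regular_irreducible:
  fixes G (structure)
  assumes G: "group G" and H: "subgroup H G"
    and inf: "\<And>g. g \<in> carrier G \<Longrightarrow> g \<notin> H \<Longrightarrow> infinite ((\<lambda>\<gamma>. \<gamma> <#\<^bsub>G\<^esub> (g <#\<^bsub>G\<^esub> H)) ` H)"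
  shows "irreducible_rep G (quasi_regular_rep G H)"
proof -
  interpret group G by (rule G)
  let ?X = "lcosets H" and ?\<alpha> = "\<lambda>g C. g <#\<^bsub>G\<^esub> C" and ?\<pi> = "quasi_regular_rep G H"
  have \<alpha>: "group_act G ?X ?\<alpha>" by (rule lcosets_group_act[OF G H])
  have U: "unitary_rep G ?\<pi>" unfolding quasi_regular_rep_eq_perm_rep by (rule perm_rep_unitary[OF G \<alpha>])
  have b: "basis ?\<pi> = ?X" by (simp add: quasi_regular_rep_eq_perm_rep)
  have H0: "\<one> <#\<^bsub>G\<^esub> H = H" using lcos_mult_one[OF subgroup.subset[OF H]] .
  have HX: "H \<in> ?X" using H0 one_closed unfolding LCOSETS_def by blast
  have act_delta: "act ?\<pi> g (delta H) = delta (g <#\<^bsub>G\<^esub> H)" if "g \<in> carrier G" for g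
    unfolding quasi_regular_rep_eq_perm_rep by (rule act_perm_rep_delta[OF G \<alpha> that HX])
  have maps: "act ?\<pi> g f \<in> ell2 ?X" if "g \<in> carrier G" "f \<in> ell2 ?X" for g f
    using op_maps[OF act_bounded_op[OF G U that(1)]] that(2) by (simp add: b)
  have inner: "ell2_inner ?X (act ?\<pi> g f) h = ell2_inner ?X f (act ?\<pi> (inv g) h)"
    if "g \<in> carrier G" "f \<in> ell2 ?X" "h \<in> ell2 ?X" for g f h
    using adjoint_inner[OF act_bounded_op[OF G U that(1)]] act_adjoint[OF G U that(1)] that(2,3) by (simp add: b)
  have "V = {\<lambda>x. 0} \<or> V = ell2 ?X"
    if V: "closed_subspace ?X V" and inv_V: "\<And>g. g \<in> carrier G \<Longrightarrow> act ?\<pi> g ` V \<subseteq> V" for V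
  proof -
    have Vsub: "V \<subseteq> ell2 ?X" and V0: "(\<lambda>x. 0) \<in> V"
      and Vadd: "\<And>f g. f \<in> V \<Longrightarrow> g \<in> V \<Longrightarrow> (\<lambda>x. f x + g x) \<in> V"
      and Vscale: "\<And>c f. f \<in> V \<Longrightarrow> (\<lambda>x. c * f x) \<in> V"
      and Vclosed: "\<And>f. f \<in> ell2 ?X \<Longrightarrow> (\<And>e. e > 0 \<Longrightarrow> \<exists>g\<in>V. ell2_norm ?X (\<lambda>x. f x - g x) < e) \<Longrightarrow> f \<in> V"
      using V by (auto simp: closed_subspace_def)
    have dH: "delta H \<in> ell2 ?X" by (rule delta_ell2[OF HX])
    obtain v where v: "v \<in> V" "\<And>w. w \<in> V \<Longrightarrow> ell2_inner ?X (\<lambda>x. delta H x - v x) w = 0"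
      using ell2_projection[OF V dH] by blast
    have vX: "v \<in> ell2 ?X" using v(1) Vsub by blast
    have fixed: "act ?\<pi> h v = v" if h: "h \<in> H" for h
    proof -
      have hc: "h \<in> carrier G" using subgroup.mem_carrier[OF H h] .
      have hv: "act ?\<pi> h v \<in> V" using inv_V[OF hc] v(1) by blast
      have hvX: "act ?\<pi> h v \<in> ell2 ?X" using hv Vsub by blast
      have "h <#\<^bsub>G\<^esub> H = H" using coset_join3[OF hc H h] .
      then have "act ?\<pi> h (\<lambda>x. delta H x - v x) = (\<lambda>x. delta H x - act ?\<pi> h v x)"
        using op_diff[OF act_bounded_op[OF G U hc]] dH vX act_delta[OF hc] by (simp add: b)
      then have orth: "ell2_inner ?X (\<lambda>x. delta H x - act ?\<pi> h v x) w = 0" if "w \<in> V" for w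
      proof -
        have "act ?\<pi> (inv h) w \<in> V" using inv_V[OF inv_closed[OF hc]] that by blast
        moreover have "w \<in> ell2 ?X" using that Vsub by blast
        ultimately show ?thesis
          using inner[OF hc ell2_diff[OF dH vX], of w] v(2) \<open>act ?\<pi> h (\<lambda>x. delta H x - v x) = _\<close> by simp
      qed
      let ?d = "\<lambda>x. v x - act ?\<pi> h v x"
      have dV: "?d \<in> V" using Vadd[OF v(1) Vscale[OF hv, of "-1"]] by simp
      have dX: "?d \<in> ell2 ?X" using dV Vsub by blast
      \<comment> \<open>Uniqueness of the projection: the difference of v and its translate lies in
        \<open>V\<close> and is orthogonal to \<open>V\<close>.\<close>
      have "?d = (\<lambda>x. (delta H x - act ?\<pi> h v x) - (delta H x - v x))" by simp
      then have "ell2_inner ?X ?d ?d = 0"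
        using ell2_inner_diff_left[OF ell2_diff[OF dH hvX] ell2_diff[OF dH vX] dX] orth[OF dV] v(2)[OF dV] by simp
      then have "ell2_norm ?X ?d = 0" by (simp add: ell2_inner_self[OF dX])
      then have "?d = (\<lambda>x. 0)" by (rule ell2_norm_eq_0[OF dX])
      then show ?thesis by (simp add: fun_eq_iff)
    qed
    have zero: "v C = 0" if C: "C \<in> ?X" "C \<noteq> H" for C
    proof -
      obtain g where g: "g \<in> carrier G" "C = g <#\<^bsub>G\<^esub> H" using C(1) by (auto simp: LCOSETS_def)
      have "g \<notin> H" using coset_join3[OF g(1) H] g(2) C(2) by blast
      from inf[OF g(1) this] show ?thesis
      proof (rule ell2_constant_on_infinite[OF vX])
        show "(\<lambda>\<gamma>. \<gamma> <#\<^bsub>G\<^esub> (g <#\<^bsub>G\<^esub> H)) ` H \<subseteq> ?X"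
          using group_act_closed[OF \<alpha> subgroup.mem_carrier[OF H] C(1)] g(2) by auto
        fix D assume "D \<in> (\<lambda>\<gamma>. \<gamma> <#\<^bsub>G\<^esub> (g <#\<^bsub>G\<^esub> H)) ` H"
        then obtain h where h: "h \<in> H" "D = h <#\<^bsub>G\<^esub> C" using g(2) by blast
        have hc: "h \<in> carrier G" using subgroup.mem_carrier[OF H h(1)] .
        have "v D = act ?\<pi> h v D" by (simp add: fixed[OF h(1)])
        also have "\<dots> = v (inv h <#\<^bsub>G\<^esub> D)"
          using vX group_act_closed[OF \<alpha> hc C(1)] h(2) by (simp add: quasi_regular_rep_def)
        also have "inv h <#\<^bsub>G\<^esub> D = C" using group_act_cancel(1)[OF G \<alpha> hc C(1)] h(2) by simp
        finally show "v D = v C" .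
      qed
    qed
    have v_eq: "v = (\<lambda>x. v H * delta H x)"
      using zero ell2_outside[OF vX] by (auto simp: fun_eq_iff delta_def)
    show ?thesis
    proof (cases "v H = 0")
      case True
      then have v0: "v = (\<lambda>x. 0)" using v_eq by simp
      have "w = (\<lambda>x. 0)" if w: "w \<in> V" for w
      proof
        fix C
        show "w C = 0"
        proof (cases "C \<in> ?X")
          case True
          then obtain g where g: "g \<in> carrier G" "C = g <#\<^bsub>G\<^esub> H" by (auto simp: LCOSETS_def)
          have "w C = ell2_inner ?X w (act ?\<pi> g (delta H))"
            using ell2_inner_delta[OF True, of w] act_delta[OF g(1)] g(2) by simp
          also have "\<dots> = cnj (ell2_inner ?X (act ?\<pi> g (delta H)) w)" by (rule ell2_inner_cnj)
          also have "\<dots> = cnj (ell2_inner ?X (delta H) (act ?\<pi> (inv g) w))"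
            using inner[OF g(1) dH] w Vsub by auto
          also have "\<dots> = 0"
          proof -
            have "act ?\<pi> (inv g) w \<in> V" using inv_V[OF inv_closed[OF g(1)]] w by blast
            from v(2)[OF this] show ?thesis by (simp add: v0)
          qed
          finally show ?thesis .
        next
          case False
          then show ?thesis using ell2_outside[OF subsetD[OF Vsub w]] by simp
        qed
      qed
      then have "V = {\<lambda>x. 0}" using V0 by blast
      then show ?thesis by blast
    next
      case False
      have "(\<lambda>x. (1 / v H) * v x) \<in> V" by (rule Vscale[OF v(1)])
      moreover have "(\<lambda>x. (1 / v H) * v x) = delta H" using False by (subst v_eq) simp
      ultimately have dV: "delta H \<in> V" by simp
      have dC: "delta C \<in> V" if "C \<in> ?X" for C
      proof -
        obtain g where g: "g \<in> carrier G" "C = g <#\<^bsub>G\<^esub> H" using \<open>C \<in> ?X\<close> by (auto simp: LCOSETS_def)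
        have "act ?\<pi> g (delta H) \<in> V" using inv_V[OF g(1)] dV by blast
        then show ?thesis using act_delta[OF g(1)] g(2) by simp
      qed
      have sumV: "(\<lambda>x. \<Sum>a\<in>F. f a * delta a x) \<in> V" if "finite F" "F \<subseteq> ?X" for F f
        using that by (induction F) (auto intro!: V0 Vadd Vscale dC)
      have "ell2 ?X \<subseteq> V"
      proof
        fix f assume f: "f \<in> ell2 ?X"
        show "f \<in> V"
        proof (rule Vclosed[OF f])
          fix e :: real assume "0 < e"
          then obtain F where F: "finite F" "F \<subseteq> ?X" "ell2_norm ?X (\<lambda>x. f x - (\<Sum>a\<in>F. f a * delta a x)) \<le> e / 2"
            using ell2_finite_approx[OF f, of "e / 2"] by auto
          then show "\<exists>g\<in>V. ell2_norm ?X (\<lambda>x. f x - g x) < e"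
            using \<open>0 < e\<close> by (intro bexI[OF _ sumV[OF F(1,2), of f]]) linarith
        qed
      qed
      then show ?thesis using Vsub by blast
    qed
  qed
  then show ?thesis unfolding irreducible_rep_def b using U HX by blast
qed

section \<open>Simplicity from averaging\<close>

lemma sum_list_product:
  fixes w :: "'a \<times> 'b \<Rightarrow> 'c :: comm_monoid_add"
  shows "(\<Sum>z\<leftarrow>List.product ks hs. w z) = (\<Sum>a\<leftarrow>ks. \<Sum>b\<leftarrow>hs. w (a, b))"
  by (induction ks) (simp_all add: o_def)

text \<open>The sum is left unnormalised so that it recurses over the list; division by the length
  takes place once, in \<open>averaging_simple\<close>.\<close>

primrec conj_sum :: "('g, 'm) monoid_scheme \<Rightarrow> ('g, 'x) rep \<Rightarrow> 'g list \<Rightarrow> 'x operator \<Rightarrow> 'x operator" where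
  "conj_sum G \<pi> [] A = (\<lambda>f x. 0)"
| "conj_sum G \<pi> (h # hs) A = (\<lambda>f x. (act \<pi> h \<circ> (A \<circ> act \<pi> (inv\<^bsub>G\<^esub> h))) f x + conj_sum G \<pi> hs A f x)"

context
  fixes G :: "('g, 'm) monoid_scheme" (structure) and \<pi> :: "('g, 'x) rep"
  assumes G: "group G" and \<pi>: "unitary_rep G \<pi>"
begin

lemma average_mult:
  assumes "f ` set ks \<subseteq> carrier G" "k ` set hs \<subseteq> carrier G"
  shows "group_alg_op \<pi> (average_list (map (\<lambda>(a, b). f a \<otimes> k b) (List.product ks hs))) =
    group_alg_op \<pi> (average_list (map f ks)) \<circ> group_alg_op \<pi> (average_list (map k hs))"
proof -
  have "average_list (map (\<lambda>(a, b). f a \<otimes> k b) (List.product ks hs)) =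
      mult_list G (average_list (map f ks)) (average_list (map k hs))"
    by (simp add: average_list_def mult_list_def product_concat_map map_concat o_def length_concat
        sum_list_triv)
  then show ?thesis
    using group_alg_op_mult[OF G \<pi> average_group_lists average_group_lists] assms by simp
qed

lemma bnd_average_conj:
  assumes as: "set as \<subseteq> carrier G" and k: "k \<in> carrier G"
    and b: "bnd (basis \<pi>) (group_alg_op \<pi> (average_list as)) C" "0 \<le> C"
  shows "bnd (basis \<pi>) (group_alg_op \<pi> (average_list (map (\<lambda>a. k \<otimes> (a \<otimes> inv k)) as))) C"
proof -
  interpret group G by (rule G)
  let ?A = "group_alg_op \<pi> (average_list as)"
  have eq: "average_list (map (\<lambda>a. k \<otimes> (a \<otimes> inv k)) as) =
      mult_list G [(1, k)] (mult_list G (average_list as) [(1, inv k)])"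
    by (induction as) (simp_all add: average_list_def mult_list_def o_def)
  have l: "average_list as \<in> group_lists G" by (rule average_group_lists[OF as])
  have "group_alg_op \<pi> (mult_list G [(1, k)] (mult_list G (average_list as) [(1, inv k)])) =
      act \<pi> k \<circ> (?A \<circ> act \<pi> (inv k))"
    using k l by (simp add: group_alg_op_mult[OF G \<pi>] mult_group_lists[OF G])
  moreover have "bnd (basis \<pi>) (act \<pi> k \<circ> (?A \<circ> act \<pi> (inv k))) (1 * (C * 1))"
    using k l b by (intro bnd_comp comp_bounded_op act_bounded_op[OF G \<pi>] group_alg_bounded_op[OF G \<pi>] bnd_act[OF G \<pi>]) auto
  ultimately show ?thesis by (simp add: eq)
qed

text \<open>A double average is an average of the inner averages, so a bound that is uniform in the
  outer index survives by the triangle inequality.\<close>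

lemma bnd_average_product:
  assumes F: "\<And>a b. a \<in> set ks \<Longrightarrow> b \<in> set hs \<Longrightarrow> F a b \<in> carrier G" and ne: "ks \<noteq> []" and C: "0 \<le> C"
    and b: "\<And>a. a \<in> set ks \<Longrightarrow> bnd (basis \<pi>) (group_alg_op \<pi> (average_list (map (F a) hs))) C"
  shows "bnd (basis \<pi>) (group_alg_op \<pi> (average_list (map (\<lambda>(a, b). F a b) (List.product ks hs)))) C"
  unfolding bnd_def
proof
  let ?X = "basis \<pi>" and ?A = "\<lambda>a. group_alg_op \<pi> (average_list (map (F a) hs))"
  fix f assume f: "f \<in> ell2 ?X"
  have A: "?A a f \<in> ell2 ?X" if "a \<in> set ks" for a
    by (rule op_maps[OF group_alg_bounded_op[OF G \<pi> average_group_lists] f]) (use F that in auto)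
  have "(\<lambda>x. \<Sum>a\<leftarrow>as. ?A a f x) \<in> ell2 ?X \<and>
      ell2_norm ?X (\<lambda>x. \<Sum>a\<leftarrow>as. ?A a f x) \<le> real (length as) * (C * ell2_norm ?X f)"
    if "set as \<subseteq> set ks" for as
    using that
  proof (induction as)
    case Nil
    then show ?case by (simp add: ell2_zero)
  next
    case (Cons a as)
    then have IH: "(\<lambda>x. \<Sum>a\<leftarrow>as. ?A a f x) \<in> ell2 ?X"
      "ell2_norm ?X (\<lambda>x. \<Sum>a\<leftarrow>as. ?A a f x) \<le> real (length as) * (C * ell2_norm ?X f)" by auto
    have a: "?A a f \<in> ell2 ?X" "ell2_norm ?X (?A a f) \<le> C * ell2_norm ?X f"
      using A bndD[OF b f] Cons.prems by auto
    show ?case using ell2_add[OF a(1) IH(1)] ell2_norm_triangle[OF a(1) IH(1)] a(2) IH(2)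
      by (simp add: distrib_right)
  qed
  from this[of ks] have s: "(\<lambda>x. \<Sum>a\<leftarrow>ks. ?A a f x) \<in> ell2 ?X"
    "ell2_norm ?X (\<lambda>x. \<Sum>a\<leftarrow>ks. ?A a f x) \<le> real (length ks) * (C * ell2_norm ?X f)" by auto
  have "group_alg_op \<pi> (average_list (map (\<lambda>(a, b). F a b) (List.product ks hs))) f =
      (\<lambda>x. of_real (1 / length ks) * (\<Sum>a\<leftarrow>ks. ?A a f x))"
    by (rule ext)
      (simp add: average_apply sum_list_product o_def case_prod_beta sum_list_const_mult[symmetric] ac_simps)
  then have "ell2_norm ?X (group_alg_op \<pi> (average_list (map (\<lambda>(a, b). F a b) (List.product ks hs))) f) =
      1 / real (length ks) * ell2_norm ?X (\<lambda>x. \<Sum>a\<leftarrow>ks. ?A a f x)"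
    by (simp only: ell2_norm_scale) (simp add: norm_divide)
  also have "\<dots> \<le> 1 / real (length ks) * (real (length ks) * (C * ell2_norm ?X f))"
    by (rule mult_left_mono[OF s(2)]) simp
  also have "\<dots> = C * ell2_norm ?X f" using ne by simp
  finally show "ell2_norm ?X (group_alg_op \<pi> (average_list (map (\<lambda>(a, b). F a b) (List.product ks hs))) f) \<le>
      C * ell2_norm ?X f" .
qed

text \<open>Either index may be taken as the outer one; \<open>Gamma_averaging\<close> bounds the
  same double average once in each order.\<close>

lemma group_alg_average_swap:
  "group_alg_op \<pi> (average_list (map (\<lambda>(a, b). F a b) (List.product ks hs))) =
   group_alg_op \<pi> (average_list (map (\<lambda>(b, a). F a b) (List.product hs ks)))"
proof -
  have swap: "(\<Sum>a\<leftarrow>ks. \<Sum>b\<leftarrow>hs. w a b) = (\<Sum>b\<leftarrow>hs. \<Sum>a\<leftarrow>ks. w a b)" for w :: "_ \<Rightarrow> _ \<Rightarrow> complex"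
    by (induction ks) (simp_all add: sum_list_addf)
  show ?thesis
    by (intro ext)
      (simp add: average_apply sum_list_product o_def case_prod_beta swap[of "\<lambda>a b. act \<pi> (F a b) _ _"] mult.commute)
qed

lemma conj_bounded_op:
  assumes "h \<in> carrier G" "A \<in> bounded_ops (basis \<pi>)"
  shows "act \<pi> h \<circ> (A \<circ> act \<pi> (inv h)) \<in> bounded_ops (basis \<pi>)"
  using assms group.inv_closed[OF G] by (intro comp_bounded_op act_bounded_op[OF G \<pi>])

lemma conj_sum_bounded_op:
  "set hs \<subseteq> carrier G \<Longrightarrow> A \<in> bounded_ops (basis \<pi>) \<Longrightarrow> conj_sum G \<pi> hs A \<in> bounded_ops (basis \<pi>)"
proof (induction hs)
  case (Cons h hs)
  then show ?case unfolding conj_sum.simps by (intro add_bounded_op conj_bounded_op) auto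
qed (simp add: zero_bounded_op)

lemma bnd_conj_sum:
  assumes "set hs \<subseteq> carrier G" "A \<in> bounded_ops (basis \<pi>)" "bnd (basis \<pi>) A C" "0 \<le> C"
  shows "bnd (basis \<pi>) (conj_sum G \<pi> hs A) (real (length hs) * C)"
  using assms(1)
proof (induction hs)
  case (Cons h hs)
  then have h: "h \<in> carrier G" "inv h \<in> carrier G" "set hs \<subseteq> carrier G" using group.inv_closed[OF G] by auto
  have "bnd (basis \<pi>) (act \<pi> h \<circ> (A \<circ> act \<pi> (inv h))) (1 * (C * 1))"
    using h assms(2-4) by (intro bnd_comp comp_bounded_op act_bounded_op[OF G \<pi>] bnd_act[OF G \<pi>]) auto
  from bnd_add[OF conj_bounded_op[OF h(1) assms(2)] conj_sum_bounded_op[OF h(3) assms(2)] this Cons.IH[OF h(3)]]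
  show ?case by (simp add: distrib_right)
qed (simp add: bnd_zero)

lemma conj_sum_lincomb:
  assumes "set hs \<subseteq> carrier G" "A \<in> bounded_ops (basis \<pi>)" "B \<in> bounded_ops (basis \<pi>)" "f \<in> ell2 (basis \<pi>)"
  shows "conj_sum G \<pi> hs (\<lambda>f x. c * A f x + B f x) f x = c * conj_sum G \<pi> hs A f x + conj_sum G \<pi> hs B f x"
  using assms(1)
proof (induction hs)
  case (Cons h hs)
  then have h: "h \<in> carrier G" "inv h \<in> carrier G" "set hs \<subseteq> carrier G" using group.inv_closed[OF G] by auto
  note H = act_bounded_op[OF G \<pi> h(1)]
  let ?f = "act \<pi> (inv h) f"
  have f: "?f \<in> ell2 (basis \<pi>)" by (rule op_maps[OF act_bounded_op[OF G \<pi> h(2)] assms(4)])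
  have "act \<pi> h (\<lambda>x. c * A ?f x + B ?f x) = (\<lambda>x. c * act \<pi> h (A ?f) x + act \<pi> h (B ?f) x)"
    using op_add[OF H ell2_scale[OF op_maps[OF assms(2) f]] op_maps[OF assms(3) f]]
      op_scale[OF H op_maps[OF assms(2) f]] by simp
  with Cons.IH[OF h(3)] show ?case by (simp add: algebra_simps)
qed simp

lemma conj_sum_id:
  assumes "set hs \<subseteq> carrier G" "f \<in> ell2 (basis \<pi>)"
  shows "conj_sum G \<pi> hs (op_id (basis \<pi>)) f x = of_nat (length hs) * f x"
  using assms(1)
proof (induction hs)
  case (Cons h hs)
  then have h: "h \<in> carrier G" "inv h \<in> carrier G" "set hs \<subseteq> carrier G" using group.inv_closed[OF G] by auto
  have "act \<pi> h (act \<pi> (inv h) f) = f"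
    using act_mult[OF G \<pi> h(1,2)] act_one[OF G \<pi>] group.r_inv[OF G h(1)] assms(2)
    by (metis comp_apply op_id_apply)
  with Cons.IH[OF h(3)] op_maps[OF act_bounded_op[OF G \<pi> h(2)] assms(2)] show ?case
    by (simp add: algebra_simps)
qed simp

lemma conj_sum_act:
  assumes "set hs \<subseteq> carrier G" "g \<in> carrier G"
  shows "conj_sum G \<pi> hs (act \<pi> g) f x = (\<Sum>h\<leftarrow>hs. act \<pi> (h \<otimes> (g \<otimes> inv h)) f x)"
  using assms(1)
proof (induction hs)
  case (Cons h hs)
  then have h: "h \<in> carrier G" "inv h \<in> carrier G" using group.inv_closed[OF G] by auto
  then have "act \<pi> (h \<otimes> (g \<otimes> inv h)) = act \<pi> h \<circ> (act \<pi> g \<circ> act \<pi> (inv h))"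
    using assms(2) G by (simp add: act_mult[OF G \<pi>] group.is_monoid monoid.m_closed)
  with Cons show ?case by simp
qed simp

lemma bnd_conj_sum_group_alg:
  assumes "l \<in> group_lists G" and hs: "set hs \<subseteq> carrier G" "hs \<noteq> []" and \<epsilon>: "0 \<le> \<epsilon>"
    and b: "\<And>g. g \<in> snd ` set l \<Longrightarrow>
      bnd (basis \<pi>) (group_alg_op \<pi> (average_list (map (\<lambda>h. h \<otimes> (g \<otimes> inv h)) hs))) \<epsilon>"
  shows "bnd (basis \<pi>) (conj_sum G \<pi> hs (group_alg_op \<pi> l)) (length hs * (\<epsilon> * (\<Sum>(c, g)\<leftarrow>l. cmod c)))"
  using assms(1) b
proof (induction rule: group_lists_induct)
  case Nil
  have "conj_sum G \<pi> hs (\<lambda>f x. 0) = (\<lambda>f x. 0)"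
    using hs(1) by (induction hs) (auto simp: op_zero[OF act_bounded_op[OF G \<pi>]])
  then show ?case by (simp add: bnd_zero)
next
  case (Cons c g l)
  let ?n = "real (length hs)"
  have n: "?n \<noteq> 0" using hs(2) by simp
  have A: "act \<pi> g \<in> bounded_ops (basis \<pi>)" "group_alg_op \<pi> l \<in> bounded_ops (basis \<pi>)"
    using Cons.hyps act_bounded_op[OF G \<pi>] group_alg_bounded_op[OF G \<pi>] by auto
  have eq: "conj_sum G \<pi> hs (act \<pi> g) =
      (\<lambda>f x. of_real ?n * group_alg_op \<pi> (average_list (map (\<lambda>h. h \<otimes> (g \<otimes> inv h)) hs)) f x)"
    using n by (intro ext) (simp add: conj_sum_act[OF hs(1) Cons.hyps(1)] average_apply o_def)
  have "bnd (basis \<pi>) (conj_sum G \<pi> hs (act \<pi> g)) (cmod (of_real ?n) * \<epsilon>)"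
    unfolding eq by (rule bnd_scale) (rule Cons.prems, simp)
  from bnd_scale[OF this, of c] have 1: "bnd (basis \<pi>) (\<lambda>f x. c * conj_sum G \<pi> hs (act \<pi> g) f x) (?n * (\<epsilon> * cmod c))"
    by (simp add: ac_simps)
  have 2: "bnd (basis \<pi>) (conj_sum G \<pi> hs (group_alg_op \<pi> l)) (?n * (\<epsilon> * (\<Sum>(c, g)\<leftarrow>l. cmod c)))"
    by (rule Cons.IH) (use Cons.prems in auto)
  from bnd_add[OF scale_bounded_op[OF conj_sum_bounded_op[OF hs(1) A(1)]] conj_sum_bounded_op[OF hs(1) A(2)] 1 2]
  have "bnd (basis \<pi>) (\<lambda>f x. c * conj_sum G \<pi> hs (act \<pi> g) f x + conj_sum G \<pi> hs (group_alg_op \<pi> l) f x)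
      (?n * (\<epsilon> * (\<Sum>(c, g)\<leftarrow>(c, g) # l. cmod c)))"
    by (simp add: distrib_left)
  moreover have "conj_sum G \<pi> hs (group_alg_op \<pi> ((c, g) # l)) f =
      (\<lambda>x. c * conj_sum G \<pi> hs (act \<pi> g) f x + conj_sum G \<pi> hs (group_alg_op \<pi> l) f x)" if "f \<in> ell2 (basis \<pi>)" for f
    by (rule ext) (simp add: conj_sum_lincomb[OF hs(1) A that])
  ultimately show ?case by (simp only: bnd_def) simp
qed

end

lemma op_zero_on_delta:
  assumes A: "A \<in> bounded_ops X" and z: "\<And>x. x \<in> X \<Longrightarrow> A (delta x) = (\<lambda>y. 0)"
  shows "A = (\<lambda>f x. 0)"
proof (rule bnd_0_eq[OF A zero_bounded_op])
  have "bnd X A 0"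
  proof (rule bnd_by_approximation[OF A order_refl])
    fix F f assume F: "finite F" "F \<subseteq> X" and f: "f \<in> ell2 X" "\<And>x. x \<notin> F \<Longrightarrow> f x = 0"
    have f_eq: "f = (\<lambda>x. \<Sum>a\<in>F. f a * delta a x)"
    proof
      fix x
      have "(\<Sum>a\<in>F. f a * delta a x) = (\<Sum>a\<in>F. if a = x then f a else 0)"
        by (rule sum.cong) (auto simp: delta_def)
      then show "f x = (\<Sum>a\<in>F. f a * delta a x)" using F(1) f(2) by simp
    qed
    have "A f = A (\<lambda>x. \<Sum>a\<in>F. f a * delta a x)" by (rule arg_cong[OF f_eq])
    also have "\<dots> = (\<lambda>x. \<Sum>a\<in>F. f a * A (delta a) x)"
      by (rule op_sum[OF A delta_ell2]) (use F(2) in auto)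
    also have "\<dots> = (\<lambda>x. 0)" using z F(2) by (intro ext sum.neutral) (auto simp: subset_iff)
    finally show "ell2_norm X (A f) \<le> 0 * ell2_norm X f" by simp
  qed
  then show "bnd X (\<lambda>f x. A f x - 0) 0" by simp
qed

text \<open>A nonzero ideal contains an element with identity coefficient 1. Averaging its
  conjugates stays in the ideal, leaves the identity coefficient alone and makes the other terms
  small, so the ideal contains an element close to 1, which is invertible.\<close>

theorem averaging_simple:
  fixes G (structure)
  assumes G: "group G"
    and avg: "\<And>F \<epsilon>. finite F \<Longrightarrow> F \<subseteq> carrier G - {\<one>} \<Longrightarrow> 0 < \<epsilon> \<Longrightarrow> \<exists>hs. hs \<noteq> [] \<and> set hs \<subseteq> carrier G \<and>
      (\<forall>g\<in>F. bnd (carrier G) (group_alg_op (regular_rep G) (average_list (map (\<lambda>h. h \<otimes> (g \<otimes> inv h)) hs))) \<epsilon>)"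
  shows "simple_cstar_algebra (Cstar_red G)"
proof -
  interpret group G by (rule G)
  let ?R = "regular_rep G" and ?X = "carrier G"
  let ?A = "Cstar_rep G ?R"
  have U: "unitary_rep G ?R" by (rule regular_rep_unitary[OF G])
  have bR: "basis ?R = ?X" by (simp add: regular_rep_eq_perm_rep)
  have act_delta: "act ?R g (delta x) = delta (g \<otimes> x)" if "g \<in> ?X" "x \<in> ?X" for g x
    unfolding regular_rep_eq_perm_rep by (rule act_perm_rep_delta[OF G regular_group_act[OF G] that])
  have act_apply: "act ?R g f x = f (inv g \<otimes> x)" if "f \<in> ell2 ?X" "x \<in> ?X" for g f x
    using that by (simp add: regular_rep_def)
  note closed = Cstar_closed[OF G U, unfolded bR]
  have d1: "delta \<one> \<in> ell2 ?X" by (rule delta_ell2) simp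
  have "op_id ?X (delta \<one>) \<one> = 1" using d1 by (simp add: delta_def)
  then have "op_id ?X \<noteq> (\<lambda>f x. 0)" by auto
  then have nontrivial: "carrier ?A \<noteq> {\<zero>\<^bsub>?A\<^esub>}" using closed(5) by auto
  have "I = {\<zero>\<^bsub>?A\<^esub>} \<or> I = carrier ?A" if I: "ideal I ?A" for I
  proof (rule disjCI)
    assume "I \<noteq> carrier ?A"
    note addI = additive_subgroup.a_closed[OF ideal.axioms(1)[OF I], unfolded Cstar_rep_simps]
    note zeroI = additive_subgroup.zero_closed[OF ideal.axioms(1)[OF I], unfolded Cstar_rep_simps]
    note multI = ideal.I_l_closed[OF I, unfolded Cstar_rep_simps] ideal.I_r_closed[OF I, unfolded Cstar_rep_simps]
    have subI: "I \<subseteq> carrier ?A" by (rule additive_subgroup.a_subset[OF ideal.axioms(1)[OF I]])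
    have scaleI: "(\<lambda>f x. c * a f x) \<in> I" if a: "a \<in> I" for c a
    proof -
      have "a \<in> bounded_ops ?X" using closed(1) a subI by blast
      then have "(\<lambda>f x. c * op_id ?X f x) \<circ> a = (\<lambda>f x. c * a f x)"
        using op_maps op_outside ell2_zero by (fastforce simp: fun_eq_iff op_id_def)
      moreover have "(\<lambda>f x. c * op_id ?X f x) \<circ> a \<in> I" by (rule multI(1)[OF a closed(4)[OF closed(5)]])
      ultimately show ?thesis by simp
    qed
    have "a = (\<lambda>f x. 0)" if a: "a \<in> I" for a
    proof (rule ccontr)
      assume "a \<noteq> (\<lambda>f x. 0)"
      have aX: "a \<in> bounded_ops ?X" using closed(1) a subI by blast
      with \<open>a \<noteq> _\<close> op_zero_on_delta[OF aX] obtain g where g: "g \<in> ?X" "a (delta g) \<noteq> (\<lambda>y. 0)" by blast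
      have ag: "a (delta g) \<in> ell2 ?X" by (rule op_maps[OF aX delta_ell2[OF g(1)]])
      obtain k where k: "k \<in> ?X" "a (delta g) k \<noteq> 0"
        using g(2) ell2_outside[OF ag] by blast
      define s where "s = a (delta g) k"
      \<comment> \<open>Translating on both sides and rescaling moves a nonzero matrix entry of
        \<open>a\<close> to the identity and makes it 1.\<close>
      define b where "b = (\<lambda>f x. (1 / s) * (act ?R (inv k) \<circ> (a \<circ> act ?R g)) f x)"
      have bI: "b \<in> I"
        unfolding b_def using g(1) k(1) by (intro scaleI multI a act_in_Cstar[OF G U]) auto
      have bA: "b \<in> carrier ?A" using bI subI by blast
      have bX: "b \<in> bounded_ops ?X" using closed(1)[OF bA] .
      have b1: "b (delta \<one>) \<one> = 1"
        using act_delta[OF g(1), of \<one>] act_apply[OF ag, of \<one> "inv k"] g(1) k by (simp add: b_def s_def)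
      have "approx_pair G ?R ?R b b" using bA by (simp add: carrier_Cstar_rep[OF G U])
      from approx_pairD[OF this, of "1/8"] obtain l where l: "l \<in> group_lists G"
        "bnd ?X (\<lambda>f x. b f x - group_alg_op ?R l f x) (1/8)" unfolding bR by auto
      define l' where "l' = filter (\<lambda>(c, g). g \<noteq> \<one>) l"
      define c1 where "c1 = (\<Sum>(c, g)\<leftarrow>l. if g = \<one> then c else 0)"
      have l': "l' \<in> group_lists G" using l(1) by (auto simp: l'_def group_lists_def)
      have split: "group_alg_op ?R l f x = c1 * f x + group_alg_op ?R l' f x" if "f \<in> ell2 ?X" for f x
        using that act_one[OF G U] unfolding c1_def l'_def bR
        by (induction l) (auto simp: algebra_simps)
      have "group_alg_op ?R m (delta \<one>) \<one> = 0" if "m \<in> group_lists G" "\<forall>(c, g)\<in>set m. g \<noteq> \<one>" for m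
        using that proof (induction rule: group_lists_induct)
          case (Cons c g m)
          then have "delta g \<one> = 0" by (auto simp: delta_def)
          with Cons show ?case by (simp add: act_delta)
        qed simp
      from this[OF l'] have "group_alg_op ?R l (delta \<one>) \<one> = c1"
        using split[OF d1] by (auto simp: l'_def delta_def)
      then have "cmod (1 - c1) \<le> ell2_norm ?X (\<lambda>x. b (delta \<one>) x - group_alg_op ?R l (delta \<one>) x)"
        using cmod_le_ell2_norm[of "\<lambda>x. b (delta \<one>) x - group_alg_op ?R l (delta \<one>) x" ?X \<one>] b1
          op_maps[OF diff_bounded_op[OF bX group_alg_bounded_op[OF G U l(1), unfolded bR]] d1] by simp
      also have "\<dots> \<le> 1/8 * ell2_norm ?X (delta \<one>)" by (rule bndD[OF l(2) d1])
      finally have c1: "cmod (1 - c1) \<le> 1/8" by (simp add: ell2_norm_delta)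
      \<comment> \<open>The total coefficient mass away from the identity. The tolerance 1 / (8 (1 +
        M)) keeps its averaged contribution below 1/8, and it makes sense also when M is 0.\<close>
      define M where "M = (\<Sum>(c, g)\<leftarrow>l'. cmod c)"
      have M: "0 \<le> M" unfolding M_def by (rule sum_list_nonneg) auto
      have "finite (snd ` set l')" "snd ` set l' \<subseteq> ?X - {\<one>}" "0 < 1 / (8 * (1 + M))"
        using l' M by (auto simp: group_lists_def l'_def)
      from avg[OF this] obtain hs where hs: "hs \<noteq> []" "set hs \<subseteq> ?X"
        "\<And>g. g \<in> snd ` set l' \<Longrightarrow> bnd ?X (group_alg_op ?R (average_list (map (\<lambda>h. h \<otimes> (g \<otimes> inv h)) hs))) (1 / (8 * (1 + M)))"
        by blast
      let ?n = "real (length hs)"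
      have n: "0 < ?n" using hs(1) by simp
      let ?\<Phi> = "conj_sum G ?R hs"
      note cs_ops = conj_sum_bounded_op[OF G U hs(2), unfolded bR]
      define L where "L = group_alg_op ?R l'"
      have LX: "L \<in> bounded_ops ?X" using group_alg_bounded_op[OF G U l'] by (simp add: L_def bR)
      define D where "D = (\<lambda>f x. b f x - group_alg_op ?R l f x)"
      have DX: "D \<in> bounded_ops ?X"
        unfolding D_def using diff_bounded_op[OF bX] group_alg_bounded_op[OF G U l(1)] by (simp add: bR)
      let ?c = "\<lambda>f x. c1 * op_id ?X f x"
      have cX: "?c \<in> bounded_ops ?X" "(\<lambda>f x. ?c f x + L f x) \<in> bounded_ops ?X"
        by (intro add_bounded_op scale_bounded_op id_bounded_op LX)+
      have b_eq: "b = (\<lambda>f x. 1 * D f x + (c1 * op_id ?X f x + L f x))"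
      proof (rule op_ext[OF bX])
        show "(\<lambda>f x. 1 * D f x + (c1 * op_id ?X f x + L f x)) \<in> bounded_ops ?X"
          using add_bounded_op[OF DX cX(2)] by simp
        show "b f = (\<lambda>x. 1 * D f x + (c1 * op_id ?X f x + L f x))" if "f \<in> ell2 ?X" for f
          using split[OF that] that by (simp add: D_def L_def fun_eq_iff)
      qed
      have \<Phi>b: "?\<Phi> b f x = ?\<Phi> D f x + (c1 * (of_real ?n * f x) + ?\<Phi> L f x)" if f: "f \<in> ell2 ?X" for f x
      proof -
        note lin = conj_sum_lincomb[OF G U hs(2), unfolded bR]
        have "?\<Phi> b f x = 1 * ?\<Phi> D f x + ?\<Phi> (\<lambda>f x. c1 * op_id ?X f x + L f x) f x"
          unfolding b_eq by (rule lin[OF DX cX(2) f])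
        also have "?\<Phi> (\<lambda>f x. c1 * op_id ?X f x + L f x) f x = c1 * ?\<Phi> (op_id ?X) f x + ?\<Phi> L f x"
          by (rule lin[OF id_bounded_op LX f])
        also have "?\<Phi> (op_id ?X) f x = of_real ?n * f x"
          using conj_sum_id[OF G U hs(2), unfolded bR, OF f] by simp
        finally show ?thesis by simp
      qed
      have rescale: "bnd ?X (\<lambda>f x. of_real (- 1 / ?n) * B f x) C" if B: "bnd ?X B (?n * C)" for B C
      proof -
        have "cmod (of_real (- 1 / ?n)) * (?n * C) = C" unfolding norm_of_real using n by simp
        with bnd_scale[OF B, of "of_real (- 1 / ?n)"] show ?thesis by (simp only:)
      qed
      have "bnd ?X (?\<Phi> D) (?n * (1/8))"
        using bnd_conj_sum[OF G U hs(2), unfolded bR, OF DX, of "1/8"] l(2) by (simp add: D_def)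
      then have 1: "bnd ?X (\<lambda>f x. of_real (- 1 / ?n) * ?\<Phi> D f x) (1/8)" by (rule rescale)
      have "bnd ?X (?\<Phi> L) (?n * (1 / (8 * (1 + M)) * M))"
        unfolding L_def M_def
        by (rule bnd_conj_sum_group_alg[OF G U l' hs(2,1), unfolded bR]) (use hs(3) M in \<open>auto simp: M_def\<close>)
      then have "bnd ?X (\<lambda>f x. of_real (- 1 / ?n) * ?\<Phi> L f x) (1 / (8 * (1 + M)) * M)" by (rule rescale)
      moreover have "1 / (8 * (1 + M)) * M \<le> 1/8" using M by (simp add: divide_simps)
      ultimately have 2: "bnd ?X (\<lambda>f x. of_real (- 1 / ?n) * ?\<Phi> L f x) (1/8)" by (rule bnd_mono)
      have 3: "bnd ?X (\<lambda>f x. (1 - c1) * op_id ?X f x) (1/8)"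
        by (rule bnd_mono[OF bnd_scale[OF bnd_id]]) (use c1 in simp)
      \<comment> \<open>The averaged conjugates of \<open>b\<close> differ from 1 by at most 3/8:
        one eighth each for the approximation of \<open>b\<close> by the group algebra, for the
        terms away from the identity, and for 1 - c1.\<close>
      define E where "E = (\<lambda>f x. of_real (1 / ?n) * ?\<Phi> b f x)"
      define K where "K = (\<lambda>f x. op_id ?X f x + (- 1) * E f x)"
      have "bnd ?X (\<lambda>f x. of_real (- 1 / ?n) * ?\<Phi> D f x + (of_real (- 1 / ?n) * ?\<Phi> L f x + (1 - c1) * op_id ?X f x))
          (1/8 + (1/8 + 1/8))"
        by (intro bnd_add 1 2 3 add_bounded_op scale_bounded_op id_bounded_op cs_ops DX LX)
      moreover have "K f = (\<lambda>x. of_real (- 1 / ?n) * ?\<Phi> D f x + (of_real (- 1 / ?n) * ?\<Phi> L f x + (1 - c1) * op_id ?X f x))"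
        if "f \<in> ell2 ?X" for f
        using n that by (intro ext) (simp add: K_def E_def \<Phi>b field_simps)
      ultimately have Kb: "bnd ?X K (3/8)" by (simp add: bnd_def)
      have "conj_sum G ?R ks b \<in> I" if "set ks \<subseteq> ?X" for ks
        using that
      proof (induction ks)
        case (Cons h ks)
        then have h: "h \<in> ?X" "inv h \<in> ?X" "set ks \<subseteq> ?X" by auto
        have "act ?R h \<circ> (b \<circ> act ?R (inv h)) \<in> I"
          by (intro multI bI act_in_Cstar[OF G U] h)
        from addI[OF this Cons.IH[OF h(3)]] show ?case by (simp only: conj_sum.simps)
      qed (simp add: zeroI)
      from scaleI[OF this[OF hs(2)]] have EI: "E \<in> I" unfolding E_def .
      have "K \<in> carrier ?A"
        unfolding K_def by (intro closed(3) closed(4) closed(5) subsetD[OF subI EI])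
      then have "approx_pair G ?R ?R K K" by (simp add: carrier_Cstar_rep[OF G U])
      from neumann_pair[OF G U U this, unfolded bR, of "3/8"] Kb
      obtain R R' where R: "approx_pair G ?R ?R R R'"
        "\<And>f. f \<in> ell2 ?X \<Longrightarrow> R (\<lambda>x. f x - K f x) = f" by auto
      have RA: "R \<in> carrier ?A" using approx_pair_refl(1)[OF R(1)] by (simp add: carrier_Cstar_rep[OF G U])
      have "R \<circ> E = op_id ?X"
      proof (rule op_ext[OF comp_bounded_op id_bounded_op])
        show "R \<in> bounded_ops ?X" "E \<in> bounded_ops ?X" using closed(1) RA EI subI by blast+
        show "(R \<circ> E) f = op_id ?X f" if "f \<in> ell2 ?X" for f
          using R(2)[OF that] that by (simp add: K_def)
      qed
      then have idI: "op_id ?X \<in> I" using multI(1)[OF EI RA] by simp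
      have "carrier ?A \<subseteq> I"
      proof
        fix x assume x: "x \<in> carrier ?A"
        have "x \<circ> op_id ?X = x"
          by (rule op_ext[OF comp_bounded_op[OF closed(1)[OF x] id_bounded_op] closed(1)[OF x]]) simp
        with multI(1)[OF idI x] show "x \<in> I" by simp
      qed
      with \<open>I \<noteq> carrier ?A\<close> subI show False by blast
    qed
    then have "I \<subseteq> {\<lambda>f x. 0}" by (intro subsetI) (simp only: singleton_iff)
    moreover have "{\<lambda>f x. 0} \<subseteq> I" by (intro insert_subsetI zeroI empty_subsetI)
    ultimately show "I = {\<zero>\<^bsub>?A\<^esub>}" unfolding Cstar_rep_simps by (rule equalityI)
  qed
  then show ?thesis using nontrivial unfolding simple_cstar_algebra_def Cstar_red_def by blast
qed

section \<open>Averages of conjugates\<close>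

lemma disjoint_support_commute:
  assumes "inj f" "inj h" and d: "\<And>x. f x = x \<or> h x = x"
  shows "f \<circ> h = h \<circ> f"
proof
  fix x
  show "(f \<circ> h) x = (h \<circ> f) x"
  proof (cases "f x = x")
    case True
    then show ?thesis using d[of x] d[of "h x"] injD[OF assms(2), of "h x" x] by auto
  next
    case False
    then show ?thesis using d[of x] d[of "f x"] injD[OF assms(1), of "f x" x] by auto
  qed
qed

abbreviation Gamma_conj :: "(real \<Rightarrow> real) \<Rightarrow> (real \<Rightarrow> real) \<Rightarrow> real \<Rightarrow> real" where
  "Gamma_conj g h \<equiv> h \<circ> (g \<circ> inv_map h)"

abbreviation Gamma_comm :: "(real \<Rightarrow> real) \<Rightarrow> (real \<Rightarrow> real) \<Rightarrow> real \<Rightarrow> real" where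
  "Gamma_comm g h \<equiv> h \<circ> (g \<circ> (inv_map h \<circ> inv_map g))"

text \<open>Transplants the ping-pong elements, which are trivial outside (-2, 7), into a prescribed
  interval. The diagonal matrix with entries 1 / p^k and p^k contracts by p^(2 k), and the numerator
  j positions the image.\<close>

lemma contracting_affine:
  assumes p: "p \<in> S" "prime p" and uv: "u < (v :: real)"
  shows "\<exists>\<theta>\<in>carrier (Gamma_group S). \<forall>z. -2 < z \<and> z < 7 \<longrightarrow> u < \<theta> z \<and> \<theta> z < v"
proof -
  obtain k where k: "10 / (v - u) < real p ^ k"
    using real_arch_pow[of "real p" "10 / (v - u)"] prime_gt_1_nat[OF p(2)] by auto
  define P where "P = real p ^ k * real p ^ k"
  have p1: "1 \<le> real p ^ k" using prime_gt_1_nat[OF p(2)] by simp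
  then have Pk: "real p ^ k \<le> P" using mult_left_mono[OF p1, of "real p ^ k"] by (simp add: P_def)
  have P0: "0 < P" using p1 Pk by linarith
  have P: "10 < P * (v - u)"
    using order.strict_trans2[OF k Pk] uv by (simp add: divide_less_eq)
  \<comment> \<open>The offset 3 is the left extent 2 of the support plus 1 for rounding; the right
    end 7 then lands no later than u P + 10, which is below v P.\<close>
  define j where "j = \<lfloor>u * P\<rfloor> + 3"
  have j: "u * P + 2 < of_int j" "of_int j \<le> u * P + 3" unfolding j_def by linarith+
  let ?q = "of_nat p ^ k :: rat"
  have q0: "?q \<noteq> 0" using p(2) by auto
  have int: "1 / ?q \<in> S_integers S" "?q \<in> S_integers S" "of_int j \<in> S_integers S" "0 \<in> S_integers S"
    using S_integers_power[OF S_integers.inverse_prime[OF p(1)], of k]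
    by (simp_all add: power_one_over S_integers_power S_integers_of_nat S_integers_of_int S_integers_zero)
  then have "of_int j * (1 / ?q) \<in> S_integers S" by (intro S_integers.mult)
  then have M: "(1 / ?q, of_int j * (1 / ?q), 0, ?q) \<in> SL2 (S_integers S)"
    using int q0 by (simp add: SL2_def)
  let ?\<theta> = "mob (1 / ?q, of_int j * (1 / ?q), 0, ?q)"
  have eq: "?\<theta> z = (z + of_int j) / P" for z
    unfolding mob_affine(1)[OF M] by (simp add: P_def of_rat_mult of_rat_divide of_rat_power add_divide_distrib)
  show ?thesis
  proof (intro bexI[OF _ affine_in_Gamma(1)[OF M]] allI impI, unfold eq)
    fix z :: real assume z: "-2 < z \<and> z < 7"
    have "u * P < z + of_int j" "z + of_int j < v * P" using z j P by (auto simp: algebra_simps)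
    then show "u < (z + of_int j) / P \<and> (z + of_int j) / P < v"
      using P0 by (simp add: less_divide_eq divide_less_eq)
  qed
qed

lemma fixed_inv:
  assumes "h \<in> carrier (Gamma_group S)" "h x = x" shows "inv_map h x = x"
  using Gamma_inv(2)[OF assms(1), of x] assms(2) by simp

lemma ping_pong_prime:
  assumes p: "p \<in> S" "prime p" and t_def: "t = 1 / of_nat p ^ 6"
  obtains b c where "b \<in> carrier (Gamma_group S)" "c \<in> carrier (Gamma_group S)"
    "\<And>z. z \<le> -2 \<or> 7 \<le> z \<Longrightarrow> b z = z \<and> c z = z"
    "\<And>z. z \<in> base_interval \<Longrightarrow> denom (1, 0, - t, 1) z \<noteq> 0 \<and> b z = mob (1, 0, - t, 1) z"
    "\<And>z. z \<in> base_interval \<Longrightarrow> c z = z + of_rat t"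
    "\<And>z. z \<in> base_interval \<Longrightarrow> (c \<circ> c) z = z + 2 * of_rat t"
proof -
  have "2 ^ 6 \<le> (of_nat p :: rat) ^ 6" using prime_ge_2_nat[OF p(2)] by (intro power_mono) auto
  then have t: "t \<in> S_integers S" "0 < t" "t \<le> 1/64"
    using S_integers_power[OF S_integers.inverse_prime[OF p(1)], of 6] prime_gt_0_nat[OF p(2)]
    by (auto simp: t_def power_one_over divide_simps)
  obtain b c where b: "b \<in> carrier (Gamma_group S)" and c: "c \<in> carrier (Gamma_group S)"
    and out: "\<And>z. z \<le> -2 \<or> 7 \<le> z \<Longrightarrow> b z = z \<and> c z = z"
    and bJ: "\<And>z. 0 \<le> z \<Longrightarrow> z \<le> 1/2 \<Longrightarrow> denom (1, 0, - t, 1) z \<noteq> 0 \<and> b z = mob (1, 0, - t, 1) z"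
    and cJ: "\<And>z. -1 \<le> z \<Longrightarrow> z \<le> 3 \<Longrightarrow> c z = z + of_rat t"
    by (rule ping_pong_elements[OF t]) (rule that; assumption)
  have "(c \<circ> c) z = z + 2 * of_rat t" if "z \<in> base_interval" for z
  proof -
    have "real_of_rat t \<le> 1/64" "0 < real_of_rat t"
      using t(2,3) of_rat_less_eq[of t "1/64", where 'a = real] by (simp_all add: of_rat_divide)
    moreover have "0 < z" "z < 1/2" using that by auto
    ultimately have "-1 \<le> z + real_of_rat t" "z + real_of_rat t \<le> 3" "-1 \<le> z" "z \<le> 3" by linarith+
    then show ?thesis using cJ[of z] cJ[of "z + of_rat t"] by simp
  qed
  moreover have "denom (1, 0, - t, 1) z \<noteq> 0 \<and> b z = mob (1, 0, - t, 1) z" if "z \<in> base_interval" for z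
    using bJ[of z] that by (simp del: denom.simps mob.simps)
  moreover have "c z = z + of_rat t" if "z \<in> base_interval" for z using cJ[of z] that by auto
  ultimately show ?thesis by (intro that[OF b c out])
qed

text \<open>Let k be a ping-pong element transplanted into (u, v). As g displaces this interval, the
  factor g k^-1 g^-1 is trivial on it, so the commutator acts there like k. Carried back by
  \<theta>, it acts on the base interval like the original element, which is all that
  \<open>quasi_regular_gap\<close> demands.\<close>

lemma commutator_gap:
  assumes primes: "\<forall>q\<in>S. prime q" and p: "p \<in> S" and g: "g \<in> carrier (Gamma_group S)"
    and uv: "u < v" and off: "\<And>x. u < x \<Longrightarrow> x < v \<Longrightarrow> \<not> (u < g x \<and> g x < v)"
  shows "\<exists>ks. ks \<noteq> [] \<and> set ks \<subseteq> carrier (Gamma_group S) \<and>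
    (\<forall>k\<in>set ks. \<forall>x. \<not> (u < x \<and> x < v) \<longrightarrow> k x = x) \<and>
    bnd (carrier (Gamma_group S))
      (group_alg_op (regular_rep (Gamma_group S)) (average_list (map (Gamma_comm g) ks))) gap_constant"
proof -
  let ?G = "Gamma_group S" and ?T = "S - {p}"
  have pp: "prime p" using primes p by blast
  define t :: rat where "t = 1 / of_nat p ^ 6"
  obtain b c where b: "b \<in> carrier ?G" and c: "c \<in> carrier ?G"
    and out: "\<And>z. z \<le> -2 \<or> 7 \<le> z \<Longrightarrow> b z = z \<and> c z = z"
    and bJ: "\<And>z. z \<in> base_interval \<Longrightarrow> denom (1, 0, - t, 1) z \<noteq> 0 \<and> b z = mob (1, 0, - t, 1) z"
    and cJ: "\<And>z. z \<in> base_interval \<Longrightarrow> c z = z + of_rat t"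
    and ccJ: "\<And>z. z \<in> base_interval \<Longrightarrow> (c \<circ> c) z = z + 2 * of_rat t"
    by (rule ping_pong_prime[OF p pp t_def]) (rule that; assumption)
  obtain \<theta> where \<theta>: "\<theta> \<in> carrier ?G" "\<And>z. -2 < z \<Longrightarrow> z < 7 \<Longrightarrow> u < \<theta> z \<and> \<theta> z < v"
    using contracting_affine[OF p pp uv] by blast
  define hh where "hh e = \<theta> \<circ> (e \<circ> inv_map \<theta>)" for e
  define ee where "ee e = inv_map \<theta> \<circ> (Gamma_comm g (hh e) \<circ> \<theta>)" for e
  have hhG: "hh e \<in> carrier ?G" if "e \<in> carrier ?G" for e
    unfolding hh_def by (intro Gamma_comp_closed Gamma_inv_closed \<theta>(1) that)
  have commG: "Gamma_comm g (hh e) \<in> carrier ?G" if "e \<in> carrier ?G" for e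
    by (intro Gamma_comp_closed Gamma_inv_closed g hhG that)
  have eeG: "ee e \<in> carrier ?G" if "e \<in> carrier ?G" for e
    unfolding ee_def by (intro Gamma_comp_closed[OF Gamma_inv_closed[OF \<theta>(1)]] Gamma_comp_closed[OF commG[OF that]] \<theta>(1))
  have supp: "hh e x = x" if e: "\<And>z. z \<le> -2 \<or> 7 \<le> z \<Longrightarrow> e z = z" and x: "\<not> (u < x \<and> x < v)" for e x
  proof -
    have "\<not> (-2 < inv_map \<theta> x \<and> inv_map \<theta> x < 7)" using \<theta>(2)[of "inv_map \<theta> x"] x Gamma_inv(1)[OF \<theta>(1)] by auto
    then have "e (inv_map \<theta> x) = inv_map \<theta> x" by (intro e) linarith
    then show ?thesis using Gamma_inv(1)[OF \<theta>(1)] by (simp add: hh_def)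
  qed
  \<comment> \<open>The point g^-1 (\<theta> z) has left (u, v), where the inverse of
    \<open>hh e\<close> is the identity, so the inner part of the commutator acts trivially.\<close>
  have ee_J: "ee e z = e z" if e: "e \<in> carrier ?G" "\<And>z. z \<le> -2 \<or> 7 \<le> z \<Longrightarrow> e z = z" and z: "z \<in> base_interval" for e z
  proof -
    have tz: "u < \<theta> z" "\<theta> z < v" using \<theta>(2)[of z] z by auto
    let ?y = "inv_map g (\<theta> z)"
    have "\<not> (u < ?y \<and> ?y < v)" using off[of ?y] tz Gamma_inv(1)[OF g] by auto
    from fixed_inv[OF hhG[OF e(1)] supp[OF e(2) this]] have "inv_map (hh e) ?y = ?y" .
    then have "ee e z = inv_map \<theta> (hh e (\<theta> z))" using Gamma_inv(1)[OF g] by (simp add: ee_def)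
    also have "\<dots> = e z" using Gamma_inv(2)[OF \<theta>(1)] by (simp add: hh_def)
    finally show ?thesis .
  qed
  have cc: "c \<circ> c \<in> carrier ?G" by (rule Gamma_comp_closed[OF c c])
  have ccout: "(c \<circ> c) z = z" if "z \<le> -2 \<or> 7 \<le> z" for z using out[OF that] by simp
  have cout: "c z = z" and bout: "b z = z" if "z \<le> -2 \<or> 7 \<le> z" for z using out[OF that] by simp_all
  let ?es = "[id, ee b, ee c, ee (c \<circ> c)]" and ?ks = "[id, hh b, hh c, hh (c \<circ> c)]"
  \<comment> \<open>The gap is obtained for cosets of the subgroup that omits the prime p only, and
    it descends to the regular representation by domination.\<close>
  have "bnd (lcosets\<^bsub>?G\<^esub> (carrier (Gamma_group ?T))) (group_alg_op (lambda_quotient S ?T) (average_list ?es)) gap_constant"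
  proof (rule quasi_regular_gap[OF _ primes p _ t_def])
    show "denom (1, 0, - t, 1) z \<noteq> 0 \<and> ee b z = mob (1, 0, - t, 1) z" if "z \<in> base_interval" for z
      using bJ[OF that] ee_J[OF b bout that] by (simp del: denom.simps mob.simps)
    show "ee c z = z + of_rat t" if "z \<in> base_interval" for z using cJ[OF that] ee_J[OF c cout that] by simp
    show "ee (c \<circ> c) z = z + 2 * of_rat t" if "z \<in> base_interval" for z
      by (rule trans[OF ee_J[OF cc _ that] ccJ[OF that]]) (erule ccout)
  qed (use eeG b c cc in auto)
  moreover have es: "set ?es \<subseteq> carrier ?G" using eeG b c cc Gamma_id by auto
  ultimately have gap: "bnd (carrier ?G) (group_alg_op (regular_rep ?G) (average_list ?es)) gap_constant"
    using regular_dominated_by_quasi_regular[OF primes _ p, of ?T] average_group_lists[OF es] gap_constant(1)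
    unfolding dominated_def by (simp add: regular_rep_eq_perm_rep quasi_regular_rep_eq_perm_rep)
  have U: "unitary_rep ?G (regular_rep ?G)" by (rule regular_rep_unitary[OF Gamma_group])
  have cancel: "\<theta> \<circ> (ee e \<circ> inv_map \<theta>) = Gamma_comm g (hh e)" for e
    using Gamma_inv(1)[OF \<theta>(1)] by (simp add: ee_def fun_eq_iff)
  have "map (\<lambda>a. \<theta> \<otimes>\<^bsub>?G\<^esub> (a \<otimes>\<^bsub>?G\<^esub> inv\<^bsub>?G\<^esub> \<theta>)) ?es = map (Gamma_comm g) ?ks"
    using Gamma_inv(1)[OF \<theta>(1)] Gamma_inv(1)[OF g] Gamma_m_inv[OF \<theta>(1)] cancel
    by (simp add: fun_eq_iff)
  with bnd_average_conj[OF Gamma_group U es \<theta>(1)] gap gap_constant(1)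
  have "bnd (carrier ?G) (group_alg_op (regular_rep ?G) (average_list (map (Gamma_comm g) ?ks))) gap_constant"
    by (simp only: regular_rep_eq_perm_rep basis_perm_rep)
  moreover have "set ?ks \<subseteq> carrier ?G" using hhG b c cc Gamma_id by auto
  moreover have "\<forall>k\<in>set ?ks. \<forall>x. \<not> (u < x \<and> x < v) \<longrightarrow> k x = x"
    using supp[of b] supp[of c] supp[of "c \<circ> c"] bout cout ccout by auto
  ultimately show ?thesis by blast
qed

text \<open>For \<open>k\<close> and \<open>h\<close> supported in disjoint halves of the displaced interval, the conjugate of \<open>g\<close> by \<open>k \<circ> h\<close> is the
  commutator of \<open>k\<close> with \<open>g\<close> times the conjugate by \<open>h\<close>, so the averages multiply.\<close>

lemma conj_averages_decay:
  assumes primes: "\<forall>q\<in>S. prime q" and p: "p \<in> S" and g: "g \<in> carrier (Gamma_group S)"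
    and uv: "u < v" and off: "\<And>x. u < x \<Longrightarrow> x < v \<Longrightarrow> \<not> (u < g x \<and> g x < v)"
  shows "\<exists>hs. hs \<noteq> [] \<and> set hs \<subseteq> carrier (Gamma_group S) \<and>
    (\<forall>h\<in>set hs. \<forall>x. \<not> (u < x \<and> x < v) \<longrightarrow> h x = x) \<and>
    bnd (carrier (Gamma_group S))
      (group_alg_op (regular_rep (Gamma_group S)) (average_list (map (Gamma_conj g) hs))) (gap_constant ^ n)"
  using uv off
proof (induction n arbitrary: u v)
  let ?G = "Gamma_group S" and ?R = "regular_rep (Gamma_group S)"
  have U: "unitary_rep ?G ?R" by (rule regular_rep_unitary[OF Gamma_group])
  have avX: "group_alg_op ?R (average_list as) \<in> bounded_ops (carrier ?G)" if "set as \<subseteq> carrier ?G" for as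
    using group_alg_bounded_op[OF Gamma_group U average_group_lists[OF that]] by (simp add: regular_rep_eq_perm_rep)
  {
    case 0
    have "group_alg_op ?R (average_list (map (Gamma_conj g) [id])) = act ?R g"
      by (simp add: average_list_def)
    then show ?case using bnd_act[OF Gamma_group U g] Gamma_id
      by (intro exI[of _ "[id]"]) (simp add: regular_rep_eq_perm_rep)
  next
    case (Suc n)
    define m where "m = (u + v) / 2"
    have m: "u < m" "m < v" using Suc.prems(1) by (auto simp: m_def)
    have "\<not> (u < g x \<and> g x < m)" if "u < x" "x < m" for x using Suc.prems(2)[of x] that m by auto
    from commutator_gap[OF primes p g m(1) this] obtain ks where ks: "ks \<noteq> []" "set ks \<subseteq> carrier ?G"
      "\<And>k x. k \<in> set ks \<Longrightarrow> \<not> (u < x \<and> x < m) \<Longrightarrow> k x = x"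
      "bnd (carrier ?G) (group_alg_op ?R (average_list (map (Gamma_comm g) ks))) gap_constant" by blast
    have "\<not> (m < g x \<and> g x < v)" if "m < x" "x < v" for x using Suc.prems(2)[of x] that m by auto
    from Suc.IH[OF m(2) this] obtain hs where hs: "hs \<noteq> []" "set hs \<subseteq> carrier ?G"
      "\<And>h x. h \<in> set hs \<Longrightarrow> \<not> (m < x \<and> x < v) \<Longrightarrow> h x = x"
      "bnd (carrier ?G) (group_alg_op ?R (average_list (map (Gamma_conj g) hs))) (gap_constant ^ n)" by blast
    have gG: "Gamma_comm g k \<in> carrier ?G" if "k \<in> set ks" for k
      using that ks(2) by (intro Gamma_comp_closed Gamma_inv_closed g) auto
    have hG: "Gamma_conj g h \<in> carrier ?G" if "h \<in> set hs" for h
      using that hs(2) by (intro Gamma_comp_closed Gamma_inv_closed g) auto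
    have split: "Gamma_conj g (k \<circ> h) = Gamma_comm g k \<circ> Gamma_conj g h" if k: "k \<in> set ks" and h: "h \<in> set hs" for k h
    proof -
      have kG: "k \<in> carrier ?G" and hG: "h \<in> carrier ?G" using k h ks(2) hs(2) by auto
      have comm1: "k \<circ> h = h \<circ> k"
      proof (rule disjoint_support_commute[OF bij_is_inj[OF Gamma_bij[OF kG]] bij_is_inj[OF Gamma_bij[OF hG]]])
        show "k x = x \<or> h x = x" for x using ks(3)[OF k, of x] hs(3)[OF h, of x] by linarith
      qed
      \<comment> \<open>The conjugate of g by k h equals k h k' g h^-1. The support of k' lies in
        the image of (u, m) under g, hence away from (m, v), so k' moves past h and the product
        splits.\<close>
      let ?k' = "g \<circ> (inv_map k \<circ> inv_map g)"
      have k'G: "?k' \<in> carrier ?G" by (intro Gamma_comp_closed Gamma_inv_closed g kG)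
      have comm2: "h \<circ> ?k' = ?k' \<circ> h"
      proof (rule disjoint_support_commute[OF bij_is_inj[OF Gamma_bij[OF hG]] bij_is_inj[OF Gamma_bij[OF k'G]]])
        fix x
        show "h x = x \<or> ?k' x = x"
        proof (cases "m < x \<and> x < v")
          case True
          let ?y = "inv_map g x"
          have "\<not> (u < ?y \<and> ?y < m)" using Suc.prems(2)[of ?y] True m Gamma_inv(1)[OF g] by auto
          from fixed_inv[OF kG ks(3)[OF k this]] show ?thesis using Gamma_inv(1)[OF g] by simp
        qed (use hs(3)[OF h] in blast)
      qed
      have "inv_map (k \<circ> h) = inv_map k \<circ> inv_map h"
        unfolding comm1 by (rule o_inv_distrib[OF Gamma_bij[OF hG] Gamma_bij[OF kG]])
      then have "Gamma_conj g (k \<circ> h) = k \<circ> (h \<circ> ?k') \<circ> (g \<circ> inv_map h)"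
        using Gamma_inv(2)[OF g] by (simp add: fun_eq_iff)
      also have "\<dots> = Gamma_comm g k \<circ> Gamma_conj g h" unfolding comm2 by (simp add: comp_assoc)
      finally show ?thesis .
    qed
    let ?hs = "map (\<lambda>(k, h). k \<circ> h) (List.product ks hs)"
    have "map (Gamma_conj g) ?hs = map (\<lambda>(k, h). Gamma_comm g k \<circ> Gamma_conj g h) (List.product ks hs)"
      using split by (auto simp del: o_assoc)
    moreover have "group_alg_op ?R (average_list (map (\<lambda>(k, h). Gamma_comm g k \<circ> Gamma_conj g h) (List.product ks hs))) =
        group_alg_op ?R (average_list (map (Gamma_comm g) ks)) \<circ> group_alg_op ?R (average_list (map (Gamma_conj g) hs))"
      by (rule average_mult[OF Gamma_group U, unfolded Gamma_simps]) (use gG hG in blast)+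
    moreover have "bnd (carrier ?G) (group_alg_op ?R (average_list (map (Gamma_comm g) ks)) \<circ>
        group_alg_op ?R (average_list (map (Gamma_conj g) hs))) (gap_constant * gap_constant ^ n)"
    proof (rule bnd_comp[OF _ _ ks(4) hs(4) gap_constant(1)])
      show "group_alg_op ?R (average_list (map (Gamma_comm g) ks)) \<in> bounded_ops (carrier ?G)"
        by (rule avX, unfold set_map, rule image_subsetI, rule gG)
      show "group_alg_op ?R (average_list (map (Gamma_conj g) hs)) \<in> bounded_ops (carrier ?G)"
        by (rule avX, unfold set_map, rule image_subsetI, rule hG)
    qed
    ultimately have "bnd (carrier ?G) (group_alg_op ?R (average_list (map (Gamma_conj g) ?hs))) (gap_constant ^ Suc n)"
      by (simp only: power_Suc)
    moreover have "?hs \<noteq> []" using ks(1) hs(1) by (cases ks; cases hs) auto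
    moreover have "set ?hs \<subseteq> carrier ?G" using ks(2) hs(2) by (auto intro!: Gamma_comp_closed)
    moreover have "\<forall>h\<in>set ?hs. \<forall>x. \<not> (u < x \<and> x < v) \<longrightarrow> h x = x"
    proof (intro ballI allI impI)
      fix h x assume "h \<in> set ?hs" "\<not> (u < x \<and> x < v)"
      then obtain k h' where kh: "k \<in> set ks" "h' \<in> set hs" "h = k \<circ> h'" by auto
      have "h' x = x" "k x = x"
        using \<open>\<not> (u < x \<and> x < v)\<close> m by (auto intro!: ks(3)[OF kh(1)] hs(3)[OF kh(2)])
      then show "h x = x" using kh(3) by simp
    qed
    ultimately show ?case by blast
  }
qed

lemma bnd_average_conj_comp:
  assumes k: "k \<in> carrier (Gamma_group S)" and hs: "set hs \<subseteq> carrier (Gamma_group S)"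
    and g: "g \<in> carrier (Gamma_group S)"
    and b: "bnd (carrier (Gamma_group S))
      (group_alg_op (regular_rep (Gamma_group S)) (average_list (map (Gamma_conj g) hs))) C" "0 \<le> C"
  shows "bnd (carrier (Gamma_group S))
      (group_alg_op (regular_rep (Gamma_group S)) (average_list (map (\<lambda>h. Gamma_conj g (k \<circ> h)) hs))) C"
proof -
  let ?G = "Gamma_group S"
  have hG: "Gamma_conj g h \<in> carrier ?G" if "h \<in> set hs" for h
    using that hs by (intro Gamma_comp_closed Gamma_inv_closed g) auto
  have sub: "set (map (Gamma_conj g) hs) \<subseteq> carrier ?G" by (unfold set_map, rule image_subsetI, rule hG)
  have "k \<circ> (Gamma_conj g h \<circ> inv_map k) = Gamma_conj g (k \<circ> h)" if "h \<in> set hs" for h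
  proof -
    have "inv_map (k \<circ> h) = inv_map h \<circ> inv_map k"
      by (rule o_inv_distrib[OF Gamma_bij[OF k] Gamma_bij[of h S]]) (use that hs in blast)
    then show ?thesis by (simp add: comp_assoc)
  qed
  then have "map (\<lambda>a. k \<otimes>\<^bsub>?G\<^esub> (a \<otimes>\<^bsub>?G\<^esub> inv\<^bsub>?G\<^esub> k)) (map (Gamma_conj g) hs) =
      map (\<lambda>h. Gamma_conj g (k \<circ> h)) hs"
    unfolding Gamma_m_inv[OF k] Gamma_simps map_map by (intro map_cong refl) (simp only: o_apply)
  with bnd_average_conj[OF Gamma_group regular_rep_unitary[OF Gamma_group] sub k, of C] b
  show ?thesis by (simp only: regular_rep_eq_perm_rep basis_perm_rep)
qed

lemma moved_point:
  assumes g: "g \<in> carrier (Gamma_group S)" "g \<noteq> id" and Z: "finite Z"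
  shows "\<exists>x. x \<notin> Z \<and> g x \<noteq> x"
proof -
  have "continuous_on UNIV g" using g(1) homeomorphism_inv(3) by (auto simp: Gamma_carrier)
  then have "closed {x. g x = x}" by (rule closed_Collect_eq[OF _ continuous_on_id])
  then have o: "open {x. g x \<noteq> x}" by (simp add: open_Collect_neg)
  have "{x. g x \<noteq> x} \<noteq> {}" using g(2) by (auto simp: fun_eq_iff)
  then have "infinite {x. g x \<noteq> x}" using o finite_imp_not_open by blast
  then have "\<not> {x. g x \<noteq> x} \<subseteq> Z" using Z finite_subset by blast
  then show ?thesis by blast
qed

text \<open>Continuity separates a short interval around a moved point from its image. The factor 2
  keeps neighbourhoods of radius r of \<open>Z\<close> disjoint from this interval.\<close>

lemma small_displaced_interval:
  fixes Z :: "real set"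
  assumes g: "g \<in> carrier (Gamma_group S)" and x0: "g x0 \<noteq> x0" "x0 \<notin> Z" and Z: "finite Z" and \<delta>: "0 < \<delta>"
  shows "\<exists>r>0. r \<le> \<delta> \<and> (\<forall>z\<in>Z. 2 * r \<le> \<bar>z - x0\<bar>) \<and>
    (\<forall>x. x0 - r < x \<longrightarrow> x < x0 + r \<longrightarrow> \<not> (x0 - r < g x \<and> g x < x0 + r))"
proof -
  define d where "d = \<bar>g x0 - x0\<bar>"
  have d: "0 < d" using x0(1) by (simp add: d_def)
  obtain s where s: "0 < s" "\<And>x. \<bar>x - x0\<bar> < s \<Longrightarrow> \<bar>g x - g x0\<bar> < d / 2"
    using Gamma_isCont(1)[OF g, of x0] d unfolding continuous_at_eps_delta dist_real_def by (meson half_gt_zero)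
  obtain \<rho> where \<rho>: "0 < \<rho>" "\<And>z. z \<in> Z \<Longrightarrow> z \<noteq> x0 \<Longrightarrow> \<rho> \<le> dist x0 z"
    using finite_set_avoid[OF Z, of x0] by blast
  define r where "r = min (min \<delta> s) (min (d / 2) (\<rho> / 2))"
  have r: "0 < r" "r \<le> \<delta>" "r \<le> s" "r \<le> d / 2" "r \<le> \<rho> / 2" using \<delta> s(1) d \<rho>(1) by (auto simp: r_def)
  have "2 * r \<le> \<bar>z - x0\<bar>" if "z \<in> Z" for z
  proof -
    have "z \<noteq> x0" using that x0(2) by blast
    from \<rho>(2)[OF that this] r(5) show ?thesis by (simp add: dist_real_def abs_minus_commute)
  qed
  moreover have "\<not> (x0 - r < g x \<and> g x < x0 + r)" if "x0 - r < x" "x < x0 + r" for x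
  proof
    assume "x0 - r < g x \<and> g x < x0 + r"
    then have "\<bar>g x - x0\<bar> < d / 2" using r(4) by linarith
    moreover have "\<bar>g x - g x0\<bar> < d / 2" using that r(3) by (intro s(2)) linarith
    ultimately show False using abs_triangle_ineq4[of "g x - x0" "g x - g x0"] by (simp add: d_def)
  qed
  ultimately show ?thesis using r by blast
qed

text \<open>The finite set \<open>Z\<close> is what makes the induction run. The conjugators for
  \<open>F\<close> can be kept trivial near a point that the new element g moves, and those for g
  are supported near this point. The two families commute, so in a double average the one suited to
  a given element can be put inside, and outer conjugation does not spoil its bound.\<close>

lemma Gamma_averaging:
  assumes primes: "\<forall>q\<in>S. prime q" and p: "p \<in> S" and F: "finite F" "F \<subseteq> carrier (Gamma_group S) - {id}"
    and Z: "finite Z" and \<epsilon>: "0 < \<epsilon>"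
  shows "\<exists>hs. hs \<noteq> [] \<and> set hs \<subseteq> carrier (Gamma_group S) \<and>
    (\<exists>\<delta>>0. \<forall>h\<in>set hs. \<forall>z\<in>Z. \<forall>x. \<bar>x - z\<bar> < \<delta> \<longrightarrow> h x = x) \<and>
    (\<forall>g\<in>F. bnd (carrier (Gamma_group S))
      (group_alg_op (regular_rep (Gamma_group S)) (average_list (map (Gamma_conj g) hs))) \<epsilon>)"
  using F Z
proof (induction F arbitrary: Z rule: finite_induct)
  case empty
  then show ?case using Gamma_id by (intro exI[of _ "[id]"]) (auto intro: exI[of _ 1])
next
  case (insert g F)
  let ?G = "Gamma_group S" and ?R = "regular_rep (Gamma_group S)"
  have U: "unitary_rep ?G ?R" by (rule regular_rep_unitary[OF Gamma_group])
  have bR: "basis ?R = carrier ?G" by (simp add: regular_rep_eq_perm_rep)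
  have g: "g \<in> carrier ?G" "g \<noteq> id" and F: "F \<subseteq> carrier ?G - {id}" using insert.prems by blast+
  obtain x0 where x0: "x0 \<notin> Z" "g x0 \<noteq> x0" using moved_point[OF g insert.prems(2)] by blast
  \<comment> \<open>The moved point x0 joins the set near which the earlier conjugators must be
    trivial, which reserves room for the new ones.\<close>
  have "finite (insert x0 Z)" using insert.prems(2) by simp
  from insert.IH[OF F this] obtain hs \<delta> where hs: "hs \<noteq> []" "set hs \<subseteq> carrier ?G" "0 < \<delta>"
    "\<And>h z x. h \<in> set hs \<Longrightarrow> z \<in> insert x0 Z \<Longrightarrow> \<bar>x - z\<bar> < \<delta> \<Longrightarrow> h x = x"
    "\<And>g. g \<in> F \<Longrightarrow> bnd (carrier ?G) (group_alg_op ?R (average_list (map (Gamma_conj g) hs))) \<epsilon>" by blast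
  obtain r where r: "0 < r" "r \<le> \<delta>" "\<And>z. z \<in> Z \<Longrightarrow> 2 * r \<le> \<bar>z - x0\<bar>"
    "\<And>x. x0 - r < x \<Longrightarrow> x < x0 + r \<Longrightarrow> \<not> (x0 - r < g x \<and> g x < x0 + r)"
    using small_displaced_interval[OF g(1) x0(2,1) insert.prems(2) hs(3)] by blast
  obtain n where n: "gap_constant ^ n < \<epsilon>" using real_arch_pow_inv[OF \<epsilon> gap_constant(2)] by blast
  have "x0 - r < x0 + r" using r(1) by simp
  from conj_averages_decay[OF primes p g(1) this r(4), of n] obtain ks where ks: "ks \<noteq> []" "set ks \<subseteq> carrier ?G"
    "\<And>k x. k \<in> set ks \<Longrightarrow> \<not> (x0 - r < x \<and> x < x0 + r) \<Longrightarrow> k x = x"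
    "bnd (carrier ?G) (group_alg_op ?R (average_list (map (Gamma_conj g) ks))) (gap_constant ^ n)" by blast
  have ks_bnd: "bnd (carrier ?G) (group_alg_op ?R (average_list (map (Gamma_conj g) ks))) \<epsilon>"
    by (rule bnd_mono[OF ks(4)]) (use n in simp)
  have closed: "Gamma_conj g' (k \<circ> h) \<in> carrier ?G" if "g' \<in> carrier ?G" "k \<in> set ks" "h \<in> set hs" for g' k h
    using that ks(2) hs(2) by (intro Gamma_comp_closed Gamma_inv_closed) auto
  let ?hs = "map (\<lambda>(k, h). k \<circ> h) (List.product ks hs)"
  have conj_map: "map (Gamma_conj g') ?hs = map (\<lambda>(k, h). Gamma_conj g' (k \<circ> h)) (List.product ks hs)" for g'
    unfolding map_map by (intro map_cong refl) (simp only: o_apply case_prod_beta)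
  have F_bnd: "bnd (carrier ?G) (group_alg_op ?R (average_list (map (Gamma_conj g') ?hs))) \<epsilon>" if g': "g' \<in> F" for g'
    unfolding conj_map
  proof (rule bnd_average_product[OF Gamma_group U, unfolded bR])
    have g'G: "g' \<in> carrier ?G" using g' F by blast
    show "Gamma_conj g' (k \<circ> h) \<in> carrier ?G" if "k \<in> set ks" "h \<in> set hs" for k h by (rule closed[OF g'G that])
    show "bnd (carrier ?G) (group_alg_op ?R (average_list (map (\<lambda>h. Gamma_conj g' (k \<circ> h)) hs))) \<epsilon>" if "k \<in> set ks" for k
      by (rule bnd_average_conj_comp[OF _ hs(2) g'G hs(5)[OF g']]) (use that ks(2) \<epsilon> in auto)
  qed (use ks(1) \<epsilon> in auto)
  have comm: "k \<circ> h = h \<circ> k" if k: "k \<in> set ks" and h: "h \<in> set hs" for k h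
  proof (rule disjoint_support_commute)
    show "inj k" "inj h" using k h ks(2) hs(2) Gamma_bij bij_is_inj by blast+
    show "k x = x \<or> h x = x" for x
    proof (cases "x0 - r < x \<and> x < x0 + r")
      case True
      then have "h x = x" using r(2) by (intro hs(4)[OF h, of x0]) auto
      then show ?thesis by simp
    qed (use ks(3)[OF k] in blast)
  qed
  have "bnd (carrier ?G) (group_alg_op ?R (average_list (map (Gamma_conj g) ?hs))) \<epsilon>"
    unfolding conj_map group_alg_average_swap[OF Gamma_group U, of "\<lambda>k h. Gamma_conj g (k \<circ> h)"]
  proof (rule bnd_average_product[OF Gamma_group U, unfolded bR])
    show "Gamma_conj g (k \<circ> h) \<in> carrier ?G" if "h \<in> set hs" "k \<in> set ks" for k h by (rule closed[OF g(1) that(2,1)])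
    show "bnd (carrier ?G) (group_alg_op ?R (average_list (map (\<lambda>k. Gamma_conj g (k \<circ> h)) ks))) \<epsilon>" if h: "h \<in> set hs" for h
    proof -
      have "map (\<lambda>k. Gamma_conj g (k \<circ> h)) ks = map (\<lambda>k. Gamma_conj g (h \<circ> k)) ks"
        by (intro map_cong refl) (simp only: comm[OF _ h])
      moreover have "bnd (carrier ?G) (group_alg_op ?R (average_list (map (\<lambda>k. Gamma_conj g (h \<circ> k)) ks))) \<epsilon>"
        by (rule bnd_average_conj_comp[OF _ ks(2) g(1) ks_bnd]) (use h hs(2) \<epsilon> in auto)
      ultimately show ?thesis by (simp only:)
    qed
  qed (use hs(1) \<epsilon> in auto)
  moreover have "?hs \<noteq> []" using ks(1) hs(1) by (cases ks; cases hs) auto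
  moreover have "set ?hs \<subseteq> carrier ?G" using ks(2) hs(2) by (auto intro!: Gamma_comp_closed)
  moreover have "\<forall>h\<in>set ?hs. \<forall>z\<in>Z. \<forall>x. \<bar>x - z\<bar> < r \<longrightarrow> h x = x"
  proof (intro ballI allI impI)
    fix h z x assume "h \<in> set ?hs" and z: "z \<in> Z" and x: "\<bar>x - z\<bar> < r"
    then obtain k h' where kh: "k \<in> set ks" "h' \<in> set hs" "h = k \<circ> h'" by auto
    have "h' x = x" using z x r(2) by (intro hs(4)[OF kh(2), of z]) auto
    moreover have "k x = x" using r(3)[OF z] x by (intro ks(3)[OF kh(1)]) linarith
    ultimately show "h x = x" using kh(3) by simp
  qed
  ultimately show ?case using F_bnd r(1) by blast
qed

theorem Gamma_Cstar_simple:
  assumes primes: "\<forall>q\<in>S. prime q" and p: "p \<in> S"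
  shows "simple_cstar_algebra (Cstar_red (Gamma_group S))"
proof (rule averaging_simple[OF Gamma_group])
  let ?G = "Gamma_group S"
  fix F :: "(real \<Rightarrow> real) set" and \<epsilon> :: real
  assume F: "finite F" "F \<subseteq> carrier ?G - {\<one>\<^bsub>?G\<^esub>}" and \<epsilon>: "0 < \<epsilon>"
  from Gamma_averaging[OF primes p F(1) _ finite.emptyI \<epsilon>] F(2) obtain hs where hs: "hs \<noteq> []" "set hs \<subseteq> carrier ?G"
    "\<And>g. g \<in> F \<Longrightarrow> bnd (carrier ?G) (group_alg_op (regular_rep ?G) (average_list (map (Gamma_conj g) hs))) \<epsilon>"
    by auto
  have eq: "map (\<lambda>h. h \<otimes>\<^bsub>?G\<^esub> (g \<otimes>\<^bsub>?G\<^esub> inv\<^bsub>?G\<^esub> h)) hs = map (Gamma_conj g) hs" for g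
    unfolding Gamma_simps by (intro map_cong refl) (use hs(2) Gamma_m_inv in auto)
  show "\<exists>hs. hs \<noteq> [] \<and> set hs \<subseteq> carrier ?G \<and> (\<forall>g\<in>F. bnd (carrier ?G) (group_alg_op (regular_rep ?G)
      (average_list (map (\<lambda>h. h \<otimes>\<^bsub>?G\<^esub> (g \<otimes>\<^bsub>?G\<^esub> inv\<^bsub>?G\<^esub> h)) hs))) \<epsilon>)"
    by (intro exI[of _ hs], unfold eq) (use hs in blast)
qed

section \<open>The main theorem\<close>

text \<open>The order of the quantifiers matters: one list, depending on p alone, serves all S and T
  with p in S but not in T, and it lies in Gamma_A for every A that contains p.\<close>

lemma gap_elements:
  assumes p: "prime p"
  shows "\<exists>gs. gs \<noteq> [] \<and> set gs \<subseteq> carrier (Gamma_group {p}) \<and>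
    (\<forall>S T. (\<forall>q\<in>S. prime q) \<and> T \<subseteq> S \<and> p \<in> S \<and> p \<notin> T \<longrightarrow>
      bnd (basis (lambda_quotient S T)) (group_alg_op (lambda_quotient S T) (average_list gs)) gap_constant)"
proof -
  define t :: rat where "t = 1 / of_nat p ^ 6"
  obtain b c where b: "b \<in> carrier (Gamma_group {p})" and c: "c \<in> carrier (Gamma_group {p})"
    and out: "\<And>z. z \<le> -2 \<or> 7 \<le> z \<Longrightarrow> b z = z \<and> c z = z"
    and bJ: "\<And>z. z \<in> base_interval \<Longrightarrow> denom (1, 0, - t, 1) z \<noteq> 0 \<and> b z = mob (1, 0, - t, 1) z"
    and cJ: "\<And>z. z \<in> base_interval \<Longrightarrow> c z = z + of_rat t"
    and ccJ: "\<And>z. z \<in> base_interval \<Longrightarrow> (c \<circ> c) z = z + 2 * of_rat t"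
    by (rule ping_pong_prime[OF singletonI p t_def]) (rule that; assumption)
  have cc: "c \<circ> c \<in> carrier (Gamma_group {p})" by (rule Gamma_comp_closed[OF c c])
  have "bnd (basis (lambda_quotient S T)) (group_alg_op (lambda_quotient S T) (average_list [id, b, c, c \<circ> c])) gap_constant"
    if S: "\<forall>q\<in>S. prime q" "T \<subseteq> S" "p \<in> S" "p \<notin> T" for S T
  proof -
    have mono: "carrier (Gamma_group {p}) \<subseteq> carrier (Gamma_group S)" using S(3) by (intro Gamma_mono) simp
    have "bnd (lcosets\<^bsub>Gamma_group S\<^esub> (carrier (Gamma_group T)))
        (group_alg_op (lambda_quotient S T) (average_list [id, b, c, c \<circ> c])) gap_constant"
      by (rule quasi_regular_gap[OF S(2,1,3,4) t_def _ _ _ bJ cJ ccJ]) (use b c cc mono in blast)+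
    then show ?thesis by (simp only: quasi_regular_rep_eq_perm_rep basis_perm_rep)
  qed
  moreover have "set [id, b, c, c \<circ> c] \<subseteq> carrier (Gamma_group {p})" using b c cc Gamma_id by simp
  ultimately show ?thesis by blast
qed

lemma lambda_quotient_unitary: "T \<subseteq> S \<Longrightarrow> unitary_rep (Gamma_group S) (lambda_quotient S T)"
  unfolding quasi_regular_rep_eq_perm_rep
  by (rule perm_rep_unitary[OF Gamma_group lcosets_group_act[OF Gamma_group Gamma_subgroup]])

lemma lambda_quotient_fixed_vector:
  assumes TS: "T \<subseteq> S"
  shows "fixed_vector (lambda_quotient S T) (carrier (Gamma_group T)) (delta (carrier (Gamma_group T)))"
proof -
  let ?G = "Gamma_group S" and ?H = "carrier (Gamma_group T)"
  have H: "subgroup ?H ?G" by (rule Gamma_subgroup[OF TS])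
  have "\<one>\<^bsub>?G\<^esub> <#\<^bsub>?G\<^esub> ?H = ?H"
    by (rule group.lcos_mult_one[OF Gamma_group subgroup.subset[OF H]])
  then have HX: "?H \<in> lcosets\<^bsub>?G\<^esub> ?H"
    using Gamma_id[of S] unfolding LCOSETS_def by (metis Gamma_simps(2) UN_iff singletonI)
  have "act (lambda_quotient S T) g (delta ?H) = delta ?H" if g: "g \<in> ?H" for g
  proof -
    have gG: "g \<in> carrier ?G" using g Gamma_mono[OF TS] by blast
    have "g <#\<^bsub>?G\<^esub> ?H = ?H" by (rule group.coset_join3[OF Gamma_group gG H g])
    with act_perm_rep_delta[OF Gamma_group lcosets_group_act[OF Gamma_group H] gG HX] show ?thesis
      by (simp only: quasi_regular_rep_eq_perm_rep)
  qed
  then show ?thesis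
    using delta_ell2[OF HX] ell2_norm_delta[OF HX] by (simp add: fixed_vector_def quasi_regular_rep_eq_perm_rep)
qed

lemma lambda_quotient_dominated:
  assumes TS: "T \<subseteq> S"
  shows "dominated (Gamma_group S) (lambda_quotient S T) (universal_rep (Gamma_group S))"
proof -
  let ?G = "Gamma_group S" and ?H = "carrier (Gamma_group T)"
  have H: "subgroup ?H ?G" by (rule Gamma_subgroup[OF TS])
  have rep: "\<exists>g. g \<in> C" if C: "C \<in> lcosets\<^bsub>?G\<^esub> ?H" for C
  proof -
    obtain g where "g \<in> carrier ?G" "C = g <#\<^bsub>?G\<^esub> ?H" using C unfolding LCOSETS_def by blast
    then show ?thesis using group.lcos_self[OF Gamma_group _ H] by blast
  qed
  have "inj_on (\<lambda>C. SOME g. g \<in> C) (lcosets\<^bsub>?G\<^esub> ?H)"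
  proof (rule inj_onI)
    fix C D assume C: "C \<in> lcosets\<^bsub>?G\<^esub> ?H" and D: "D \<in> lcosets\<^bsub>?G\<^esub> ?H" and eq: "(SOME g. g \<in> C) = (SOME g. g \<in> D)"
    have "(SOME g. g \<in> C) \<in> C \<inter> D" using someI_ex[OF rep[OF C]] someI_ex[OF rep[OF D]] eq by simp
    then show "C = D" using group.lcos_disjoint[OF Gamma_group H] C D unfolding disjoint_def by blast
  qed
  from universal_rep_dominates[OF Gamma_group lcosets_group_act[OF Gamma_group H] this]
  show ?thesis by (simp only: quasi_regular_rep_eq_perm_rep)
qed

lemma star_epi_comp:
  assumes q: "q \<in> star_epi A B" and r: "r \<in> star_epi B C"
  shows "r \<circ> q \<in> star_epi A C"
proof -
  have q': "q \<in> ring_hom A B" "q ` carrier A = carrier B" and r': "r \<in> ring_hom B C" "r ` carrier B = carrier C"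
    using q r by (auto simp: star_epi_def star_hom_def)
  have qB: "q a \<in> carrier B" if "a \<in> carrier A" for a using q'(2) that by blast
  show ?thesis
    unfolding star_epi_def star_hom_def
  proof (intro CollectI conjI allI ballI)
    show "r \<circ> q \<in> ring_hom A C" using q'(1) r'(1) by (rule ring_hom_trans)
    show "(r \<circ> q) ` carrier A = carrier C" using q'(2) r'(2) by (simp only: image_comp[symmetric])
    fix a assume a: "a \<in> carrier A"
    show "(r \<circ> q) (c \<odot>\<^bsub>A\<^esub> a) = c \<odot>\<^bsub>C\<^esub> (r \<circ> q) a" for c
      using q r a qB[OF a] by (simp add: star_epi_def star_hom_def)
    show "(r \<circ> q) (star A a) = star C ((r \<circ> q) a)"
      using q r a qB[OF a] by (simp add: star_epi_def star_hom_def)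
  qed
qed

theorem mainTheorem1:
  fixes S :: "nat set"
  assumes primes: "\<forall>p\<in>S. prime p"
  shows
    "(\<forall>T. T \<noteq> {} \<and> T \<subset> S \<longrightarrow>
        (\<exists>q r. canonical_quotient (Gamma_group S) (lambda_quotient S T) q \<and>
               exotic_factorization (Gamma_group S)
                 (Cstar_rep (Gamma_group S) (lambda_quotient S T)) q r) \<and>
        irreducible_rep (Gamma_group S) (lambda_quotient S T) \<and>
        simple_cstar_algebra (Cstar_red (Gamma_group S))) \<and>
     (\<forall>T T'. T \<noteq> {} \<and> T \<subset> S \<and> T' \<noteq> {} \<and> T' \<subset> S \<and> T \<noteq> T' \<longrightarrow>
        (\<forall>q q'. canonical_quotient (Gamma_group S) (lambda_quotient S T) q \<and>
                canonical_quotient (Gamma_group S) (lambda_quotient S T') q' \<longrightarrow>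
           \<not> (\<exists>\<phi>. \<phi> \<in> star_iso (Cstar_rep (Gamma_group S) (lambda_quotient S T))
                                (Cstar_rep (Gamma_group S) (lambda_quotient S T')) \<and>
                   (\<forall>a\<in>carrier (Cstar_max (Gamma_group S)). \<phi> (q a) = q' a))) \<and>
        \<not> weakly_equivalent (Gamma_group S) (lambda_quotient S T) (lambda_quotient S T'))"
proof -
  let ?G = "Gamma_group S" and ?U = "universal_rep (Gamma_group S)" and ?R = "regular_rep (Gamma_group S)"
  let ?L = "\<lambda>T. lambda_quotient S T"
  note G = Gamma_group[of S]
  note UU = universal_rep_unitary[OF G] and UR = regular_rep_unitary[OF G]
  have gap: "\<exists>gs. gs \<noteq> [] \<and> set gs \<subseteq> carrier (Gamma_group {p}) \<and>
      (\<forall>T. T \<subseteq> S \<and> p \<notin> T \<longrightarrow> bnd (basis (?L T)) (group_alg_op (?L T) (average_list gs)) gap_constant)" if p: "p \<in> S" for p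
  proof -
    have "prime p" using primes p by blast
    from gap_elements[OF this] obtain gs where gs: "gs \<noteq> []" "set gs \<subseteq> carrier (Gamma_group {p})"
      "\<forall>S T. (\<forall>q\<in>S. prime q) \<and> T \<subseteq> S \<and> p \<in> S \<and> p \<notin> T \<longrightarrow>
        bnd (basis (lambda_quotient S T)) (group_alg_op (lambda_quotient S T) (average_list gs)) gap_constant"
      by (elim exE conjE)
    have "bnd (basis (?L T)) (group_alg_op (?L T) (average_list gs)) gap_constant" if "T \<subseteq> S \<and> p \<notin> T" for T
      using gs(3)[rule_format, of S T] primes p that by simp
    with gs(1,2) show ?thesis by (intro exI[of _ gs]) simp
  qed
  show ?thesis
  proof (intro conjI allI impI)
    fix T assume T: "T \<noteq> {} \<and> T \<subset> S"
    then have TS: "T \<subseteq> S" by blast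
    obtain p where p: "p \<in> S" "p \<notin> T" using T by blast
    obtain p' where p': "p' \<in> T" "p' \<in> S" using T by blast
    note UL = lambda_quotient_unitary[OF TS]
    show "simple_cstar_algebra (Cstar_red ?G)" by (rule Gamma_Cstar_simple[OF primes p(1)])
    show "irreducible_rep ?G (?L T)"
      by (rule quasi_regular_irreducible[OF G Gamma_subgroup[OF TS] infinite_double_coset[OF primes TS]])
    obtain q where q: "q \<in> star_epi (Cstar_rep ?G ?U) (Cstar_rep ?G (?L T))"
      "\<And>g. g \<in> carrier ?G \<Longrightarrow> q (act ?U g) = act (?L T) g"
      using dominated_quotient[OF G UU UL lambda_quotient_dominated[OF TS]] by blast
    obtain r where r: "r \<in> star_epi (Cstar_rep ?G (?L T)) (Cstar_rep ?G ?R)"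
      "\<And>g. g \<in> carrier ?G \<Longrightarrow> r (act (?L T) g) = act ?R g"
      using dominated_quotient[OF G UL UR regular_dominated_by_quasi_regular[OF primes TS p]] by blast
    \<comment> \<open>The universal representation contains a vector fixed by the whole group, while
      the quotient has a gap at a prime outside T.\<close>
    have "q \<notin> star_iso (Cstar_rep ?G ?U) (Cstar_rep ?G (?L T))"
    proof
      assume iso: "q \<in> star_iso (Cstar_rep ?G ?U) (Cstar_rep ?G (?L T))"
      obtain gs where gs: "gs \<noteq> []" "set gs \<subseteq> carrier (Gamma_group {p})"
        "bnd (basis (?L T)) (group_alg_op (?L T) (average_list gs)) gap_constant" using gap[OF p(1)] TS p(2) by blast
      have "set gs \<subseteq> carrier ?G" using gs(2) Gamma_mono[of "{p}" S] p(1) by blast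
      moreover obtain \<xi> where "fixed_vector ?U (carrier ?G) \<xi>" using universal_rep_fixed_vector[OF G] by blast
      ultimately show False
        using gap_no_iso_from_fixed[OF G UL UU iso q(2) _ _ gs(1) order_refl gs(3) gap_constant] by blast
    qed
    \<comment> \<open>Here T must be non-empty: elements for a prime p' in T fix the basis vector of
      the trivial coset, but they have a gap in the quotient for S without p', hence in the regular
      representation.\<close>
    moreover have "r \<notin> star_iso (Cstar_rep ?G (?L T)) (Cstar_rep ?G ?R)"
    proof
      assume iso: "r \<in> star_iso (Cstar_rep ?G (?L T)) (Cstar_rep ?G ?R)"
      let ?T' = "S - {p'}"
      obtain gs where gs: "gs \<noteq> []" "set gs \<subseteq> carrier (Gamma_group {p'})"
        "bnd (basis (?L ?T')) (group_alg_op (?L ?T') (average_list gs)) gap_constant" using gap[OF p'(2)] by blast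
      have sub: "set gs \<subseteq> carrier (Gamma_group T)" using gs(2) Gamma_mono[of "{p'}" T] p'(1) by blast
      then have "average_list gs \<in> group_lists ?G" using Gamma_mono[OF TS] by (intro average_group_lists) blast
      moreover have "dominated ?G ?R (?L ?T')"
        by (rule regular_dominated_by_quasi_regular[OF primes _ p'(2)]) auto
      ultimately have "bnd (basis ?R) (group_alg_op ?R (average_list gs)) gap_constant"
        using gs(3) gap_constant(1) unfolding dominated_def by blast
      then show False
        using gap_no_iso_from_fixed[OF G UR UL iso r(2) lambda_quotient_fixed_vector[OF TS] sub gs(1) Gamma_mono[OF TS]]
          gap_constant by blast
    qed
    moreover have "r \<circ> q \<in> star_epi (Cstar_rep ?G ?U) (Cstar_rep ?G ?R)" by (rule star_epi_comp[OF q(1) r(1)])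
    ultimately show "\<exists>q r. canonical_quotient ?G (?L T) q \<and> exotic_factorization ?G (Cstar_rep ?G (?L T)) q r"
      using q r unfolding canonical_quotient_def exotic_factorization_def Cstar_max_def Cstar_red_def
      by (intro exI[of _ q] exI[of _ r]) simp
  next
    fix T T' assume T: "T \<noteq> {} \<and> T \<subset> S \<and> T' \<noteq> {} \<and> T' \<subset> S \<and> T \<noteq> T'"
    then have TS: "T \<subseteq> S" "T' \<subseteq> S" by auto
    note UL = lambda_quotient_unitary[OF TS(1)] lambda_quotient_unitary[OF TS(2)]
    \<comment> \<open>The separating prime may lie on either side; a failure of weak containment in
      one direction is enough.\<close>
    have "(\<exists>p. p \<in> T \<and> p \<notin> T') \<or> (\<exists>p. p \<in> T' \<and> p \<notin> T)" using T by blast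
    note separating = this
    have fix_gap: "\<exists>gs. gs \<noteq> [] \<and> set gs \<subseteq> carrier (Gamma_group A) \<and>
        bnd (basis (?L B)) (group_alg_op (?L B) (average_list gs)) gap_constant"
      if "p \<in> A" "p \<notin> B" "A \<subseteq> S" "B \<subseteq> S" for p A B
    proof -
      have "carrier (Gamma_group {p}) \<subseteq> carrier (Gamma_group A)" using that(1) by (intro Gamma_mono) simp
      with gap[of p] that show ?thesis by blast
    qed
    have one: "\<one>\<^bsub>?G\<^esub> \<in> carrier (Gamma_group A)" for A by (simp add: Gamma_id)
    show "\<not> weakly_equivalent ?G (?L T) (?L T')"
      using separating
    proof
      assume "\<exists>p. p \<in> T \<and> p \<notin> T'"
      then obtain p where p: "p \<in> T" "p \<notin> T'" by blast
      from fix_gap[OF p TS(1,2)] obtain gs where gs: "gs \<noteq> []" "set gs \<subseteq> carrier (Gamma_group T)"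
        "bnd (basis (?L T')) (group_alg_op (?L T') (average_list gs)) gap_constant" by blast
      from gap_not_weakly_contained[OF G UL(2) lambda_quotient_fixed_vector[OF TS(1)] gs(2,1) Gamma_mono[OF TS(1)] one gs(3) gap_constant]
      show ?thesis by (simp add: weakly_equivalent_def)
    next
      assume "\<exists>p. p \<in> T' \<and> p \<notin> T"
      then obtain p where p: "p \<in> T'" "p \<notin> T" by blast
      from fix_gap[OF p TS(2,1)] obtain gs where gs: "gs \<noteq> []" "set gs \<subseteq> carrier (Gamma_group T')"
        "bnd (basis (?L T)) (group_alg_op (?L T) (average_list gs)) gap_constant" by blast
      from gap_not_weakly_contained[OF G UL(1) lambda_quotient_fixed_vector[OF TS(2)] gs(2,1) Gamma_mono[OF TS(2)] one gs(3) gap_constant]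
      show ?thesis by (simp add: weakly_equivalent_def)
    qed
    fix q q' assume q: "canonical_quotient ?G (?L T) q \<and> canonical_quotient ?G (?L T') q'"
    show "\<not> (\<exists>\<phi>. \<phi> \<in> star_iso (Cstar_rep ?G (?L T)) (Cstar_rep ?G (?L T')) \<and>
        (\<forall>a\<in>carrier (Cstar_max ?G). \<phi> (q a) = q' a))"
    proof
      assume "\<exists>\<phi>. \<phi> \<in> star_iso (Cstar_rep ?G (?L T)) (Cstar_rep ?G (?L T')) \<and>
        (\<forall>a\<in>carrier (Cstar_max ?G). \<phi> (q a) = q' a)"
      then obtain \<phi> where iso: "\<phi> \<in> star_iso (Cstar_rep ?G (?L T)) (Cstar_rep ?G (?L T'))"
        and comm: "\<And>a. a \<in> carrier (Cstar_max ?G) \<Longrightarrow> \<phi> (q a) = q' a" by blast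
      have hom: "\<phi> \<in> star_hom (Cstar_rep ?G (?L T)) (Cstar_rep ?G (?L T'))" using iso by (simp add: star_iso_def)
      have act: "\<phi> (act (?L T) g) = act (?L T') g" if g: "g \<in> carrier ?G" for g
        using comm[of "act ?U g"] act_in_Cstar[OF G UU g] q g unfolding canonical_quotient_def Cstar_max_def by simp
      \<comment> \<open>Depending on the side of the separating prime, the inverse of 1 minus the
        average is pulled back through \<phi> or pushed forward by it.\<close>
      show False
        using separating
      proof
        assume "\<exists>p. p \<in> T \<and> p \<notin> T'"
        then obtain p where p: "p \<in> T" "p \<notin> T'" by blast
        from fix_gap[OF p TS(1,2)] obtain gs where gs: "gs \<noteq> []" "set gs \<subseteq> carrier (Gamma_group T)"
          "bnd (basis (?L T')) (group_alg_op (?L T') (average_list gs)) gap_constant" by blast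
        show False
          by (rule gap_no_iso_from_fixed[OF G UL(2,1) iso act lambda_quotient_fixed_vector[OF TS(1)] gs(2,1)
              Gamma_mono[OF TS(1)] gs(3) gap_constant])
      next
        assume "\<exists>p. p \<in> T' \<and> p \<notin> T"
        then obtain p where p: "p \<in> T'" "p \<notin> T" by blast
        from fix_gap[OF p TS(2,1)] obtain gs where gs: "gs \<noteq> []" "set gs \<subseteq> carrier (Gamma_group T')"
          "bnd (basis (?L T)) (group_alg_op (?L T) (average_list gs)) gap_constant" by blast
        show False
          by (rule gap_no_hom_to_fixed[OF G UL(1,2) hom act lambda_quotient_fixed_vector[OF TS(2)] gs(2,1)
              Gamma_mono[OF TS(2)] gs(3) gap_constant])
      qed
    qed
  qed
qed

end
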